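(* Let $A=\frac{\Bbbk Q}{J^k}$ be a truncated path algebra which is not self-injective, and suppose that $Q$ has no sources and no sinks. Put $d=\phi\dim\left(\frac{\Bbbk Q}{J^2}\right)$. Then $$\phi\dim(A)=\begin{cases}2\left(\frac{d-1}{k}\right)+1 & \text{if } d-1\equiv 0 \pmod k,\\[2pt] 2\left(\frac{d-2}{k}\right)+2 & \text{if } d-1\equiv 1\pmod k,\\[2pt] 2\left\lceil\frac{d-2}{k}\right\rceil+1 & \text{if } d-1\not\equiv 0,1\pmod k.\end{cases}$$
   Context: $\Bbbk$ is a field, quivers are finite and connected, $\Bbbk Q$ is the path algebra, $J$ is the ideal generated by the arrows, and $k$ is a positive integer. A truncated path algebra is an algebra isomorphic to $\frac{\Bbbk Q}{J^k}$. A source is a vertex that is not the target of any arrow; a sink is a vertex that is not the start of any arrow. Definition of $\phi\dim$. For a finite dimensional algebra $A$, modules are finitely generated right $A$-modules. $K_0(A)$ is the abelian group generated by symbols $[M]$, one for each finitely generated module $M$, modulo $[M]-[M']-[M'']$ whenever $M\cong M'\oplus M''$, and $[P]$ for each projective $P$. The syzygy $\Omega$ induces an endomorphism $\bar\Omega$ of $K_0(A)$. For a module $M$, $\langle\mathrm{add}\,M\rangle$ is the subgroup of $K_0(A)$ generated by the classes of the indecomposable direct summands of $M$, and $\phi(M)=\min\{l\in\mathbb{N}:\bar\Omega|_{\bar\Omega^{l+s}\langle\mathrm{add}\,M\rangle}\text{ is a monomorphism for all }s\in\mathbb{N}\}$, with $0\in\mathbb{N}$. Finally $\phi\dim(A)=\sup\{\phi(M):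 M \text{ a finitely generated } A\text{-module}\}$. *)

theory Defs
  imports
    "HOL-Library.Extended_Nat"
    "HOL-Number_Theory.Cong"
    "Graph_Theory.Digraph_Component"
    "HOL-Algebra.Free_Abelian_Groups"
    "HOL-Algebra.QuotRing"
    "HOL-Algebra.Module"
    "HOL-Algebra.Ideal_Product"
begin

hide_const (open) Multiset.mult

section \<open>Quivers and truncated path algebras\<close>

text \<open>A quiver is a directed multigraph, loops allowed, i.e. a \<^typ>\<open>('v, 'e) pre_digraph\<close>.
  Finiteness is \<^locale>\<open>fin_digraph\<close>, and connectedness (of the underlying undirected graph,
  including nonemptiness) is \<^const>\<open>Digraph_Component.connected\<close>.\<close>

definition is_source :: "('v, 'e) pre_digraph \<Rightarrow> 'v \<Rightarrow> bool" where
  "is_source Q v \<longleftrightarrow> v \<in> verts Q \<and> \<not> (\<exists>a \<in> arcs Q. head Q a = v)"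

definition is_sink :: "('v, 'e) pre_digraph \<Rightarrow> 'v \<Rightarrow> bool" where
  "is_sink Q v \<longleftrightarrow> v \<in> verts Q \<and> \<not> (\<exists>a \<in> arcs Q. tail Q a = v)"

text \<open>A path is recorded with its two end points, so that the trivial path at \<open>v\<close> is
  \<open>(v, [], v)\<close>. Paths are composed from left to right.\<close>

type_synonym ('v, 'e) path = "'v \<times> 'e list \<times> 'v"

definition quiver_paths :: "('v, 'e) pre_digraph \<Rightarrow> ('v, 'e) path set" where
  "quiver_paths Q = {(u, p, v). pre_digraph.awalk Q u p v}"

definition path_mult ::
  "(('v, 'e) path \<Rightarrow>\<^sub>0 'k::field) \<Rightarrow> (('v, 'e) path \<Rightarrow>\<^sub>0 'k) \<Rightarrow> (('v, 'e) path \<Rightarrow>\<^sub>0 'k)" where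
  "path_mult f g =
     (\<Sum>(u, p, v) \<in> Poly_Mapping.keys f. \<Sum>(v', q, w) \<in> Poly_Mapping.keys g.
        if v = v'
        then Poly_Mapping.single (u, p @ q, w)
               (Poly_Mapping.lookup f (u, p, v) * Poly_Mapping.lookup g (v', q, w))
        else 0)"

definition path_algebra ::
  "'k::field itself \<Rightarrow> ('v, 'e) pre_digraph \<Rightarrow> (('v, 'e) path \<Rightarrow>\<^sub>0 'k) ring" where
  "path_algebra _ Q =
     \<lparr> carrier = {f. Poly_Mapping.keys f \<subseteq> quiver_paths Q},
       mult = path_mult,
       one = (\<Sum>v \<in> verts Q. Poly_Mapping.single (v, [], v) 1),
       zero = 0,
       add = (+) \<rparr>"

definition arrow_ideal ::
  "'k::field itself \<Rightarrow> ('v, 'e) pre_digraph \<Rightarrow> (('v, 'e) path \<Rightarrow>\<^sub>0 'k) set" where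
  "arrow_ideal K Q =
     genideal (path_algebra K Q)
       ((\<lambda>a. Poly_Mapping.single (tail Q a, [a], head Q a) 1) ` arcs Q)"

definition truncated_path_algebra ::
  "'k::field itself \<Rightarrow> ('v, 'e) pre_digraph \<Rightarrow> nat \<Rightarrow> (('v, 'e) path \<Rightarrow>\<^sub>0 'k) set ring" where
  "truncated_path_algebra K Q n =
     path_algebra K Q Quot (arrow_ideal K Q [^]\<^bsub>ideals_set (path_algebra K Q)\<^esub> n)"


section \<open>Right modules\<close>

text \<open>The library's \<^locale>\<open>module\<close> requires a commutative ring of scalars. We reuse its record type,
  reading \<open>a \<odot>\<^bsub>M\<^esub> x\<close> as the right action \<open>x \<cdot> a\<close>; the fields \<open>mult\<close> and \<open>one\<close> of the record
  play no role. The library's \<^locale>\<open>submodule\<close> needs no commutativity and applies unchanged.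

  For an algebra over a field \<open>k\<close> the action of \<open>k\<close> on a unital module is that of the
  multiples of the unit, and homomorphisms over the underlying ring respect it.
  So the module category, and everything below, depends on the underlying ring only.\<close>

locale right_module = R?: ring R + M?: abelian_group M
  for R (structure) and M (structure) +
  assumes rsmult_closed: "\<lbrakk>a \<in> carrier R; x \<in> carrier M\<rbrakk> \<Longrightarrow> a \<odot>\<^bsub>M\<^esub> x \<in> carrier M"
    and rsmult_add_scalar: "\<lbrakk>a \<in> carrier R; b \<in> carrier R; x \<in> carrier M\<rbrakk> \<Longrightarrow>
           (a \<oplus>\<^bsub>R\<^esub> b) \<odot>\<^bsub>M\<^esub> x = a \<odot>\<^bsub>M\<^esub> x \<oplus>\<^bsub>M\<^esub> b \<odot>\<^bsub>M\<^esub> x"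
    and rsmult_add: "\<lbrakk>a \<in> carrier R; x \<in> carrier M; y \<in> carrier M\<rbrakk> \<Longrightarrow>
           a \<odot>\<^bsub>M\<^esub> (x \<oplus>\<^bsub>M\<^esub> y) = a \<odot>\<^bsub>M\<^esub> x \<oplus>\<^bsub>M\<^esub> a \<odot>\<^bsub>M\<^esub> y"
    and rsmult_assoc: "\<lbrakk>a \<in> carrier R; b \<in> carrier R; x \<in> carrier M\<rbrakk> \<Longrightarrow>
           (a \<otimes>\<^bsub>R\<^esub> b) \<odot>\<^bsub>M\<^esub> x = b \<odot>\<^bsub>M\<^esub> (a \<odot>\<^bsub>M\<^esub> x)"
    and rsmult_one: "x \<in> carrier M \<Longrightarrow> \<one>\<^bsub>R\<^esub> \<odot>\<^bsub>M\<^esub> x = x"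

definition regular_module :: "('r, 'm) ring_scheme \<Rightarrow> ('r, 'r) module" where
  "regular_module R =
     \<lparr> carrier = carrier R, mult = mult R, one = one R, zero = zero R, add = add R,
       smult = (\<lambda>a x. x \<otimes>\<^bsub>R\<^esub> a) \<rparr>"

definition module_hom ::
  "('r, 'm) ring_scheme \<Rightarrow> ('r, 'a) module \<Rightarrow> ('r, 'b) module \<Rightarrow> ('a \<Rightarrow> 'b) set" where
  "module_hom R M N =
     {f \<in> carrier M \<rightarrow> carrier N.
        (\<forall>x \<in> carrier M. \<forall>y \<in> carrier M. f (x \<oplus>\<^bsub>M\<^esub> y) = f x \<oplus>\<^bsub>N\<^esub> f y) \<and>
        (\<forall>a \<in> carrier R. \<forall>x \<in> carrier M. f (a \<odot>\<^bsub>M\<^esub> x) = a \<odot>\<^bsub>N\<^esub> f x)}"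

definition module_iso ::
  "('r, 'm) ring_scheme \<Rightarrow> ('r, 'a) module \<Rightarrow> ('r, 'b) module \<Rightarrow> bool" where
  "module_iso R M N \<longleftrightarrow> (\<exists>f \<in> module_hom R M N. bij_betw f (carrier M) (carrier N))"

definition module_sum :: "('r, 'a) module \<Rightarrow> ('r, 'b) module \<Rightarrow> ('r, 'a \<times> 'b) module" where
  "module_sum M N =
     \<lparr> carrier = carrier M \<times> carrier N,
       mult = (\<lambda>(x, y) (x', y'). (x \<otimes>\<^bsub>M\<^esub> x', y \<otimes>\<^bsub>N\<^esub> y')),
       one = (\<one>\<^bsub>M\<^esub>, \<one>\<^bsub>N\<^esub>),
       zero = (\<zero>\<^bsub>M\<^esub>, \<zero>\<^bsub>N\<^esub>),
       add = (\<lambda>(x, y) (x', y'). (x \<oplus>\<^bsub>M\<^esub> x', y \<oplus>\<^bsub>N\<^esub> y')),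
       smult = (\<lambda>a (x, y). (a \<odot>\<^bsub>M\<^esub> x, a \<odot>\<^bsub>N\<^esub> y)) \<rparr>"

definition fin_gen_module :: "('r, 'm) ring_scheme \<Rightarrow> ('r, 'a) module \<Rightarrow> bool" where
  "fin_gen_module R M \<longleftrightarrow>
     (\<exists>S. finite S \<and> S \<subseteq> carrier M \<and> (\<forall>N. submodule N R M \<and> S \<subseteq> N \<longrightarrow> N = carrier M))"

text \<open>A finitely generated \<open>R\<close>-module is a quotient of some \<open>R\<^sup>n\<close>; hence it has an isomorphic copy
  whose carrier is a set of lists over the carrier type \<open>'r\<close> of \<open>R\<close>. We therefore take the modules
  with elements of type \<open>'r list\<close> as a universe: \<open>fg_modules R\<close> meets every isomorphism class of
  finitely generated modules. The universe also contains copies of \<open>R\<close> and its right ideals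
  (so that Baer's criterion applies) and of all free modules \<open>R\<^sup>n\<close>, so that testing
  injectivity, and projectivity of finitely generated modules, inside it is no restriction.\<close>

definition fg_modules :: "('r, 'm) ring_scheme \<Rightarrow> ('r, 'r list) module set" where
  "fg_modules R = {M. right_module R M \<and> fin_gen_module R M}"

definition injective_module :: "('r, 'm) ring_scheme \<Rightarrow> ('r, 'a) module \<Rightarrow> bool" where
  "injective_module R E \<longleftrightarrow>
     (\<forall>(X :: ('r, 'r list) module) (Y :: ('r, 'r list) module) i f.
        right_module R X \<and> right_module R Y \<and>
        i \<in> module_hom R X Y \<and> inj_on i (carrier X) \<and> f \<in> module_hom R X E \<longrightarrow>
        (\<exists>g \<in> module_hom R Y E. \<forall>x \<in> carrier X. g (i x) = f x))"

definition projective_module :: "('r, 'm) ring_scheme \<Rightarrow> ('r, 'a) module \<Rightarrow> bool" where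
  "projective_module R P \<longleftrightarrow>
     (\<forall>(X :: ('r, 'r list) module) (Y :: ('r, 'r list) module) p f.
        right_module R X \<and> right_module R Y \<and>
        p \<in> module_hom R X Y \<and> p ` carrier X = carrier Y \<and> f \<in> module_hom R P Y \<longrightarrow>
        (\<exists>g \<in> module_hom R P X. \<forall>x \<in> carrier P. p (g x) = f x))"

definition self_injective :: "('r, 'm) ring_scheme \<Rightarrow> bool" where
  "self_injective R \<longleftrightarrow> injective_module R (regular_module R)"

definition indecomposable_module :: "('r, 'm) ring_scheme \<Rightarrow> ('r, 'r list) module \<Rightarrow> bool" where
  "indecomposable_module R M \<longleftrightarrow>
     carrier M \<noteq> {\<zero>\<^bsub>M\<^esub>} \<and>
     (\<forall>(X :: ('r, 'r list) module) (Y :: ('r, 'r list) module).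
        right_module R X \<and> right_module R Y \<and> module_iso R M (module_sum X Y) \<longrightarrow>
        carrier X = {\<zero>\<^bsub>X\<^esub>} \<or> carrier Y = {\<zero>\<^bsub>Y\<^esub>})"

definition module_kernel :: "('r, 'a) module \<Rightarrow> ('r, 'b) module \<Rightarrow> ('a \<Rightarrow> 'b) \<Rightarrow> 'a set" where
  "module_kernel M N f = {x \<in> carrier M. f x = \<zero>\<^bsub>N\<^esub>}"

definition superfluous :: "('r, 'm) ring_scheme \<Rightarrow> ('r, 'a) module \<Rightarrow> 'a set \<Rightarrow> bool" where
  "superfluous R M K \<longleftrightarrow>
     (\<forall>N. submodule N R M \<and> K <+>\<^bsub>M\<^esub> N = carrier M \<longrightarrow> N = carrier M)"

definition projective_cover ::
  "('r, 'm) ring_scheme \<Rightarrow> ('r, 'a) module \<Rightarrow> ('r, 'b) module \<Rightarrow> ('a \<Rightarrow> 'b) \<Rightarrow> bool" where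
  "projective_cover R P M p \<longleftrightarrow>
     right_module R P \<and> projective_module R P \<and>
     p \<in> module_hom R P M \<and> p ` carrier P = carrier M \<and>
     superfluous R P (module_kernel P M p)"

text \<open>The syzygy is the kernel of a projective cover; it is determined up to isomorphism only, and
  one representative is chosen. The class in \<open>K0\<close> does not depend on the choice. Over a finite
  dimensional algebra, a syzygy of a finitely generated module exists and is finitely generated.\<close>

definition syzygy ::
  "('r, 'm) ring_scheme \<Rightarrow> ('r, 'r list) module \<Rightarrow> ('r, 'r list) module" where
  "syzygy R M =
     (SOME N. \<exists>P \<in> fg_modules R. \<exists>p. projective_cover R P M p \<and>
        N = P\<lparr>carrier := module_kernel P M p\<rparr>)"


section \<open>The function $\phi$ and the $\phi$-dimension\<close>

definition K0_relations :: "('r, 'm) ring_scheme \<Rightarrow> (('r, 'r list) module \<Rightarrow>\<^sub>0 int) set" where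
  "K0_relations R =
     {frag_of M - frag_of M' - frag_of M'' | M M' M''.
        M \<in> fg_modules R \<and> M' \<in> fg_modules R \<and> M'' \<in> fg_modules R \<and>
        module_iso R M (module_sum M' M'')} \<union>
     {frag_of P | P. P \<in> fg_modules R \<and> projective_module R P}"

definition K0_relation_subgroup ::
  "('r, 'm) ring_scheme \<Rightarrow> (('r, 'r list) module \<Rightarrow>\<^sub>0 int) set" where
  "K0_relation_subgroup R = generate (free_Abelian_group (fg_modules R)) (K0_relations R)"

definition K0 :: "('r, 'm) ring_scheme \<Rightarrow> (('r, 'r list) module \<Rightarrow>\<^sub>0 int) set monoid" where
  "K0 R = free_Abelian_group (fg_modules R) Mod K0_relation_subgroup R"

definition K0_proj ::
  "('r, 'm) ring_scheme \<Rightarrow> (('r, 'r list) module \<Rightarrow>\<^sub>0 int) \<Rightarrow> (('r, 'r list) module \<Rightarrow>\<^sub>0 int) set" where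
  "K0_proj R x = K0_relation_subgroup R #>\<^bsub>free_Abelian_group (fg_modules R)\<^esub> x"

definition K0_class ::
  "('r, 'm) ring_scheme \<Rightarrow> ('r, 'r list) module \<Rightarrow> (('r, 'r list) module \<Rightarrow>\<^sub>0 int) set" where
  "K0_class R M = K0_proj R (frag_of M)"

text \<open>The endomorphism of \<open>K0 R\<close> with \<open>[M] \<mapsto> [syzygy M]\<close>: the extension to the free abelian group,
  passed to the quotient.\<close>

definition K0_syzygy ::
  "('r, 'm) ring_scheme \<Rightarrow> (('r, 'r list) module \<Rightarrow>\<^sub>0 int) set \<Rightarrow> (('r, 'r list) module \<Rightarrow>\<^sub>0 int) set" where
  "K0_syzygy R X =
     the_elem ((\<lambda>x. K0_proj R (frag_extend (\<lambda>M. frag_of (syzygy R M)) x)) ` X)"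

definition add_subgroup ::
  "('r, 'm) ring_scheme \<Rightarrow> ('r, 'r list) module \<Rightarrow> (('r, 'r list) module \<Rightarrow>\<^sub>0 int) set set" where
  "add_subgroup R M =
     generate (K0 R)
       (K0_class R ` {N \<in> fg_modules R. indecomposable_module R N \<and>
                        (\<exists>N' \<in> fg_modules R. module_iso R M (module_sum N N'))})"

definition phi :: "('r, 'm) ring_scheme \<Rightarrow> ('r, 'r list) module \<Rightarrow> nat" where
  "phi R M =
     (LEAST l. \<forall>s. inj_on (K0_syzygy R) ((K0_syzygy R ^^ (l + s)) ` add_subgroup R M))"

definition phi_dim :: "('r, 'm) ring_scheme \<Rightarrow> enat" where
  "phi_dim R = (SUP M \<in> fg_modules R. enat (phi R M))"

end

theory Submission
  imports Defs
begin

text \<open>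
  Write \<open>A = kQ/J\<^sup>k\<close>. Every submodule of a projective module is a direct sum of modules \<open>e\<^sub>vA/e\<^sub>vJ\<^sup>l\<close>
  with \<open>l \<le> k\<close>, and those with \<open>l = k\<close> are projective; so the ones with \<open>1 \<le> l < k\<close> span the image of
  the syzygy operator on \<open>K\<^sub>0\<close>. Their classes are linearly independent, as the dimensions of
  \<open>((Ann J\<^sup>l + MJ)/MJ)e\<^sub>v\<close> show. Since the syzygy of \<open>e\<^sub>vA/e\<^sub>vJ\<^sup>l\<close> is the sum of the
  \<open>e\<^sub>wA/e\<^sub>wJ\<^bsup>k-l\<^esup>\<close> over the paths of length \<open>l\<close> from \<open>v\<close> to \<open>w\<close>, the operator acts on their span by the
  \<open>l\<close>-th power of the adjacency operator of \<open>Q\<close>, exchanging \<open>l\<close> and \<open>k - l\<close>; two steps give its \<open>k\<close>-th power.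
  Let \<open>m\<close> be the least number such that the kernels of the powers of the adjacency operator are constant from
  the \<open>m\<close>-th one on. Counting steps yields \<open>\<phi>dim(A) = 1 + f(k, m)\<close> for an explicit \<open>f\<close> with \<open>f(2, m) = m\<close>, the
  summand 1 being due to the first syzygy, which can annihilate classes outside that span as soon as \<open>Q\<close> has a
  vertex with two outgoing arrows. If there is no such vertex, or if \<open>k = 1\<close>, then \<open>A\<close> is a Frobenius algebra.
\<close>

text \<open>The structure theorem for submodules of projectives rests on a choice: among generating
  families of a fixed shape, one lying as deep in the radical as possible. An unexpected relation
  could be divided on the right by a path, giving a deeper generator. Absence of sinks puts Ann J^l
  of e_vA inside its radical for l < k, so the ranks vanish on projectives and descend to K_0.
  Absence of sources makes every e_wA/e_wJ^l with 1 <= l < k the syzygy of some e_uA/pA, p a path,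
  so the whole span is reached by the first syzygy. After 2i further steps the component l has met
  the power ki of the adjacency operator, after 2i+1 steps the power ki + l. The smallest l is 1,
  which is why the residues 0, 1 and the others of m modulo k behave differently. The summand 1 has
  to be earned separately when m = 0: for n vertices, the n modules e_vA/e_vJ together with one
  e_uA/aA, where the arrow a shares its source u with another arrow, have syzygies spanned by only n
  classes. So some combination of them dies, and the ranks show that it was not zero before.\<close>

section \<open>Right modules, submodules and homomorphisms\<close>

context right_module
begin

lemma rsmult_zero_scalar:
  assumes x: "x \<in> carrier M" shows "\<zero> \<odot>\<^bsub>M\<^esub> x = \<zero>\<^bsub>M\<^esub>"
proof -
  have "\<zero> \<odot>\<^bsub>M\<^esub> x \<oplus>\<^bsub>M\<^esub> \<zero> \<odot>\<^bsub>M\<^esub> x = \<zero> \<odot>\<^bsub>M\<^esub> x"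
    using rsmult_add_scalar[of \<zero> \<zero> x] x by simp
  then show ?thesis
    using x rsmult_closed[of \<zero> x] by (simp add: M.add.l_cancel_one)
qed

lemma rsmult_zero:
  assumes a: "a \<in> carrier R" shows "a \<odot>\<^bsub>M\<^esub> \<zero>\<^bsub>M\<^esub> = \<zero>\<^bsub>M\<^esub>"
proof -
  have "a \<odot>\<^bsub>M\<^esub> \<zero>\<^bsub>M\<^esub> \<oplus>\<^bsub>M\<^esub> a \<odot>\<^bsub>M\<^esub> \<zero>\<^bsub>M\<^esub> = a \<odot>\<^bsub>M\<^esub> \<zero>\<^bsub>M\<^esub>"
    using rsmult_add[of a "\<zero>\<^bsub>M\<^esub>" "\<zero>\<^bsub>M\<^esub>"] a by simp
  then show ?thesis
    using a rsmult_closed[of a "\<zero>\<^bsub>M\<^esub>"] by (simp add: M.add.l_cancel_one)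
qed

lemma rsmult_minus:
  assumes "a \<in> carrier R" "x \<in> carrier M" shows "a \<odot>\<^bsub>M\<^esub> (\<ominus>\<^bsub>M\<^esub> x) = \<ominus>\<^bsub>M\<^esub> (a \<odot>\<^bsub>M\<^esub> x)"
proof -
  have "a \<odot>\<^bsub>M\<^esub> (\<ominus>\<^bsub>M\<^esub> x) \<oplus>\<^bsub>M\<^esub> a \<odot>\<^bsub>M\<^esub> x = \<zero>\<^bsub>M\<^esub>"
    using assms by (simp add: rsmult_zero M.l_neg flip: rsmult_add)
  then show ?thesis
    using assms by (metis M.a_inv_closed M.minus_equality rsmult_closed)
qed

lemma rsmult_minus_scalar:
  assumes "a \<in> carrier R" "x \<in> carrier M" shows "(\<ominus> a) \<odot>\<^bsub>M\<^esub> x = \<ominus>\<^bsub>M\<^esub> (a \<odot>\<^bsub>M\<^esub> x)"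
proof -
  have "(\<ominus> a) \<odot>\<^bsub>M\<^esub> x \<oplus>\<^bsub>M\<^esub> a \<odot>\<^bsub>M\<^esub> x = \<zero>\<^bsub>M\<^esub>"
    using assms by (simp add: rsmult_zero_scalar R.l_neg flip: rsmult_add_scalar)
  then show ?thesis
    using assms by (metis R.a_inv_closed M.minus_equality rsmult_closed)
qed

lemma rsmult_finsum:
  assumes "a \<in> carrier R" "f \<in> I \<rightarrow> carrier M"
  shows "a \<odot>\<^bsub>M\<^esub> (\<Oplus>\<^bsub>M\<^esub>i\<in>I. f i) = (\<Oplus>\<^bsub>M\<^esub>i\<in>I. a \<odot>\<^bsub>M\<^esub> f i)"
  using assms(2)
proof (induction I rule: infinite_finite_induct)
  case (insert i I)
  then have "(\<lambda>i. a \<odot>\<^bsub>M\<^esub> f i) \<in> I \<rightarrow> carrier M" "a \<odot>\<^bsub>M\<^esub> f i \<in> carrier M" "f i \<in> carrier M"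
    "f \<in> I \<rightarrow> carrier M"
    using assms(1) by (auto intro!: rsmult_closed)
  then show ?case
    using insert assms(1) by (simp add: rsmult_add M.finsum_closed)
qed (simp_all add: rsmult_zero assms(1))

text \<open>Closure under negation follows from closure under the scalar
  \<open>\<ominus> \<one>\<close>, so it does not appear among the conditions.\<close>

lemma submodule_iff:
  "submodule N R M \<longleftrightarrow> N \<subseteq> carrier M \<and> \<zero>\<^bsub>M\<^esub> \<in> N \<and> (\<forall>x\<in>N. \<forall>y\<in>N. x \<oplus>\<^bsub>M\<^esub> y \<in> N)
     \<and> (\<forall>a\<in>carrier R. \<forall>x\<in>N. a \<odot>\<^bsub>M\<^esub> x \<in> N)" (is "?L \<longleftrightarrow> ?R")
proof
  assume ?L
  then interpret N: submodule N R M .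
  show ?R using N.subset N.one_closed N.m_closed by auto
next
  assume r: ?R
  have "inv\<^bsub>add_monoid M\<^esub> x \<in> N" if x: "x \<in> N" for x
  proof -
    have "\<ominus>\<^bsub>M\<^esub> x = (\<ominus> \<one>) \<odot>\<^bsub>M\<^esub> x"
      using r x by (auto simp: rsmult_minus_scalar rsmult_one)
    then show ?thesis using r x by (simp add: a_inv_def[symmetric])
  qed
  then show ?L
    using r by (auto intro!: submodule.intro subgroup.intro simp: submodule_axioms_def)
qed

lemma submodule_minus:
  assumes "submodule N R M" "x \<in> N" shows "\<ominus>\<^bsub>M\<^esub> x \<in> N"
proof -
  have "\<ominus>\<^bsub>M\<^esub> x = (\<ominus> \<one>) \<odot>\<^bsub>M\<^esub> x"
    using assms by (auto simp: submodule_iff rsmult_minus_scalar rsmult_one)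
  then show ?thesis using assms by (simp add: submodule_iff)
qed

lemma submodule_diff:
  assumes "submodule N R M" "x \<in> N" "y \<in> N" shows "x \<ominus>\<^bsub>M\<^esub> y \<in> N"
  using assms submodule_minus unfolding a_minus_def submodule_iff by blast

lemma submodule_finsum:
  assumes "submodule N R M" "f \<in> I \<rightarrow> N"
  shows "(\<Oplus>\<^bsub>M\<^esub>i\<in>I. f i) \<in> N"
  using assms(2)
proof (induction I rule: infinite_finite_induct)
  case (insert i I)
  moreover have "f \<in> insert i I \<rightarrow> carrier M"
    using insert.prems assms(1) by (auto simp: submodule_iff)
  ultimately show ?case
    using assms(1) by (auto simp: submodule_iff)
qed (use assms(1) in \<open>simp_all add: submodule_iff\<close>)

lemma minus_minus_cancel:
  "\<lbrakk>x \<in> carrier M; y \<in> carrier M\<rbrakk> \<Longrightarrow> x = y \<oplus>\<^bsub>M\<^esub> (x \<ominus>\<^bsub>M\<^esub> y)"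
  by (simp add: a_minus_def M.add.m_lcomm M.r_neg)

lemma diff_zero_iff:
  "\<lbrakk>x \<in> carrier M; y \<in> carrier M\<rbrakk> \<Longrightarrow> x \<ominus>\<^bsub>M\<^esub> y = \<zero>\<^bsub>M\<^esub> \<longleftrightarrow> x = y"
  by (metis M.minus_closed M.r_neg M.r_zero a_minus_def minus_minus_cancel)

lemma carrier_submodule: "submodule (carrier M) R M"
  by (auto simp: submodule_iff rsmult_closed)

lemma zero_submodule: "submodule {\<zero>\<^bsub>M\<^esub>} R M"
  by (auto simp: submodule_iff rsmult_zero)

lemma submodule_is_right_module:
  assumes N: "submodule N R M"
  shows "right_module R (M\<lparr>carrier := N\<rparr>)"
proof -
  have s: "N \<subseteq> carrier M" using N by (simp add: submodule_iff)
  have "abelian_group (M\<lparr>carrier := N\<rparr>)"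
  proof (rule abelian_groupI)
    fix x assume "x \<in> carrier (M\<lparr>carrier := N\<rparr>)"
    then have "\<ominus>\<^bsub>M\<^esub> x \<in> N" "x \<in> carrier M" using N s submodule_minus by auto
    then show "\<exists>y\<in>carrier (M\<lparr>carrier := N\<rparr>). y \<oplus>\<^bsub>M\<lparr>carrier := N\<rparr>\<^esub> x = \<zero>\<^bsub>M\<lparr>carrier := N\<rparr>\<^esub>"
      by (auto intro!: bexI[of _ "\<ominus>\<^bsub>M\<^esub> x"] simp: M.l_neg)
  qed (use N s in \<open>auto simp: submodule_iff subset_iff M.a_ac\<close>)
  then show ?thesis
    using N s R.ring_axioms unfolding right_module_def right_module_axioms_def
    by (auto simp: submodule_iff subset_iff rsmult_add_scalar rsmult_add rsmult_assoc rsmult_one)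
qed

end

lemma right_moduleI:
  fixes R (structure) and M (structure)
  assumes "ring R"
    and "\<And>x y. \<lbrakk>x \<in> carrier M; y \<in> carrier M\<rbrakk> \<Longrightarrow> x \<oplus>\<^bsub>M\<^esub> y \<in> carrier M"
    and "\<zero>\<^bsub>M\<^esub> \<in> carrier M"
    and "\<And>x y z. \<lbrakk>x \<in> carrier M; y \<in> carrier M; z \<in> carrier M\<rbrakk> \<Longrightarrow> (x \<oplus>\<^bsub>M\<^esub> y) \<oplus>\<^bsub>M\<^esub> z = x \<oplus>\<^bsub>M\<^esub> (y \<oplus>\<^bsub>M\<^esub> z)"
    and "\<And>x y. \<lbrakk>x \<in> carrier M; y \<in> carrier M\<rbrakk> \<Longrightarrow> x \<oplus>\<^bsub>M\<^esub> y = y \<oplus>\<^bsub>M\<^esub> x"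
    and "\<And>x. x \<in> carrier M \<Longrightarrow> \<zero>\<^bsub>M\<^esub> \<oplus>\<^bsub>M\<^esub> x = x"
    and "\<And>x. x \<in> carrier M \<Longrightarrow> \<exists>y\<in>carrier M. y \<oplus>\<^bsub>M\<^esub> x = \<zero>\<^bsub>M\<^esub>"
    and "\<And>a x. \<lbrakk>a \<in> carrier R; x \<in> carrier M\<rbrakk> \<Longrightarrow> a \<odot>\<^bsub>M\<^esub> x \<in> carrier M"
    and "\<And>a b x. \<lbrakk>a \<in> carrier R; b \<in> carrier R; x \<in> carrier M\<rbrakk> \<Longrightarrow>
           (a \<oplus>\<^bsub>R\<^esub> b) \<odot>\<^bsub>M\<^esub> x = a \<odot>\<^bsub>M\<^esub> x \<oplus>\<^bsub>M\<^esub> b \<odot>\<^bsub>M\<^esub> x"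
    and "\<And>a x y. \<lbrakk>a \<in> carrier R; x \<in> carrier M; y \<in> carrier M\<rbrakk> \<Longrightarrow>
           a \<odot>\<^bsub>M\<^esub> (x \<oplus>\<^bsub>M\<^esub> y) = a \<odot>\<^bsub>M\<^esub> x \<oplus>\<^bsub>M\<^esub> a \<odot>\<^bsub>M\<^esub> y"
    and "\<And>a b x. \<lbrakk>a \<in> carrier R; b \<in> carrier R; x \<in> carrier M\<rbrakk> \<Longrightarrow>
           (a \<otimes>\<^bsub>R\<^esub> b) \<odot>\<^bsub>M\<^esub> x = b \<odot>\<^bsub>M\<^esub> (a \<odot>\<^bsub>M\<^esub> x)"
    and "\<And>x. x \<in> carrier M \<Longrightarrow> \<one>\<^bsub>R\<^esub> \<odot>\<^bsub>M\<^esub> x = x"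
  shows "right_module R M"
  using assms unfolding right_module_def right_module_axioms_def
  by (auto intro!: abelian_groupI)

lemma module_homI:
  assumes "\<And>x. x \<in> carrier M \<Longrightarrow> f x \<in> carrier N"
    and "\<And>x y. \<lbrakk>x \<in> carrier M; y \<in> carrier M\<rbrakk> \<Longrightarrow> f (x \<oplus>\<^bsub>M\<^esub> y) = f x \<oplus>\<^bsub>N\<^esub> f y"
    and "\<And>a x. \<lbrakk>a \<in> carrier R; x \<in> carrier M\<rbrakk> \<Longrightarrow> f (a \<odot>\<^bsub>M\<^esub> x) = a \<odot>\<^bsub>N\<^esub> f x"
  shows "f \<in> module_hom R M N"
  using assms by (auto simp: module_hom_def)

lemma module_homD:
  assumes "f \<in> module_hom R M N"
  shows "x \<in> carrier M \<Longrightarrow> f x \<in> carrier N"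
    and "\<lbrakk>x \<in> carrier M; y \<in> carrier M\<rbrakk> \<Longrightarrow> f (x \<oplus>\<^bsub>M\<^esub> y) = f x \<oplus>\<^bsub>N\<^esub> f y"
    and "\<lbrakk>a \<in> carrier R; x \<in> carrier M\<rbrakk> \<Longrightarrow> f (a \<odot>\<^bsub>M\<^esub> x) = a \<odot>\<^bsub>N\<^esub> f x"
  using assms by (auto simp: module_hom_def)

lemma module_hom_comp:
  assumes "f \<in> module_hom R M N" "g \<in> module_hom R N L"
  shows "(\<lambda>x. g (f x)) \<in> module_hom R M L"
  using module_homD[OF assms(1)] module_homD[OF assms(2)] by (auto intro!: module_homI)

lemma module_hom_id: "(\<lambda>x. x) \<in> module_hom R M M"
  by (auto simp: module_hom_def)

locale rmodule_hom = M: right_module R M + N: right_module R N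
  for R (structure) and M (structure) and N (structure) and f +
  assumes hom: "f \<in> module_hom R M N"
begin

lemmas closed = module_homD(1)[OF hom]
lemmas add = module_homD(2)[OF hom]
lemmas smult = module_homD(3)[OF hom]

lemma zero: "f \<zero>\<^bsub>M\<^esub> = \<zero>\<^bsub>N\<^esub>"
proof -
  have "f (\<zero> \<odot>\<^bsub>M\<^esub> \<zero>\<^bsub>M\<^esub>) = \<zero> \<odot>\<^bsub>N\<^esub> f \<zero>\<^bsub>M\<^esub>"
    by (simp add: smult)
  then show ?thesis by (simp add: closed M.rsmult_zero N.rsmult_zero_scalar)
qed

lemma minus: assumes "x \<in> carrier M" shows "f (\<ominus>\<^bsub>M\<^esub> x) = \<ominus>\<^bsub>N\<^esub> f x"
proof -
  have "f ((\<ominus> \<one>) \<odot>\<^bsub>M\<^esub> x) = (\<ominus> \<one>) \<odot>\<^bsub>N\<^esub> f x"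
    using assms by (simp add: smult)
  then show ?thesis
    using assms by (simp add: closed M.rsmult_minus_scalar N.rsmult_minus_scalar M.rsmult_one N.rsmult_one)
qed

lemma diff: "\<lbrakk>x \<in> carrier M; y \<in> carrier M\<rbrakk> \<Longrightarrow> f (x \<ominus>\<^bsub>M\<^esub> y) = f x \<ominus>\<^bsub>N\<^esub> f y"
  by (simp add: a_minus_def add minus)

lemma finsum:
  assumes "g \<in> I \<rightarrow> carrier M"
  shows "f (\<Oplus>\<^bsub>M\<^esub>i\<in>I. g i) = (\<Oplus>\<^bsub>N\<^esub>i\<in>I. f (g i))"
  using assms
proof (induction I rule: infinite_finite_induct)
  case (insert i I)
  then have "(\<lambda>i. f (g i)) \<in> I \<rightarrow> carrier N" "f (g i) \<in> carrier N" "g i \<in> carrier M" "g \<in> I \<rightarrow> carrier M"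
    using closed by auto
  then show ?case
    using insert by (simp add: add M.finsum_closed)
qed (simp_all add: zero)

lemma kernel_iff: "x \<in> module_kernel M N f \<longleftrightarrow> x \<in> carrier M \<and> f x = \<zero>\<^bsub>N\<^esub>"
  by (simp add: module_kernel_def)

lemma kernel_submodule: "submodule (module_kernel M N f) R M"
  by (auto simp: M.submodule_iff kernel_iff zero add smult M.rsmult_closed N.rsmult_zero)

lemma image_submodule: 
  assumes "submodule L R M" shows "submodule (f ` L) R N"
proof -
  have L: "L \<subseteq> carrier M" "\<zero>\<^bsub>M\<^esub> \<in> L" "\<And>x y. \<lbrakk>x \<in> L; y \<in> L\<rbrakk> \<Longrightarrow> x \<oplus>\<^bsub>M\<^esub> y \<in> L"
    "\<And>a x. \<lbrakk>a \<in> carrier R; x \<in> L\<rbrakk> \<Longrightarrow> a \<odot>\<^bsub>M\<^esub> x \<in> L"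
    using assms by (auto simp: M.submodule_iff)
  have "f x \<oplus>\<^bsub>N\<^esub> f y \<in> f ` L" if "x \<in> L" "y \<in> L" for x y
    using that L add[of x y] by (metis image_eqI subsetD)
  moreover have "a \<odot>\<^bsub>N\<^esub> f x \<in> f ` L" if "a \<in> carrier R" "x \<in> L" for a x
    using that L smult[of a x] by (metis image_eqI subsetD)
  moreover have "\<zero>\<^bsub>N\<^esub> \<in> f ` L"
    using zero L(2) by (metis image_eqI)
  ultimately show ?thesis
    using L(1) closed by (auto simp: N.submodule_iff)
qed

lemma vimage_submodule:
  assumes "submodule L R N" shows "submodule {x \<in> carrier M. f x \<in> L} R M"
  using assms by (auto simp: M.submodule_iff N.submodule_iff zero add smult M.rsmult_closed)

lemma eq_iff_kernel:
  "\<lbrakk>x \<in> carrier M; y \<in> carrier M\<rbrakk> \<Longrightarrow> f x = f y \<longleftrightarrow> x \<ominus>\<^bsub>M\<^esub> y \<in> module_kernel M N f"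
  by (simp add: kernel_iff diff N.diff_zero_iff closed)

lemma inj_on_iff_kernel: "inj_on f (carrier M) \<longleftrightarrow> module_kernel M N f = {\<zero>\<^bsub>M\<^esub>}"
proof
  assume i: "inj_on f (carrier M)"
  have "x = \<zero>\<^bsub>M\<^esub>" if "x \<in> module_kernel M N f" for x
    using that zero i by (metis M.M.zero_closed inj_onD kernel_iff)
  then show "module_kernel M N f = {\<zero>\<^bsub>M\<^esub>}"
    using zero by (auto simp: kernel_iff)
next
  assume "module_kernel M N f = {\<zero>\<^bsub>M\<^esub>}"
  then show "inj_on f (carrier M)"
    by (auto intro!: inj_onI simp: eq_iff_kernel M.diff_zero_iff)
qed

end

lemma rmodule_homI: "\<lbrakk>right_module R M; right_module R N; f \<in> module_hom R M N\<rbrakk> \<Longrightarrow> rmodule_hom R M N f"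
  by (simp add: rmodule_hom_def rmodule_hom_axioms_def)

subsection \<open>Isomorphisms and quotients\<close>

lemma module_isoI:
  "\<lbrakk>f \<in> module_hom R M N; inj_on f (carrier M); f ` carrier M = carrier N\<rbrakk> \<Longrightarrow> module_iso R M N"
  by (auto simp: module_iso_def bij_betw_def)

lemma module_iso_refl: "module_iso R M M"
  by (rule module_isoI[OF module_hom_id]) auto

lemma module_iso_sym:
  assumes "module_iso R M N" "right_module R M" shows "module_iso R N M"
proof -
  interpret right_module R M by fact
  obtain f where f: "f \<in> module_hom R M N" "bij_betw f (carrier M) (carrier N)"
    using assms by (auto simp: module_iso_def)
  let ?g = "inv_into (carrier M) f"
  have bij: "bij_betw ?g (carrier N) (carrier M)"
    by (rule bij_betw_inv_into[OF f(2)])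
  have gc: "x \<in> carrier N \<Longrightarrow> ?g x \<in> carrier M" for x
    using bij by (auto simp: bij_betw_def)
  have fg: "x \<in> carrier N \<Longrightarrow> f (?g x) = x" for x
    using f(2) by (simp add: bij_betw_inv_into_right)
  have gf: "x \<in> carrier M \<Longrightarrow> ?g (f x) = x" for x
    using f(2) by (simp add: bij_betw_inv_into_left)
  have "?g \<in> module_hom R N M"
  proof (rule module_homI)
    show "?g (x \<oplus>\<^bsub>N\<^esub> y) = ?g x \<oplus>\<^bsub>M\<^esub> ?g y" if "x \<in> carrier N" "y \<in> carrier N" for x y
      using gf[of "?g x \<oplus>\<^bsub>M\<^esub> ?g y"] that by (simp add: gc fg module_homD(2)[OF f(1)])
    show "?g (a \<odot>\<^bsub>N\<^esub> x) = a \<odot>\<^bsub>M\<^esub> ?g x" if "a \<in> carrier R" "x \<in> carrier N" for a x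
      using gf[of "a \<odot>\<^bsub>M\<^esub> ?g x"] that by (simp add: gc fg rsmult_closed module_homD(3)[OF f(1)])
  qed (rule gc)
  then show ?thesis using bij by (auto simp: module_iso_def)
qed

lemma module_iso_trans:
  assumes "module_iso R M N" "module_iso R N L" shows "module_iso R M L"
proof -
  obtain f g where f: "f \<in> module_hom R M N" "bij_betw f (carrier M) (carrier N)"
    and g: "g \<in> module_hom R N L" "bij_betw g (carrier N) (carrier L)"
    using assms by (auto simp: module_iso_def)
  show ?thesis
    using module_hom_comp[OF f(1) g(1)] bij_betw_trans[OF f(2) g(2)]
    by (auto simp: module_iso_def comp_def)
qed

text \<open>The comparison map sends \<open>y\<close> to the value of \<open>g\<close> at any
  \<open>f\<close>-preimage of \<open>y\<close>; equal kernels make the choice irrelevant. It serves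
  as the isomorphism theorem for explicit presentations, without mentioning a quotient.\<close>

lemma module_iso_of_same_kernel:
  assumes "right_module R M" "right_module R N" "right_module R L"
    and f: "f \<in> module_hom R M N" "f ` carrier M = carrier N"
    and g: "g \<in> module_hom R M L" "g ` carrier M = carrier L"
    and ker: "\<And>x. x \<in> carrier M \<Longrightarrow> f x = \<zero>\<^bsub>N\<^esub> \<longleftrightarrow> g x = \<zero>\<^bsub>L\<^esub>"
  shows "module_iso R N L"
proof -
  interpret f: rmodule_hom R M N f using assms by (simp add: rmodule_homI)
  interpret g: rmodule_hom R M L g using assms by (simp add: rmodule_homI)
  have eq: "f x = f y \<longleftrightarrow> g x = g y" if "x \<in> carrier M" "y \<in> carrier M" for x y
    using that ker by (simp add: f.eq_iff_kernel g.eq_iff_kernel f.kernel_iff g.kernel_iff)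
  define s where "s = inv_into (carrier M) f"
  have s: "s y \<in> carrier M" "f (s y) = y" if "y \<in> carrier N" for y
    using that f(2) unfolding s_def by (auto simp: inv_into_into f_inv_into_f)
  have gs: "g (s (f x)) = g x" if "x \<in> carrier M" for x
    using that eq[of "s (f x)" x] s by (simp add: f.closed)
  have "(\<lambda>y. g (s y)) \<in> module_hom R N L"
  proof (rule module_homI)
    show "g (s y) \<in> carrier L" if "y \<in> carrier N" for y using that s g.closed by auto
    show "g (s (x \<oplus>\<^bsub>N\<^esub> y)) = g (s x) \<oplus>\<^bsub>L\<^esub> g (s y)" if "x \<in> carrier N" "y \<in> carrier N" for x y
      using gs[of "s x \<oplus>\<^bsub>M\<^esub> s y"] that by (simp add: s f.add g.add)
    show "g (s (a \<odot>\<^bsub>N\<^esub> x)) = a \<odot>\<^bsub>L\<^esub> g (s x)" if "a \<in> carrier R" "x \<in> carrier N" for a x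
      using gs[of "a \<odot>\<^bsub>M\<^esub> s x"] that by (simp add: s f.smult g.smult f.M.rsmult_closed)
  qed
  moreover have "inj_on (\<lambda>y. g (s y)) (carrier N)"
    by (rule inj_onI) (metis eq s)
  moreover have "(\<lambda>y. g (s y)) ` carrier N = carrier L"
  proof -
    have "z \<in> (\<lambda>y. g (s y)) ` carrier N" if "z \<in> carrier L" for z
    proof -
      have "z \<in> g ` carrier M" using that by (simp only: g(2))
      then obtain x where "z = g x" "x \<in> carrier M" by (rule imageE)
      then show ?thesis using gs[of x] f.closed[of x] by (metis imageI)
    qed
    then show ?thesis using s g.closed by auto
  qed
  ultimately show ?thesis by (rule module_isoI)
qed

definition quotient_rep :: "('r, 'a, 'm) module_scheme \<Rightarrow> 'a set \<Rightarrow> 'a \<Rightarrow> 'a" where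
  "quotient_rep M N x = (SOME y. y \<in> carrier M \<and> x \<ominus>\<^bsub>M\<^esub> y \<in> N)"

text \<open>The quotient is realised on a transversal, so that it keeps the element type of \<open>M\<close>.\<close>

definition quotient_module :: "('r, 'a, 'm) module_scheme \<Rightarrow> 'a set \<Rightarrow> ('r, 'a) module" where
  "quotient_module M N =
     \<lparr> carrier = quotient_rep M N ` carrier M, mult = mult M, one = one M,
       zero = quotient_rep M N \<zero>\<^bsub>M\<^esub>, add = (\<lambda>x y. quotient_rep M N (x \<oplus>\<^bsub>M\<^esub> y)),
       smult = (\<lambda>a x. quotient_rep M N (a \<odot>\<^bsub>M\<^esub> x)) \<rparr>"

context
  fixes R (structure) and M :: "('r, 'a) module" (structure) and N
  assumes M: "right_module R M" and N: "submodule N R M"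
begin

interpretation right_module R M by (rule M)

lemma diff_in_sym: "\<lbrakk>x \<in> carrier M; y \<in> carrier M; x \<ominus>\<^bsub>M\<^esub> y \<in> N\<rbrakk> \<Longrightarrow> y \<ominus>\<^bsub>M\<^esub> x \<in> N"
  using submodule_minus[OF N, of "x \<ominus>\<^bsub>M\<^esub> y"]
  by (simp add: a_minus_def M.minus_add M.a_comm)

lemma diff_in_trans:
  assumes "x \<in> carrier M" "y \<in> carrier M" "z \<in> carrier M" "x \<ominus>\<^bsub>M\<^esub> y \<in> N" "y \<ominus>\<^bsub>M\<^esub> z \<in> N"
  shows "x \<ominus>\<^bsub>M\<^esub> z \<in> N"
proof -
  have "x \<ominus>\<^bsub>M\<^esub> z = (x \<ominus>\<^bsub>M\<^esub> y) \<oplus>\<^bsub>M\<^esub> (y \<ominus>\<^bsub>M\<^esub> z)"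
    using assms by (simp add: a_minus_def M.a_assoc M.r_neg1)
  then show ?thesis using N assms by (simp add: submodule_iff)
qed

lemma quotient_rep:
  assumes x: "x \<in> carrier M"
  shows "quotient_rep M N x \<in> carrier M" "x \<ominus>\<^bsub>M\<^esub> quotient_rep M N x \<in> N"
proof -
  have "x \<in> carrier M \<and> x \<ominus>\<^bsub>M\<^esub> x \<in> N"
    using x N diff_zero_iff[of x x] by (simp add: submodule_iff)
  then show "quotient_rep M N x \<in> carrier M" "x \<ominus>\<^bsub>M\<^esub> quotient_rep M N x \<in> N"
    unfolding quotient_rep_def by (metis (mono_tags, lifting) someI)+
qed

lemma quotient_rep_eq_iff:
  assumes x: "x \<in> carrier M" and y: "y \<in> carrier M"
  shows "quotient_rep M N x = quotient_rep M N y \<longleftrightarrow> x \<ominus>\<^bsub>M\<^esub> y \<in> N"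
proof
  assume "quotient_rep M N x = quotient_rep M N y"
  then show "x \<ominus>\<^bsub>M\<^esub> y \<in> N"
    using quotient_rep[OF x] quotient_rep[OF y] diff_in_trans diff_in_sym x y by metis
next
  assume d: "x \<ominus>\<^bsub>M\<^esub> y \<in> N"
  have "(z \<in> carrier M \<and> x \<ominus>\<^bsub>M\<^esub> z \<in> N) = (z \<in> carrier M \<and> y \<ominus>\<^bsub>M\<^esub> z \<in> N)" for z
    using x y d diff_in_trans diff_in_sym by blast
  then show "quotient_rep M N x = quotient_rep M N y"
    unfolding quotient_rep_def by simp
qed

lemma quotient_rep_idem: "x \<in> carrier M \<Longrightarrow> quotient_rep M N (quotient_rep M N x) = quotient_rep M N x"
  using quotient_rep quotient_rep_eq_iff diff_in_sym by blast

lemma quotient_rep_add: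
  assumes "x \<in> carrier M" "y \<in> carrier M"
  shows "quotient_rep M N (quotient_rep M N x \<oplus>\<^bsub>M\<^esub> quotient_rep M N y) = quotient_rep M N (x \<oplus>\<^bsub>M\<^esub> y)"
proof -
  have "(x \<oplus>\<^bsub>M\<^esub> y) \<ominus>\<^bsub>M\<^esub> (quotient_rep M N x \<oplus>\<^bsub>M\<^esub> quotient_rep M N y)
      = (x \<ominus>\<^bsub>M\<^esub> quotient_rep M N x) \<oplus>\<^bsub>M\<^esub> (y \<ominus>\<^bsub>M\<^esub> quotient_rep M N y)"
    using assms quotient_rep by (simp add: a_minus_def M.minus_add M.a_ac)
  moreover have "\<dots> \<in> N"
    using N assms quotient_rep by (simp add: submodule_iff)
  ultimately show ?thesis
    using assms quotient_rep by (metis M.a_closed quotient_rep_eq_iff)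
qed

lemma quotient_rep_smult:
  assumes "a \<in> carrier R" "x \<in> carrier M"
  shows "quotient_rep M N (a \<odot>\<^bsub>M\<^esub> quotient_rep M N x) = quotient_rep M N (a \<odot>\<^bsub>M\<^esub> x)"
proof -
  have "a \<odot>\<^bsub>M\<^esub> x \<ominus>\<^bsub>M\<^esub> a \<odot>\<^bsub>M\<^esub> quotient_rep M N x = a \<odot>\<^bsub>M\<^esub> (x \<ominus>\<^bsub>M\<^esub> quotient_rep M N x)"
    using assms quotient_rep by (simp add: a_minus_def rsmult_add rsmult_minus)
  moreover have "\<dots> \<in> N"
    using N assms quotient_rep by (simp add: submodule_iff)
  ultimately show ?thesis
    using assms quotient_rep rsmult_closed by (metis quotient_rep_eq_iff)
qed

lemma quotient_right_module: "right_module R (quotient_module M N)"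
proof (rule right_moduleI)
  show "\<exists>y\<in>carrier (quotient_module M N). y \<oplus>\<^bsub>quotient_module M N\<^esub> x = \<zero>\<^bsub>quotient_module M N\<^esub>"
    if x: "x \<in> carrier (quotient_module M N)" for x
  proof -
    obtain y where y: "y \<in> carrier M" "x = quotient_rep M N y"
      using x unfolding quotient_module_def by auto
    then show ?thesis
      by (intro bexI[of _ "quotient_rep M N (\<ominus>\<^bsub>M\<^esub> y)"])
        (auto simp: quotient_module_def quotient_rep_add M.l_neg)
  qed
  have q: "quotient_rep M N (quotient_rep M N x \<oplus>\<^bsub>M\<^esub> y) = quotient_rep M N (x \<oplus>\<^bsub>M\<^esub> y)"
    if "x \<in> carrier M" "y \<in> quotient_rep M N ` carrier M" for x y
    using that quotient_rep_add quotient_rep_idem quotient_rep by (metis (no_types, lifting) image_iff)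
  have ra: "quotient_rep M N (quotient_rep M N x \<oplus>\<^bsub>M\<^esub> y) = quotient_rep M N (x \<oplus>\<^bsub>M\<^esub> y)"
    "quotient_rep M N (y \<oplus>\<^bsub>M\<^esub> quotient_rep M N x) = quotient_rep M N (y \<oplus>\<^bsub>M\<^esub> x)"
    if "x \<in> carrier M" "y \<in> carrier M" for x y
    using that quotient_rep_add quotient_rep_idem quotient_rep by (metis)+
  show "ring R" by (rule R.ring_axioms)
  show "x \<oplus>\<^bsub>quotient_module M N\<^esub> y \<oplus>\<^bsub>quotient_module M N\<^esub> z =
        x \<oplus>\<^bsub>quotient_module M N\<^esub> (y \<oplus>\<^bsub>quotient_module M N\<^esub> z)"
    if "x \<in> carrier (quotient_module M N)" "y \<in> carrier (quotient_module M N)" "z \<in> carrier (quotient_module M N)"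
    for x y z
    using that by (auto simp: quotient_module_def quotient_rep ra M.a_assoc)
  have c: "x \<in> carrier M" if "x \<in> carrier (quotient_module M N)" for x
    using that quotient_rep(1) unfolding quotient_module_def by auto
  show "(a \<oplus> b) \<odot>\<^bsub>quotient_module M N\<^esub> x =
        a \<odot>\<^bsub>quotient_module M N\<^esub> x \<oplus>\<^bsub>quotient_module M N\<^esub> b \<odot>\<^bsub>quotient_module M N\<^esub> x"
    if "a \<in> carrier R" "b \<in> carrier R" "x \<in> carrier (quotient_module M N)" for a b x
    using that(1,2) c[OF that(3)]
    by (simp add: quotient_module_def quotient_rep_add rsmult_add_scalar rsmult_closed)
  show "(a \<otimes> b) \<odot>\<^bsub>quotient_module M N\<^esub> x = b \<odot>\<^bsub>quotient_module M N\<^esub> (a \<odot>\<^bsub>quotient_module M N\<^esub> x)"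
    if "a \<in> carrier R" "b \<in> carrier R" "x \<in> carrier (quotient_module M N)" for a b x
    using that(1,2) c[OF that(3)]
    by (simp add: quotient_module_def quotient_rep_smult rsmult_assoc rsmult_closed)
qed (auto simp: quotient_module_def quotient_rep_idem quotient_rep_add quotient_rep quotient_rep_smult
      rsmult_closed rsmult_add rsmult_one M.a_comm)

lemma quotient_rep_hom: "quotient_rep M N \<in> module_hom R M (quotient_module M N)"
  by (rule module_homI) (auto simp: quotient_module_def quotient_rep_add quotient_rep_smult)

lemma quotient_rep_surj: "quotient_rep M N ` carrier M = carrier (quotient_module M N)"
  by (simp add: quotient_module_def)

lemma quotient_rep_zero_iff:
  "x \<in> carrier M \<Longrightarrow> quotient_rep M N x = \<zero>\<^bsub>quotient_module M N\<^esub> \<longleftrightarrow> x \<in> N"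
proof -
  assume x: "x \<in> carrier M"
  have "\<ominus>\<^bsub>M\<^esub> \<zero>\<^bsub>M\<^esub> = \<zero>\<^bsub>M\<^esub>" by (metis M.r_neg M.l_zero M.zero_closed M.a_inv_closed)
  then have "x \<ominus>\<^bsub>M\<^esub> \<zero>\<^bsub>M\<^esub> = x" using x by (metis M.r_zero a_minus_def)
  then show ?thesis using x by (simp add: quotient_module_def quotient_rep_eq_iff)
qed

lemma quotient_rep_kernel: "module_kernel M (quotient_module M N) (quotient_rep M N) = N"
  using N quotient_rep_zero_iff by (auto simp: module_kernel_def submodule_iff)

end

subsection \<open>Direct sums\<close>

lemma module_sum_simps [simp]:
  "carrier (module_sum M N) = carrier M \<times> carrier N"
  "\<zero>\<^bsub>module_sum M N\<^esub> = (\<zero>\<^bsub>M\<^esub>, \<zero>\<^bsub>N\<^esub>)"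
  "(x, y) \<oplus>\<^bsub>module_sum M N\<^esub> (x', y') = (x \<oplus>\<^bsub>M\<^esub> x', y \<oplus>\<^bsub>N\<^esub> y')"
  "a \<odot>\<^bsub>module_sum M N\<^esub> (x, y) = (a \<odot>\<^bsub>M\<^esub> x, a \<odot>\<^bsub>N\<^esub> y)"
  by (simp_all add: module_sum_def)

lemma module_sum_right_module:
  assumes "right_module R M" "right_module R N" shows "right_module R (module_sum M N)"
proof -
  interpret M: right_module R M by fact
  interpret N: right_module R N by fact
  show ?thesis
  proof (rule right_moduleI)
    show "ring R" by (rule M.R.ring_axioms)
    show "\<exists>y\<in>carrier (module_sum M N). y \<oplus>\<^bsub>module_sum M N\<^esub> x = \<zero>\<^bsub>module_sum M N\<^esub>"
      if "x \<in> carrier (module_sum M N)" for x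
      using that M.M.l_neg N.M.l_neg
      by (intro bexI[of _ "(\<ominus>\<^bsub>M\<^esub> fst x, \<ominus>\<^bsub>N\<^esub> snd x)"]) auto
  qed (auto simp: M.rsmult_closed N.rsmult_closed M.rsmult_add_scalar N.rsmult_add_scalar M.rsmult_add
      N.rsmult_add M.rsmult_assoc N.rsmult_assoc M.rsmult_one N.rsmult_one M.M.a_ac N.M.a_ac)
qed

lemma module_sum_homs:
  assumes "right_module R M" "right_module R N"
  shows "fst \<in> module_hom R (module_sum M N) M" "snd \<in> module_hom R (module_sum M N) N"
    "(\<lambda>x. (x, \<zero>\<^bsub>N\<^esub>)) \<in> module_hom R M (module_sum M N)"
    "(\<lambda>y. (\<zero>\<^bsub>M\<^esub>, y)) \<in> module_hom R N (module_sum M N)"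
proof -
  interpret M: right_module R M by fact
  interpret N: right_module R N by fact
  show "fst \<in> module_hom R (module_sum M N) M" "snd \<in> module_hom R (module_sum M N) N"
    "(\<lambda>x. (x, \<zero>\<^bsub>N\<^esub>)) \<in> module_hom R M (module_sum M N)"
    "(\<lambda>y. (\<zero>\<^bsub>M\<^esub>, y)) \<in> module_hom R N (module_sum M N)"
    by (auto intro!: module_homI simp: M.rsmult_zero N.rsmult_zero)
qed

subsection \<open>Modules generated by idempotents\<close>

text \<open>The direct sum of the right ideals eR for e in \<open>es\<close>, with coordinates
  stored in a list. The elements therefore have the type \<open>'r list\<close> of the module
  universe, and free modules are the case where every entry is the unit.\<close>

definition idem_module :: "('r, 'm) ring_scheme \<Rightarrow> 'r list \<Rightarrow> ('r, 'r list) module" where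
  "idem_module R es =
     \<lparr> carrier = {xs. length xs = length es \<and> (\<forall>i<length es. xs ! i \<in> carrier R \<and> es ! i \<otimes>\<^bsub>R\<^esub> xs ! i = xs ! i)},
       mult = (\<lambda>xs ys. xs), one = [], zero = replicate (length es) \<zero>\<^bsub>R\<^esub>,
       add = (\<lambda>xs ys. map2 (\<lambda>x y. x \<oplus>\<^bsub>R\<^esub> y) xs ys), smult = (\<lambda>a. map (\<lambda>x. x \<otimes>\<^bsub>R\<^esub> a)) \<rparr>"

text \<open>A homomorphism from eR to M is the same as an element b of M with b e = b, the image of
  e. Adapted lists thus encode the homomorphisms out of \<open>idem_module R es\<close>, and
  \<open>comb\<close> is the homomorphism attached to one.\<close>

definition adapted :: "('r, 'm) ring_scheme \<Rightarrow> ('r, 'a) module \<Rightarrow> 'r list \<Rightarrow> 'a list \<Rightarrow> bool" where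
  "adapted R M es bs \<longleftrightarrow> length bs = length es \<and>
     (\<forall>i<length es. bs ! i \<in> carrier M \<and> (es ! i) \<odot>\<^bsub>M\<^esub> (bs ! i) = bs ! i)"

definition comb :: "('r, 'a) module \<Rightarrow> 'a list \<Rightarrow> 'r list \<Rightarrow> 'a" where
  "comb M bs xs = (\<Oplus>\<^bsub>M\<^esub>i\<in>{..<length bs}. (xs ! i) \<odot>\<^bsub>M\<^esub> (bs ! i))"

definition unit_vec :: "('r, 'm) ring_scheme \<Rightarrow> 'r list \<Rightarrow> nat \<Rightarrow> 'r list" where
  "unit_vec R es j = (replicate (length es) \<zero>\<^bsub>R\<^esub>)[j := es ! j]"

lemma idem_module_carrier_iff:
  "xs \<in> carrier (idem_module R es) \<longleftrightarrow>
     length xs = length es \<and> (\<forall>i<length es. xs ! i \<in> carrier R \<and> es ! i \<otimes>\<^bsub>R\<^esub> xs ! i = xs ! i)"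
  by (simp add: idem_module_def)

lemma idem_module_nth:
  "\<lbrakk>length xs = length es; length ys = length es; i < length es\<rbrakk> \<Longrightarrow> (xs \<oplus>\<^bsub>idem_module R es\<^esub> ys) ! i = xs ! i \<oplus>\<^bsub>R\<^esub> ys ! i"
  "\<lbrakk>length xs = length es; i < length es\<rbrakk> \<Longrightarrow> (a \<odot>\<^bsub>idem_module R es\<^esub> xs) ! i = xs ! i \<otimes>\<^bsub>R\<^esub> a"
  "i < length es \<Longrightarrow> \<zero>\<^bsub>idem_module R es\<^esub> ! i = \<zero>\<^bsub>R\<^esub>"
  by (simp_all add: idem_module_def)

lemma idem_module_length:
  "\<lbrakk>length xs = length es; length ys = length es\<rbrakk> \<Longrightarrow> length (xs \<oplus>\<^bsub>idem_module R es\<^esub> ys) = length es"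
  "length xs = length es \<Longrightarrow> length (a \<odot>\<^bsub>idem_module R es\<^esub> xs) = length es"
  "length \<zero>\<^bsub>idem_module R es\<^esub> = length es"
  by (simp_all add: idem_module_def)

lemma (in ring) idem_module_right_module:
  assumes es: "set es \<subseteq> carrier R"
  shows "right_module R (idem_module R es)"
proof -
  have esi: "i < length es \<Longrightarrow> es ! i \<in> carrier R" for i using es by auto
  let ?P = "idem_module R es"
  show ?thesis
  proof (rule right_moduleI)
    show "\<exists>y\<in>carrier ?P. y \<oplus>\<^bsub>?P\<^esub> x = \<zero>\<^bsub>?P\<^esub>" if "x \<in> carrier ?P" for x
      using that esi
      by (intro bexI[of _ "map (\<lambda>x. \<ominus> x) x"])
        (auto simp: idem_module_carrier_iff idem_module_nth idem_module_length l_neg r_minus intro!: nth_equalityI)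
  qed (use esi in \<open>auto simp: idem_module_carrier_iff idem_module_nth idem_module_length r_distr l_distr
      a_ac m_assoc[symmetric] intro!: nth_equalityI ring_axioms\<close>)
qed

context
  fixes R (structure) and M :: "('r, 'a) module" (structure)
  assumes M: "right_module R M"
begin

interpretation right_module R M by (rule M)

lemma smult_nth_in:
  "\<lbrakk>adapted R M es bs; xs \<in> carrier (idem_module R es)\<rbrakk> \<Longrightarrow>
   (\<lambda>i. (xs ! i) \<odot>\<^bsub>M\<^esub> (bs ! i)) \<in> {..<length bs} \<rightarrow> carrier M"
  by (auto simp: adapted_def idem_module_carrier_iff rsmult_closed)

lemma comb_hom:
  assumes a: "adapted R M es bs"
  shows "comb M bs \<in> module_hom R (idem_module R es) M"
proof (rule module_homI)
  note s = smult_nth_in[OF a]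
  have len: "length bs = length es" using a by (simp add: adapted_def)
  have b: "i < length es \<Longrightarrow> bs ! i \<in> carrier M" for i using a by (simp add: adapted_def)
  fix xs assume xs: "xs \<in> carrier (idem_module R es)"
  then have xs': "length xs = length es" "\<And>i. i < length es \<Longrightarrow> xs ! i \<in> carrier R"
    by (auto simp: idem_module_carrier_iff)
  show "comb M bs xs \<in> carrier M"
    unfolding comb_def using s[OF xs] by (simp add: M.finsum_closed)
  show "comb M bs (xs \<oplus>\<^bsub>idem_module R es\<^esub> ys) = comb M bs xs \<oplus>\<^bsub>M\<^esub> comb M bs ys"
    if ys: "ys \<in> carrier (idem_module R es)" for ys
  proof -
    have ys': "length ys = length es" "\<And>i. i < length es \<Longrightarrow> ys ! i \<in> carrier R"
      using ys by (auto simp: idem_module_carrier_iff)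
    have "comb M bs (xs \<oplus>\<^bsub>idem_module R es\<^esub> ys)
        = (\<Oplus>\<^bsub>M\<^esub>i\<in>{..<length bs}. (xs ! i) \<odot>\<^bsub>M\<^esub> (bs ! i) \<oplus>\<^bsub>M\<^esub> (ys ! i) \<odot>\<^bsub>M\<^esub> (bs ! i))"
      unfolding comb_def
      by (rule M.finsum_cong')
        (auto simp: len idem_module_nth xs' ys' rsmult_add_scalar b rsmult_closed)
    then show ?thesis
      unfolding comb_def by (simp add: M.finsum_addf s[OF xs] s[OF ys])
  qed
  show "comb M bs (a \<odot>\<^bsub>idem_module R es\<^esub> xs) = a \<odot>\<^bsub>M\<^esub> comb M bs xs" if a: "a \<in> carrier R" for a
  proof -
    have "comb M bs (a \<odot>\<^bsub>idem_module R es\<^esub> xs)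
        = (\<Oplus>\<^bsub>M\<^esub>i\<in>{..<length bs}. a \<odot>\<^bsub>M\<^esub> ((xs ! i) \<odot>\<^bsub>M\<^esub> (bs ! i)))"
      unfolding comb_def
      by (rule M.finsum_cong')
        (auto simp: len idem_module_nth xs' rsmult_assoc b a rsmult_closed)
    then show ?thesis
      unfolding comb_def using rsmult_finsum[OF a s[OF xs]] by simp
  qed
qed

lemma comb_in_submodule:
  assumes N: "submodule N R M" and bs: "set bs \<subseteq> N"
    and xs: "\<And>i. i < length bs \<Longrightarrow> xs ! i \<in> carrier R"
  shows "comb M bs xs \<in> N"
  unfolding comb_def
  by (rule submodule_finsum[OF N]) (use N bs xs in \<open>auto simp: submodule_iff subset_iff\<close>)

lemma comb_map:
  assumes "\<And>i. i < n \<Longrightarrow> g i \<in> carrier M" "\<And>i. i < n \<Longrightarrow> xs ! i \<in> carrier R"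
  shows "comb M (map g [0..<n]) xs = (\<Oplus>\<^bsub>M\<^esub>i\<in>{..<n}. (xs ! i) \<odot>\<^bsub>M\<^esub> g i)"
  unfolding comb_def by (rule M.finsum_cong') (auto simp: assms rsmult_closed)

lemma comb_unit_vec:
  assumes a: "adapted R M es bs" and j: "j < length es" and es: "set es \<subseteq> carrier R"
  shows "comb M bs (unit_vec R es j) = bs ! j"
proof -
  have b: "i < length es \<Longrightarrow> bs ! i \<in> carrier M" "length bs = length es" for i
    using a by (simp_all add: adapted_def)
  have "comb M bs (unit_vec R es j) = (\<Oplus>\<^bsub>M\<^esub>i\<in>{..<length bs}. if j = i then bs ! i else \<zero>\<^bsub>M\<^esub>)"
    unfolding comb_def
    by (rule M.finsum_cong')
      (use a es in \<open>auto simp: adapted_def unit_vec_def nth_list_update rsmult_zero_scalar\<close>)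
  also have "\<dots> = bs ! j"
    using j b by (subst M.finsum_singleton) auto
  finally show ?thesis .
qed

end

context
  fixes R (structure) and es :: "'r list"
  assumes R: "ring R" and es: "set es \<subseteq> carrier R" and idem: "\<And>e. e \<in> set es \<Longrightarrow> e \<otimes> e = e"
begin

interpretation ring R by (rule R)
interpretation P: right_module R "idem_module R es" by (rule idem_module_right_module[OF es])

private lemma es_nth: "i < length es \<Longrightarrow> es ! i \<in> carrier R" "i < length es \<Longrightarrow> es ! i \<otimes> es ! i = es ! i"
  using es idem by auto

lemma unit_vec_carrier: "i < length es \<Longrightarrow> unit_vec R es i \<in> carrier (idem_module R es)"
  by (auto simp: idem_module_carrier_iff unit_vec_def nth_list_update es_nth)

lemma unit_vecs_adapted: "adapted R (idem_module R es) es (map (unit_vec R es) [0..<length es])"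
proof -
  have "es ! i \<odot>\<^bsub>idem_module R es\<^esub> unit_vec R es i = unit_vec R es i" if "i < length es" for i
    using that by (auto simp: idem_module_nth idem_module_length unit_vec_def nth_list_update es_nth
        intro!: nth_equalityI)
  then show ?thesis by (simp add: adapted_def unit_vec_carrier)
qed

lemma idem_module_finsum_nth:
  assumes "f \<in> I \<rightarrow> carrier (idem_module R es)" "j < length es"
  shows "(\<Oplus>\<^bsub>idem_module R es\<^esub>i\<in>I. f i) ! j = (\<Oplus>i\<in>I. f i ! j)"
  using assms(1)
proof (induction I rule: infinite_finite_induct)
  case (insert i I)
  have f: "f \<in> I \<rightarrow> carrier (idem_module R es)" "f i \<in> carrier (idem_module R es)" using insert.prems by auto
  then have "finsum (idem_module R es) f I \<in> carrier (idem_module R es)"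
    by (simp add: P.M.finsum_closed)
  then show ?case
    using insert f assms(2)
    by (subst finsum_insert) (auto simp: idem_module_nth idem_module_carrier_iff Pi_iff)
qed (use assms(2) in \<open>auto simp: idem_module_nth P.M.finsum_infinite\<close>)

lemma comb_unit_vecs:
  assumes xs: "xs \<in> carrier (idem_module R es)"
  shows "comb (idem_module R es) (map (unit_vec R es) [0..<length es]) xs = xs"
proof (rule nth_equalityI)
  let ?P = "idem_module R es" and ?bs = "map (unit_vec R es) [0..<length es]"
  note hom = module_homD[OF comb_hom[OF P.right_module_axioms unit_vecs_adapted]]
  show l: "length (comb ?P ?bs xs) = length xs"
    using hom(1)[OF xs] xs by (simp add: idem_module_carrier_iff)
  fix j assume "j < length (comb ?P ?bs xs)"
  then have j: "j < length es" using l xs by (simp add: idem_module_carrier_iff)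
  have x: "i < length es \<Longrightarrow> xs ! i \<in> carrier R" for i using xs by (simp add: idem_module_carrier_iff)
  have "comb ?P ?bs xs ! j = (\<Oplus>i\<in>{..<length ?bs}. ((xs ! i) \<odot>\<^bsub>?P\<^esub> (?bs ! i)) ! j)"
    unfolding comb_def
    by (rule idem_module_finsum_nth[OF smult_nth_in[OF P.right_module_axioms unit_vecs_adapted xs] j])
  also have "\<dots> = (\<Oplus>i\<in>{..<length es}. if j = i then xs ! i else \<zero>)"
    by (rule finsum_cong')
      (use xs j in \<open>auto simp: idem_module_nth unit_vec_def nth_list_update idem_module_carrier_iff\<close>)
  also have "\<dots> = xs ! j"
    using j x by (subst finsum_singleton) auto
  finally show "comb ?P ?bs xs ! j = xs ! j" .
qed

lemma module_hom_idem_module: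
  assumes M: "right_module R M" and f: "f \<in> module_hom R (idem_module R es) M"
    and xs: "xs \<in> carrier (idem_module R es)"
  shows "f xs = comb M (map (\<lambda>i. f (unit_vec R es i)) [0..<length es]) xs"
proof -
  let ?P = "idem_module R es" and ?bs = "map (unit_vec R es) [0..<length es]"
  interpret f: rmodule_hom R ?P M f by (rule rmodule_homI[OF P.right_module_axioms M f])
  have x: "i < length es \<Longrightarrow> xs ! i \<in> carrier R" for i using xs by (simp add: idem_module_carrier_iff)
  have "f xs = f (comb ?P ?bs xs)" by (simp add: comb_unit_vecs[OF xs])
  also have "\<dots> = (\<Oplus>\<^bsub>M\<^esub>i\<in>{..<length ?bs}. f ((xs ! i) \<odot>\<^bsub>?P\<^esub> (?bs ! i)))"
    unfolding comb_def by (rule f.finsum[OF smult_nth_in[OF P.right_module_axioms unit_vecs_adapted xs]])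
  also have "\<dots> = (\<Oplus>\<^bsub>M\<^esub>i\<in>{..<length es}. (xs ! i) \<odot>\<^bsub>M\<^esub> f (unit_vec R es i))"
    by (rule f.N.M.finsum_cong') (auto simp: f.smult unit_vec_carrier x f.closed f.N.rsmult_closed)
  finally show ?thesis by (simp add: comb_map[OF M] f.closed unit_vec_carrier x)
qed

lemma idem_module_projective: "projective_module R (idem_module R es)"
  unfolding projective_module_def
proof (intro allI impI, elim conjE)
  fix X Y :: "('r, 'r list) module" and p f
  assume X: "right_module R X" and Y: "right_module R Y" and p: "p \<in> module_hom R X Y"
    and surj: "p ` carrier X = carrier Y" and f: "f \<in> module_hom R (idem_module R es) Y"
  let ?P = "idem_module R es"
  interpret p: rmodule_hom R X Y p by (rule rmodule_homI[OF X Y p])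
  interpret f: rmodule_hom R ?P Y f by (rule rmodule_homI[OF P.right_module_axioms Y f])
  have "\<forall>i<length es. \<exists>b\<in>carrier X. p b = f (unit_vec R es i)"
    using surj f.closed[OF unit_vec_carrier] by (metis imageE)
  then obtain b where b: "\<And>i. i < length es \<Longrightarrow> b i \<in> carrier X"
    "\<And>i. i < length es \<Longrightarrow> p (b i) = f (unit_vec R es i)"
    by metis
  \<comment> \<open>A preimage of the image of the i-th unit vector need not be fixed by the
    idempotent. Acting on it with \<open>es ! i\<close> repairs this and leaves its image under
    \<open>p\<close> unchanged.\<close>
  let ?bs = "map (\<lambda>i. es ! i \<odot>\<^bsub>X\<^esub> b i) [0..<length es]"
  have ad: "adapted R X es ?bs"
    by (auto simp: adapted_def p.M.rsmult_closed es_nth b simp flip: p.M.rsmult_assoc)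
  have fu: "es ! i \<odot>\<^bsub>Y\<^esub> f (unit_vec R es i) = f (unit_vec R es i)" if "i < length es" for i
    using unit_vecs_adapted that f.smult[of "es ! i" "unit_vec R es i"]
    by (simp add: adapted_def unit_vec_carrier es_nth)
  have "p (comb X ?bs xs) = f xs" if xs: "xs \<in> carrier ?P" for xs
  proof -
    have x: "i < length es \<Longrightarrow> xs ! i \<in> carrier R" for i using xs by (simp add: idem_module_carrier_iff)
    have "p (comb X ?bs xs) = (\<Oplus>\<^bsub>Y\<^esub>i\<in>{..<length ?bs}. p ((xs ! i) \<odot>\<^bsub>X\<^esub> (?bs ! i)))"
      unfolding comb_def by (rule p.finsum[OF smult_nth_in[OF X ad xs]])
    also have "\<dots> = (\<Oplus>\<^bsub>Y\<^esub>i\<in>{..<length es}. (xs ! i) \<odot>\<^bsub>Y\<^esub> f (unit_vec R es i))"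
      by (rule p.N.M.finsum_cong')
        (auto simp: p.smult b x p.M.rsmult_closed es_nth fu f.closed unit_vec_carrier p.N.rsmult_closed)
    also have "\<dots> = f xs"
      by (subst module_hom_idem_module[OF Y f xs]) (simp add: comb_map[OF Y] f.closed unit_vec_carrier x)
    finally show ?thesis .
  qed
  then show "\<exists>g\<in>module_hom R ?P X. \<forall>x\<in>carrier ?P. p (g x) = f x"
    using comb_hom[OF X ad] by blast
qed

lemma idem_module_fin_gen: "fin_gen_module R (idem_module R es)"
proof -
  let ?P = "idem_module R es"
  have "N = carrier ?P" if N: "submodule N R ?P" "unit_vec R es ` {..<length es} \<subseteq> N" for N
  proof
    show "N \<subseteq> carrier ?P" using N by (simp add: P.submodule_iff)
    show "carrier ?P \<subseteq> N"
    proof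
      fix xs assume xs: "xs \<in> carrier ?P"
      have "comb ?P (map (unit_vec R es) [0..<length es]) xs \<in> N"
        by (rule comb_in_submodule[OF P.right_module_axioms N(1)])
          (use N(2) xs in \<open>auto simp: idem_module_carrier_iff\<close>)
      then show "xs \<in> N" by (simp add: comb_unit_vecs[OF xs])
    qed
  qed
  then show ?thesis
    unfolding fin_gen_module_def using unit_vec_carrier
    by (intro exI[of _ "unit_vec R es ` {..<length es}"]) auto
qed

lemma idem_module_fg: "idem_module R es \<in> fg_modules R"
  by (simp add: fg_modules_def P.right_module_axioms idem_module_fin_gen)

end

subsection \<open>Finitely generated modules\<close>

lemma fin_gen_image:
  assumes M: "right_module R M" and N: "right_module R N" and f: "f \<in> module_hom R M N"
    and surj: "f ` carrier M = carrier N" and fg: "fin_gen_module R M"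
  shows "fin_gen_module R N"
proof -
  interpret f: rmodule_hom R M N f by (rule rmodule_homI[OF M N f])
  obtain S where S: "finite S" "S \<subseteq> carrier M" "\<And>L. \<lbrakk>submodule L R M; S \<subseteq> L\<rbrakk> \<Longrightarrow> L = carrier M"
    using fg by (auto simp: fin_gen_module_def)
  have "L = carrier N" if L: "submodule L R N" "f ` S \<subseteq> L" for L
  proof -
    have "{x \<in> carrier M. f x \<in> L} = carrier M"
      using S L by (intro S(3) f.vimage_submodule) auto
    then have "f ` carrier M \<subseteq> L" by auto
    then show ?thesis using surj L by (simp add: f.N.submodule_iff)
  qed
  then show ?thesis
    unfolding fin_gen_module_def using S(1,2) f.closed by (intro exI[of _ "f ` S"]) auto
qed

lemma fin_gen_sum:
  assumes M: "right_module R M" and N: "right_module R N"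
    and fg: "fin_gen_module R M" "fin_gen_module R N"
  shows "fin_gen_module R (module_sum M N)"
proof -
  note homs = module_sum_homs[OF M N] and sum = module_sum_right_module[OF M N]
  interpret S: right_module R "module_sum M N" by (rule sum)
  interpret i: rmodule_hom R M "module_sum M N" "\<lambda>x. (x, \<zero>\<^bsub>N\<^esub>)" by (rule rmodule_homI[OF M sum homs(3)])
  interpret j: rmodule_hom R N "module_sum M N" "\<lambda>y. (\<zero>\<^bsub>M\<^esub>, y)" by (rule rmodule_homI[OF N sum homs(4)])
  obtain A where A: "finite A" "A \<subseteq> carrier M" "\<And>L. \<lbrakk>submodule L R M; A \<subseteq> L\<rbrakk> \<Longrightarrow> L = carrier M"
    using fg by (auto simp: fin_gen_module_def)
  obtain B where B: "finite B" "B \<subseteq> carrier N" "\<And>L. \<lbrakk>submodule L R N; B \<subseteq> L\<rbrakk> \<Longrightarrow> L = carrier N"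
    using fg by (auto simp: fin_gen_module_def)
  have "L = carrier (module_sum M N)"
    if L: "submodule L R (module_sum M N)" "(\<lambda>x. (x, \<zero>\<^bsub>N\<^esub>)) ` A \<union> (\<lambda>y. (\<zero>\<^bsub>M\<^esub>, y)) ` B \<subseteq> L" for L
  proof -
    have "{x \<in> carrier M. (x, \<zero>\<^bsub>N\<^esub>) \<in> L} = carrier M"
      using A L by (intro A(3) i.vimage_submodule) auto
    moreover have "{x \<in> carrier N. (\<zero>\<^bsub>M\<^esub>, x) \<in> L} = carrier N"
      using B L by (intro B(3) j.vimage_submodule) auto
    ultimately have "(x, y) \<in> L" if "x \<in> carrier M" "y \<in> carrier N" for x y
    proof -
      have "(x, \<zero>\<^bsub>N\<^esub>) \<oplus>\<^bsub>module_sum M N\<^esub> (\<zero>\<^bsub>M\<^esub>, y) \<in> L"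
        using \<open>{x \<in> carrier M. (x, \<zero>\<^bsub>N\<^esub>) \<in> L} = _\<close> \<open>{x \<in> carrier N. (\<zero>\<^bsub>M\<^esub>, x) \<in> L} = _\<close> that L(1)
        unfolding S.submodule_iff by blast
      then show ?thesis using that by simp
    qed
    then show ?thesis using L(1) by (auto simp: S.submodule_iff)
  qed
  then show ?thesis
    unfolding fin_gen_module_def using A(1,2) B(1,2)
    by (intro exI[of _ "(\<lambda>x. (x, \<zero>\<^bsub>N\<^esub>)) ` A \<union> (\<lambda>y. (\<zero>\<^bsub>M\<^esub>, y)) ` B"]) auto
qed

lemma fin_gen_cover:
  assumes M: "right_module R M" and fg: "fin_gen_module R M"
  obtains es bs where "set es \<subseteq> {\<one>\<^bsub>R\<^esub>}" "adapted R M es bs"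
    "comb M bs ` carrier (idem_module R es) = carrier M"
proof -
  interpret right_module R M by (rule M)
  obtain S where S: "finite S" "S \<subseteq> carrier M" "\<And>L. \<lbrakk>submodule L R M; S \<subseteq> L\<rbrakk> \<Longrightarrow> L = carrier M"
    using fg by (auto simp: fin_gen_module_def)
  obtain bs where bs: "set bs = S" using finite_list[OF S(1)] by blast
  let ?es = "replicate (length bs) \<one>\<^bsub>R\<^esub>"
  have e: "set ?es \<subseteq> carrier R" by auto
  have ad: "adapted R M ?es bs"
    using S(2) bs nth_mem by (auto simp: adapted_def subset_iff rsmult_one)
  interpret c: rmodule_hom R "idem_module R ?es" M "comb M bs"
    by (rule rmodule_homI[OF idem_module_right_module[OF e] M comb_hom[OF M ad]])
  have "comb M bs ` carrier (idem_module R ?es) = carrier M"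
  proof (rule S(3)[OF c.image_submodule[OF c.M.carrier_submodule]])
    show "S \<subseteq> comb M bs ` carrier (idem_module R ?es)"
    proof
      fix x assume "x \<in> S"
      then obtain i where i: "i < length bs" "bs ! i = x" using bs by (metis in_set_conv_nth)
      then have "comb M bs (unit_vec R ?es i) = x"
        using comb_unit_vec[OF M ad _ e, of i] by simp
      moreover have "unit_vec R ?es i \<in> carrier (idem_module R ?es)"
        using i by (intro unit_vec_carrier R.ring_axioms e) auto
      ultimately show "x \<in> comb M bs ` carrier (idem_module R ?es)" by force
    qed
  qed
  then show thesis using that[of ?es bs] ad by (metis set_replicate_conv_if empty_subsetI subset_refl)
qed

text \<open>A quotient taken on a transversal of a module of lists again consists of lists. This
  brings modules with other element types back into the universe, in particular direct sums, whose
  elements are pairs.\<close>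

lemma fg_modules_copy:
  assumes M: "right_module R M" and fg: "fin_gen_module R M"
  obtains M' where "M' \<in> fg_modules R" "module_iso R M M'"
proof -
  interpret right_module R M by (rule M)
  obtain es bs where e: "set es \<subseteq> {\<one>\<^bsub>R\<^esub>}" and ad: "adapted R M es bs"
    and surj: "comb M bs ` carrier (idem_module R es) = carrier M"
    using fin_gen_cover[OF M fg] by blast
  have e': "set es \<subseteq> carrier R" "\<And>e. e \<in> set es \<Longrightarrow> e \<otimes>\<^bsub>R\<^esub> e = e" using e by auto
  let ?P = "idem_module R es"
  note P = idem_module_right_module[OF e'(1)]
  interpret c: rmodule_hom R ?P M "comb M bs"
    by (rule rmodule_homI[OF P M comb_hom[OF M ad]])
  let ?K = "module_kernel ?P M (comb M bs)"
  let ?Q = "quotient_module ?P ?K"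
  note Q = quotient_right_module[OF P c.kernel_submodule]
  have "?Q \<in> fg_modules R"
    unfolding fg_modules_def
    using Q fin_gen_image[OF P Q quotient_rep_hom[OF P c.kernel_submodule]
        quotient_rep_surj[OF P c.kernel_submodule] idem_module_fin_gen[OF R.ring_axioms e']] by simp
  moreover have "module_iso R M ?Q"
    by (rule module_iso_of_same_kernel[OF P M Q c.hom surj quotient_rep_hom[OF P c.kernel_submodule]
        quotient_rep_surj[OF P c.kernel_submodule]])
      (simp add: quotient_rep_zero_iff[OF P c.kernel_submodule] c.kernel_iff)
  ultimately show thesis by (rule that)
qed

lemma fin_gen_iso:
  assumes "module_iso R M N" "right_module R M" "right_module R N" "fin_gen_module R M"
  shows "fin_gen_module R N"
  using assms fin_gen_image by (metis bij_betw_def module_iso_def)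

subsection \<open>Projective modules and projective covers\<close>

lemma projective_iso:
  fixes P :: "('r, 'a) module" and P' :: "('r, 'b) module"
  assumes P: "projective_module R P" and iso: "module_iso R P P'" and rP: "right_module R P"
  shows "projective_module R P'"
  unfolding projective_module_def
proof (intro allI impI, elim conjE)
  fix X Y :: "('r, 'r list) module" and p f
  assume a: "right_module R X" "right_module R Y" "p \<in> module_hom R X Y" "p ` carrier X = carrier Y"
    and f: "f \<in> module_hom R P' Y"
  obtain h where h: "h \<in> module_hom R P P'" "bij_betw h (carrier P) (carrier P')"
    using iso by (auto simp: module_iso_def)
  let ?h' = "inv_into (carrier P) h"
  have h': "?h' \<in> module_hom R P' P" 
  proof (rule module_homI)
    interpret right_module R P by (rule rP)
    have gc: "x \<in> carrier P' \<Longrightarrow> ?h' x \<in> carrier P" for x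
      using bij_betw_inv_into[OF h(2)] by (auto simp: bij_betw_def)
    have fg: "x \<in> carrier P' \<Longrightarrow> h (?h' x) = x" for x
      using h(2) by (simp add: bij_betw_inv_into_right)
    have gf: "x \<in> carrier P \<Longrightarrow> ?h' (h x) = x" for x
      using h(2) by (simp add: bij_betw_inv_into_left)
    show "x \<in> carrier P' \<Longrightarrow> ?h' x \<in> carrier P" for x by (rule gc)
    show "?h' (x \<oplus>\<^bsub>P'\<^esub> y) = ?h' x \<oplus>\<^bsub>P\<^esub> ?h' y" if "x \<in> carrier P'" "y \<in> carrier P'" for x y
      using gf[of "?h' x \<oplus>\<^bsub>P\<^esub> ?h' y"] that by (simp add: gc fg module_homD(2)[OF h(1)])
    show "?h' (a \<odot>\<^bsub>P'\<^esub> x) = a \<odot>\<^bsub>P\<^esub> ?h' x" if "a \<in> carrier R" "x \<in> carrier P'" for a x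
      using gf[of "a \<odot>\<^bsub>P\<^esub> ?h' x"] that by (simp add: gc fg rsmult_closed module_homD(3)[OF h(1)])
  qed
  obtain g where g: "g \<in> module_hom R P X" "\<forall>x\<in>carrier P. p (g x) = f (h x)"
    using P a module_hom_comp[OF h(1) f] unfolding projective_module_def by meson
  have "p (g (?h' x)) = f x" if "x \<in> carrier P'" for x
    using g(2) that h(2) module_homD(1)[OF h'] by (simp add: bij_betw_inv_into_right)
  then show "\<exists>g\<in>module_hom R P' X. \<forall>x\<in>carrier P'. p (g x) = f x"
    by (intro bexI[OF _ module_hom_comp[OF h' g(1)]] ballI)
qed

lemma projective_sum:
  assumes P: "projective_module R P" "right_module R P" and Q: "projective_module R Q" "right_module R Q"
  shows "projective_module R (module_sum P Q)"
  unfolding projective_module_def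
proof (intro allI impI, elim conjE)
  fix X Y :: "('a, 'a list) module" and p f
  assume a: "right_module R X" "right_module R Y" "p \<in> module_hom R X Y" "p ` carrier X = carrier Y"
    and f: "f \<in> module_hom R (module_sum P Q) Y"
  interpret p: rmodule_hom R X Y p using a by (simp add: rmodule_homI)
  interpret P: right_module R P by fact
  interpret Q: right_module R Q by fact
  note homs = module_sum_homs[OF P(2) Q(2)]
  obtain g where g: "g \<in> module_hom R P X" "\<And>x. x \<in> carrier P \<Longrightarrow> p (g x) = f (x, \<zero>\<^bsub>Q\<^esub>)"
    using P(1) a module_hom_comp[OF homs(3) f] unfolding projective_module_def by blast
  obtain h where h: "h \<in> module_hom R Q X" "\<And>x. x \<in> carrier Q \<Longrightarrow> p (h x) = f (\<zero>\<^bsub>P\<^esub>, x)"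
    using Q(1) a module_hom_comp[OF homs(4) f] unfolding projective_module_def by blast
  let ?g = "\<lambda>z. g (fst z) \<oplus>\<^bsub>X\<^esub> h (snd z)"
  have "?g \<in> module_hom R (module_sum P Q) X"
    using module_homD[OF g(1)] module_homD[OF h(1)]
    by (intro module_homI) (auto simp: p.M.M.a_ac p.M.rsmult_add)
  moreover have "p (?g z) = f z" if "z \<in> carrier (module_sum P Q)" for z
    using that module_homD(1)[OF g(1)] module_homD(1)[OF h(1)]
      module_homD(2)[OF f, of "(fst z, \<zero>\<^bsub>Q\<^esub>)" "(\<zero>\<^bsub>P\<^esub>, snd z)"]
    by (auto simp: p.add g h)
  ultimately show "\<exists>g\<in>module_hom R (module_sum P Q) X. \<forall>x\<in>carrier (module_sum P Q). p (g x) = f x"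
    by (intro bexI[of _ ?g] ballI)
qed

lemma projective_zero:
  assumes "right_module R P" "carrier P = {\<zero>\<^bsub>P\<^esub>}"
  shows "projective_module R P"
  unfolding projective_module_def
proof (intro allI impI, elim conjE)
  fix X Y :: "('a, 'a list) module" and p f
  assume a: "right_module R X" "right_module R Y" "p \<in> module_hom R X Y" "p ` carrier X = carrier Y"
    and f: "f \<in> module_hom R P Y"
  interpret p: rmodule_hom R X Y p using a by (simp add: rmodule_homI)
  interpret f: rmodule_hom R P Y f using a assms f by (simp add: rmodule_homI)
  have "(\<lambda>x. \<zero>\<^bsub>X\<^esub>) \<in> module_hom R P X"
    by (auto intro!: module_homI simp: p.M.rsmult_zero)
  then show "\<exists>g\<in>module_hom R P X. \<forall>x\<in>carrier P. p (g x) = f x"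
    using assms f.zero p.zero by (metis singletonD)
qed

lemma superfluousD:
  assumes sup: "superfluous R M K" and N: "submodule N R M"
    and sum: "\<And>x. x \<in> carrier M \<Longrightarrow> \<exists>y\<in>K. \<exists>z\<in>N. x = y \<oplus>\<^bsub>M\<^esub> z"
    and M: "right_module R M" and K: "K \<subseteq> carrier M"
  shows "N = carrier M"
proof -
  interpret right_module R M by (rule M)
  have "K <+>\<^bsub>M\<^esub> N = carrier M"
  proof
    show "K <+>\<^bsub>M\<^esub> N \<subseteq> carrier M"
      using K N by (auto simp: set_add_def' submodule_iff subset_iff)
    show "carrier M \<subseteq> K <+>\<^bsub>M\<^esub> N"
    proof
      fix x assume "x \<in> carrier M"
      from sum[OF this] show "x \<in> K <+>\<^bsub>M\<^esub> N" by (auto simp: set_add_def')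
    qed
  qed
  then show ?thesis using sup N by (simp add: superfluous_def)
qed

lemma superfluousI:
  assumes "\<And>N. \<lbrakk>submodule N R M; \<And>x. x \<in> carrier M \<Longrightarrow> \<exists>y\<in>K. \<exists>z\<in>N. x = y \<oplus>\<^bsub>M\<^esub> z\<rbrakk> \<Longrightarrow> N = carrier M"
  shows "superfluous R M K"
  unfolding superfluous_def
proof (intro allI impI, elim conjE)
  fix N assume N: "submodule N R M" and eq: "K <+>\<^bsub>M\<^esub> N = carrier M"
  show "N = carrier M"
  proof (rule assms[OF N])
    fix x assume "x \<in> carrier M"
    then have "x \<in> K <+>\<^bsub>M\<^esub> N" by (simp only: eq)
    then show "\<exists>y\<in>K. \<exists>z\<in>N. x = y \<oplus>\<^bsub>M\<^esub> z" by (auto simp: set_add_def')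
  qed
qed

text \<open>If f(K) + L is all of N, then K together with the preimage of L fills M, so that
  preimage is M. Hence f(K) already lies in L.\<close>

lemma superfluous_image:
  assumes M: "right_module R M" and N: "right_module R N" and f: "f \<in> module_hom R M N"
    and K: "superfluous R M K" "K \<subseteq> carrier M"
  shows "superfluous R N (f ` K)"
proof (rule superfluousI)
  interpret f: rmodule_hom R M N f by (rule rmodule_homI[OF M N f])
  fix L assume L: "submodule L R N" and sum: "\<And>x. x \<in> carrier N \<Longrightarrow> \<exists>y\<in>f ` K. \<exists>z\<in>L. x = y \<oplus>\<^bsub>N\<^esub> z"
  have "{x \<in> carrier M. f x \<in> L} = carrier M"
  proof (rule superfluousD[OF K(1) f.vimage_submodule[OF L] _ M K(2)])
    fix x assume x: "x \<in> carrier M"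
    obtain y z where yz: "y \<in> K" "z \<in> L" "f x = f y \<oplus>\<^bsub>N\<^esub> z" using sum[OF f.closed[OF x]] by blast
    have z: "z \<in> carrier N" using L yz by (auto simp: f.N.submodule_iff)
    have y: "y \<in> carrier M" using K(2) yz by auto
    have "f (x \<ominus>\<^bsub>M\<^esub> y) = z"
      unfolding f.diff[OF x y] yz(3) using z f.closed[OF y]
      by (simp add: a_minus_def f.N.M.a_comm[of "f y" z] f.N.M.a_assoc f.N.M.r_neg)
    then show "\<exists>y\<in>K. \<exists>z\<in>{x \<in> carrier M. f x \<in> L}. x = y \<oplus>\<^bsub>M\<^esub> z"
      using x y yz f.M.minus_minus_cancel[OF x y] by (intro bexI[of _ y] bexI[of _ "x \<ominus>\<^bsub>M\<^esub> y"]) auto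
  qed
  then have fL: "f ` K \<subseteq> L" using K(2) by auto
  show "L = carrier N"
  proof
    show "L \<subseteq> carrier N" using L by (simp add: f.N.submodule_iff)
    show "carrier N \<subseteq> L"
    proof
      fix x assume "x \<in> carrier N"
      from sum[OF this] obtain y z where "y \<in> L" "z \<in> L" "x = y \<oplus>\<^bsub>N\<^esub> z" using fL by blast
      then show "x \<in> L" using L by (simp add: f.N.submodule_iff)
    qed
  qed
qed

lemma superfluous_sum:
  assumes M: "right_module R M" and N: "right_module R N"
    and K: "superfluous R M K" "K \<subseteq> carrier M" and L: "superfluous R N L" "L \<subseteq> carrier N"
    and z: "submodule L R N"
  shows "superfluous R (module_sum M N) (K \<times> L)"
proof (rule superfluousI)
  note homs = module_sum_homs[OF M N] and S = module_sum_right_module[OF M N]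
  interpret M: right_module R M by fact
  interpret N: right_module R N by fact
  interpret S: right_module R "module_sum M N" by fact
  note sK = superfluous_image[OF M S homs(3) K] and sL = superfluous_image[OF N S homs(4) L]
  fix T assume T: "submodule T R (module_sum M N)"
    and sum: "\<And>x. x \<in> carrier (module_sum M N) \<Longrightarrow> \<exists>y\<in>K \<times> L. \<exists>z\<in>T. x = y \<oplus>\<^bsub>module_sum M N\<^esub> z"
  have Tc: "T \<subseteq> carrier (module_sum M N)" using T by (simp add: S.submodule_iff)
  let ?T' = "{x \<in> carrier (module_sum M N). \<exists>l\<in>L. \<exists>t\<in>T. x = (\<zero>\<^bsub>M\<^esub>, l) \<oplus>\<^bsub>module_sum M N\<^esub> t}"
  have "submodule ?T' R (module_sum M N)"
    unfolding S.submodule_iff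
  proof (intro conjI ballI)
    show "\<zero>\<^bsub>module_sum M N\<^esub> \<in> ?T'"
      using T z by (auto simp: S.submodule_iff N.submodule_iff intro!: bexI[of _ "\<zero>\<^bsub>N\<^esub>"] bexI[of _ "(\<zero>\<^bsub>M\<^esub>,\<zero>\<^bsub>N\<^esub>)"])
    fix x y assume "x \<in> ?T'" "y \<in> ?T'"
    then obtain l t l' t' where l: "l \<in> L" "t \<in> T" "x = (\<zero>\<^bsub>M\<^esub>, l) \<oplus>\<^bsub>module_sum M N\<^esub> t" "x \<in> carrier (module_sum M N)"
      and l': "l' \<in> L" "t' \<in> T" "y = (\<zero>\<^bsub>M\<^esub>, l') \<oplus>\<^bsub>module_sum M N\<^esub> t'" "y \<in> carrier (module_sum M N)" by blast
    have c: "l \<in> carrier N" "l' \<in> carrier N" "t \<in> carrier (module_sum M N)" "t' \<in> carrier (module_sum M N)"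
      using l l' L Tc by auto
    have "x \<oplus>\<^bsub>module_sum M N\<^esub> y = (\<zero>\<^bsub>M\<^esub>, l \<oplus>\<^bsub>N\<^esub> l') \<oplus>\<^bsub>module_sum M N\<^esub> (t \<oplus>\<^bsub>module_sum M N\<^esub> t')"
      using l(3) l'(3) c by (cases t; cases t') (auto simp: M.M.a_ac N.M.a_ac)
    moreover have "l \<oplus>\<^bsub>N\<^esub> l' \<in> L" "t \<oplus>\<^bsub>module_sum M N\<^esub> t' \<in> T"
      using z T l l' by (auto simp only: N.submodule_iff S.submodule_iff)
    ultimately show "x \<oplus>\<^bsub>module_sum M N\<^esub> y \<in> ?T'" using S.M.a_closed[OF l(4) l'(4)] by blast
  next
    fix a x assume a: "a \<in> carrier R" and "x \<in> ?T'"
    then obtain l t where l: "l \<in> L" "t \<in> T" "x = (\<zero>\<^bsub>M\<^esub>, l) \<oplus>\<^bsub>module_sum M N\<^esub> t" "x \<in> carrier (module_sum M N)"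
      by blast
    have c: "l \<in> carrier N" "t \<in> carrier (module_sum M N)"
      using l L Tc by auto
    have "a \<odot>\<^bsub>module_sum M N\<^esub> x = (\<zero>\<^bsub>M\<^esub>, a \<odot>\<^bsub>N\<^esub> l) \<oplus>\<^bsub>module_sum M N\<^esub> (a \<odot>\<^bsub>module_sum M N\<^esub> t)"
      using l(3) c a by (cases t) (auto simp: M.rsmult_add N.rsmult_add M.rsmult_zero M.rsmult_closed)
    moreover have "a \<odot>\<^bsub>N\<^esub> l \<in> L" "a \<odot>\<^bsub>module_sum M N\<^esub> t \<in> T"
      using z T l a by (auto simp only: N.submodule_iff S.submodule_iff)
    ultimately show "a \<odot>\<^bsub>module_sum M N\<^esub> x \<in> ?T'" using S.rsmult_closed[OF a l(4)] by blast
  qed auto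
  moreover have "\<exists>y\<in>(\<lambda>x. (x, \<zero>\<^bsub>N\<^esub>)) ` K. \<exists>z\<in>?T'. x = y \<oplus>\<^bsub>module_sum M N\<^esub> z"
    if x: "x \<in> carrier (module_sum M N)" for x
  proof -
    obtain k l t where *: "k \<in> K" "l \<in> L" "t \<in> T" "x = (k, l) \<oplus>\<^bsub>module_sum M N\<^esub> t" using sum[OF x] by auto
    have c: "k \<in> carrier M" "l \<in> carrier N" "t \<in> carrier (module_sum M N)" using * K L Tc by auto
    have "x = (k, \<zero>\<^bsub>N\<^esub>) \<oplus>\<^bsub>module_sum M N\<^esub> ((\<zero>\<^bsub>M\<^esub>, l) \<oplus>\<^bsub>module_sum M N\<^esub> t)"
      using *(4) c by (cases t) auto
    moreover have "(\<zero>\<^bsub>M\<^esub>, l) \<oplus>\<^bsub>module_sum M N\<^esub> t \<in> ?T'"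
      using * c by (auto intro!: S.M.a_closed)
    ultimately show ?thesis using *(1) by blast
  qed
  ultimately have T': "?T' = carrier (module_sum M N)"
    using K(2) by (intro superfluousD[OF sK _ _ S]) auto
  show "T = carrier (module_sum M N)"
  proof (rule superfluousD[OF sL T _ S])
    show "\<exists>y\<in>(\<lambda>y. (\<zero>\<^bsub>M\<^esub>, y)) ` L. \<exists>z\<in>T. x = y \<oplus>\<^bsub>module_sum M N\<^esub> z"
      if "x \<in> carrier (module_sum M N)" for x
      using that T' by blast
  qed (use L(2) in auto)
qed

text \<open>The relation from which \<open>syzygy\<close> selects a value. The module
  \<open>M\<close> may have any element type here, so that syzygies of direct sums can be discussed
  before they are copied into the universe.\<close>

definition is_syzygy :: "('r, 'm) ring_scheme \<Rightarrow> ('r, 'a) module \<Rightarrow> ('r, 'r list) module \<Rightarrow> bool" where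
  "is_syzygy R M N \<longleftrightarrow> (\<exists>P\<in>fg_modules R. \<exists>p. projective_cover R P M p \<and> N = P\<lparr>carrier := module_kernel P M p\<rparr>)"

lemma projective_cover_unique:
  fixes P P' M :: "('r, 'r list) module"
  assumes c: "projective_cover R P M p" and c': "projective_cover R P' M p'" and M: "right_module R M"
  shows "module_iso R (P\<lparr>carrier := module_kernel P M p\<rparr>) (P'\<lparr>carrier := module_kernel P' M p'\<rparr>)"
proof -
  have p: "right_module R P" "projective_module R P" "p \<in> module_hom R P M" "p ` carrier P = carrier M"
    "superfluous R P (module_kernel P M p)"
    using c by (auto simp: projective_cover_def)
  have p': "right_module R P'" "projective_module R P'" "p' \<in> module_hom R P' M" "p' ` carrier P' = carrier M"
    "superfluous R P' (module_kernel P' M p')"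
    using c' by (auto simp: projective_cover_def)
  interpret p: rmodule_hom R P M p by (rule rmodule_homI[OF p(1) M p(3)])
  interpret p': rmodule_hom R P' M p' by (rule rmodule_homI[OF p'(1) M p'(3)])
  obtain f where f: "f \<in> module_hom R P P'" and pf: "\<And>x. x \<in> carrier P \<Longrightarrow> p' (f x) = p x"
    using p(2) p'(1,3,4) M p(3) unfolding projective_module_def by blast
  interpret f: rmodule_hom R P P' f by (rule rmodule_homI[OF p(1) p'(1) f])
  have fsurj: "f ` carrier P = carrier P'"
  proof (rule superfluousD[OF p'(5) f.image_submodule[OF p.M.carrier_submodule] _ p'(1)])
    fix y assume y: "y \<in> carrier P'"
    obtain x where x: "x \<in> carrier P" "p x = p' y" using p(4) p'.closed[OF y] by (metis imageE)
    have "y \<ominus>\<^bsub>P'\<^esub> f x \<in> module_kernel P' M p'"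
      using x y pf[OF x(1)] p'.eq_iff_kernel[OF y f.closed[OF x(1)]] by simp
    then show "\<exists>a\<in>module_kernel P' M p'. \<exists>z\<in>f ` carrier P. y = a \<oplus>\<^bsub>P'\<^esub> z"
      using x y f.closed[OF x(1)] p'.M.minus_minus_cancel[of y "f x"] p'.M.M.a_comm
      by (intro bexI[of _ "y \<ominus>\<^bsub>P'\<^esub> f x"] bexI[of _ "f x"]) (auto simp: p'.M.M.minus_closed)
  qed (auto simp: module_kernel_def)
  obtain g where g: "g \<in> module_hom R P' P" and fg: "\<And>x. x \<in> carrier P' \<Longrightarrow> f (g x) = x"
    using p'(2) p(1) p'(1) f fsurj module_hom_id[of R P'] unfolding projective_module_def by blast
  interpret g: rmodule_hom R P' P g by (rule rmodule_homI[OF p'(1) p(1) g])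
  have gsurj: "g ` carrier P' = carrier P"
  proof (rule superfluousD[OF p(5) g.image_submodule[OF p'.M.carrier_submodule] _ p(1)])
    fix x assume x: "x \<in> carrier P"
    have c: "g (f x) \<in> carrier P" using x f.closed g.closed by blast
    have "p (g (f x)) = p x" using pf[OF c] pf[OF x] fg[OF f.closed[OF x]] by simp
    then have "x \<ominus>\<^bsub>P\<^esub> g (f x) \<in> module_kernel P M p"
      using x c p.eq_iff_kernel[OF x c] by simp
    then show "\<exists>a\<in>module_kernel P M p. \<exists>z\<in>g ` carrier P'. x = a \<oplus>\<^bsub>P\<^esub> z"
      using x c f.closed[OF x] p.M.minus_minus_cancel[OF x c] p.M.M.a_comm
      by (intro bexI[of _ "x \<ominus>\<^bsub>P\<^esub> g (f x)"] bexI[of _ "g (f x)"]) (auto simp: p.M.M.minus_closed)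
  qed (auto simp: module_kernel_def)
  have finj: "inj_on f (carrier P)"
    by (rule inj_onI) (metis gsurj fg imageE)
  let ?K = "module_kernel P M p" and ?K' = "module_kernel P' M p'"
  show ?thesis
  proof (rule module_isoI)
    show "f \<in> module_hom R (P\<lparr>carrier := ?K\<rparr>) (P'\<lparr>carrier := ?K'\<rparr>)"
      by (rule module_homI) (auto simp: module_kernel_def f.closed f.add f.smult pf)
    show "inj_on f (carrier (P\<lparr>carrier := ?K\<rparr>))"
      using finj by (auto simp: inj_on_def module_kernel_def)
    show "f ` carrier (P\<lparr>carrier := ?K\<rparr>) = carrier (P'\<lparr>carrier := ?K'\<rparr>)"
    proof -
      have "y \<in> f ` ?K" if "y \<in> ?K'" for y
        using that pf[of "g y"] fg[of y] g.closed[of y]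
        by (intro image_eqI[of _ _ "g y"]) (auto simp: module_kernel_def)
      then show ?thesis by (auto simp: module_kernel_def f.closed pf)
    qed
  qed
qed

lemma is_syzygy_iso_left:
  assumes iso: "module_iso R M M'" and M: "right_module R M" "right_module R M'" and s: "is_syzygy R M N"
  shows "is_syzygy R M' N"
proof -
  obtain P p where P: "P \<in> fg_modules R" "projective_cover R P M p" "N = P\<lparr>carrier := module_kernel P M p\<rparr>"
    using s by (auto simp: is_syzygy_def)
  obtain h where h: "h \<in> module_hom R M M'" "bij_betw h (carrier M) (carrier M')"
    using iso by (auto simp: module_iso_def)
  interpret h: rmodule_hom R M M' h by (rule rmodule_homI[OF M h(1)])
  have ph: "p \<in> module_hom R P M" and surj: "p ` carrier P = carrier M"
    using P(2) by (auto simp: projective_cover_def)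
  have "h x = \<zero>\<^bsub>M'\<^esub> \<longleftrightarrow> x = \<zero>\<^bsub>M\<^esub>" if "x \<in> carrier M" for x
    using that h(2) h.zero by (metis bij_betw_def h.M.M.zero_closed inj_on_eq_iff)
  then have k: "module_kernel P M' (\<lambda>x. h (p x)) = module_kernel P M p"
    using module_homD(1)[OF ph] by (auto simp: module_kernel_def)
  have "(\<lambda>x. h (p x)) ` carrier P = carrier M'"
    using surj h(2) by (metis bij_betw_def image_image)
  then have "projective_cover R P M' (\<lambda>x. h (p x))"
    using P(2) module_hom_comp[OF ph h(1)] k by (simp add: projective_cover_def)
  then show ?thesis unfolding is_syzygy_def using P k by force
qed

lemma is_syzygy_unique:
  fixes M' :: "('r, 'r list) module"
  assumes "is_syzygy R M N" "is_syzygy R M' N'" "module_iso R M M'" "right_module R M" "right_module R M'"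
  shows "module_iso R N N'"
proof -
  have "is_syzygy R M' N" using is_syzygy_iso_left assms by blast
  then obtain P p P' p' where "projective_cover R P M' p" "N = P\<lparr>carrier := module_kernel P M' p\<rparr>"
    "projective_cover R P' M' p'" "N' = P'\<lparr>carrier := module_kernel P' M' p'\<rparr>"
    using assms(2) unfolding is_syzygy_def by blast
  then show ?thesis using projective_cover_unique assms(5) by simp
qed

lemma is_syzygy_sum:
  assumes M: "right_module R M" and M': "right_module R M'"
    and s: "is_syzygy R M N" "is_syzygy R M' N'" and L: "right_module R L" "module_iso R L (module_sum M M')"
  obtains K where "is_syzygy R L K" "module_iso R K (module_sum N N')" "right_module R N" "right_module R N'"
proof -
  obtain P p where P: "P \<in> fg_modules R" "projective_cover R P M p" "N = P\<lparr>carrier := module_kernel P M p\<rparr>"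
    using s by (auto simp: is_syzygy_def)
  obtain P' p' where P': "P' \<in> fg_modules R" "projective_cover R P' M' p'" "N' = P'\<lparr>carrier := module_kernel P' M' p'\<rparr>"
    using s by (auto simp: is_syzygy_def)
  have p: "right_module R P" "projective_module R P" "p \<in> module_hom R P M" "p ` carrier P = carrier M"
    "superfluous R P (module_kernel P M p)"
    using P by (auto simp: projective_cover_def)
  have p': "right_module R P'" "projective_module R P'" "p' \<in> module_hom R P' M'" "p' ` carrier P' = carrier M'"
    "superfluous R P' (module_kernel P' M' p')"
    using P' by (auto simp: projective_cover_def)
  interpret p: rmodule_hom R P M p by (rule rmodule_homI[OF p(1) M p(3)])
  interpret p': rmodule_hom R P' M' p' by (rule rmodule_homI[OF p'(1) M' p'(3)])
  let ?S = "module_sum P P'" and ?q = "map_prod p p'" and ?T = "module_sum M M'"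
  note S = module_sum_right_module[OF p(1) p'(1)] and T = module_sum_right_module[OF M M']
  have q: "?q \<in> module_hom R ?S ?T"
    by (rule module_homI) (auto simp: p.closed p'.closed p.add p'.add p.smult p'.smult)
  have k: "module_kernel ?S ?T ?q = module_kernel P M p \<times> module_kernel P' M' p'"
    by (auto simp: module_kernel_def)
  have surj: "?q ` carrier ?S = carrier ?T"
    using p(4) p'(4) by (simp add: map_prod_surj_on)
  have sup: "superfluous R ?S (module_kernel ?S ?T ?q)"
    unfolding k using p p' by (intro superfluous_sum p'.kernel_submodule) (auto simp: module_kernel_def)
  have "fin_gen_module R ?S"
    using P(1) P'(1) by (intro fin_gen_sum) (auto simp: fg_modules_def)
  \<comment> \<open>The cover of the direct sum consists of pairs, while \<open>is_syzygy\<close>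
    asks for a cover in the universe; \<open>W\<close> is such a copy and the whole covering map is
    transported to it.\<close>
  then obtain W where W: "W \<in> fg_modules R" "module_iso R ?S W" using fg_modules_copy[OF S] by blast
  then have rW: "right_module R W" by (simp add: fg_modules_def)
  obtain h where h: "h \<in> module_hom R W ?S" "bij_betw h (carrier W) (carrier ?S)"
    using module_iso_sym[OF W(2) S] by (auto simp: module_iso_def)
  obtain h' where h': "h' \<in> module_hom R ?S W" "bij_betw h' (carrier ?S) (carrier W)"
    and hh': "\<And>z. z \<in> carrier ?S \<Longrightarrow> h (h' z) = z" "\<And>w. w \<in> carrier W \<Longrightarrow> h' (h w) = w"
  proof -
    let ?h = "inv_into (carrier W) h"
    have b: "bij_betw ?h (carrier ?S) (carrier W)" by (rule bij_betw_inv_into[OF h(2)])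
    have 1: "z \<in> carrier ?S \<Longrightarrow> h (?h z) = z" "w \<in> carrier W \<Longrightarrow> ?h (h w) = w" for z w
      using h(2) by (simp_all add: bij_betw_inv_into_right bij_betw_inv_into_left)
    interpret h: rmodule_hom R W ?S h by (rule rmodule_homI[OF rW S h(1)])
    have c: "z \<in> carrier ?S \<Longrightarrow> ?h z \<in> carrier W" for z using b by (auto simp: bij_betw_def)
    have "?h \<in> module_hom R ?S W"
    proof (rule module_homI)
      show "?h (x \<oplus>\<^bsub>?S\<^esub> y) = ?h x \<oplus>\<^bsub>W\<^esub> ?h y" if "x \<in> carrier ?S" "y \<in> carrier ?S" for x y
        using 1(2)[of "?h x \<oplus>\<^bsub>W\<^esub> ?h y"] that by (simp only: c 1 h.add h.M.M.a_closed)
      show "?h (a \<odot>\<^bsub>?S\<^esub> x) = a \<odot>\<^bsub>W\<^esub> ?h x" if "a \<in> carrier R" "x \<in> carrier ?S" for a x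
        using 1(2)[of "a \<odot>\<^bsub>W\<^esub> ?h x"] that by (simp only: c 1 h.smult h.M.rsmult_closed)
    qed (rule c)
    then show thesis using that[of ?h] b 1 by blast
  qed
  let ?r = "\<lambda>w. ?q (h w)"
  have kr: "module_kernel W ?T ?r = h' ` module_kernel ?S ?T ?q"
  proof -
    have "w \<in> h' ` module_kernel ?S ?T ?q" if "w \<in> module_kernel W ?T ?r" for w
      using that hh'(2)[of w] module_homD(1)[OF h(1), of w]
      by (intro image_eqI[of _ _ "h w"]) (auto simp: module_kernel_def)
    moreover have "h' z \<in> module_kernel W ?T ?r" if "z \<in> module_kernel ?S ?T ?q" for z
    proof -
      have "z \<in> carrier ?S" "?q z = \<zero>\<^bsub>?T\<^esub>" using that by (auto simp: module_kernel_def)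
      then show ?thesis using hh'(1)[of z] module_homD(1)[OF h'(1), of z] by (simp add: module_kernel_def)
    qed
    ultimately show ?thesis by blast
  qed
  have "projective_cover R W ?T ?r"
    unfolding projective_cover_def
  proof (intro conjI)
    show "projective_module R W" using projective_iso[OF projective_sum[OF p(2,1) p'(2,1)] W(2) S] .
    show "?r \<in> module_hom R W ?T" by (rule module_hom_comp[OF h(1) q])
    show "?r ` carrier W = carrier ?T" using h(2) surj by (metis bij_betw_def image_image)
    show "superfluous R W (module_kernel W ?T ?r)"
      unfolding kr by (rule superfluous_image[OF S rW h'(1) sup]) (auto simp: module_kernel_def)
  qed (rule rW)
  then have sW: "is_syzygy R ?T (W\<lparr>carrier := module_kernel W ?T ?r\<rparr>)" (is "is_syzygy R ?T ?K")
    using W(1) by (auto simp: is_syzygy_def)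
  have "module_iso R ?K (module_sum N N')"
  proof (rule module_isoI[of h])
    show "h \<in> module_hom R ?K (module_sum N N')"
    proof (rule module_homI)
      have sm: "module_sum N N' = ?S\<lparr>carrier := module_kernel P M p \<times> module_kernel P' M' p'\<rparr>"
        by (simp add: module_sum_def P(3) P'(3))
      show "h x \<in> carrier (module_sum N N')" if "x \<in> carrier ?K" for x
      proof -
        have "x \<in> h' ` module_kernel ?S ?T ?q" using that kr by simp
        then obtain z where z: "z \<in> module_kernel ?S ?T ?q" "x = h' z" by blast
        then have "h x = z" using hh'(1) by (simp add: module_kernel_def)
        then show ?thesis using z(1) unfolding k by (simp add: sm)
      qed
      show "h (x \<oplus>\<^bsub>?K\<^esub> y) = h x \<oplus>\<^bsub>module_sum N N'\<^esub> h y" if "x \<in> carrier ?K" "y \<in> carrier ?K" for x y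
        using that module_homD(2)[OF h(1), of x y] by (simp add: sm module_kernel_def)
      show "h (a \<odot>\<^bsub>?K\<^esub> x) = a \<odot>\<^bsub>module_sum N N'\<^esub> h x" if "a \<in> carrier R" "x \<in> carrier ?K" for a x
        using that module_homD(3)[OF h(1), of a x] by (simp add: sm module_kernel_def)
    qed
    show "inj_on h (carrier ?K)" using h(2) by (auto simp: bij_betw_def inj_on_def module_kernel_def)
    have "h ` h' ` module_kernel ?S ?T ?q = module_kernel ?S ?T ?q"
      using hh'(1) unfolding image_image by (force simp: module_kernel_def)
    then show "h ` carrier ?K = carrier (module_sum N N')"
      unfolding k kr by (simp add: kr k P(3) P'(3))
  qed
  moreover have "is_syzygy R L ?K"
    using is_syzygy_iso_left[OF module_iso_sym[OF L(2,1)] T L(1) sW] .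
  moreover have "right_module R N" "right_module R N'"
    using p.M.submodule_is_right_module[OF p.kernel_submodule] p'.M.submodule_is_right_module[OF p'.kernel_submodule]
    by (simp_all add: P(3) P'(3))
  ultimately show thesis using that by blast
qed

subsection \<open>The Grothendieck group and the function $\phi$\<close>

lemma is_syzygy_right_module:
  assumes "is_syzygy R M N" "right_module R M" shows "right_module R N"
proof -
  obtain P p where P: "projective_cover R P M p" "N = P\<lparr>carrier := module_kernel P M p\<rparr>"
    using assms(1) by (auto simp: is_syzygy_def)
  interpret rmodule_hom R P M p using P(1) assms(2) by (auto simp: projective_cover_def intro: rmodule_homI)
  show ?thesis unfolding P(2) by (rule M.submodule_is_right_module[OF kernel_submodule])
qed

lemma superfluous_zero:
  assumes "right_module R M" shows "superfluous R M {\<zero>\<^bsub>M\<^esub>}"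
proof (rule superfluousI)
  interpret right_module R M by fact
  fix N assume N: "submodule N R M" and s: "\<And>x. x \<in> carrier M \<Longrightarrow> \<exists>y\<in>{\<zero>\<^bsub>M\<^esub>}. \<exists>z\<in>N. x = y \<oplus>\<^bsub>M\<^esub> z"
  have "N \<subseteq> carrier M" using N by (simp add: submodule_iff)
  moreover have "x \<in> N" if "x \<in> carrier M" for x
    using s[OF that] \<open>N \<subseteq> carrier M\<close> by (auto simp: subset_iff)
  ultimately show "N = carrier M" by blast
qed

text \<open>Isolates the property that turns the syzygy into a well-defined operator on
  \<open>K0\<close>. For truncated path algebras it is supplied later by Nakayama's lemma and finite
  dimension.\<close>

locale syzygy_ring = ring R for R :: "('r, 'm) ring_scheme" (structure) +
  assumes ex_syzygy: "M \<in> fg_modules R \<Longrightarrow> \<exists>N\<in>fg_modules R. is_syzygy R M N"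
begin

abbreviation FA where "FA \<equiv> free_Abelian_group (fg_modules R)"
abbreviation H where "H \<equiv> K0_relation_subgroup R"
abbreviation Syz where "Syz \<equiv> frag_extend (\<lambda>M. frag_of (syzygy R M))"

lemma fg_right_module: "M \<in> fg_modules R \<Longrightarrow> right_module R M"
  by (simp add: fg_modules_def)

lemma is_syzygy_syzygy: "M \<in> fg_modules R \<Longrightarrow> is_syzygy R M (syzygy R M)"
proof -
  assume "M \<in> fg_modules R"
  then have "\<exists>N. is_syzygy R M N" using ex_syzygy by blast
  then have "is_syzygy R M (SOME N. is_syzygy R M N)" by (rule someI_ex)
  then show ?thesis by (simp only: syzygy_def is_syzygy_def)
qed

lemma syzygy_fg:
  assumes M: "M \<in> fg_modules R" shows "syzygy R M \<in> fg_modules R"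
proof -
  obtain N where N: "N \<in> fg_modules R" "is_syzygy R M N" using ex_syzygy[OF M] by blast
  note r = fg_right_module[OF M]
  have iso: "module_iso R N (syzygy R M)"
    by (rule is_syzygy_unique[OF N(2) is_syzygy_syzygy[OF M] module_iso_refl r r])
  have s: "right_module R (syzygy R M)" by (rule is_syzygy_right_module[OF is_syzygy_syzygy[OF M] r])
  show ?thesis
    using fin_gen_iso[OF iso fg_right_module[OF N(1)] s] N(1) s by (simp add: fg_modules_def)
qed

lemma syzygy_iso:
  assumes M: "M \<in> fg_modules R" and s: "is_syzygy R M' N" and M': "right_module R M'" and iso: "module_iso R M' M"
  shows "module_iso R N (syzygy R M)"
  by (rule is_syzygy_unique[OF s is_syzygy_syzygy[OF M] iso M' fg_right_module[OF M]])

lemma K0_relations_carrier: "K0_relations R \<subseteq> carrier FA"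
  by (auto simp: K0_relations_def dest!: subsetD[OF keys_diff])

lemma H_subgroup: "subgroup H FA"
  unfolding K0_relation_subgroup_def
  by (rule group.generate_is_subgroup[OF group_free_Abelian_group K0_relations_carrier])

lemma H_carrier: "x \<in> H \<Longrightarrow> Poly_Mapping.keys x \<subseteq> fg_modules R"
  using subgroup.mem_carrier[OF H_subgroup] by simp

lemma H_zero: "0 \<in> H"
  using subgroup.one_closed[OF H_subgroup] by simp

lemma H_add: "\<lbrakk>x \<in> H; y \<in> H\<rbrakk> \<Longrightarrow> x + y \<in> H"
  using subgroup.m_closed[OF H_subgroup] by simp

lemma H_uminus: "x \<in> H \<Longrightarrow> - x \<in> H"
  using subgroup.m_inv_closed[OF H_subgroup, of x] H_carrier by simp

lemma H_diff: "\<lbrakk>x \<in> H; y \<in> H\<rbrakk> \<Longrightarrow> x - y \<in> H"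
  using H_add[OF _ H_uminus, of x y] by simp

lemma H_sum: "(\<And>i. i \<in> I \<Longrightarrow> f i \<in> H) \<Longrightarrow> sum f I \<in> H"
  by (induction I rule: infinite_finite_induct) (auto intro: H_zero H_add)

lemma H_cmul: assumes "x \<in> H" shows "frag_cmul c x \<in> H"
proof -
  have n: "frag_cmul (int n) x \<in> H" for n
    by (induction n) (auto simp: frag_cmul_distrib assms H_zero intro: H_add)
  show ?thesis
  proof (cases "c \<ge> 0")
    case True then show ?thesis using n[of "nat c"] by simp
  next
    case False
    then have "int (nat (- c)) = - c" by simp
    then have "frag_cmul c x = - frag_cmul (int (nat (- c))) x" by (simp only: minus_frag_cmul group_add_class.minus_minus)
    then show ?thesis by (simp only: n H_uminus)
  qed
qed

lemma H_proj: "\<lbrakk>P \<in> fg_modules R; projective_module R P\<rbrakk> \<Longrightarrow> frag_of P \<in> H"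
  unfolding K0_relation_subgroup_def K0_relations_def by (rule generate.incl) blast

lemma H_iso_sum:
  "\<lbrakk>M \<in> fg_modules R; M' \<in> fg_modules R; M'' \<in> fg_modules R; module_iso R M (module_sum M' M'')\<rbrakk>
    \<Longrightarrow> frag_of M - frag_of M' - frag_of M'' \<in> H"
  unfolding K0_relation_subgroup_def K0_relations_def by (rule generate.incl) blast

lemma zero_module: "idem_module R [] \<in> fg_modules R" "projective_module R (idem_module R [])"
  by (rule idem_module_fg[OF ring_axioms], simp_all)
     (rule idem_module_projective[OF ring_axioms], simp_all)

text \<open>There is no explicit relation for isomorphic modules in \<open>K0_relations\<close>;
  this one comes from M being isomorphic to the sum of N and the zero module, which is
  projective.\<close>

lemma H_iso:
  assumes "M \<in> fg_modules R" "N \<in> fg_modules R" "module_iso R M N"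
  shows "frag_of M - frag_of N \<in> H"
proof -
  let ?Z = "idem_module R []"
  obtain f where f: "f \<in> module_hom R M N" "bij_betw f (carrier M) (carrier N)"
    using assms(3) by (auto simp: module_iso_def)
  have Z: "carrier ?Z = {[]}" "\<And>a. a \<odot>\<^bsub>?Z\<^esub> [] = []" "[] \<oplus>\<^bsub>?Z\<^esub> [] = []"
    by (auto simp: idem_module_def)
  have "module_iso R M (module_sum N ?Z)"
  proof (rule module_isoI)
    show "(\<lambda>x. (f x, [])) \<in> module_hom R M (module_sum N ?Z)"
      using module_homD[OF f(1)] by (intro module_homI) (auto simp: Z)
    show "inj_on (\<lambda>x. (f x, [])) (carrier M)" using f(2) by (auto simp: bij_betw_def inj_on_def)
    show "(\<lambda>x. (f x, [])) ` carrier M = carrier (module_sum N ?Z)"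
      using f(2) by (auto simp: bij_betw_def Z)
  qed
  then have "frag_of M - frag_of N - frag_of ?Z \<in> H"
    using assms zero_module by (intro H_iso_sum)
  then have "frag_of M - frag_of N - frag_of ?Z + frag_of ?Z \<in> H"
    using zero_module by (intro H_add H_proj)
  then show ?thesis by simp
qed

lemma H_zero_module:
  "\<lbrakk>M \<in> fg_modules R; carrier M = {\<zero>\<^bsub>M\<^esub>}\<rbrakk> \<Longrightarrow> frag_of M \<in> H"
  by (intro H_proj projective_zero fg_right_module)

text \<open>The identity is a projective cover with zero kernel, so every chosen syzygy is
  isomorphic to the zero module.\<close>

lemma syzygy_projective:
  assumes P: "P \<in> fg_modules R" "projective_module R P"
  shows "frag_of (syzygy R P) \<in> H"
proof -
  interpret P: right_module R P by (rule fg_right_module[OF P(1)])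
  have k: "module_kernel P P (\<lambda>x. x) = {\<zero>\<^bsub>P\<^esub>}" by (auto simp: module_kernel_def)
  have "is_syzygy R P (P\<lparr>carrier := {\<zero>\<^bsub>P\<^esub>}\<rparr>)"
    unfolding is_syzygy_def projective_cover_def
    using P k module_hom_id superfluous_zero[OF P.right_module_axioms]
    by (intro bexI[of _ P] exI[of _ "\<lambda>x. x"]) (simp_all add: P.right_module_axioms)
  then have iso: "module_iso R (P\<lparr>carrier := {\<zero>\<^bsub>P\<^esub>}\<rparr>) (syzygy R P)"
    by (rule syzygy_iso[OF P(1) _ P.right_module_axioms module_iso_refl])
  have r: "right_module R (P\<lparr>carrier := {\<zero>\<^bsub>P\<^esub>}\<rparr>)"
    by (rule P.submodule_is_right_module[OF P.zero_submodule])
  have "projective_module R (syzygy R P)"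
    by (rule projective_iso[OF projective_zero[OF r] iso r]) simp
  then show ?thesis by (intro H_proj syzygy_fg P)
qed

lemma Syz_relation: assumes "h \<in> K0_relations R" shows "Syz h \<in> H"
proof -
  consider M M' M'' where "h = frag_of M - frag_of M' - frag_of M''" "M \<in> fg_modules R" "M' \<in> fg_modules R"
      "M'' \<in> fg_modules R" "module_iso R M (module_sum M' M'')"
    | P where "h = frag_of P" "P \<in> fg_modules R" "projective_module R P"
    using assms by (auto simp: K0_relations_def)
  then show ?thesis
  proof cases
    case 1
    obtain K where K: "is_syzygy R M K" "module_iso R K (module_sum (syzygy R M') (syzygy R M''))"
      using is_syzygy_sum[OF fg_right_module fg_right_module is_syzygy_syzygy is_syzygy_syzygy fg_right_module]
        1 by metis
    have "module_iso R (syzygy R M) K"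
      by (rule is_syzygy_unique[OF is_syzygy_syzygy K(1) module_iso_refl]) (use 1 in \<open>simp_all add: fg_right_module\<close>)
    then have "module_iso R (syzygy R M) (module_sum (syzygy R M') (syzygy R M''))"
      using K(2) module_iso_trans by blast
    then show ?thesis
      using H_iso_sum 1 by (simp add: frag_extend_diff syzygy_fg)
  next
    case 2
    then show ?thesis using syzygy_projective by simp
  qed
qed

text \<open>The lift of the syzygy operator to the free group preserves the relations, which is what
  makes \<open>the_elem\<close> in \<open>K0_syzygy\<close> meaningful.\<close>

lemma Syz_H: assumes "x \<in> H" shows "Syz x \<in> H"
  using assms unfolding K0_relation_subgroup_def[of R]
proof (induction x rule: generate.induct)
  case one
  then show ?case using H_zero by (simp add: K0_relation_subgroup_def)
next
  case (incl h)
  then show ?case using Syz_relation by (simp add: K0_relation_subgroup_def)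
next
  case (inv h)
  have "Poly_Mapping.keys h \<subseteq> fg_modules R" using subsetD[OF K0_relations_carrier inv] by simp
  moreover have "- Syz h \<in> H" using Syz_relation[OF inv] by (rule H_uminus)
  ultimately show ?case by (simp add: K0_relation_subgroup_def frag_extend_minus)
next
  case (eng h1 h2)
  then show ?case using H_add by (simp add: K0_relation_subgroup_def frag_extend_add)
qed

lemma Syz_pow_diff: "(Syz ^^ n) (x - y) = (Syz ^^ n) x - (Syz ^^ n) y"
  by (induction n) (auto simp: frag_extend_diff)

lemma Syz_pow_H: "x \<in> H \<Longrightarrow> (Syz ^^ n) x \<in> H"
  by (induction n) (auto simp: Syz_H)

lemma Syz_pow_cong: "x - y \<in> H \<Longrightarrow> (Syz ^^ n) x \<in> H \<longleftrightarrow> (Syz ^^ n) y \<in> H"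
  using Syz_pow_H[of "x - y" n] H_diff[of "(Syz ^^ n) x" "(Syz ^^ n) x - (Syz ^^ n) y"]
    H_add[of "(Syz ^^ n) x - (Syz ^^ n) y" "(Syz ^^ n) y"]
  by (auto simp: Syz_pow_diff)

lemma K0_proj_eq_iff: "K0_proj R x = K0_proj R y \<longleftrightarrow> x - y \<in> H"
proof -
  have p: "K0_proj R x = (\<lambda>h. h + x) ` H" for x
    by (auto simp: K0_proj_def r_coset_def)
  show ?thesis
  proof
    assume "K0_proj R x = K0_proj R y"
    then have "0 + x \<in> (\<lambda>h. h + y) ` H" using H_zero unfolding p by blast
    then obtain h where h: "h \<in> H" "x = h + y" by auto
    then show "x - y \<in> H" by simp
  next
    assume d: "x - y \<in> H"
    have "h + x \<in> (\<lambda>h. h + y) ` H" if "h \<in> H" for h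
      using H_add[OF that d] by (intro image_eqI[of _ _ "h + (x - y)"]) auto
    moreover have "h + y \<in> (\<lambda>h. h + x) ` H" if "h \<in> H" for h
      using H_diff[OF that d] by (intro image_eqI[of _ _ "h - (x - y)"]) auto
    ultimately show "K0_proj R x = K0_proj R y" unfolding p by blast
  qed
qed

lemma K0_syzygy_proj: "K0_syzygy R (K0_proj R x) = K0_proj R (Syz x)"
proof -
  have p: "K0_proj R x = (\<lambda>h. h + x) ` H"
    by (auto simp: K0_proj_def r_coset_def)
  have "K0_proj R (Syz (h + x)) = K0_proj R (Syz x)" if "h \<in> H" for h
    using Syz_H[OF that] by (simp add: K0_proj_eq_iff frag_extend_add)
  then have "(\<lambda>x. K0_proj R (Syz x)) ` K0_proj R x = {K0_proj R (Syz x)}"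
    unfolding p using H_zero by (auto simp: image_image)
  then show ?thesis by (simp add: K0_syzygy_def)
qed

lemma K0_syzygy_pow_proj: "(K0_syzygy R ^^ n) (K0_proj R x) = K0_proj R ((Syz ^^ n) x)"
  by (induction n) (simp_all add: K0_syzygy_proj)

section \<open>The condition defining phi, lifted to the free abelian group\<close>

definition summands :: "('r, 'r list) module \<Rightarrow> ('r, 'r list) module set" where
  "summands M = {N \<in> fg_modules R. indecomposable_module R N \<and>
                        (\<exists>N' \<in> fg_modules R. module_iso R M (module_sum N N'))}"

text \<open>A lift of the subgroup spanned by add M to the free abelian group; the quotient map
  carries it onto \<open>add_subgroup\<close>.\<close>

definition add_span :: "('r, 'r list) module \<Rightarrow> (('r, 'r list) module \<Rightarrow>\<^sub>0 int) set" where
  "add_span M = generate FA (frag_of ` summands M)"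

lemma add_subgroup_eq: "add_subgroup R M = K0_proj R ` add_span M"
proof -
  have n: "H \<lhd> FA"
    by (rule comm_group.subgroup_imp_normal[OF abelian_free_Abelian_group H_subgroup])
  have "K0_proj R \<in> hom FA (FA Mod H)"
    using normal.r_coset_hom_Mod[OF n] by (simp add: K0_proj_def[abs_def])
  then interpret h: group_hom FA "K0 R" "K0_proj R"
    using normal.factorgroup_is_group[OF n]
    by (simp add: group_hom_def group_hom_axioms_def K0_def)
  have "frag_of ` summands M \<subseteq> carrier FA" by (auto simp: summands_def)
  then show ?thesis
    unfolding add_subgroup_def add_span_def
    by (simp add: h.generate_img[symmetric] image_image K0_class_def[abs_def] flip: summands_def)
qed

lemma add_span_subgroup: "subgroup (add_span M) FA"
  unfolding add_span_def
  by (rule group.generate_is_subgroup) (auto simp: summands_def)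

lemma add_span_carrier: "x \<in> add_span M \<Longrightarrow> Poly_Mapping.keys x \<subseteq> fg_modules R"
  using subgroup.mem_carrier[OF add_span_subgroup] by simp

lemma add_span_incl: "N \<in> summands M \<Longrightarrow> frag_of N \<in> add_span M"
  unfolding add_span_def by (intro generate.incl) auto

lemma add_span_diff: "\<lbrakk>x \<in> add_span M; y \<in> add_span M\<rbrakk> \<Longrightarrow> x - y \<in> add_span M"
  using subgroup.m_closed[OF add_span_subgroup, of x M "- y"]
    subgroup.m_inv_closed[OF add_span_subgroup, of y M] add_span_carrier by simp

lemma add_span_zero: "0 \<in> add_span M"
  using subgroup.one_closed[OF add_span_subgroup] by simp

lemma add_span_add: "\<lbrakk>x \<in> add_span M; y \<in> add_span M\<rbrakk> \<Longrightarrow> x + y \<in> add_span M"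
  using subgroup.m_closed[OF add_span_subgroup, of x M y] by simp

lemma add_span_cmul: assumes "x \<in> add_span M" shows "frag_cmul c x \<in> add_span M"
proof -
  have n: "frag_cmul (int n) x \<in> add_span M" for n
    by (induction n) (auto simp: frag_cmul_distrib assms add_span_zero intro: add_span_add)
  show ?thesis
  proof (cases "c \<ge> 0")
    case True then show ?thesis using n[of "nat c"] by simp
  next
    case False
    then have "int (nat (- c)) = - c" by simp
    then have "frag_cmul c x = 0 - frag_cmul (int (nat (- c))) x" by (simp only: minus_frag_cmul group_add_class.minus_minus diff_0)
    then show ?thesis by (simp only: n add_span_diff add_span_zero)
  qed
qed

lemma add_span_sum: "(\<And>i. i \<in> I \<Longrightarrow> f i \<in> add_span M) \<Longrightarrow> sum f I \<in> add_span M"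
  by (induction I rule: infinite_finite_induct) (auto intro: add_span_zero add_span_add)

text \<open>Injectivity of a homomorphism on a subgroup is tested on differences, so only a kernel
  condition remains, and that is membership of powers of \<open>Syz\<close> in \<open>H\<close>.
  From here on no coset has to be handled.\<close>

lemma phi_eq:
  "phi R M = (LEAST l. \<forall>s. \<forall>x\<in>add_span M. (Syz ^^ Suc (l + s)) x \<in> H \<longrightarrow> (Syz ^^ (l + s)) x \<in> H)"
proof -
  have "inj_on (K0_syzygy R) ((K0_syzygy R ^^ n) ` add_subgroup R M) \<longleftrightarrow>
      (\<forall>x\<in>add_span M. (Syz ^^ Suc n) x \<in> H \<longrightarrow> (Syz ^^ n) x \<in> H)" for n
  proof -
    have "inj_on (K0_syzygy R) ((K0_syzygy R ^^ n) ` add_subgroup R M) \<longleftrightarrow>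
      (\<forall>x\<in>add_span M. \<forall>y\<in>add_span M. (Syz ^^ Suc n) (x - y) \<in> H \<longrightarrow> (Syz ^^ n) (x - y) \<in> H)"
      unfolding inj_on_def add_subgroup_eq
      by (simp add: K0_syzygy_pow_proj K0_syzygy_proj K0_proj_eq_iff Syz_pow_diff frag_extend_diff)
    also have "\<dots> \<longleftrightarrow> (\<forall>x\<in>add_span M. (Syz ^^ Suc n) x \<in> H \<longrightarrow> (Syz ^^ n) x \<in> H)"
      using add_span_diff add_span_zero by (metis diff_zero)
    finally show ?thesis .
  qed
  then show ?thesis unfolding phi_def by simp
qed

section \<open>Integer-valued functionals on K0\<close>

text \<open>The additive extension of a function on modules to an integer-valued map. The integers
  are represented by the free abelian group on the single generator \<open>()\<close>, so that the
  library extension map can be used.\<close>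

definition frag_eval :: "(('r, 'r list) module \<Rightarrow> int) \<Rightarrow> (('r, 'r list) module \<Rightarrow>\<^sub>0 int) \<Rightarrow> int" where
  "frag_eval F x = Poly_Mapping.lookup (frag_extend (\<lambda>M. frag_cmul (F M) (frag_of ())) x) ()"

lemma frag_eval_simps [simp]:
  "frag_eval F 0 = 0" "frag_eval F (x + y) = frag_eval F x + frag_eval F y"
  "frag_eval F (x - y) = frag_eval F x - frag_eval F y" "frag_eval F (- x) = - frag_eval F x"
  "frag_eval F (frag_of M) = F M" "frag_eval F (frag_cmul c x) = c * frag_eval F x"
  by (simp_all add: frag_eval_def frag_extend_add frag_extend_diff frag_extend_minus frag_extend_cmul
      lookup_add lookup_minus)

lemma frag_eval_sum [simp]: "frag_eval F (sum f I) = (\<Sum>i\<in>I. frag_eval F (f i))"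
  by (induction I rule: infinite_finite_induct) auto

text \<open>The two assumptions are exactly the two kinds of generators of \<open>H\<close>. This is
  the tool for proving that a class is not zero.\<close>

lemma frag_eval_H:
  assumes add: "\<And>M M' M''. \<lbrakk>M \<in> fg_modules R; M' \<in> fg_modules R; M'' \<in> fg_modules R;
        module_iso R M (module_sum M' M'')\<rbrakk> \<Longrightarrow> F M = F M' + F M''"
    and proj: "\<And>P. \<lbrakk>P \<in> fg_modules R; projective_module R P\<rbrakk> \<Longrightarrow> F P = 0"
    and x: "x \<in> H"
  shows "frag_eval F x = 0"
proof -
  have r: "frag_eval F h = 0" if "h \<in> K0_relations R" for h
    using that add proj by (auto simp: K0_relations_def)
  have "x \<in> H \<and> frag_eval F x = 0"
    using x unfolding K0_relation_subgroup_def
  proof (induction x rule: generate.induct)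
    case (inv h)
    have "Poly_Mapping.keys h \<subseteq> fg_modules R" using subsetD[OF K0_relations_carrier inv] by simp
    then show ?case using inv r generate.inv[OF inv, of FA] by simp
  next
    case (eng h1 h2)
    then show ?case using generate.eng[of h1 FA "K0_relations R" h2] by simp
  next
    case one
    show ?case using generate.one[of FA "K0_relations R"] by simp
  next
    case (incl h)
    then show ?case by (simp add: r generate.incl)
  qed
  then show ?thesis by simp
qed

end

subsection \<open>Rings with path coefficients\<close>

text \<open>The end of a path is a function of its source and its arrows. Pairs
  \<open>(u, p)\<close> can therefore replace the triples \<open>(u, p, v)\<close> of the path
  algebra.\<close>

fun path_target :: "('v, 'e) pre_digraph \<Rightarrow> 'v \<Rightarrow> 'e list \<Rightarrow> 'v" where
  "path_target Q u [] = u"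
| "path_target Q u (e # p) = path_target Q (head Q e) p"

fun is_path :: "('v, 'e) pre_digraph \<Rightarrow> 'v \<Rightarrow> 'e list \<Rightarrow> bool" where
  "is_path Q u [] \<longleftrightarrow> u \<in> verts Q"
| "is_path Q u (e # p) \<longleftrightarrow> e \<in> arcs Q \<and> tail Q e = u \<and> is_path Q (head Q e) p"

lemma path_target_append: "path_target Q u (p @ q) = path_target Q (path_target Q u p) q"
  by (induction p arbitrary: u) auto

context fin_digraph
begin

lemma is_path_source: "is_path G u p \<Longrightarrow> u \<in> verts G"
  by (cases p) auto

lemma is_path_append: "is_path G u (p @ q) \<longleftrightarrow> is_path G u p \<and> is_path G (path_target G u p) q"
  by (induction p arbitrary: u) (auto dest: is_path_source)

lemma is_path_target: "is_path G u p \<Longrightarrow> path_target G u p \<in> verts G"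
  by (induction p arbitrary: u) auto

lemma is_path_set: "is_path G u p \<Longrightarrow> set p \<subseteq> arcs G"
  by (induction p arbitrary: u) auto

lemma finite_paths: "finite {z. is_path G (fst z) (snd z) \<and> length (snd z) < n}"
proof (rule finite_subset)
  show "{z. is_path G (fst z) (snd z) \<and> length (snd z) < n} \<subseteq> verts G \<times> {p. set p \<subseteq> arcs G \<and> length p \<le> n}"
    using is_path_source is_path_set by fastforce
  show "finite (verts G \<times> {p. set p \<subseteq> arcs G \<and> length p \<le> n})"
    by (intro finite_cartesian_product finite_lists_length_le) auto
qed

end

text \<open>The function \<open>co\<close> reads off the coefficients of an element of a truncated path algebra at the paths
  of length less than \<open>k\<close>; a path is given by its source and its list of arrows.\<close>

locale path_coefficients = Q: fin_digraph Q + ring R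
  for Q :: "('v, 'e) pre_digraph" and R :: "('r, 'm) ring_scheme" (structure) +
  fixes k :: nat and co :: "'r \<Rightarrow> 'v \<times> 'e list \<Rightarrow> 'f::field"
  assumes k_pos: "k > 0"
    and co_ext: "\<lbrakk>a \<in> carrier R; b \<in> carrier R; co a = co b\<rbrakk> \<Longrightarrow> a = b"
    and co_surj: "\<exists>a\<in>carrier R. \<forall>u p. co a (u, p) = (if is_path Q u p \<and> length p < k then f (u, p) else 0)"
    and co_support: "\<lbrakk>a \<in> carrier R; \<not> (is_path Q u p \<and> length p < k)\<rbrakk> \<Longrightarrow> co a (u, p) = 0"
    and co_add: "\<lbrakk>a \<in> carrier R; b \<in> carrier R\<rbrakk> \<Longrightarrow> co (a \<oplus> b) z = co a z + co b z"
    and co_one: "is_path Q u p \<Longrightarrow> co \<one> (u, p) = (if p = [] then 1 else 0)"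
    and co_mult: "\<lbrakk>a \<in> carrier R; b \<in> carrier R; is_path Q u p; length p < k\<rbrakk> \<Longrightarrow>
       co (a \<otimes> b) (u, p) = (\<Sum>i\<le>length p. co a (u, take i p) * co b (path_target Q u (take i p), drop i p))"
begin

abbreviation "tgt \<equiv> path_target Q"

definition paths :: "('v \<times> 'e list) set" where
  "paths = {z. is_path Q (fst z) (snd z) \<and> length (snd z) < k}"

lemma paths_iff: "(u, p) \<in> paths \<longleftrightarrow> is_path Q u p \<and> length p < k"
  by (simp add: paths_def)

lemma finite_paths: "finite paths"
  unfolding paths_def by (rule Q.finite_paths)

lemma paths_append_left: "(u, p @ q) \<in> paths \<Longrightarrow> (u, p) \<in> paths"
  by (auto simp: paths_iff Q.is_path_append)

lemma paths_append_right: "(u, p @ q) \<in> paths \<Longrightarrow> (tgt u p, q) \<in> paths"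
  by (auto simp: paths_iff Q.is_path_append)

lemma paths_take_drop:
  assumes "(u, p) \<in> paths" shows "(u, take i p) \<in> paths" "(tgt u (take i p), drop i p) \<in> paths"
  using assms paths_append_left[of u "take i p" "drop i p"] paths_append_right[of u "take i p" "drop i p"]
  by simp_all

lemma paths_verts: "(u, p) \<in> paths \<Longrightarrow> u \<in> verts Q" "(u, p) \<in> paths \<Longrightarrow> tgt u p \<in> verts Q"
  by (auto simp: paths_iff Q.is_path_source Q.is_path_target)

lemma trivial_path: "(v, []) \<in> paths \<longleftrightarrow> v \<in> verts Q"
  by (simp add: paths_iff k_pos)

lemma co_off: "\<lbrakk>a \<in> carrier R; z \<notin> paths\<rbrakk> \<Longrightarrow> co a z = 0"
  by (cases z) (auto simp: paths_iff co_support)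

section \<open>Elements with prescribed coefficients; multiplication by paths and scalars\<close>

text \<open>The inverse of \<open>co\<close>: the unique element with the given coefficients at the
  paths of length less than \<open>k\<close>. Values of \<open>f\<close> outside
  \<open>paths\<close> are discarded.\<close>

definition el :: "('v \<times> 'e list \<Rightarrow> 'f) \<Rightarrow> 'r" where
  "el f = (SOME a. a \<in> carrier R \<and> (\<forall>z. co a z = (if z \<in> paths then f z else 0)))"

lemma el: "el f \<in> carrier R" "co (el f) z = (if z \<in> paths then f z else 0)"
proof -
  obtain a where "a \<in> carrier R" "\<forall>u p. co a (u, p) = (if is_path Q u p \<and> length p < k then f (u, p) else 0)"
    using co_surj by blast
  then have "\<exists>a. a \<in> carrier R \<and> (\<forall>z. co a z = (if z \<in> paths then f z else 0))"
    by (intro exI[of _ a]) (simp add: paths_def)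
  from someI_ex[OF this] show "el f \<in> carrier R" "co (el f) z = (if z \<in> paths then f z else 0)"
    unfolding el_def by blast+
qed

lemma co_eqI:
  assumes "a \<in> carrier R" "b \<in> carrier R" "\<And>u p. (u, p) \<in> paths \<Longrightarrow> co a (u, p) = co b (u, p)"
  shows "a = b"
proof (intro co_ext ext)
  fix z show "co a z = co b z"
    using assms(3)[of "fst z" "snd z"] co_off[OF assms(1), of z] co_off[OF assms(2), of z] by (cases "z \<in> paths") auto
qed (use assms in auto)

lemma co_zero: "co \<zero> z = 0"
proof -
  have "co \<zero> z + co \<zero> z = co \<zero> z + 0" using co_add[of \<zero> \<zero> z] by simp
  then show ?thesis by (rule add_left_imp_eq)
qed

lemma co_minus: "a \<in> carrier R \<Longrightarrow> co (\<ominus> a) z = - co a z"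
  using co_add[of a "\<ominus> a" z] by (simp add: r_neg co_zero eq_neg_iff_add_eq_0 add.commute)

lemma co_finsum: "f \<in> I \<rightarrow> carrier R \<Longrightarrow> co (\<Oplus>i\<in>I. f i) z = (\<Sum>i\<in>I. co (f i) z)"
proof (induction I rule: infinite_finite_induct)
  case (insert i I)
  then show ?case by (subst finsum_insert) (auto simp: co_add Pi_iff)
qed (auto simp: co_zero)

lemma co_mult':
  "\<lbrakk>a \<in> carrier R; b \<in> carrier R; (u, p) \<in> paths\<rbrakk> \<Longrightarrow>
     co (a \<otimes> b) (u, p) = (\<Sum>i\<le>length p. co a (u, take i p) * co b (tgt u (take i p), drop i p))"
  by (simp add: paths_iff co_mult)

lemma co_one': "(u, p) \<in> paths \<Longrightarrow> co \<one> (u, p) = (if p = [] then 1 else 0)"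
  by (simp add: paths_iff co_one)

definition pe :: "'v \<times> 'e list \<Rightarrow> 'r" where
  "pe z = el (\<lambda>y. if y = z then 1 else 0)"

definition ev :: "'v \<Rightarrow> 'r" where
  "ev v = pe (v, [])"

text \<open>The copy of the field inside the algebra: c times the unit, that is, the coefficient c
  at each trivial path. It is central, and it gives every module its vector space structure.\<close>

definition sc :: "'f \<Rightarrow> 'r" where
  "sc c = el (\<lambda>z. if snd z = [] then c else 0)"

lemma pe_closed [simp]: "pe z \<in> carrier R" by (simp add: pe_def el)
lemma ev_closed [simp]: "ev v \<in> carrier R" by (simp add: ev_def)
lemma sc_closed [simp]: "sc c \<in> carrier R" by (simp add: sc_def el)

lemma co_pe: "z \<in> paths \<Longrightarrow> co (pe z) y = (if y = z then 1 else 0)"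
  by (simp add: pe_def el)

lemma co_sc: "co (sc c) (u, p) = (if p = [] \<and> u \<in> verts Q then c else 0)"
  by (auto simp: sc_def el trivial_path)

lemma sum_single: 
  assumes "finite I" "j \<in> I" "\<And>i. \<lbrakk>i \<in> I; i \<noteq> j\<rbrakk> \<Longrightarrow> f i = (0::'b::comm_monoid_add)"
  shows "sum f I = f j"
proof -
  have "sum f I = (\<Sum>i\<in>I. if i = j then f j else 0)"
    using assms(3) by (intro sum.cong) auto
  then show ?thesis using assms by simp
qed

text \<open>Of all ways to split \<open>p\<close> only the one whose second part is \<open>q\<close>
  meets the support of the path element. Right multiplication by a path therefore moves coefficients
  from r to r q.\<close>

lemma co_mult_pe:
  assumes a: "a \<in> carrier R" and wq: "(w, q) \<in> paths"
  shows "co (a \<otimes> pe (w, q)) (u, p) =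
    (if (u, p) \<in> paths \<and> (\<exists>r. p = r @ q \<and> tgt u r = w) then co a (u, take (length p - length q) p) else 0)"
proof (cases "(u, p) \<in> paths")
  case True
  let ?f = "\<lambda>i. co a (u, take i p) * co (pe (w, q)) (tgt u (take i p), drop i p)"
  have s: "co (a \<otimes> pe (w, q)) (u, p) = sum ?f {..length p}"
    using True a by (simp add: co_mult')
  show ?thesis
  proof (cases "\<exists>r. p = r @ q \<and> tgt u r = w")
    case r: True
    then obtain r where r': "p = r @ q" "tgt u r = w" by blast
    have "sum ?f {..length p} = ?f (length r)"
    proof (rule sum_single)
      fix i assume i: "i \<in> {..length p}" "i \<noteq> length r"
      then have "length (drop i p) \<noteq> length q" using r' by auto
      then have "drop i p \<noteq> q" by blast
      then show "?f i = 0" by (simp add: co_pe[OF wq])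
    qed (use r' in auto)
    then show ?thesis using s r r' True by (simp add: co_pe[OF wq])
  next
    case False
    have "?f i = 0" if "i \<in> {..length p}" for i
    proof -
      have "(tgt u (take i p), drop i p) \<noteq> (w, q)"
        using False by (metis append_take_drop_id prod.inject)
      then show ?thesis by (auto simp: co_pe[OF wq])
    qed
    then have "sum ?f {..length p} = 0" by (rule sum.neutral[OF ballI])
    then show ?thesis using s False by auto
  qed
qed (use a in \<open>simp add: co_off\<close>)

lemma co_pe_mult:
  assumes a: "a \<in> carrier R" and wq: "(w, q) \<in> paths"
  shows "co (pe (w, q) \<otimes> a) (u, p) =
    (if (u, p) \<in> paths \<and> u = w \<and> (\<exists>r. p = q @ r) then co a (tgt w q, drop (length q) p) else 0)"
proof (cases "(u, p) \<in> paths")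
  case True
  let ?f = "\<lambda>i. co (pe (w, q)) (u, take i p) * co a (tgt u (take i p), drop i p)"
  have s: "co (pe (w, q) \<otimes> a) (u, p) = sum ?f {..length p}"
    using True a by (simp add: co_mult')
  show ?thesis
  proof (cases "u = w \<and> (\<exists>r. p = q @ r)")
    case r: True
    then obtain r where r': "p = q @ r" "u = w" by blast
    have "sum ?f {..length p} = ?f (length q)"
    proof (rule sum_single)
      fix i assume i: "i \<in> {..length p}" "i \<noteq> length q"
      then have "length (take i p) \<noteq> length q" by auto
      then have "take i p \<noteq> q" by blast
      then show "?f i = 0" by (simp add: co_pe[OF wq])
    qed (use r' in auto)
    then show ?thesis using s r r' True by (simp add: co_pe[OF wq])
  next
    case False
    have "?f i = 0" if "i \<in> {..length p}" for i
    proof -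
      have "(u, take i p) \<noteq> (w, q)"
        using False by (metis append_take_drop_id prod.inject)
      then show ?thesis by (auto simp: co_pe[OF wq])
    qed
    then have "sum ?f {..length p} = 0" by (rule sum.neutral[OF ballI])
    then show ?thesis using s False by auto
  qed
qed (use a in \<open>simp add: co_off\<close>)

lemma co_ev: "v \<in> verts Q \<Longrightarrow> co (ev v) z = (if z = (v, []) then 1 else 0)"
  by (simp add: ev_def co_pe trivial_path)

lemma co_ev_mult:
  "\<lbrakk>a \<in> carrier R; v \<in> verts Q\<rbrakk> \<Longrightarrow> co (ev v \<otimes> a) (u, p) = (if u = v then co a (u, p) else 0)"
  using co_off[of a "(u, p)"] by (auto simp: ev_def co_pe_mult trivial_path)

lemma co_mult_ev:
  "\<lbrakk>a \<in> carrier R; v \<in> verts Q\<rbrakk> \<Longrightarrow> co (a \<otimes> ev v) (u, p) = (if tgt u p = v then co a (u, p) else 0)"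
  using co_off[of a "(u, p)"] by (auto simp: ev_def co_mult_pe trivial_path)

lemma co_sc_mult: assumes a: "a \<in> carrier R" shows "co (sc c \<otimes> a) z = c * co a z"
proof (cases z)
  case (Pair u p)
  show ?thesis
  proof (cases "(u, p) \<in> paths")
    case True
    let ?f = "\<lambda>i. co (sc c) (u, take i p) * co a (tgt u (take i p), drop i p)"
    have "co (sc c \<otimes> a) (u, p) = sum ?f {..length p}"
      using True a by (simp add: co_mult')
    also have "\<dots> = ?f 0"
      by (rule sum_single) (auto simp: co_sc)
    finally show ?thesis using True by (simp add: co_sc Pair paths_verts)
  qed (use a Pair in \<open>simp add: co_off\<close>)
qed

lemma co_mult_sc: assumes a: "a \<in> carrier R" shows "co (a \<otimes> sc c) z = c * co a z"
proof (cases z)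
  case (Pair u p)
  show ?thesis
  proof (cases "(u, p) \<in> paths")
    case True
    let ?f = "\<lambda>i. co a (u, take i p) * co (sc c) (tgt u (take i p), drop i p)"
    have "co (a \<otimes> sc c) (u, p) = sum ?f {..length p}"
      using True a by (simp add: co_mult')
    also have "\<dots> = ?f (length p)"
      by (rule sum_single) (auto simp: co_sc)
    finally show ?thesis using True by (simp add: co_sc Pair paths_verts)
  qed (use a Pair in \<open>simp add: co_off\<close>)
qed

lemma sc_comm: "a \<in> carrier R \<Longrightarrow> a \<otimes> sc c = sc c \<otimes> a"
  by (rule co_eqI) (auto simp: co_sc_mult co_mult_sc)

lemma sc_one: "sc 1 = \<one>"
  by (rule co_eqI) (auto simp: co_sc co_one' paths_verts)

lemma sc_zero: "sc 0 = \<zero>"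
  by (rule co_eqI) (auto simp: co_sc co_zero)

lemma sc_add: "sc (c + d) = sc c \<oplus> sc d"
  by (rule co_eqI) (auto simp: co_sc co_add)

lemma sc_minus: "sc (- c) = \<ominus> sc c"
  by (rule co_eqI) (auto simp: co_sc co_minus)

lemma sc_mult: "sc (c * d) = sc c \<otimes> sc d"
  by (rule co_eqI) (auto simp: co_sc_mult, auto simp: co_sc)

lemma ev_idem: "v \<in> verts Q \<Longrightarrow> ev v \<otimes> ev v = ev v"
  by (rule co_eqI) (auto simp: co_ev_mult co_ev)

lemma sum_ev: "(\<Oplus>v\<in>verts Q. ev v) = \<one>"
  by (rule co_eqI) (auto simp: co_finsum co_ev co_one' finsum_closed paths_verts intro!: sum.neutral)

lemma pe_ev: 
  assumes "(u, p) \<in> paths"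
  shows "ev u \<otimes> pe (u, p) = pe (u, p)" "pe (u, p) \<otimes> ev (tgt u p) = pe (u, p)"
  using assms by (auto intro!: co_eqI simp: co_ev_mult co_mult_ev co_pe paths_verts)

lemma decompose: "a \<in> carrier R \<Longrightarrow> a = (\<Oplus>z\<in>paths. pe z \<otimes> sc (co a z))"
  by (rule co_eqI) (auto simp: co_finsum co_mult_sc co_pe finite_paths if_distrib[of "(*) _"] finsum_closed cong: if_cong)

lemma ev_left_iff:
  assumes "a \<in> carrier R" "v \<in> verts Q"
  shows "ev v \<otimes> a = a \<longleftrightarrow> (\<forall>u p. u \<noteq> v \<longrightarrow> co a (u, p) = 0)"
proof
  assume "ev v \<otimes> a = a"
  then show "\<forall>u p. u \<noteq> v \<longrightarrow> co a (u, p) = 0" using co_ev_mult[OF assms] by metis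
next
  assume "\<forall>u p. u \<noteq> v \<longrightarrow> co a (u, p) = 0"
  then show "ev v \<otimes> a = a" using assms by (intro co_eqI) (auto simp: co_ev_mult)
qed

section \<open>Powers of the radical, and division by a path on the right\<close>

text \<open>The image of the ideal power J^l in the truncated algebra, described by supports; it is
  the whole ring for \<open>l = 0\<close> and zero for \<open>l = k\<close>.\<close>

definition Jp :: "nat \<Rightarrow> 'r set" where
  "Jp l = {a \<in> carrier R. \<forall>u p. length p < l \<longrightarrow> co a (u, p) = 0}"

lemma Jp_carrier: "a \<in> Jp l \<Longrightarrow> a \<in> carrier R" by (simp add: Jp_def)

lemma JpD: "\<lbrakk>a \<in> Jp l; length p < l\<rbrakk> \<Longrightarrow> co a (u, p) = 0" by (simp add: Jp_def)

lemma Jp_0: "Jp 0 = carrier R" by (auto simp: Jp_def)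

lemma Jp_k: "Jp k = {\<zero>}"
proof -
  have "a = \<zero>" if "a \<in> Jp k" for a
    using that by (intro co_eqI) (auto simp: Jp_def paths_iff co_zero)
  then show ?thesis by (auto simp: Jp_def co_zero)
qed

lemma Jp_zero [simp]: "\<zero> \<in> Jp l" by (simp add: Jp_def co_zero)

lemma Jp_add: "\<lbrakk>a \<in> Jp l; b \<in> Jp l\<rbrakk> \<Longrightarrow> a \<oplus> b \<in> Jp l"
  by (simp add: Jp_def co_add)

lemma Jp_antimono: "l \<le> l' \<Longrightarrow> Jp l' \<subseteq> Jp l" by (auto simp: Jp_def)

lemma Jp_mult: assumes a: "a \<in> Jp i" and b: "b \<in> Jp j" shows "a \<otimes> b \<in> Jp (i + j)"
proof -
  have "co (a \<otimes> b) (u, p) = 0" if p: "length p < i + j" for u p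
  proof (cases "(u, p) \<in> paths")
    case True
    have "co a (u, take n p) * co b (tgt u (take n p), drop n p) = 0" if "n \<in> {..length p}" for n
    proof (cases "n < i")
      case True
      then show ?thesis using JpD[OF a, of "take n p"] by simp
    next
      case False
      then have "length (drop n p) < j" using p that by auto
      then show ?thesis using JpD[OF b] by simp
    qed
    then have "(\<Sum>i\<le>length p. co a (u, take i p) * co b (tgt u (take i p), drop i p)) = 0"
      by (rule sum.neutral[OF ballI])
    then show ?thesis using True Jp_carrier[OF a] Jp_carrier[OF b] by (simp add: co_mult')
  qed (use Jp_carrier[OF a] Jp_carrier[OF b] in \<open>simp add: co_off\<close>)
  then show ?thesis using Jp_carrier[OF a] Jp_carrier[OF b] by (simp add: Jp_def)
qed

lemma Jp_mult_right: "\<lbrakk>a \<in> Jp l; b \<in> carrier R\<rbrakk> \<Longrightarrow> a \<otimes> b \<in> Jp l"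
  using Jp_mult[of a l b 0] by (simp add: Jp_0)

lemma Jp_mult_left: "\<lbrakk>a \<in> Jp l; b \<in> carrier R\<rbrakk> \<Longrightarrow> b \<otimes> a \<in> Jp l"
  using Jp_mult[of b 0 a l] by (simp add: Jp_0)

lemma pe_Jp: "\<lbrakk>(u, p) \<in> paths; l \<le> length p\<rbrakk> \<Longrightarrow> pe (u, p) \<in> Jp l"
  by (auto simp: Jp_def co_pe)

text \<open>Right division by the path \<open>z\<close>: terms p z become p and all other terms
  disappear. The test on the target keeps only p that can be followed by \<open>z\<close>.\<close>

definition strip :: "'v \<times> 'e list \<Rightarrow> 'r \<Rightarrow> 'r" where
  "strip z a = el (\<lambda>y. if tgt (fst y) (snd y) = fst z then co a (fst y, snd y @ snd z) else 0)"

lemma strip_closed [simp]: "strip z a \<in> carrier R" by (simp add: strip_def el)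

lemma co_strip:
  assumes "a \<in> carrier R"
  shows "co (strip (w, q) a) (u, p) = (if tgt u p = w then co a (u, p @ q) else 0)"
proof -
  have "(u, p @ q) \<notin> paths" if "(u, p) \<notin> paths" using that paths_append_left by blast
  then show ?thesis using assms by (auto simp: strip_def el co_off)
qed

text \<open>In the convolution at p q, a cut strictly inside q leaves for \<open>b\<close> a suffix
  shorter than q, where \<open>b\<close> vanishes. The remaining cuts lie inside p, and they form
  the convolution with the divided element.\<close>

lemma co_mult_strip:
  assumes a: "a \<in> carrier R" and b: "b \<in> Jp (length q)" and p: "(u, p @ q) \<in> paths" "tgt u p = w"
  shows "co (a \<otimes> strip (w, q) b) (u, p) = co (a \<otimes> b) (u, p @ q)"
proof -
  have bR: "b \<in> carrier R" using b by (rule Jp_carrier)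
  let ?f = "\<lambda>i. co a (u, take i (p @ q)) * co b (tgt u (take i (p @ q)), drop i (p @ q))"
  have "co (a \<otimes> b) (u, p @ q) = sum ?f {..length (p @ q)}"
    by (rule co_mult'[OF a bR p(1)])
  also have "\<dots> = sum ?f {..length p}"
  proof (rule sum.mono_neutral_right)
    show "\<forall>i\<in>{..length (p @ q)} - {..length p}. ?f i = 0"
    proof
      fix i assume i: "i \<in> {..length (p @ q)} - {..length p}"
      then have "length (drop i (p @ q)) < length q" by auto
      then show "?f i = 0" using JpD[OF b] by simp
    qed
  qed auto
  also have "\<dots> = (\<Sum>i\<le>length p. co a (u, take i p) * co (strip (w, q) b) (tgt u (take i p), drop i p))"
  proof (rule sum.cong)
    fix i assume i: "i \<in> {..length p}"
    have "tgt (tgt u (take i p)) (drop i p) = w"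
      using p(2) by (simp flip: path_target_append)
    then show "?f i = co a (u, take i p) * co (strip (w, q) b) (tgt u (take i p), drop i p)"
      using i by (simp add: co_strip bR)
  qed simp
  also have "\<dots> = co (a \<otimes> strip (w, q) b) (u, p)"
    using paths_append_left[OF p(1)] by (simp add: co_mult' a)
  finally show ?thesis by simp
qed

end

subsection \<open>The radical and Nakayama's lemma\<close>

text \<open>The product M J, that is, the finite sums of elements y a with a in J, built one summand
  at a time so that rule induction is available.\<close>

inductive_set mod_prod :: "('r, 'a) module \<Rightarrow> 'r set \<Rightarrow> 'a set" for M J where
  zero: "\<zero>\<^bsub>M\<^esub> \<in> mod_prod M J"
| step: "\<lbrakk>x \<in> mod_prod M J; y \<in> carrier M; a \<in> J\<rbrakk> \<Longrightarrow> x \<oplus>\<^bsub>M\<^esub> a \<odot>\<^bsub>M\<^esub> y \<in> mod_prod M J"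

context
  fixes R (structure) and M :: "('r, 'a) module" (structure) and J
  assumes M: "right_module R M" and J: "J \<subseteq> carrier R"
begin

interpretation right_module R M by (rule M)

lemma mod_prod_carrier: "x \<in> mod_prod M J \<Longrightarrow> x \<in> carrier M"
  by (induction rule: mod_prod.induct) (use J in \<open>auto intro: rsmult_closed\<close>)

lemma mod_prod_add:
  assumes x: "x \<in> mod_prod M J" and y: "y \<in> mod_prod M J" shows "x \<oplus>\<^bsub>M\<^esub> y \<in> mod_prod M J"
  using y
proof (induction rule: mod_prod.induct)
  case zero
  then show ?case using x by (simp add: mod_prod_carrier)
next
  case (step y z a)
  have "x \<oplus>\<^bsub>M\<^esub> (y \<oplus>\<^bsub>M\<^esub> a \<odot>\<^bsub>M\<^esub> z) = (x \<oplus>\<^bsub>M\<^esub> y) \<oplus>\<^bsub>M\<^esub> a \<odot>\<^bsub>M\<^esub> z"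
    using step J x by (intro M.a_assoc[symmetric]) (auto simp: mod_prod_carrier rsmult_closed)
  then show ?case using mod_prod.step[OF step.IH step(2,3)] by simp
qed

lemma mod_prod_incl:
  assumes "y \<in> carrier M" "a \<in> J" shows "a \<odot>\<^bsub>M\<^esub> y \<in> mod_prod M J"
proof -
  have "a \<odot>\<^bsub>M\<^esub> y \<in> carrier M" using assms J by (auto intro: rsmult_closed)
  then show ?thesis using mod_prod.step[OF mod_prod.zero assms] by simp
qed

lemma mod_prod_smult:
  assumes "\<And>a b. \<lbrakk>a \<in> J; b \<in> carrier R\<rbrakk> \<Longrightarrow> a \<otimes> b \<in> J" and b: "b \<in> carrier R" and x: "x \<in> mod_prod M J"
  shows "b \<odot>\<^bsub>M\<^esub> x \<in> mod_prod M J"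
  using x
proof (induction rule: mod_prod.induct)
  case zero
  then show ?case using b by (simp add: rsmult_zero mod_prod.zero)
next
  case (step y z a)
  have c: "a \<in> carrier R" using step J by auto
  have "b \<odot>\<^bsub>M\<^esub> (y \<oplus>\<^bsub>M\<^esub> a \<odot>\<^bsub>M\<^esub> z) = b \<odot>\<^bsub>M\<^esub> y \<oplus>\<^bsub>M\<^esub> (a \<otimes> b) \<odot>\<^bsub>M\<^esub> z"
    using step c b by (simp add: rsmult_add rsmult_assoc mod_prod_carrier rsmult_closed)
  then show ?case using mod_prod.step[OF step.IH step(2) assms(1)[OF step(3) b]] by simp
qed

lemma mod_prod_submodule:
  assumes "\<And>a b. \<lbrakk>a \<in> J; b \<in> carrier R\<rbrakk> \<Longrightarrow> a \<otimes> b \<in> J"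
  shows "submodule (mod_prod M J) R M"
  using assms by (auto simp: submodule_iff mod_prod_carrier mod_prod.zero mod_prod_add mod_prod_smult)

lemma sum_submodule:
  assumes N: "submodule N R M" and L: "submodule L R M"
  shows "submodule {x. \<exists>n\<in>N. \<exists>l\<in>L. x = n \<oplus>\<^bsub>M\<^esub> l} R M"
proof -
  have Nc: "n \<in> N \<Longrightarrow> n \<in> carrier M" for n using N by (auto simp: submodule_iff)
  have Lc: "n \<in> L \<Longrightarrow> n \<in> carrier M" for n using L by (auto simp: submodule_iff)
  have "x \<oplus>\<^bsub>M\<^esub> y \<in> {x. \<exists>n\<in>N. \<exists>l\<in>L. x = n \<oplus>\<^bsub>M\<^esub> l}"
    if x: "x \<in> {x. \<exists>n\<in>N. \<exists>l\<in>L. x = n \<oplus>\<^bsub>M\<^esub> l}" and y: "y \<in> {x. \<exists>n\<in>N. \<exists>l\<in>L. x = n \<oplus>\<^bsub>M\<^esub> l}" for x y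
  proof -
    obtain n l n' l' where *: "n \<in> N" "l \<in> L" "x = n \<oplus>\<^bsub>M\<^esub> l" "n' \<in> N" "l' \<in> L" "y = n' \<oplus>\<^bsub>M\<^esub> l'"
      using x y by blast
    then have "x \<oplus>\<^bsub>M\<^esub> y = (n \<oplus>\<^bsub>M\<^esub> n') \<oplus>\<^bsub>M\<^esub> (l \<oplus>\<^bsub>M\<^esub> l')" by (simp add: Nc Lc M.a_ac)
    moreover have "n \<oplus>\<^bsub>M\<^esub> n' \<in> N" "l \<oplus>\<^bsub>M\<^esub> l' \<in> L" using * N L by (auto simp: submodule_iff)
    ultimately show ?thesis by blast
  qed
  moreover have "a \<odot>\<^bsub>M\<^esub> x \<in> {x. \<exists>n\<in>N. \<exists>l\<in>L. x = n \<oplus>\<^bsub>M\<^esub> l}"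
    if a: "a \<in> carrier R" and x: "x \<in> {x. \<exists>n\<in>N. \<exists>l\<in>L. x = n \<oplus>\<^bsub>M\<^esub> l}" for a x
  proof -
    obtain n l where *: "n \<in> N" "l \<in> L" "x = n \<oplus>\<^bsub>M\<^esub> l" using x by blast
    then have "a \<odot>\<^bsub>M\<^esub> x = a \<odot>\<^bsub>M\<^esub> n \<oplus>\<^bsub>M\<^esub> a \<odot>\<^bsub>M\<^esub> l" by (simp add: Nc Lc rsmult_add a)
    moreover have "a \<odot>\<^bsub>M\<^esub> n \<in> N" "a \<odot>\<^bsub>M\<^esub> l \<in> L" using * N L a by (auto simp: submodule_iff)
    ultimately show ?thesis by blast
  qed
  moreover have "\<zero>\<^bsub>M\<^esub> \<in> {x. \<exists>n\<in>N. \<exists>l\<in>L. x = n \<oplus>\<^bsub>M\<^esub> l}"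
    using N L by (auto simp: submodule_iff intro!: bexI[of _ "\<zero>\<^bsub>M\<^esub>"])
  moreover have "{x. \<exists>n\<in>N. \<exists>l\<in>L. x = n \<oplus>\<^bsub>M\<^esub> l} \<subseteq> carrier M" using Nc Lc by auto
  ultimately show ?thesis unfolding submodule_iff by (intro conjI ballI)
qed

lemma submodule_restrict:
  assumes K: "submodule K R M"
  shows "submodule N R (M\<lparr>carrier := K\<rparr>) \<longleftrightarrow> submodule N R M \<and> N \<subseteq> K"
proof -
  interpret K: right_module R "M\<lparr>carrier := K\<rparr>" by (rule submodule_is_right_module[OF K])
  have "K \<subseteq> carrier M" using K by (simp add: submodule_iff)
  then show ?thesis unfolding submodule_iff K.submodule_iff by auto
qed

end

lemma mod_prod_hom:
  assumes "right_module R M" "right_module R N" and f: "f \<in> module_hom R M N" and J: "J \<subseteq> carrier R"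
    and x: "x \<in> mod_prod M J"
  shows "f x \<in> mod_prod N J"
proof -
  interpret f: rmodule_hom R M N f using assms by (simp add: rmodule_homI)
  show ?thesis
    using x
  proof (induction rule: mod_prod.induct)
    case (step y z a)
    have "a \<in> carrier R" using step J by auto
    then have "f (y \<oplus>\<^bsub>M\<^esub> a \<odot>\<^bsub>M\<^esub> z) = f y \<oplus>\<^bsub>N\<^esub> a \<odot>\<^bsub>N\<^esub> f z"
      using step mod_prod_carrier[OF assms(1) J] by (simp add: f.add f.smult f.M.rsmult_closed)
    then show ?case using mod_prod.step[OF step.IH f.closed[OF step(2)] step(3)] by simp
  qed (simp add: f.zero mod_prod.zero)
qed

context path_coefficients
begin

lemma Jp_subset: "Jp l \<subseteq> carrier R" by (auto simp: Jp_def)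

lemma rad_submodule: "right_module R M \<Longrightarrow> submodule (mod_prod M (Jp l)) R M"
  by (rule mod_prod_submodule[OF _ Jp_subset]) (auto intro: Jp_mult_right)

text \<open>Substituting M = N + MJ into itself gives M = N + M J^i for every i, and J^k is zero. No
  finiteness of M is involved, because the ideal is nilpotent.\<close>

lemma nakayama:
  assumes M: "right_module R M" and N: "submodule N R M"
    and sum: "\<And>x. x \<in> carrier M \<Longrightarrow> \<exists>n\<in>N. \<exists>r\<in>mod_prod M (Jp 1). x = n \<oplus>\<^bsub>M\<^esub> r"
  shows "N = carrier M"
proof -
  interpret right_module R M by (rule M)
  have Nc: "n \<in> N \<Longrightarrow> n \<in> carrier M" for n using N by (auto simp: submodule_iff)
  note mc = mod_prod_carrier[OF M Jp_subset]
  have shift: "a \<odot>\<^bsub>M\<^esub> s \<in> mod_prod M (Jp (Suc i))" if s: "s \<in> mod_prod M (Jp 1)" and a: "a \<in> Jp i" for a s i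
    using s
  proof (induction rule: mod_prod.induct)
    case zero
    then show ?case using Jp_carrier[OF a] by (simp add: rsmult_zero mod_prod.zero)
  next
    case (step y z b)
    have "a \<odot>\<^bsub>M\<^esub> (y \<oplus>\<^bsub>M\<^esub> b \<odot>\<^bsub>M\<^esub> z) = a \<odot>\<^bsub>M\<^esub> y \<oplus>\<^bsub>M\<^esub> (b \<otimes> a) \<odot>\<^bsub>M\<^esub> z"
      using step Jp_carrier[OF a] Jp_carrier[OF step(3)] mc[OF step(1)]
      by (simp add: rsmult_add rsmult_assoc rsmult_closed)
    then show ?case using mod_prod.step[OF step.IH step(2)] Jp_mult[OF step(3) a] by simp
  qed
  \<comment> \<open>For a product z a with a in J^i, write z as n' + s with s in MJ: then n' a stays
    in N and s a falls into M J^(i+1) by \<open>shift\<close>.\<close>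
  have next_power: "\<exists>n\<in>N. \<exists>r'\<in>mod_prod M (Jp (Suc i)). r = n \<oplus>\<^bsub>M\<^esub> r'" if r: "r \<in> mod_prod M (Jp i)" for r i
    using r
  proof (induction rule: mod_prod.induct)
    case zero
    then show ?case using N by (auto simp: submodule_iff mod_prod.zero intro!: bexI[of _ "\<zero>\<^bsub>M\<^esub>"])
  next
    case (step y z a)
    obtain n r' where n: "n \<in> N" "r' \<in> mod_prod M (Jp (Suc i))" "y = n \<oplus>\<^bsub>M\<^esub> r'" using step.IH by blast
    obtain n' s where n': "n' \<in> N" "s \<in> mod_prod M (Jp 1)" "z = n' \<oplus>\<^bsub>M\<^esub> s" using sum[OF step(2)] by blast
    have a: "a \<in> carrier R" using Jp_carrier[OF step(3)] .
    have "y \<oplus>\<^bsub>M\<^esub> a \<odot>\<^bsub>M\<^esub> z = (n \<oplus>\<^bsub>M\<^esub> a \<odot>\<^bsub>M\<^esub> n') \<oplus>\<^bsub>M\<^esub> (r' \<oplus>\<^bsub>M\<^esub> a \<odot>\<^bsub>M\<^esub> s)"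
      using n n' a mc Nc by (simp add: rsmult_add rsmult_closed M.a_ac)
    moreover have "n \<oplus>\<^bsub>M\<^esub> a \<odot>\<^bsub>M\<^esub> n' \<in> N" using N n n' a by (simp add: submodule_iff)
    moreover have "r' \<oplus>\<^bsub>M\<^esub> a \<odot>\<^bsub>M\<^esub> s \<in> mod_prod M (Jp (Suc i))"
      by (rule mod_prod_add[OF M Jp_subset n(2) shift[OF n'(2) step(3)]])
    ultimately show ?case by blast
  qed
  have all: "\<exists>n\<in>N. \<exists>r\<in>mod_prod M (Jp i). x = n \<oplus>\<^bsub>M\<^esub> r" if x: "x \<in> carrier M" for x i
  proof (induction i)
    case 0
    have "\<one> \<odot>\<^bsub>M\<^esub> x \<in> mod_prod M (Jp 0)" by (rule mod_prod_incl[OF M Jp_subset x]) (simp add: Jp_0)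
    then show ?case using x N by (intro bexI[of _ "\<zero>\<^bsub>M\<^esub>"] bexI[of _ x]) (auto simp: rsmult_one submodule_iff)
  next
    case (Suc i)
    then obtain n r where n: "n \<in> N" "r \<in> mod_prod M (Jp i)" "x = n \<oplus>\<^bsub>M\<^esub> r" by blast
    obtain n' r' where n': "n' \<in> N" "r' \<in> mod_prod M (Jp (Suc i))" "r = n' \<oplus>\<^bsub>M\<^esub> r'" using next_power[OF n(2)] by blast
    have "x = (n \<oplus>\<^bsub>M\<^esub> n') \<oplus>\<^bsub>M\<^esub> r'" using n n' Nc mc by (simp add: M.a_assoc)
    then show ?case using N n n' by (auto simp: submodule_iff)
  qed
  have triv: "r = \<zero>\<^bsub>M\<^esub>" if "r \<in> mod_prod M (Jp k)" for r
    using that by (induction rule: mod_prod.induct) (auto simp: Jp_k rsmult_zero_scalar)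
  show ?thesis
  proof
    show "carrier M \<subseteq> N"
    proof
      fix x assume "x \<in> carrier M"
      then obtain n r where n: "n \<in> N" "r \<in> mod_prod M (Jp k)" "x = n \<oplus>\<^bsub>M\<^esub> r" using all by blast
      then show "x \<in> N" using triv[OF n(2)] Nc[OF n(1)] by simp
    qed
  qed (use Nc in auto)
qed

lemma superfluous_rad:
  assumes M: "right_module R M" and K: "K \<subseteq> mod_prod M (Jp 1)"
  shows "superfluous R M K"
proof (rule superfluousI)
  interpret right_module R M by (rule M)
  fix N assume N: "submodule N R M" and s: "\<And>x. x \<in> carrier M \<Longrightarrow> \<exists>y\<in>K. \<exists>z\<in>N. x = y \<oplus>\<^bsub>M\<^esub> z"
  show "N = carrier M"
  proof (rule nakayama[OF M N])
    fix x assume "x \<in> carrier M"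
    then obtain y z where yz: "y \<in> K" "z \<in> N" "x = y \<oplus>\<^bsub>M\<^esub> z" using s by blast
    have "y \<in> carrier M" "z \<in> carrier M" using yz K N mod_prod_carrier[OF M Jp_subset] by (auto simp: submodule_iff)
    then show "\<exists>n\<in>N. \<exists>r\<in>mod_prod M (Jp 1). x = n \<oplus>\<^bsub>M\<^esub> r" using yz K M.a_comm by blast
  qed
qed

text \<open>Write a = c e_v + r with r in J and c not zero. Then b = c^(-1) (b a) - c^(-1) (b r),
  and the second term is radical. This is what allows a generator to be discarded or replaced when
  some relation involves it with an invertible coefficient.\<close>

lemma exchange:
  assumes M: "right_module R M" and N: "submodule N R M" and b: "b \<in> carrier M" and v: "v \<in> verts Q"
    and evb: "ev v \<odot>\<^bsub>M\<^esub> b = b" and a: "a \<in> carrier R" "ev v \<otimes> a = a" and c: "co a (v, []) \<noteq> 0"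
    and ab: "a \<odot>\<^bsub>M\<^esub> b \<in> N"
  shows "\<exists>n\<in>N. \<exists>r\<in>mod_prod M (Jp 1). b = n \<oplus>\<^bsub>M\<^esub> r"
proof -
  interpret right_module R M by (rule M)
  let ?c = "co a (v, [])"
  define r where "r = a \<ominus> (ev v \<otimes> sc ?c)"
  have "co r (u, []) = 0" for u
    using co_off[OF a(1), of "(u, [])"] ev_left_iff[OF a(1) v] a v
    by (auto simp: r_def a_minus_def co_add co_minus co_ev_mult co_sc)
  then have r: "r \<in> Jp 1" unfolding Jp_def using a(1) by (auto simp: r_def)
  have rR: "r \<in> carrier R" using Jp_carrier[OF r] .
  have a_eq: "a = (ev v \<otimes> sc ?c) \<oplus> r"
    using a(1) by (intro co_eqI) (auto simp: r_def a_minus_def co_add co_minus)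
  have "a \<odot>\<^bsub>M\<^esub> b = sc ?c \<odot>\<^bsub>M\<^esub> b \<oplus>\<^bsub>M\<^esub> r \<odot>\<^bsub>M\<^esub> b"
    by (subst a_eq) (simp add: rsmult_add_scalar rsmult_assoc b rR evb)
  then have s: "sc ?c \<odot>\<^bsub>M\<^esub> b = a \<odot>\<^bsub>M\<^esub> b \<oplus>\<^bsub>M\<^esub> (\<ominus> r) \<odot>\<^bsub>M\<^esub> b"
    using b rR by (simp add: rsmult_minus_scalar M.a_assoc M.r_neg rsmult_closed)
  have "b = sc (inverse ?c) \<odot>\<^bsub>M\<^esub> (sc ?c \<odot>\<^bsub>M\<^esub> b)"
    using c by (simp add: b sc_one rsmult_one flip: rsmult_assoc sc_mult)
  also have "\<dots> = sc (inverse ?c) \<odot>\<^bsub>M\<^esub> (a \<odot>\<^bsub>M\<^esub> b) \<oplus>\<^bsub>M\<^esub> ((\<ominus> r) \<otimes> sc (inverse ?c)) \<odot>\<^bsub>M\<^esub> b"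
    unfolding s using a rR b by (simp add: rsmult_add rsmult_assoc rsmult_closed)
  finally have "b = sc (inverse ?c) \<odot>\<^bsub>M\<^esub> (a \<odot>\<^bsub>M\<^esub> b) \<oplus>\<^bsub>M\<^esub> ((\<ominus> r) \<otimes> sc (inverse ?c)) \<odot>\<^bsub>M\<^esub> b" .
  moreover have "sc (inverse ?c) \<odot>\<^bsub>M\<^esub> (a \<odot>\<^bsub>M\<^esub> b) \<in> N" using N ab by (simp add: submodule_iff)
  moreover have "\<ominus> r \<in> Jp 1" using r by (auto simp: Jp_def co_minus)
  then have "((\<ominus> r) \<otimes> sc (inverse ?c)) \<odot>\<^bsub>M\<^esub> b \<in> mod_prod M (Jp 1)"
    by (intro mod_prod_incl[OF M Jp_subset b] Jp_mult_right) auto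
  ultimately show ?thesis by blast
qed

lemma sum_ev_smult:
  assumes M: "right_module R M" and x: "x \<in> carrier M"
  shows "(\<Oplus>\<^bsub>M\<^esub>v\<in>verts Q. ev v \<odot>\<^bsub>M\<^esub> x) = x"
proof -
  interpret right_module R M by (rule M)
  have *: "(\<Oplus>v\<in>I. ev v) \<odot>\<^bsub>M\<^esub> x = (\<Oplus>\<^bsub>M\<^esub>v\<in>I. ev v \<odot>\<^bsub>M\<^esub> x)" for I
  proof (induction I rule: infinite_finite_induct)
    case (insert v I)
    then show ?case
      by (simp add: finsum_insert M.finsum_insert Pi_iff rsmult_closed x rsmult_add_scalar finsum_closed)
  qed (simp_all add: x rsmult_zero_scalar)
  show ?thesis using *[of "verts Q"] by (simp add: sum_ev rsmult_one x)
qed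

section \<open>Direct sums of the projectives e_vA, and minimal covers\<close>

abbreviation evs :: "'v list \<Rightarrow> 'r list" where "evs \<equiv> map ev"
abbreviation PM :: "'v list \<Rightarrow> ('r, 'r list) module" where "PM vs \<equiv> idem_module R (evs vs)"

lemma evs_ok: "set (evs vs) \<subseteq> carrier R" "\<lbrakk>set vs \<subseteq> verts Q; e \<in> set (evs vs)\<rbrakk> \<Longrightarrow> e \<otimes> e = e"
  by (auto simp: ev_idem)

lemma PM_right_module: "right_module R (PM vs)"
  by (rule idem_module_right_module[OF evs_ok(1)])

lemma PM_fg: "set vs \<subseteq> verts Q \<Longrightarrow> PM vs \<in> fg_modules R"
  by (rule idem_module_fg[OF ring_axioms evs_ok])

lemma PM_projective: "set vs \<subseteq> verts Q \<Longrightarrow> projective_module R (PM vs)"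
  by (rule idem_module_projective[OF ring_axioms evs_ok])

lemma PM_carrier_iff:
  "xs \<in> carrier (PM vs) \<longleftrightarrow> length xs = length vs \<and> (\<forall>i<length vs. xs ! i \<in> carrier R \<and> ev (vs ! i) \<otimes> xs ! i = xs ! i)"
  by (auto simp: idem_module_carrier_iff)

lemma PM_nth:
  "\<lbrakk>length xs = length vs; length ys = length vs; i < length vs\<rbrakk> \<Longrightarrow> (xs \<oplus>\<^bsub>PM vs\<^esub> ys) ! i = xs ! i \<oplus> ys ! i"
  "\<lbrakk>length xs = length vs; i < length vs\<rbrakk> \<Longrightarrow> (a \<odot>\<^bsub>PM vs\<^esub> xs) ! i = xs ! i \<otimes> a"
  "i < length vs \<Longrightarrow> \<zero>\<^bsub>PM vs\<^esub> ! i = \<zero>"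
  by (simp_all add: idem_module_nth)

lemma PM_rad_iff:
  assumes vs: "set vs \<subseteq> verts Q" and xs: "xs \<in> carrier (PM vs)"
  shows "xs \<in> mod_prod (PM vs) (Jp l) \<longleftrightarrow> (\<forall>i<length vs. xs ! i \<in> Jp l)"
proof
  assume "xs \<in> mod_prod (PM vs) (Jp l)"
  then show "\<forall>i<length vs. xs ! i \<in> Jp l"
  proof (induction rule: mod_prod.induct)
    case (step x y a)
    then have c: "x \<in> carrier (PM vs)" "y \<in> carrier (PM vs)"
      using mod_prod_carrier[OF PM_right_module Jp_subset] by auto
    have l: "length (a \<odot>\<^bsub>PM vs\<^esub> y) = length vs"
      using c idem_module_length(2)[of y "evs vs" R a] by (simp add: PM_carrier_iff)
    show ?case
      using step c l by (auto simp: PM_carrier_iff PM_nth intro!: Jp_add Jp_mult_left)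
  qed (simp add: PM_nth)
next
  assume x: "\<forall>i<length vs. xs ! i \<in> Jp l"
  interpret P: right_module R "PM vs" by (rule PM_right_module)
  note u = unit_vec_carrier[OF ring_axioms evs_ok(1) evs_ok(2)[OF vs]]
  have "xs = comb (PM vs) (map (unit_vec R (evs vs)) [0..<length (evs vs)]) xs"
    by (rule comb_unit_vecs[OF ring_axioms evs_ok(1) evs_ok(2)[OF vs] xs, symmetric])
  also have "\<dots> \<in> mod_prod (PM vs) (Jp l)"
    unfolding comb_def
    by (rule P.submodule_finsum[OF rad_submodule[OF PM_right_module]])
      (use x u in \<open>auto intro!: mod_prod_incl[OF PM_right_module Jp_subset]\<close>)
  finally show "xs \<in> mod_prod (PM vs) (Jp l)" .
qed

subsection \<open>Existence of projective covers\<close>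

text \<open>Each generator is homogeneous, that is, fixed by one vertex idempotent; such a generator
  is the image of the unit vector of a summand e_vA, so the set gives a cover by
  \<open>PM\<close>.\<close>

definition generates :: "('r, 'a) module \<Rightarrow> 'a set \<Rightarrow> bool" where
  "generates M B \<longleftrightarrow> finite B \<and> (\<forall>b\<in>B. b \<in> carrier M \<and> (\<exists>v\<in>verts Q. ev v \<odot>\<^bsub>M\<^esub> b = b)) \<and>
     (\<forall>N. submodule N R M \<and> B \<subseteq> N \<longrightarrow> N = carrier M)"

lemma fin_gen_generates:
  assumes M: "right_module R M" and fg: "fin_gen_module R M"
  shows "\<exists>B. generates M B"
proof -
  interpret right_module R M by (rule M)
  obtain S where S: "finite S" "S \<subseteq> carrier M" "\<And>L. \<lbrakk>submodule L R M; S \<subseteq> L\<rbrakk> \<Longrightarrow> L = carrier M"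
    using fg by (auto simp: fin_gen_module_def)
  let ?B = "(\<lambda>(v, x). ev v \<odot>\<^bsub>M\<^esub> x) ` (verts Q \<times> S)"
  have "N = carrier M" if N: "submodule N R M" "?B \<subseteq> N" for N
  proof (rule S(3)[OF N(1)])
    show "S \<subseteq> N"
    proof
      fix x assume x: "x \<in> S"
      have "(\<Oplus>\<^bsub>M\<^esub>v\<in>verts Q. ev v \<odot>\<^bsub>M\<^esub> x) \<in> N"
        by (rule submodule_finsum[OF N(1)]) (use N(2) x in auto)
      then show "x \<in> N" using sum_ev_smult[OF M] x S(2) by auto
    qed
  qed
  moreover have "ev v \<odot>\<^bsub>M\<^esub> (ev v \<odot>\<^bsub>M\<^esub> x) = ev v \<odot>\<^bsub>M\<^esub> x" if "v \<in> verts Q" "x \<in> S" for v x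
    using that S(2) ev_idem[of v] by (auto simp: rsmult_assoc[symmetric])
  ultimately have "generates M ?B"
    unfolding generates_def using S(1,2) by (auto simp: rsmult_closed)
  then show ?thesis by blast
qed

lemma generates_list:
  assumes M: "right_module R M" and B: "generates M B"
  obtains vs bs where "set vs \<subseteq> verts Q" "set bs = B" "distinct bs" "adapted R M (evs vs) bs"
    "comb M bs ` carrier (PM vs) = carrier M"
proof -
  interpret right_module R M by (rule M)
  obtain bs where bs: "set bs = B" "distinct bs" using finite_distinct_list[of B] B by (auto simp: generates_def)
  have "\<forall>b\<in>B. \<exists>v. v \<in> verts Q \<and> ev v \<odot>\<^bsub>M\<^esub> b = b" using B by (auto simp: generates_def)
  then obtain f where f: "\<And>b. b \<in> B \<Longrightarrow> f b \<in> verts Q \<and> ev (f b) \<odot>\<^bsub>M\<^esub> b = b" by metis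
  let ?vs = "map f bs"
  have vs: "set ?vs \<subseteq> verts Q" using f bs by auto
  have Bc: "b \<in> B \<Longrightarrow> b \<in> carrier M" for b using B by (auto simp: generates_def)
  have ad: "adapted R M (evs ?vs) bs" using f bs Bc by (auto simp: adapted_def)
  interpret c: rmodule_hom R "PM ?vs" M "comb M bs" by (rule rmodule_homI[OF PM_right_module M comb_hom[OF M ad]])
  have "B \<subseteq> comb M bs ` carrier (PM ?vs)"
  proof
    fix b assume "b \<in> B"
    then obtain i where i: "i < length bs" "bs ! i = b" using bs by (metis in_set_conv_nth)
    then have "comb M bs (unit_vec R (evs ?vs) i) = b"
      using comb_unit_vec[OF M ad _ evs_ok(1), of i] by simp
    moreover have "unit_vec R (evs ?vs) i \<in> carrier (PM ?vs)"
      by (rule unit_vec_carrier[OF ring_axioms evs_ok(1) evs_ok(2)[OF vs]]) (use i in auto)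
    ultimately show "b \<in> comb M bs ` carrier (PM ?vs)" by force
  qed
  then have "comb M bs ` carrier (PM ?vs) = carrier M"
    using B c.image_submodule[OF c.M.carrier_submodule] unfolding generates_def by blast
  then show thesis using that vs bs ad by blast
qed

lemma minimal_cover:
  assumes M: "right_module R M" and fg: "fin_gen_module R M"
  obtains vs bs where "set vs \<subseteq> verts Q" "adapted R M (evs vs) bs" "comb M bs ` carrier (PM vs) = carrier M"
    "module_kernel (PM vs) M (comb M bs) \<subseteq> mod_prod (PM vs) (Jp 1)"
proof -
  interpret right_module R M by (rule M)
  obtain B where B: "generates M B" and min: "\<And>B'. generates M B' \<Longrightarrow> card B \<le> card B'"
    using fin_gen_generates[OF M fg] ex_has_least_nat[of "generates M" _ card] by blast
  obtain vs bs where vs: "set vs \<subseteq> verts Q" and bs: "set bs = B" "distinct bs" and ad: "adapted R M (evs vs) bs"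
    and surj: "comb M bs ` carrier (PM vs) = carrier M"
    by (rule generates_list[OF M B])
  have len: "length bs = length vs" using ad by (simp add: adapted_def)
  have Bc: "b \<in> B \<Longrightarrow> b \<in> carrier M" for b using B by (auto simp: generates_def)
  have bc: "i < length vs \<Longrightarrow> bs ! i \<in> carrier M" for i using ad by (simp add: adapted_def)
  have "xs ! i \<in> Jp 1" if xs: "xs \<in> carrier (PM vs)" and z: "comb M bs xs = \<zero>\<^bsub>M\<^esub>" and i: "i < length vs" for xs i
  proof (rule ccontr)
    assume nJ: "xs ! i \<notin> Jp 1"
    let ?v = "vs ! i" and ?b = "bs ! i"
    have v: "?v \<in> verts Q" using vs i by auto
    have x: "j < length vs \<Longrightarrow> xs ! j \<in> carrier R" for j using xs by (simp add: PM_carrier_iff)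
    have ex: "ev ?v \<otimes> xs ! i = xs ! i" using xs i by (simp add: PM_carrier_iff)
    obtain u where "co (xs ! i) (u, []) \<noteq> 0" using nJ x[OF i] by (auto simp: Jp_def)
    then have c: "co (xs ! i) (?v, []) \<noteq> 0" using ev_left_iff[OF x[OF i] v] ex by metis
    \<comment> \<open>The relation puts the \<open>xs ! i\<close> multiple of \<open>?b\<close> into
      any submodule N containing the other generators, so exchange gives \<open>?b\<close> in N +
      MJ. Then N + MJ is all of M and hence so is N.\<close>
    have "generates M (B - {?b})"
      unfolding generates_def
    proof (intro conjI allI impI)
      fix N assume N: "submodule N R M \<and> B - {?b} \<subseteq> N"
      let ?L = "{x. \<exists>n\<in>N. \<exists>r\<in>mod_prod M (Jp 1). x = n \<oplus>\<^bsub>M\<^esub> r}"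
      have L: "submodule ?L R M"
        using N by (intro sum_submodule[OF M Jp_subset[of 1]] rad_submodule[OF M]) auto
      have f: "(\<lambda>j. xs ! j \<odot>\<^bsub>M\<^esub> bs ! j) \<in> {..<length bs} \<rightarrow> carrier M"
        by (rule smult_nth_in[OF M ad xs])
      have "comb M bs xs = xs ! i \<odot>\<^bsub>M\<^esub> ?b \<oplus>\<^bsub>M\<^esub> (\<Oplus>\<^bsub>M\<^esub>j\<in>{..<length bs} - {i}. xs ! j \<odot>\<^bsub>M\<^esub> bs ! j)"
        unfolding comb_def using f i len
        by (subst M.finsum_insert[symmetric]) (auto simp: insert_absorb Pi_iff)
      moreover have sN: "(\<Oplus>\<^bsub>M\<^esub>j\<in>{..<length bs} - {i}. xs ! j \<odot>\<^bsub>M\<^esub> bs ! j) \<in> N"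
      proof (rule submodule_finsum)
        show "(\<lambda>j. xs ! j \<odot>\<^bsub>M\<^esub> bs ! j) \<in> {..<length bs} - {i} \<rightarrow> N"
        proof
          fix j assume j: "j \<in> {..<length bs} - {i}"
          then have "bs ! j \<in> B - {?b}" using bs i len by (auto simp: nth_eq_iff_index_eq)
          then show "xs ! j \<odot>\<^bsub>M\<^esub> bs ! j \<in> N" using N x[of j] j len unfolding submodule_iff by auto
        qed
      qed (use N in auto)
      ultimately have "xs ! i \<odot>\<^bsub>M\<^esub> ?b = \<ominus>\<^bsub>M\<^esub> (\<Oplus>\<^bsub>M\<^esub>j\<in>{..<length bs} - {i}. xs ! j \<odot>\<^bsub>M\<^esub> bs ! j)"
        using z N x[OF i] bc[OF i] unfolding submodule_iff
        by (intro M.minus_equality[symmetric]) (auto simp: rsmult_closed)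
      then have "xs ! i \<odot>\<^bsub>M\<^esub> ?b \<in> N" using submodule_minus sN N by simp
      then have "?b \<in> ?L"
        using exchange[OF M _ bc[OF i] v _ x[OF i] ex c] N ad i by (auto simp: adapted_def)
      moreover have "N \<subseteq> ?L"
      proof
        fix n assume n: "n \<in> N"
        then have "n = n \<oplus>\<^bsub>M\<^esub> \<zero>\<^bsub>M\<^esub>" using N by (auto simp: submodule_iff)
        then show "n \<in> ?L" using n mod_prod.zero by blast
      qed
      ultimately have "B \<subseteq> ?L" using N by blast
      then have "?L = carrier M" using B L by (auto simp: generates_def)
      then show "N = carrier M" using N by (intro nakayama[OF M]) auto
    qed (use B in \<open>auto simp: generates_def\<close>)
    then have "card B \<le> card (B - {?b})" by (rule min)
    moreover have "?b \<in> B" "finite B" using bs i len B by (auto simp: generates_def)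
    ultimately show False by (meson card_Diff1_less not_less)
  qed
  then have "module_kernel (PM vs) M (comb M bs) \<subseteq> mod_prod (PM vs) (Jp 1)"
    by (auto simp: module_kernel_def PM_rad_iff[OF vs])
  then show thesis using that vs ad surj by blast
qed

lemma cover_of_minimal:
  assumes M: "right_module R M" and vs: "set vs \<subseteq> verts Q" and ad: "p \<in> module_hom R (PM vs) M"
    and surj: "p ` carrier (PM vs) = carrier M"
    and ker: "module_kernel (PM vs) M p \<subseteq> mod_prod (PM vs) (Jp 1)"
  shows "is_syzygy R M ((PM vs)\<lparr>carrier := module_kernel (PM vs) M p\<rparr>)"
  unfolding is_syzygy_def projective_cover_def
  using superfluous_rad[OF PM_right_module ker] PM_fg[OF vs] PM_projective[OF vs] PM_right_module ad surj
  by blast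

section \<open>Finite dimension of submodules of projectives\<close>

definition k_subspace :: "('r, 'a) module \<Rightarrow> 'a set \<Rightarrow> bool" where
  "k_subspace M V \<longleftrightarrow> V \<subseteq> carrier M \<and> \<zero>\<^bsub>M\<^esub> \<in> V \<and> (\<forall>x\<in>V. \<forall>y\<in>V. x \<oplus>\<^bsub>M\<^esub> y \<in> V) \<and> (\<forall>c. \<forall>x\<in>V. sc c \<odot>\<^bsub>M\<^esub> x \<in> V)"

lemma submodule_k_subspace: "\<lbrakk>right_module R M; submodule N R M\<rbrakk> \<Longrightarrow> k_subspace M N"
  by (simp add: k_subspace_def right_module.submodule_iff)

lemma k_subspace_minus:
  assumes M: "right_module R M" and V: "k_subspace M V" and x: "x \<in> V" shows "\<ominus>\<^bsub>M\<^esub> x \<in> V"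
proof -
  interpret right_module R M by (rule M)
  have "\<ominus>\<^bsub>M\<^esub> x = sc (- 1) \<odot>\<^bsub>M\<^esub> x"
    using V x by (auto simp: k_subspace_def sc_minus sc_one rsmult_minus_scalar rsmult_one)
  then show ?thesis using V x by (simp add: k_subspace_def)
qed

text \<open>Induction on the number of functionals that jointly separate V: passing to the kernel of
  one functional costs at most one spanning vector. This replaces a dimension theory for the
  modules.\<close>

lemma finite_spanning:
  assumes M: "right_module R M" and "finite I" and "k_subspace M V"
    and "\<And>i x y. \<lbrakk>i \<in> I; x \<in> V; y \<in> V\<rbrakk> \<Longrightarrow> g i (x \<oplus>\<^bsub>M\<^esub> y) = g i x + (g i y :: 'f)"
    and "\<And>i c x. \<lbrakk>i \<in> I; x \<in> V\<rbrakk> \<Longrightarrow> g i (sc c \<odot>\<^bsub>M\<^esub> x) = c * g i x"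
    and "\<And>x. \<lbrakk>x \<in> V; \<And>i. i \<in> I \<Longrightarrow> g i x = 0\<rbrakk> \<Longrightarrow> x = \<zero>\<^bsub>M\<^esub>"
  shows "\<exists>B. finite B \<and> B \<subseteq> V \<and> (\<forall>W. k_subspace M W \<and> B \<subseteq> W \<longrightarrow> V \<subseteq> W)"
  using assms(2-)
proof (induction I arbitrary: V)
  case empty
  then have "V \<subseteq> {\<zero>\<^bsub>M\<^esub>}" by blast
  then show ?case by (intro exI[of _ "{}"]) (auto simp: k_subspace_def)
next
  case (insert i I)
  interpret right_module R M by (rule M)
  note V = insert.prems(1)
  have Vc: "x \<in> V \<Longrightarrow> x \<in> carrier M" for x using V by (auto simp: k_subspace_def)
  let ?V = "{x \<in> V. g i x = 0}"
  have g0: "g i \<zero>\<^bsub>M\<^esub> = 0"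
    using insert.prems(3)[of i "\<zero>\<^bsub>M\<^esub>" 0] V by (simp add: k_subspace_def sc_zero rsmult_zero_scalar)
  have "k_subspace M ?V"
    using V insert.prems(2,3)[of i] g0 by (auto simp: k_subspace_def)
  then have "\<exists>B. finite B \<and> B \<subseteq> ?V \<and> (\<forall>W. k_subspace M W \<and> B \<subseteq> W \<longrightarrow> ?V \<subseteq> W)"
  proof (rule insert.IH)
    show "g j (x \<oplus>\<^bsub>M\<^esub> y) = g j x + g j y" if "j \<in> I" "x \<in> ?V" "y \<in> ?V" for j x y
      using that by (intro insert.prems(2)) auto
    show "g j (sc c \<odot>\<^bsub>M\<^esub> x) = c * g j x" if "j \<in> I" "x \<in> ?V" for j c x
      using that by (intro insert.prems(3)) auto
    show "x = \<zero>\<^bsub>M\<^esub>" if "x \<in> ?V" "\<And>j. j \<in> I \<Longrightarrow> g j x = 0" for x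
      using that by (intro insert.prems(4)) auto
  qed
  then obtain B where B': "finite B \<and> B \<subseteq> ?V \<and> (\<forall>W. k_subspace M W \<and> B \<subseteq> W \<longrightarrow> ?V \<subseteq> W)" by (rule exE)
  note B = conjunct1[OF B'] conjunct1[OF conjunct2[OF B']] conjunct2[OF conjunct2[OF B'], THEN spec, THEN mp, OF conjI]
  show ?case
  proof (cases "\<exists>x\<in>V. g i x \<noteq> 0")
    case False
    then have "?V = V" by auto
    then show ?thesis using B' by (simp only:) (rule exI)
  next
    case True
    then obtain x where x: "x \<in> V" "g i x \<noteq> 0" by blast
    have span: "V \<subseteq> W" if W: "k_subspace M W" "insert x B \<subseteq> W" for W
    proof
      fix y assume y: "y \<in> V"
      \<comment> \<open>With this factor, y minus its multiple of x is killed by \<open>g i\<close>,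
        hence lies in the subspace covered by the induction hypothesis.\<close>
      let ?c = "g i y / g i x"
      let ?s = "sc (- ?c) \<odot>\<^bsub>M\<^esub> x"
      have s: "?s \<in> V" using V x by (simp add: k_subspace_def)
      have "g i (y \<oplus>\<^bsub>M\<^esub> ?s) = 0"
        using insert.prems(2)[of i y ?s] insert.prems(3)[of i x "- ?c"] x y s by simp
      moreover have "y \<oplus>\<^bsub>M\<^esub> ?s \<in> V" using V y s by (simp add: k_subspace_def)
      ultimately have "y \<oplus>\<^bsub>M\<^esub> ?s \<in> W" using B(3)[OF W(1)] W(2) by auto
      moreover have "sc ?c \<odot>\<^bsub>M\<^esub> x \<in> W" using W by (simp add: k_subspace_def)
      ultimately have "(y \<oplus>\<^bsub>M\<^esub> ?s) \<oplus>\<^bsub>M\<^esub> sc ?c \<odot>\<^bsub>M\<^esub> x \<in> W" using W(1) unfolding k_subspace_def by blast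
      moreover have "(y \<oplus>\<^bsub>M\<^esub> ?s) \<oplus>\<^bsub>M\<^esub> sc ?c \<odot>\<^bsub>M\<^esub> x = y"
        using Vc[OF x(1)] Vc[OF y]
        by (simp add: M.a_assoc rsmult_closed sc_minus rsmult_minus_scalar M.l_neg)
      ultimately show "y \<in> W" by simp
    qed
    have fin: "finite (insert x B)" "insert x B \<subseteq> V" using B(1,2) x(1) by auto
    show ?thesis
      by (intro exI[of _ "insert x B"] conjI allI impI fin, erule conjE, rule span)
  qed
qed

text \<open>The coefficients of the entries are finitely many functionals that separate points, so a
  submodule has a finite spanning set over the field, which also generates it as a module.\<close>

lemma PM_submodule_fin_gen:
  assumes vs: "set vs \<subseteq> verts Q" and K: "submodule K R (PM vs)"
  shows "(PM vs)\<lparr>carrier := K\<rparr> \<in> fg_modules R"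
proof -
  interpret P: right_module R "PM vs" by (rule PM_right_module)
  let ?K = "(PM vs)\<lparr>carrier := K\<rparr>"
  interpret K: right_module R ?K by (rule P.submodule_is_right_module[OF K])
  have Kc: "x \<in> K \<Longrightarrow> x \<in> carrier (PM vs)" for x using K by (auto simp: P.submodule_iff)
  let ?I = "{..<length vs} \<times> paths"
  let ?g = "\<lambda>(i, z) x. co (x ! i) z"
  have "\<exists>B. finite B \<and> B \<subseteq> K \<and> (\<forall>W. k_subspace (PM vs) W \<and> B \<subseteq> W \<longrightarrow> K \<subseteq> W)"
  proof (rule finite_spanning[OF P.right_module_axioms _ submodule_k_subspace[OF P.right_module_axioms K]])
    show "finite ?I" using finite_paths by simp
    show "?g i (x \<oplus>\<^bsub>PM vs\<^esub> y) = ?g i x + ?g i y" if "i \<in> ?I" "x \<in> K" "y \<in> K" for i x y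
      using that Kc[OF that(2)] Kc[OF that(3)] by (auto simp: PM_carrier_iff PM_nth co_add)
    show "?g i (sc c \<odot>\<^bsub>PM vs\<^esub> x) = c * ?g i x" if "i \<in> ?I" "x \<in> K" for i c x
      using that Kc[OF that(2)] by (auto simp: PM_carrier_iff PM_nth co_mult_sc)
    show "x = \<zero>\<^bsub>PM vs\<^esub>" if "x \<in> K" "\<And>i. i \<in> ?I \<Longrightarrow> ?g i x = 0" for x
    proof (rule nth_equalityI)
      have x: "length x = length vs" "\<And>i. i < length vs \<Longrightarrow> x ! i \<in> carrier R"
        using Kc[OF that(1)] by (auto simp: PM_carrier_iff)
      show "length x = length \<zero>\<^bsub>PM vs\<^esub>" using x by (simp add: idem_module_length)
      show "x ! i = \<zero>\<^bsub>PM vs\<^esub> ! i" if "i < length x" for i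
      proof -
        have "i < length vs" using that x by simp
        then have "x ! i = \<zero>" using x \<open>\<And>i. i \<in> ?I \<Longrightarrow> ?g i x = 0\<close> by (intro co_eqI) (auto simp: co_zero)
        then show ?thesis using \<open>i < length vs\<close> by (simp add: PM_nth)
      qed
    qed
  qed
  then obtain B where B': "finite B \<and> B \<subseteq> K \<and> (\<forall>W. k_subspace (PM vs) W \<and> B \<subseteq> W \<longrightarrow> K \<subseteq> W)" by (rule exE)
  note B = conjunct1[OF B'] conjunct1[OF conjunct2[OF B']] conjunct2[OF conjunct2[OF B'], THEN spec, THEN mp, OF conjI]
  have "fin_gen_module R ?K"
    unfolding fin_gen_module_def
  proof (intro exI[of _ B] conjI allI impI)
    fix N assume N: "submodule N R ?K \<and> B \<subseteq> N"
    then have N': "submodule N R (PM vs)" "N \<subseteq> K"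
      using submodule_restrict[OF P.right_module_axioms Jp_subset[of 0] K] by auto
    show "N = carrier ?K"
      using B(3)[OF submodule_k_subspace[OF P.right_module_axioms N'(1)]] N N' by auto
  qed (use B in auto)
  then show ?thesis using K.right_module_axioms by (simp add: fg_modules_def)
qed

lemma ex_syzygy: assumes "M \<in> fg_modules R" shows "\<exists>N\<in>fg_modules R. is_syzygy R M N"
proof -
  have M: "right_module R M" "fin_gen_module R M" using assms by (auto simp: fg_modules_def)
  obtain vs bs where c: "set vs \<subseteq> verts Q" "adapted R M (evs vs) bs" "comb M bs ` carrier (PM vs) = carrier M"
    "module_kernel (PM vs) M (comb M bs) \<subseteq> mod_prod (PM vs) (Jp 1)"
    by (rule minimal_cover[OF M])
  interpret p: rmodule_hom R "PM vs" M "comb M bs" by (rule rmodule_homI[OF PM_right_module M(1) comb_hom[OF M(1) c(2)]])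
  show ?thesis
    using cover_of_minimal[OF M(1) c(1) p.hom c(3,4)] PM_submodule_fin_gen[OF c(1) p.kernel_submodule] by blast
qed

sublocale syzygy_ring R
  by unfold_locales (rule ex_syzygy)

subsection \<open>Submodules of projective modules\<close>

lemma comb_restrict:
  assumes M: "right_module R M" and K: "submodule K R M" and bs: "set bs \<subseteq> K"
    and xs: "\<And>i. i < length bs \<Longrightarrow> xs ! i \<in> carrier R"
  shows "comb (M\<lparr>carrier := K\<rparr>) bs xs = comb M bs xs"
proof -
  interpret M: right_module R M by (rule M)
  let ?K = "M\<lparr>carrier := K\<rparr>"
  have Kc: "K \<subseteq> carrier M" using K by (simp add: M.submodule_iff)
  note KM = M.submodule_is_right_module[OF K]
  have "(\<lambda>x. x) \<in> module_hom R ?K M" using Kc by (intro module_homI) auto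
  then interpret i: rmodule_hom R ?K M "\<lambda>x. x" by (rule rmodule_homI[OF KM M])
  have "(\<lambda>i. xs ! i \<odot>\<^bsub>M\<^esub> bs ! i) \<in> {..<length bs} \<rightarrow> carrier ?K"
    using bs xs K by (auto simp: M.submodule_iff subset_iff)
  from i.finsum[OF this] show ?thesis by (simp add: comb_def)
qed

lemma co_comb_nth:
  assumes us: "set us \<subseteq> verts Q" and ad: "adapted R (PM us) (evs vs) bs" and xs: "xs \<in> carrier (PM vs)"
    and i: "i < length us"
  shows "co (comb (PM us) bs xs ! i) z = (\<Sum>j<length vs. co (bs ! j ! i \<otimes> xs ! j) z)"
proof -
  have len: "length bs = length vs" using ad by (simp add: adapted_def)
  have b: "bs ! j \<in> carrier (PM us)" if "j < length vs" for j using ad that by (simp add: adapted_def)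
  have x: "xs ! j \<in> carrier R" if "j < length vs" for j using xs that by (simp add: PM_carrier_iff)
  have bi: "bs ! j ! i \<in> carrier R" if "j < length vs" for j using b[OF that] i by (simp add: PM_carrier_iff)
  have "comb (PM us) bs xs ! i = (\<Oplus>j\<in>{..<length bs}. (xs ! j \<odot>\<^bsub>PM us\<^esub> bs ! j) ! i)"
    unfolding comb_def
    by (rule idem_module_finsum_nth[OF ring_axioms evs_ok(1) evs_ok(2)[OF us]
          smult_nth_in[OF PM_right_module ad xs]]) (simp_all add: i)
  also have "\<dots> = (\<Oplus>j\<in>{..<length vs}. bs ! j ! i \<otimes> xs ! j)"
    by (rule finsum_cong') (use b i in \<open>auto simp: len PM_nth PM_carrier_iff bi x\<close>)
  finally show ?thesis by (simp add: co_finsum bi x)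
qed

text \<open>The radical order of an element of a projective: the largest d with the element in P
  J^d. The cap \<open>k\<close> gives the zero element a finite order too.\<close>

definition order_in :: "nat \<Rightarrow> 'r list \<Rightarrow> nat" where
  "order_in n x = Max {d. d \<le> k \<and> (\<forall>i<n. x ! i \<in> Jp d)}"

lemma order_in:
  assumes "\<And>i. i < n \<Longrightarrow> x ! i \<in> carrier R"
  shows "order_in n x \<le> k" "\<And>i. i < n \<Longrightarrow> x ! i \<in> Jp (order_in n x)"
    "\<And>d. \<lbrakk>d \<le> k; \<And>i. i < n \<Longrightarrow> x ! i \<in> Jp d\<rbrakk> \<Longrightarrow> d \<le> order_in n x"
proof -
  let ?D = "{d. d \<le> k \<and> (\<forall>i<n. x ! i \<in> Jp d)}"
  have f: "finite ?D" by (rule finite_subset[of _ "{..k}"]) auto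
  have "0 \<in> ?D" using assms by (simp add: Jp_0)
  then have "Max ?D \<in> ?D" using f Max_in by blast
  then show "order_in n x \<le> k" "\<And>i. i < n \<Longrightarrow> x ! i \<in> Jp (order_in n x)" by (auto simp: order_in_def)
  show "\<And>d. \<lbrakk>d \<le> k; \<And>i. i < n \<Longrightarrow> x ! i \<in> Jp d\<rbrakk> \<Longrightarrow> d \<le> order_in n x"
    unfolding order_in_def by (rule Max_ge[OF f]) auto
qed

text \<open>The list \<open>vs\<close> of vertices stays fixed while \<open>bs\<close> varies, so
  that the total orders of different families are comparable and bounded.\<close>

definition spanning :: "'v list \<Rightarrow> 'r list set \<Rightarrow> 'v list \<Rightarrow> 'r list list \<Rightarrow> bool" where
  "spanning us K vs bs \<longleftrightarrow> adapted R (PM us) (evs vs) bs \<and> set bs \<subseteq> K \<and> comb (PM us) bs ` carrier (PM vs) = K"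

lemma strip_in_PM:
  assumes "a \<in> carrier R" "v \<in> verts Q" "ev v \<otimes> a = a" shows "ev v \<otimes> strip z a = strip z a"
proof -
  obtain w q where z: "z = (w, q)" by (cases z)
  have "co a (u, p) = 0" if "u \<noteq> v" for u p using assms that ev_left_iff by blast
  then show ?thesis by (auto simp: z ev_left_iff assms(1,2) co_strip)
qed

lemma strip_ev: 
  assumes "a \<in> carrier R" "w \<in> verts Q" shows "strip (w, q) a \<otimes> ev w = strip (w, q) a"
  by (rule co_eqI) (auto simp: co_mult_ev assms co_strip)

lemma co_mult_strip_off:
  assumes a: "a \<in> carrier R" and b: "b \<in> carrier R" and p: "tgt u p \<noteq> w"
  shows "co (a \<otimes> strip (w, q) b) (u, p) = 0"
proof (cases "(u, p) \<in> paths")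
  case True
  have "co a (u, take i p) * co (strip (w, q) b) (tgt u (take i p), drop i p) = 0" if "i \<in> {..length p}" for i
  proof -
    have "tgt (tgt u (take i p)) (drop i p) \<noteq> w" using p by (simp flip: path_target_append)
    then show ?thesis by (simp add: co_strip b)
  qed
  then have "(\<Sum>i\<le>length p. co a (u, take i p) * co (strip (w, q) b) (tgt u (take i p), drop i p)) = 0"
    by (rule sum.neutral[OF ballI])
  then show ?thesis using True a by (simp add: co_mult')
qed (use a in \<open>simp add: co_off\<close>)

text \<open>The relations to be expected have \<open>xs ! j\<close> in J^(k - d_j), where d_j is the
  order of the j-th generator, since these products vanish by length alone. Any other relation,
  divided on the right by a suitable path, yields a combination of larger order that can replace one
  generator.\<close>

lemma improve:
  assumes us: "set us \<subseteq> verts Q" and K: "submodule K R (PM us)" and vs: "set vs \<subseteq> verts Q"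
    and span: "spanning us K vs bs" and xs: "xs \<in> carrier (PM vs)" and z: "comb (PM us) bs xs = \<zero>\<^bsub>PM us\<^esub>"
    and j1: "j1 < length vs" "xs ! j1 \<notin> Jp (k - order_in (length us) (bs ! j1))"
  shows "\<exists>bs'. spanning us K vs bs' \<and>
    (\<Sum>j<length vs. order_in (length us) (bs ! j)) < (\<Sum>j<length vs. order_in (length us) (bs' ! j))"
proof -
  interpret P: right_module R "PM us" by (rule PM_right_module)
  interpret V: right_module R "PM vs" by (rule PM_right_module)
  let ?d = "\<lambda>j. order_in (length us) (bs ! j)"
  have ad: "adapted R (PM us) (evs vs) bs" and bK: "set bs \<subseteq> K" and surj: "comb (PM us) bs ` carrier (PM vs) = K"
    using span by (auto simp: spanning_def)
  have len: "length bs = length vs" using ad by (simp add: adapted_def)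
  have b: "bs ! j \<in> carrier (PM us)" if "j < length vs" for j using ad that by (simp add: adapted_def)
  have evb: "ev (vs ! j) \<odot>\<^bsub>PM us\<^esub> bs ! j = bs ! j" if "j < length vs" for j using ad that by (simp add: adapted_def)
  have x: "xs ! j \<in> carrier R" "ev (vs ! j) \<otimes> xs ! j = xs ! j" if "j < length vs" for j
    using xs that by (simp_all add: PM_carrier_iff)
  have bi: "bs ! j ! i \<in> carrier R" if "j < length vs" "i < length us" for j i
    using b[OF that(1)] that(2) by (simp add: PM_carrier_iff)
  have dk: "?d j \<le> k" and bJ: "i < length us \<Longrightarrow> bs ! j ! i \<in> Jp (?d j)" if "j < length vs" for i j
    using order_in[of "length us" "bs ! j"] bi that by blast+
  define T where "T = {(j, u, q). j < length vs \<and> co (xs ! j) (u, q) \<noteq> 0}"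
  \<comment> \<open>The least total degree d_j + length q at which a term of the relation lives. It
    is below \<open>k\<close> because of the offending entry \<open>j1\<close>, so paths of this
    length have not been truncated.\<close>
  define e where "e = (LEAST e. \<exists>(j, u, q) \<in> T. ?d j + length q = e)"
  obtain u1 q1 where q1: "length q1 < k - ?d j1" "co (xs ! j1) (u1, q1) \<noteq> 0"
    using j1 x(1)[OF j1(1)] by (auto simp: Jp_def)
  then have ex: "\<exists>(j, u, q) \<in> T. ?d j + length q = ?d j1 + length q1"
    using j1(1) by (auto simp: T_def intro!: bexI[of _ "(j1, u1, q1)"])
  have e_ex: "\<exists>(j, u, q) \<in> T. ?d j + length q = e"
    unfolding e_def by (rule LeastI[where P = "\<lambda>e. \<exists>(j, u, q) \<in> T. ?d j + length q = e", OF ex])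
  have "e \<le> ?d j1 + length q1"
    unfolding e_def by (rule Least_le[where P = "\<lambda>e. \<exists>(j, u, q) \<in> T. ?d j + length q = e", OF ex])
  then have ek: "e < k" using q1(1) by simp
  have e_le: "e \<le> ?d j + length q" if "j < length vs" "co (xs ! j) (u, q) \<noteq> 0" for j u q
    unfolding e_def using that
    by (intro Least_le) (auto simp: T_def intro!: bexI[of _ "(j, u, q)"])
  define S where "S = {j. j < length vs \<and> (\<exists>u q. co (xs ! j) (u, q) \<noteq> 0 \<and> ?d j + length q = e)}"
  have "S \<noteq> {}" "finite S" using e_ex by (auto simp: S_def T_def)
  \<comment> \<open>A largest d_j among the indices reaching degree e makes the corresponding path q
    shortest. Every entry with index in S then starts in degree at least length q, which is the
    condition for dividing by q.\<close>
  then have "\<exists>j0\<in>S. \<forall>j\<in>S. ?d j \<le> ?d j0" using Max_in[of "?d ` S"] Max_ge[of "?d ` S"] by fastforce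
  then obtain j0 where j0: "j0 \<in> S" and j0max: "\<And>j. j \<in> S \<Longrightarrow> ?d j \<le> ?d j0" by blast
  then obtain w q where q: "co (xs ! j0) (w, q) \<noteq> 0" "?d j0 + length q = e" and j0n: "j0 < length vs" by (auto simp: S_def)
  have w: "vs ! j0 \<in> verts Q" using vs j0n by auto
  then have wv: "w = vs ! j0" using q(1) x[OF j0n] ev_left_iff by blast
  have wq: "(w, q) \<in> paths" using q(1) x(1)[OF j0n] co_off by blast
  have xJ: "xs ! j \<in> Jp (e - ?d j)" if "j < length vs" for j
    using e_le[OF that] x(1)[OF that] by (fastforce simp: Jp_def)
  have xJS: "xs ! j \<in> Jp (length q)" if "j \<in> S" for j
  proof -
    have j: "j < length vs" using that by (simp add: S_def)
    have "length q \<le> e - ?d j" using j0max[OF that] q(2) by linarith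
    from subsetD[OF Jp_antimono[OF this] xJ[OF j]] show ?thesis .
  qed
  \<comment> \<open>Indices outside S contribute to the relation only in degrees greater than e, so
    dropping them is harmless in the degrees examined below.\<close>
  have off: "co (bs ! j ! i \<otimes> xs ! j) (u, p) = 0"
    if j: "j < length vs" "j \<notin> S" and i: "i < length us" and p: "length p \<le> e" for j i u p
  proof -
    have "xs ! j \<in> Jp (Suc e - ?d j)"
    proof -
      have "co (xs ! j) (u, r) = 0" if "length r < Suc e - ?d j" for u r
      proof (rule ccontr)
        assume c: "co (xs ! j) (u, r) \<noteq> 0"
        then have "?d j + length r \<noteq> e" using j by (auto simp: S_def)
        then show False using e_le[OF j(1) c] that by simp
      qed
      then show ?thesis using x(1)[OF j(1)] by (simp add: Jp_def)
    qed
    then have "bs ! j ! i \<otimes> xs ! j \<in> Jp (?d j + (Suc e - ?d j))" by (rule Jp_mult[OF bJ[OF j(1) i]])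
    then show ?thesis by (rule JpD) (use p in simp)
  qed
  \<comment> \<open>The relation divided on the right by q, restricted to S. At \<open>j0\<close>
    the path q itself turns into a trivial path with nonzero coefficient.\<close>
  define ys where "ys = map (\<lambda>j. if j \<in> S then strip (w, q) (xs ! j) else \<zero>) [0..<length vs]"
  have ys: "ys \<in> carrier (PM vs)"
    using x subsetD[OF vs nth_mem] by (auto simp: ys_def PM_carrier_iff strip_in_PM)
  have ysR: "j < length vs \<Longrightarrow> ys ! j \<in> carrier R" for j using ys by (simp add: PM_carrier_iff)
  define b' where "b' = comb (PM us) bs ys"
  have b'K: "b' \<in> K" using surj ys unfolding b'_def by blast
  have b'P: "b' \<in> carrier (PM us)" using b'K K by (auto simp: P.submodule_iff)
  \<comment> \<open>For length p at most d_j0 and p ending at w, the coefficient of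
    \<open>b'\<close> at p is that of the original relation at p q, of length at most e, and the
    relation is zero. For other ends of p the division leaves nothing.\<close>
  have "b' ! i \<in> Jp (Suc (?d j0))" if i: "i < length us" for i
  proof -
    have "co (b' ! i) (u, p) = 0" if p: "length p < Suc (?d j0)" for u p
    proof (cases "(u, p) \<in> paths \<and> tgt u p = w")
      case True
      then have up: "(u, p @ q) \<in> paths"
        using p q(2) ek wq by (auto simp: paths_iff Q.is_path_append)
      have "co (b' ! i) (u, p) = (\<Sum>j<length vs. co (bs ! j ! i \<otimes> ys ! j) (u, p))"
        unfolding b'_def by (rule co_comb_nth[OF us ad ys i])
      also have "\<dots> = (\<Sum>j<length vs. co (bs ! j ! i \<otimes> xs ! j) (u, p @ q))"
      proof (rule sum.cong)
        fix j assume "j \<in> {..<length vs}"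
        then have j: "j < length vs" by simp
        show "co (bs ! j ! i \<otimes> ys ! j) (u, p) = co (bs ! j ! i \<otimes> xs ! j) (u, p @ q)"
        proof (cases "j \<in> S")
          case jS: True
          then show ?thesis
            using co_mult_strip[OF bi[OF j i] xJS[OF jS] up] True j by (simp add: ys_def)
        next
          case False
          then show ?thesis
            using off[OF j False i, of "p @ q"] p q(2) j bi[OF j i] by (simp add: ys_def co_zero)
        qed
      qed simp
      also have "\<dots> = co (comb (PM us) bs xs ! i) (u, p @ q)"
        by (rule co_comb_nth[OF us ad xs i, symmetric])
      also have "\<dots> = 0" using i by (simp add: z PM_nth co_zero)
      finally show ?thesis .
    next
      case False
      show ?thesis
      proof (cases "(u, p) \<in> paths")
        case True
        then have "tgt u p \<noteq> w" using False by simp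
        then have "co (bs ! j ! i \<otimes> ys ! j) (u, p) = 0" if "j < length vs" for j
          using that bi[OF that i] x(1)[OF that] by (simp add: ys_def co_mult_strip_off co_zero)
        then show ?thesis unfolding b'_def by (simp add: co_comb_nth[OF us ad ys i])
      qed (use b'P i in \<open>simp add: co_off PM_carrier_iff\<close>)
    qed
    then show ?thesis using b'P i by (simp add: Jp_def PM_carrier_iff)
  qed
  moreover have "Suc (?d j0) \<le> k" using q(2) ek by simp
  moreover have b'i: "i < length us \<Longrightarrow> b' ! i \<in> carrier R" for i using b'P by (simp add: PM_carrier_iff)
  ultimately have ord: "?d j0 < order_in (length us) b'" using order_in(3)[of "length us" b' "Suc (?d j0)"] by simp
  \<comment> \<open>Division by q keeps only paths ending at w, the vertex of the generator
    \<open>bs ! j0\<close>. The replacement therefore fits into the same list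
    \<open>vs\<close>.\<close>
  have evb': "ev (vs ! j0) \<odot>\<^bsub>PM us\<^esub> b' = b'"
  proof -
    have "ev w \<odot>\<^bsub>PM vs\<^esub> ys = ys"
    proof (rule nth_equalityI)
      have l: "length ys = length vs" using ys by (simp add: PM_carrier_iff)
      then show l': "length (ev w \<odot>\<^bsub>PM vs\<^esub> ys) = length ys" by (simp add: idem_module_length)
      fix j assume "j < length (ev w \<odot>\<^bsub>PM vs\<^esub> ys)"
      then have j: "j < length vs" using l l' by simp
      then show "(ev w \<odot>\<^bsub>PM vs\<^esub> ys) ! j = ys ! j"
        using l x(1)[OF j] w wv by (simp add: PM_nth) (simp add: ys_def strip_ev)
    qed
    moreover have "comb (PM us) bs (ev w \<odot>\<^bsub>PM vs\<^esub> ys) = ev w \<odot>\<^bsub>PM us\<^esub> b'"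
      unfolding b'_def by (rule module_homD(3)[OF comb_hom[OF PM_right_module ad] ev_closed ys])
    ultimately show ?thesis by (simp add: b'_def wv)
  qed
  define bs' where "bs' = bs[j0 := b']"
  have ad': "adapted R (PM us) (evs vs) bs'"
    using ad b'P evb' by (auto simp: adapted_def bs'_def) (metis nth_list_update_eq nth_list_update_neq)+
  have b'sK: "set bs' \<subseteq> K" using bK b'K len by (auto simp: bs'_def dest!: subsetD[OF set_update_subset_insert])
  interpret c': rmodule_hom R "PM vs" "PM us" "comb (PM us) bs'"
    by (rule rmodule_homI[OF PM_right_module PM_right_module comb_hom[OF PM_right_module ad']])
  let ?KM = "(PM us)\<lparr>carrier := K\<rparr>"
  have KM: "right_module R ?KM" by (rule P.submodule_is_right_module[OF K])
  interpret KM: right_module R ?KM by (rule KM)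
  let ?N = "comb (PM us) bs' ` carrier (PM vs)"
  have NP: "submodule ?N R (PM us)" by (rule c'.image_submodule[OF V.carrier_submodule])
  have NK: "?N \<subseteq> K"
    using comb_in_submodule[OF PM_right_module K b'sK] len by (auto simp: PM_carrier_iff bs'_def)
  have N: "submodule ?N R ?KM" unfolding submodule_restrict[OF PM_right_module Jp_subset[of 0] K]
    by (rule conjI[OF NP NK])
  have inN: "bs' ! j \<in> ?N" if j: "j < length vs" for j
  proof -
    have "comb (PM us) bs' (unit_vec R (evs vs) j) = bs' ! j"
      by (rule comb_unit_vec[OF PM_right_module ad' _ evs_ok(1)]) (use j in simp)
    moreover have "unit_vec R (evs vs) j \<in> carrier (PM vs)"
      by (rule unit_vec_carrier[OF ring_axioms evs_ok(1) evs_ok(2)[OF vs]]) (use j in auto)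
    ultimately show ?thesis by force
  qed
  let ?L = "{x. \<exists>n\<in>?N. \<exists>r\<in>mod_prod ?KM (Jp 1). x = n \<oplus>\<^bsub>?KM\<^esub> r}"
  have L: "submodule ?L R ?KM" by (rule sum_submodule[OF KM Jp_subset[of 1] N rad_submodule[OF KM]])
  note LPK = L[unfolded submodule_restrict[OF PM_right_module Jp_subset[of 0] K]]
  note LP = conjunct1[OF LPK] and LK = conjunct2[OF LPK]
  \<comment> \<open>The combination \<open>b'\<close> and the other generators lie in
    \<open>?N\<close>, so does the \<open>ys ! j0\<close> multiple of \<open>bs ! j0\<close>. Its
    coefficient at the trivial path is that of \<open>xs ! j0\<close> at q, which is not zero, and
    exchange applies inside K.\<close>
  have "\<exists>n\<in>?N. \<exists>r\<in>mod_prod ?KM (Jp 1). bs ! j0 = n \<oplus>\<^bsub>?KM\<^esub> r"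
  proof (rule exchange[OF KM N _ w])
    show "bs ! j0 \<in> carrier ?KM" using bK j0n len by auto
    show "ev (vs ! j0) \<odot>\<^bsub>?KM\<^esub> bs ! j0 = bs ! j0" using evb[OF j0n] by simp
    show "ys ! j0 \<in> carrier R" by (rule ysR[OF j0n])
    show "ev (vs ! j0) \<otimes> ys ! j0 = ys ! j0" using ys j0n by (simp add: PM_carrier_iff)
    show "co (ys ! j0) (vs ! j0, []) \<noteq> 0"
      using j0 j0n q(1) x(1)[OF j0n] wv by (simp add: ys_def co_strip)
    have f: "(\<lambda>j. ys ! j \<odot>\<^bsub>PM us\<^esub> bs ! j) \<in> {..<length bs} \<rightarrow> carrier (PM us)"
      by (rule smult_nth_in[OF PM_right_module ad ys])
    let ?s = "\<Oplus>\<^bsub>PM us\<^esub>j\<in>{..<length bs} - {j0}. ys ! j \<odot>\<^bsub>PM us\<^esub> bs ! j"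
    have "b' = ys ! j0 \<odot>\<^bsub>PM us\<^esub> bs ! j0 \<oplus>\<^bsub>PM us\<^esub> ?s"
      unfolding b'_def comb_def using f j0n len
      by (subst P.M.finsum_insert[symmetric]) (auto simp: insert_absorb Pi_iff)
    moreover have s: "?s \<in> ?N"
    proof (rule P.submodule_finsum[OF NP])
      show "(\<lambda>j. ys ! j \<odot>\<^bsub>PM us\<^esub> bs ! j) \<in> {..<length bs} - {j0} \<rightarrow> ?N"
      proof
        fix j assume j: "j \<in> {..<length bs} - {j0}"
        then have "bs ! j \<in> ?N" using inN[of j] len by (simp add: bs'_def)
        then show "ys ! j \<odot>\<^bsub>PM us\<^esub> bs ! j \<in> ?N" using NP ysR[of j] j len unfolding P.submodule_iff by auto
      qed
    qed
    moreover have "ys ! j0 \<odot>\<^bsub>PM us\<^esub> bs ! j0 \<in> carrier (PM us)" "?s \<in> carrier (PM us)"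
      using P.rsmult_closed[OF ysR b] j0n s NP by (auto simp: P.submodule_iff)
    ultimately have "ys ! j0 \<odot>\<^bsub>PM us\<^esub> bs ! j0 = b' \<ominus>\<^bsub>PM us\<^esub> ?s"
      by (simp add: a_minus_def P.M.a_assoc P.M.r_neg)
    moreover have "b' \<in> ?N" using inN[OF j0n] j0n len by (simp add: bs'_def)
    ultimately have "ys ! j0 \<odot>\<^bsub>PM us\<^esub> bs ! j0 \<in> ?N" using P.submodule_diff[OF NP _ s] by simp
    then show "ys ! j0 \<odot>\<^bsub>?KM\<^esub> bs ! j0 \<in> ?N" by simp
  qed
  then have bL: "bs ! j0 \<in> ?L" by (rule CollectI)
  have "?N \<subseteq> ?L"
  proof
    fix n assume n: "n \<in> ?N"
    have "n \<in> carrier ?KM" using subsetD[OF NK n] by simp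
    from KM.M.r_zero[OF this, symmetric] have "n = n \<oplus>\<^bsub>?KM\<^esub> \<zero>\<^bsub>?KM\<^esub>" .
    with n show "n \<in> ?L" by (intro CollectI bexI[OF _ n] bexI[OF _ mod_prod.zero])
  qed
  have "set bs \<subseteq> ?L"
  proof
    fix b assume "b \<in> set bs"
    then obtain j where j: "j < length vs" "b = bs ! j" using len by (metis in_set_conv_nth)
    show "b \<in> ?L"
    proof (cases "j = j0")
      case False
      then show ?thesis using inN[OF j(1)] \<open>?N \<subseteq> ?L\<close> j by (auto simp: bs'_def)
    qed (use bL j in simp)
  qed
  have "K \<subseteq> ?L"
  proof
    fix y assume "y \<in> K"
    then have "y \<in> comb (PM us) bs ` carrier (PM vs)" by (simp only: surj)
    then obtain xs' where xs': "y = comb (PM us) bs xs'" "xs' \<in> carrier (PM vs)" by (rule imageE)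
    show "y \<in> ?L"
      unfolding xs'(1)
      by (rule comb_in_submodule[OF PM_right_module LP \<open>set bs \<subseteq> ?L\<close>]) (use xs' len in \<open>simp add: PM_carrier_iff\<close>)
  qed
  \<comment> \<open>The new family generates K modulo K J, hence K. The radical of K itself is used,
    not the intersection of K with the radical of the projective.\<close>
  have "?N = carrier ?KM"
  proof (rule nakayama[OF KM N])
    fix x assume "x \<in> carrier ?KM"
    then have "x \<in> ?L" using \<open>K \<subseteq> ?L\<close> by auto
    then show "\<exists>n\<in>?N. \<exists>r\<in>mod_prod ?KM (Jp 1). x = n \<oplus>\<^bsub>?KM\<^esub> r" by (rule CollectD)
  qed
  then have "spanning us K vs bs'" using ad' b'sK by (simp add: spanning_def)
  moreover have "(\<Sum>j<length vs. ?d j) < (\<Sum>j<length vs. order_in (length us) (bs' ! j))"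
    by (rule sum_strict_mono_ex1) (use ord j0n len in \<open>auto simp: bs'_def nth_list_update intro!: bexI[of _ j0]\<close>)
  ultimately show ?thesis by blast
qed

text \<open>Take a family of largest total order. No improvement is possible, so every relation is
  an expected one, and the relation module is a product of powers of the radical: K is a direct sum
  of modules e_vA/e_vJ^l.\<close>

lemma submodule_structure:
  assumes us: "set us \<subseteq> verts Q" and K: "submodule K R (PM us)"
  obtains vs bs ls where "set vs \<subseteq> verts Q" "adapted R (PM us) (evs vs) bs" "comb (PM us) bs ` carrier (PM vs) = K"
    "length ls = length vs" "\<And>xs. xs \<in> carrier (PM vs) \<Longrightarrow>
       comb (PM us) bs xs = \<zero>\<^bsub>PM us\<^esub> \<longleftrightarrow> (\<forall>j<length vs. xs ! j \<in> Jp (ls ! j))"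
    "\<And>j. j < length vs \<Longrightarrow> ls ! j \<le> k"
proof -
  interpret P: right_module R "PM us" by (rule PM_right_module)
  let ?KM = "(PM us)\<lparr>carrier := K\<rparr>"
  have Kc: "K \<subseteq> carrier (PM us)" using K by (simp add: P.submodule_iff)
  have KM: "right_module R ?KM" "fin_gen_module R ?KM" using PM_submodule_fin_gen[OF us K] by (auto simp: fg_modules_def)
  obtain B where B: "generates ?KM B" using fin_gen_generates[OF KM] by blast
  obtain vs bs where vs: "set vs \<subseteq> verts Q" and adK: "adapted R ?KM (evs vs) bs"
    and surj: "comb ?KM bs ` carrier (PM vs) = carrier ?KM"
    by (rule generates_list[OF KM(1) B])
  have bK: "set bs \<subseteq> K" using adK by (auto simp: adapted_def in_set_conv_nth)
  have "comb ?KM bs xs = comb (PM us) bs xs" if "xs \<in> carrier (PM vs)" for xs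
    by (rule comb_restrict[OF PM_right_module K bK]) (use that adK in \<open>simp add: PM_carrier_iff adapted_def\<close>)
  then have "comb (PM us) bs ` carrier (PM vs) = K" using surj by (simp cong: image_cong)
  then have sp: "spanning us K vs bs"
    using adK bK Kc by (auto simp: spanning_def adapted_def subset_iff)
  let ?m = "\<lambda>bs. \<Sum>j<length vs. order_in (length us) (bs ! j)"
  have bound: "?m bs \<le> length vs * k" if "spanning us K vs bs" for bs
  proof -
    have "order_in (length us) (bs ! j) \<le> k" if "j < length vs" for j
      using that \<open>spanning us K vs bs\<close> by (intro order_in) (simp add: spanning_def adapted_def PM_carrier_iff)
    then have "?m bs \<le> (\<Sum>j<length vs. k)" by (intro sum_mono) simp
    then show ?thesis by simp
  qed
  have "\<exists>bs. spanning us K vs bs \<and> (\<forall>bs'. spanning us K vs bs' \<longrightarrow> ?m bs' \<le> ?m bs)"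
    by (rule ex_has_greatest_nat[of "spanning us K vs" bs ?m "Suc (length vs * k)", OF sp])
      (intro allI impI le_imp_less_Suc bound)
  then obtain bs where best: "spanning us K vs bs \<and> (\<forall>bs'. spanning us K vs bs' \<longrightarrow> ?m bs' \<le> ?m bs)"
    by (rule exE)
  note sp = conjunct1[OF best] and max = conjunct2[OF best, rule_format]
  \<comment> \<open>A generator of order d lies in P J^d, so J^(k - d) kills it; the complement to
    \<open>k\<close> is therefore the exponent of its annihilator.\<close>
  let ?ls = "map (\<lambda>j. k - order_in (length us) (bs ! j)) [0..<length vs]"
  have ad: "adapted R (PM us) (evs vs) bs" using sp by (simp add: spanning_def)
  have "comb (PM us) bs xs = \<zero>\<^bsub>PM us\<^esub> \<longleftrightarrow> (\<forall>j<length vs. xs ! j \<in> Jp (?ls ! j))" if xs: "xs \<in> carrier (PM vs)" for xs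
  proof
    assume z: "comb (PM us) bs xs = \<zero>\<^bsub>PM us\<^esub>"
    show "\<forall>j<length vs. xs ! j \<in> Jp (?ls ! j)"
    proof (rule ccontr)
      assume "\<not> (\<forall>j<length vs. xs ! j \<in> Jp (?ls ! j))"
      then obtain j where "j < length vs" "xs ! j \<notin> Jp (k - order_in (length us) (bs ! j))" by auto
      then obtain bs' where "spanning us K vs bs'" "?m bs < ?m bs'"
        using improve[OF us K vs sp xs z] by blast
      then show False using max[of bs'] by simp
    qed
  next
    assume J: "\<forall>j<length vs. xs ! j \<in> Jp (?ls ! j)"
    have summand_zero: "xs ! j \<odot>\<^bsub>PM us\<^esub> bs ! j = \<zero>\<^bsub>PM us\<^esub>" if j: "j < length vs" for j
    proof (rule nth_equalityI)
      have b: "bs ! j \<in> carrier (PM us)" using ad j by (simp add: adapted_def)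
      then have bi: "i < length us \<Longrightarrow> bs ! j ! i \<in> carrier R" for i by (simp add: PM_carrier_iff)
      have l: "length (bs ! j) = length us" using b by (simp add: PM_carrier_iff)
      show l': "length (xs ! j \<odot>\<^bsub>PM us\<^esub> bs ! j) = length \<zero>\<^bsub>PM us\<^esub>"
        using l by (simp add: idem_module_length)
      fix i assume "i < length (xs ! j \<odot>\<^bsub>PM us\<^esub> bs ! j)"
      then have i: "i < length us" using l' by (simp add: idem_module_length)
      have "bs ! j ! i \<otimes> xs ! j \<in> Jp (order_in (length us) (bs ! j) + (k - order_in (length us) (bs ! j)))"
        using J j i order_in(2)[of "length us" "bs ! j"] bi by (intro Jp_mult) auto
      then have "bs ! j ! i \<otimes> xs ! j \<in> Jp k" using order_in(1)[of "length us" "bs ! j"] bi by simp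
      then show "(xs ! j \<odot>\<^bsub>PM us\<^esub> bs ! j) ! i = \<zero>\<^bsub>PM us\<^esub> ! i" using i l by (simp add: PM_nth Jp_k)
    qed
    have len: "length bs = length vs" using ad by (simp add: adapted_def)
    have "comb (PM us) bs xs = (\<Oplus>\<^bsub>PM us\<^esub>j\<in>{..<length bs}. \<zero>\<^bsub>PM us\<^esub>)"
      unfolding comb_def by (rule P.M.finsum_cong') (auto simp: summand_zero len)
    then show "comb (PM us) bs xs = \<zero>\<^bsub>PM us\<^esub>" by simp
  qed
  note iff = this
  have surj: "comb (PM us) bs ` carrier (PM vs) = K" using sp by (simp only: spanning_def)
  show thesis
    by (rule that[OF vs ad surj _ iff]) simp_all
qed

subsection \<open>Quotients of projective modules by right ideals\<close>

lemma PM_single: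
  "xs \<in> carrier (idem_module R [ev v]) \<longleftrightarrow> length xs = 1 \<and> xs ! 0 \<in> carrier R \<and> ev v \<otimes> xs ! 0 = xs ! 0"
  by (auto simp: idem_module_carrier_iff)

lemmas PM_carrier = PM_carrier_iff PM_single

definition right_ideal :: "'r set \<Rightarrow> bool" where
  "right_ideal I \<longleftrightarrow> I \<subseteq> carrier R \<and> \<zero> \<in> I \<and> (\<forall>a\<in>I. \<forall>b\<in>I. a \<oplus> b \<in> I) \<and> (\<forall>a\<in>I. \<forall>b\<in>carrier R. a \<otimes> b \<in> I)"

text \<open>Each ideal is taken in the whole ring and meets e_vA through the carrier condition. One
  set such as \<open>Jp l\<close> can thus be used at every vertex.\<close>

definition sub_ideals :: "'v list \<Rightarrow> 'r set list \<Rightarrow> 'r list set" where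
  "sub_ideals vs Is = {xs \<in> carrier (PM vs). \<forall>i<length vs. xs ! i \<in> Is ! i}"

definition quot_PM :: "'v list \<Rightarrow> 'r set list \<Rightarrow> ('r, 'r list) module" where
  "quot_PM vs Is = quotient_module (PM vs) (sub_ideals vs Is)"

definition ideals_ok :: "'v list \<Rightarrow> 'r set list \<Rightarrow> bool" where
  "ideals_ok vs Is \<longleftrightarrow> set vs \<subseteq> verts Q \<and> length Is = length vs \<and> (\<forall>I\<in>set Is. right_ideal I)"

lemma ideals_ok_nth: "\<lbrakk>ideals_ok vs Is; i < length vs\<rbrakk> \<Longrightarrow> right_ideal (Is ! i)"
  by (simp add: ideals_ok_def)

lemma sub_ideals_submodule:
  assumes "ideals_ok vs Is" shows "submodule (sub_ideals vs Is) R (PM vs)"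
proof -
  interpret P: right_module R "PM vs" by (rule PM_right_module)
  have I: "i < length vs \<Longrightarrow> right_ideal (Is ! i)" for i using assms by (rule ideals_ok_nth)
  have l: "xs \<in> carrier (PM vs) \<Longrightarrow> length xs = length vs" for xs by (simp add: PM_carrier)
  show ?thesis
    unfolding P.submodule_iff
  proof (intro conjI ballI)
    show "\<zero>\<^bsub>PM vs\<^esub> \<in> sub_ideals vs Is" using I by (simp add: sub_ideals_def PM_nth right_ideal_def)
    show "x \<oplus>\<^bsub>PM vs\<^esub> y \<in> sub_ideals vs Is" if "x \<in> sub_ideals vs Is" "y \<in> sub_ideals vs Is" for x y
      using that I l unfolding sub_ideals_def by (auto simp: PM_nth right_ideal_def)
    show "a \<odot>\<^bsub>PM vs\<^esub> x \<in> sub_ideals vs Is" if "a \<in> carrier R" "x \<in> sub_ideals vs Is" for a x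
      using that I l unfolding sub_ideals_def by (auto simp: PM_nth right_ideal_def P.rsmult_closed)
  qed (auto simp: sub_ideals_def)
qed

context
  fixes vs Is assumes ok: "ideals_ok vs Is"
begin

lemma quot_PM_right_module: "right_module R (quot_PM vs Is)"
  unfolding quot_PM_def by (rule quotient_right_module[OF PM_right_module sub_ideals_submodule[OF ok]])

lemma rep_hom: "quotient_rep (PM vs) (sub_ideals vs Is) \<in> module_hom R (PM vs) (quot_PM vs Is)"
  unfolding quot_PM_def by (rule quotient_rep_hom[OF PM_right_module sub_ideals_submodule[OF ok]])

lemma rep_surj: "quotient_rep (PM vs) (sub_ideals vs Is) ` carrier (PM vs) = carrier (quot_PM vs Is)"
  unfolding quot_PM_def by (rule quotient_rep_surj[OF PM_right_module sub_ideals_submodule[OF ok]])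

lemma rep_zero_iff:
  "xs \<in> carrier (PM vs) \<Longrightarrow>
     quotient_rep (PM vs) (sub_ideals vs Is) xs = \<zero>\<^bsub>quot_PM vs Is\<^esub> \<longleftrightarrow> (\<forall>i<length vs. xs ! i \<in> Is ! i)"
  unfolding quot_PM_def
  by (simp add: quotient_rep_zero_iff[OF PM_right_module sub_ideals_submodule[OF ok]]) (simp add: sub_ideals_def)

lemma quot_PM_fg: "quot_PM vs Is \<in> fg_modules R"
proof -
  have "set vs \<subseteq> verts Q" using ok by (simp add: ideals_ok_def)
  then have "fin_gen_module R (PM vs)" using PM_fg by (simp add: fg_modules_def)
  then show ?thesis
    using fin_gen_image[OF PM_right_module quot_PM_right_module rep_hom rep_surj] quot_PM_right_module
    by (simp add: fg_modules_def)
qed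

end

definition remove_nth :: "nat \<Rightarrow> 'x list \<Rightarrow> 'x list" where
  "remove_nth n xs = take n xs @ drop (Suc n) xs"

lemma length_remove_nth: "n < length xs \<Longrightarrow> length (remove_nth n xs) = length xs - 1"
  by (simp add: remove_nth_def)

lemma nth_remove_nth:
  "\<lbrakk>n < length xs; i < length xs - 1\<rbrakk> \<Longrightarrow> remove_nth n xs ! i = xs ! (if i < n then i else Suc i)"
  by (auto simp: remove_nth_def nth_append)

lemma all_remove_nth:
  assumes "n < N"
  shows "(\<forall>i<N. P i) \<longleftrightarrow> P n \<and> (\<forall>i<N - 1. P (if i < n then i else Suc i))"
proof
  assume r: "P n \<and> (\<forall>i<N - 1. P (if i < n then i else Suc i))"
  show "\<forall>i<N. P i"
  proof (intro allI impI)
    fix i assume i: "i < N"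
    consider "i < n" | "i = n" | "i > n" by linarith
    then show "P i"
    proof cases
      case 1
      then have "i < N - 1" using assms by simp
      then have "P (if i < n then i else Suc i)" using r by blast
      then show ?thesis using 1 by simp
    next
      case 3
      then have "i - 1 < N - 1" using i by simp
      then have "P (if i - 1 < n then i - 1 else Suc (i - 1))" using r by blast
      then show ?thesis using 3 by (simp split: if_splits)
    qed (use r in simp)
  qed
qed (use assms in auto)

lemma remove_nth_ok:
  assumes "ideals_ok vs Is" "n < length vs"
  shows "ideals_ok (remove_nth n vs) (remove_nth n Is)" "ideals_ok [vs ! n] [Is ! n]"
proof -
  show "ideals_ok (remove_nth n vs) (remove_nth n Is)"
    using assms set_take_subset[of n vs] set_drop_subset[of "Suc n" vs] set_take_subset[of n Is] set_drop_subset[of "Suc n" Is]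
    by (auto simp: ideals_ok_def length_remove_nth) (auto simp: remove_nth_def)
  show "ideals_ok [vs ! n] [Is ! n]"
    using assms by (auto simp: ideals_ok_def subset_iff)
qed

text \<open>Both sides are images of \<open>PM vs\<close> with the same coordinatewise kernel.
  Splitting at an arbitrary position gives the class of the quotient by induction and also exhibits
  each cyclic piece as a direct summand.\<close>

lemma quot_PM_split:
  assumes ok: "ideals_ok vs Is" and n: "n < length vs"
  shows "module_iso R (quot_PM vs Is) (module_sum (quot_PM [vs ! n] [Is ! n]) (quot_PM (remove_nth n vs) (remove_nth n Is)))"
proof -
  note ok1 = remove_nth_ok(2)[OF ok n] and ok2 = remove_nth_ok(1)[OF ok n]
  let ?A = "quot_PM [vs ! n] [Is ! n]" and ?B = "quot_PM (remove_nth n vs) (remove_nth n Is)"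
  let ?q1 = "quotient_rep (PM [vs ! n]) (sub_ideals [vs ! n] [Is ! n])"
  let ?q2 = "quotient_rep (PM (remove_nth n vs)) (sub_ideals (remove_nth n vs) (remove_nth n Is))"
  have lI: "length Is = length vs" using ok by (simp add: ideals_ok_def)
  note lr = length_remove_nth[OF n] 
  have xl: "length xs = length vs" "\<And>i. i < length vs \<Longrightarrow> xs ! i \<in> carrier R" if "xs \<in> carrier (PM vs)" for xs
    using that by (auto simp: PM_carrier)
  have a: "(\<lambda>xs. [xs ! n]) \<in> module_hom R (PM vs) (PM [vs ! n])"
  proof (rule module_homI)
    show "[(x \<oplus>\<^bsub>PM vs\<^esub> y) ! n] = [x ! n] \<oplus>\<^bsub>PM [vs ! n]\<^esub> [y ! n]" if "x \<in> carrier (PM vs)" "y \<in> carrier (PM vs)" for x y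
      using xl(1)[OF that(1)] xl(1)[OF that(2)] n by (simp add: PM_nth) (simp add: idem_module_def)
    show "[(a \<odot>\<^bsub>PM vs\<^esub> x) ! n] = a \<odot>\<^bsub>PM [vs ! n]\<^esub> [x ! n]" if "x \<in> carrier (PM vs)" for a x
      using xl(1)[OF that] n by (simp add: PM_nth) (simp add: idem_module_def)
  qed (use n in \<open>auto simp: PM_carrier\<close>)
  have b: "remove_nth n \<in> module_hom R (PM vs) (PM (remove_nth n vs))"
  proof (rule module_homI)
    show c: "remove_nth n x \<in> carrier (PM (remove_nth n vs))" if "x \<in> carrier (PM vs)" for x
      using that xl(1)[OF that] n lr by (auto simp: PM_carrier length_remove_nth nth_remove_nth)
    show "remove_nth n (x \<oplus>\<^bsub>PM vs\<^esub> y) = remove_nth n x \<oplus>\<^bsub>PM (remove_nth n vs)\<^esub> remove_nth n y"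
      if "x \<in> carrier (PM vs)" "y \<in> carrier (PM vs)" for x y
      using xl(1)[OF that(1)] xl(1)[OF that(2)] n lr
      by (intro nth_equalityI) (auto simp: length_remove_nth nth_remove_nth PM_nth idem_module_length)
    show "remove_nth n (a \<odot>\<^bsub>PM vs\<^esub> x) = a \<odot>\<^bsub>PM (remove_nth n vs)\<^esub> remove_nth n x"
      if "x \<in> carrier (PM vs)" for a x
      using xl(1)[OF that] n lr
      by (intro nth_equalityI) (auto simp: length_remove_nth nth_remove_nth PM_nth idem_module_length)
  qed
  let ?h = "\<lambda>xs. (?q1 [xs ! n], ?q2 (remove_nth n xs))"
  note q1 = module_hom_comp[OF a rep_hom[OF ok1]] and q2 = module_hom_comp[OF b rep_hom[OF ok2]]
  have h: "?h \<in> module_hom R (PM vs) (module_sum ?A ?B)"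
    using module_homD[OF q1] module_homD[OF q2] by (intro module_homI) auto
  have surj: "?h ` carrier (PM vs) = carrier (module_sum ?A ?B)"
  proof
    show "?h ` carrier (PM vs) \<subseteq> carrier (module_sum ?A ?B)" using module_homD(1)[OF h] by blast
    show "carrier (module_sum ?A ?B) \<subseteq> ?h ` carrier (PM vs)"
    proof
      fix z assume "z \<in> carrier (module_sum ?A ?B)"
      then obtain z1 z2 where z: "z = (z1, z2)" "z1 \<in> carrier ?A" "z2 \<in> carrier ?B" by auto
      have "z1 \<in> ?q1 ` carrier (PM [vs ! n])" "z2 \<in> ?q2 ` carrier (PM (remove_nth n vs))"
        using z by (simp_all only: rep_surj[OF ok1] rep_surj[OF ok2])
      then obtain y ys where y: "y \<in> carrier (PM [vs ! n])" "z1 = ?q1 y" and ys: "ys \<in> carrier (PM (remove_nth n vs))" "z2 = ?q2 ys"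
        by blast
      have ly: "length ys = length vs - 1" using ys(1) by (simp add: PM_carrier lr)
      have y1: "y = [y ! 0]" using y(1) by (auto simp: PM_carrier length_Suc_conv)
      let ?x = "take n ys @ y ! 0 # drop n ys"
      have xn: "?x ! n = y ! 0" using ly n by (simp add: nth_append)
      have xr: "remove_nth n ?x = ys" using ly n by (simp add: remove_nth_def)
      have lx: "length ?x = length vs" using ly n by simp
      have xc: "?x ! i \<in> carrier R \<and> ev (vs ! i) \<otimes> ?x ! i = ?x ! i" if "i < length vs" for i
      proof -
        have "(\<forall>i<length vs. ?x ! i \<in> carrier R \<and> ev (vs ! i) \<otimes> ?x ! i = ?x ! i)"
          unfolding all_remove_nth[OF n]
        proof (intro conjI allI impI)
          show "?x ! n \<in> carrier R" "ev (vs ! n) \<otimes> ?x ! n = ?x ! n" using y(1) by (simp_all only: xn) (simp_all add: PM_carrier)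
          fix i assume i: "i < length vs - 1"
          have e: "?x ! (if i < n then i else Suc i) = ys ! i"
            using nth_remove_nth[of n ?x i] i n lx by (simp only: xr)
          have v: "vs ! (if i < n then i else Suc i) = remove_nth n vs ! i"
            using nth_remove_nth[OF n i] by simp
          show "?x ! (if i < n then i else Suc i) \<in> carrier R"
            "ev (vs ! (if i < n then i else Suc i)) \<otimes> ?x ! (if i < n then i else Suc i) = ?x ! (if i < n then i else Suc i)"
            unfolding e v using ys(1) i lr by (simp_all add: PM_carrier)
        qed
        then show ?thesis using that by blast
      qed
      then have "?x \<in> carrier (PM vs)" using lx by (simp only: PM_carrier_iff) blast
      moreover have "z = ?h ?x" using z y(2) ys(2) y1 xn xr by simp
      ultimately show "z \<in> ?h ` carrier (PM vs)" by blast
    qed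
  qed
  show ?thesis
  proof (rule module_iso_of_same_kernel[OF PM_right_module quot_PM_right_module[OF ok] _ rep_hom[OF ok] rep_surj[OF ok] h surj])
    show "right_module R (module_sum ?A ?B)"
      by (rule module_sum_right_module[OF quot_PM_right_module[OF ok1] quot_PM_right_module[OF ok2]])
    fix xs assume xs: "xs \<in> carrier (PM vs)"
    have "quotient_rep (PM vs) (sub_ideals vs Is) xs = \<zero>\<^bsub>quot_PM vs Is\<^esub> \<longleftrightarrow> (\<forall>i<length vs. xs ! i \<in> Is ! i)"
      by (rule rep_zero_iff[OF ok xs])
    also have "\<dots> \<longleftrightarrow> xs ! n \<in> Is ! n \<and> (\<forall>i<length vs - 1. xs ! (if i < n then i else Suc i) \<in> Is ! (if i < n then i else Suc i))"
      by (rule all_remove_nth[OF n])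
    also have "\<dots> \<longleftrightarrow> ?h xs = \<zero>\<^bsub>module_sum ?A ?B\<^esub>"
      using rep_zero_iff[OF ok1 module_homD(1)[OF a xs]] rep_zero_iff[OF ok2 module_homD(1)[OF b xs]] xl(1)[OF xs] n lI lr
      by (simp add: nth_remove_nth)
    finally show "quotient_rep (PM vs) (sub_ideals vs Is) xs = \<zero>\<^bsub>quot_PM vs Is\<^esub> \<longleftrightarrow> ?h xs = \<zero>\<^bsub>module_sum ?A ?B\<^esub>" .
  qed
qed

lemma quot_PM_class:
  "ideals_ok vs Is \<Longrightarrow> frag_of (quot_PM vs Is) - (\<Sum>i<length vs. frag_of (quot_PM [vs ! i] [Is ! i])) \<in> H"
proof (induction vs arbitrary: Is)
  case Nil
  have "carrier (quot_PM [] Is) = {\<zero>\<^bsub>quot_PM [] Is\<^esub>}"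
    using rep_surj[OF Nil] rep_zero_iff[OF Nil, of "[]"] by (simp add: idem_module_def)
  then show ?case using H_zero_module[OF quot_PM_fg[OF Nil]] by simp
next
  case (Cons v vs)
  obtain I Is' where Is: "Is = I # Is'" using Cons.prems by (cases Is) (auto simp: ideals_ok_def)
  have r: "remove_nth 0 (v # vs) = vs" "remove_nth 0 (I # Is') = Is'" by (simp_all add: remove_nth_def)
  note ok = remove_nth_ok[OF Cons.prems, of 0]
  have "module_iso R (quot_PM (v # vs) Is) (module_sum (quot_PM [v] [I]) (quot_PM vs Is'))"
    using quot_PM_split[OF Cons.prems, of 0] by (simp add: Is r)
  then have "frag_of (quot_PM (v # vs) Is) - frag_of (quot_PM [v] [I]) - frag_of (quot_PM vs Is') \<in> H"
    using ok by (intro H_iso_sum quot_PM_fg Cons.prems) (simp_all add: Is r)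
  moreover have "frag_of (quot_PM vs Is') - (\<Sum>i<length vs. frag_of (quot_PM [vs ! i] [Is' ! i])) \<in> H"
    using ok by (intro Cons.IH) (simp add: Is r)
  ultimately have "(frag_of (quot_PM (v # vs) Is) - frag_of (quot_PM [v] [I]) - frag_of (quot_PM vs Is'))
      + (frag_of (quot_PM vs Is') - (\<Sum>i<length vs. frag_of (quot_PM [vs ! i] [Is' ! i]))) \<in> H"
    by (rule H_add)
  moreover have "(\<Sum>i<length (v # vs). frag_of (quot_PM [(v # vs) ! i] [Is ! i])) =
      frag_of (quot_PM [v] [I]) + (\<Sum>i<length vs. frag_of (quot_PM [vs ! i] [Is' ! i]))"
    by (simp add: Is sum.lessThan_Suc_shift del: sum.lessThan_Suc)
  ultimately show ?case by (simp only:) (simp add: algebra_simps)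
qed

text \<open>When the relations of a presentation are independent conditions on the separate
  coordinates, the module is a direct sum of cyclic ones. This is how the classes of all syzygies
  below are read off.\<close>

lemma presentation_class:
  assumes ok: "ideals_ok vs Is" and N: "N \<in> fg_modules R" and f: "f \<in> module_hom R (PM vs) N"
    and surj: "f ` carrier (PM vs) = carrier N"
    and ker: "\<And>xs. xs \<in> carrier (PM vs) \<Longrightarrow> f xs = \<zero>\<^bsub>N\<^esub> \<longleftrightarrow> (\<forall>i<length vs. xs ! i \<in> Is ! i)"
  shows "frag_of N - (\<Sum>i<length vs. frag_of (quot_PM [vs ! i] [Is ! i])) \<in> H"
proof -
  have "module_iso R N (quot_PM vs Is)"
    by (rule module_iso_of_same_kernel[OF PM_right_module fg_right_module[OF N] quot_PM_right_module[OF ok] f surj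
          rep_hom[OF ok] rep_surj[OF ok]]) (simp add: ker rep_zero_iff[OF ok])
  then have "frag_of N - frag_of (quot_PM vs Is) \<in> H" by (rule H_iso[OF N quot_PM_fg[OF ok]])
  from H_add[OF this quot_PM_class[OF ok]] show ?thesis by simp
qed

text \<open>The standard module e_vA/e_vJ^l. At the ends of the range it is trivial in
  \<open>K0\<close>: zero for \<open>l = 0\<close> and projective for \<open>l = k\<close>, so only
  1 <= l < k contributes.\<close>

definition St :: "'v \<Rightarrow> nat \<Rightarrow> ('r, 'r list) module" where
  "St v l = quot_PM [v] [Jp l]"

lemma Jp_right_ideal: "right_ideal (Jp l)"
  by (auto simp: right_ideal_def Jp_add Jp_mult_right dest: Jp_carrier)

lemma St_ok: "v \<in> verts Q \<Longrightarrow> ideals_ok [v] [Jp l]"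
  by (simp add: ideals_ok_def Jp_right_ideal)

lemma St_fg: "v \<in> verts Q \<Longrightarrow> St v l \<in> fg_modules R"
  unfolding St_def by (rule quot_PM_fg[OF St_ok])

lemma St_0: assumes "v \<in> verts Q" shows "frag_of (St v 0) \<in> H"
proof (rule H_zero_module[OF St_fg[OF assms]])
  have "quotient_rep (PM [v]) (sub_ideals [v] [Jp 0]) xs = \<zero>\<^bsub>St v 0\<^esub>" if "xs \<in> carrier (PM [v])" for xs
  proof -
    have "xs ! 0 \<in> Jp 0" using that by (simp add: Jp_0 PM_carrier)
    then show ?thesis using rep_zero_iff[OF St_ok[OF assms] that] by (simp add: St_def)
  qed
  moreover have "\<zero>\<^bsub>PM [v]\<^esub> \<in> carrier (PM [v])"
    using right_module.carrier_submodule[OF PM_right_module] right_module.submodule_iff[OF PM_right_module] by blast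
  ultimately have "quotient_rep (PM [v]) (sub_ideals [v] [Jp 0]) ` carrier (PM [v]) = {\<zero>\<^bsub>St v 0\<^esub>}"
    by (intro equalityI image_subsetI subsetI) (simp_all only: singleton_iff image_iff, metis)
  then show "carrier (St v 0) = {\<zero>\<^bsub>St v 0\<^esub>}"
    by (simp only: rep_surj[OF St_ok[OF assms]] St_def)
qed

lemma St_k: assumes v: "v \<in> verts Q" shows "frag_of (St v k) \<in> H"
proof (rule H_proj[OF St_fg[OF v]])
  have "module_iso R (PM [v]) (St v k)"
  proof (rule module_isoI)
    interpret q: rmodule_hom R "PM [v]" "St v k" "quotient_rep (PM [v]) (sub_ideals [v] [Jp k])"
      unfolding St_def by (rule rmodule_homI[OF PM_right_module quot_PM_right_module[OF St_ok[OF v]] rep_hom[OF St_ok[OF v]]])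
    show "quotient_rep (PM [v]) (sub_ideals [v] [Jp k]) \<in> module_hom R (PM [v]) (St v k)" by (rule q.hom)
    show "quotient_rep (PM [v]) (sub_ideals [v] [Jp k]) ` carrier (PM [v]) = carrier (St v k)"
      unfolding St_def by (rule rep_surj[OF St_ok[OF v]])
    have "xs = \<zero>\<^bsub>PM [v]\<^esub>" if "xs \<in> carrier (PM [v])" "xs ! 0 \<in> Jp k" for xs
      using that by (auto simp: Jp_k PM_carrier idem_module_def length_Suc_conv)
    then have "module_kernel (PM [v]) (St v k) (quotient_rep (PM [v]) (sub_ideals [v] [Jp k])) \<subseteq> {\<zero>\<^bsub>PM [v]\<^esub>}"
      using rep_zero_iff[OF St_ok[OF v]] by (auto simp: module_kernel_def St_def)
    then show "inj_on (quotient_rep (PM [v]) (sub_ideals [v] [Jp k])) (carrier (PM [v]))"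
      unfolding q.inj_on_iff_kernel
    proof (rule subset_antisym)
      have "\<zero>\<^bsub>PM [v]\<^esub> \<in> module_kernel (PM [v]) (St v k) (quotient_rep (PM [v]) (sub_ideals [v] [Jp k]))"
        unfolding q.kernel_iff by (rule conjI[OF q.M.M.zero_closed q.zero])
      then show "{\<zero>\<^bsub>PM [v]\<^esub>} \<subseteq> module_kernel (PM [v]) (St v k) (quotient_rep (PM [v]) (sub_ideals [v] [Jp k]))"
        by (simp only: empty_subsetI insert_subset simp_thms)
    qed
  qed
  moreover have "set [v] \<subseteq> verts Q" using v by simp
  ultimately show "projective_module R (St v k)"
    by (intro projective_iso[OF PM_projective _ PM_right_module])
qed

text \<open>The syzygy is the kernel of a minimal cover, hence a submodule of a projective, to which
  the structure theorem applies; the arbitrary choice made by \<open>syzygy\<close> changes nothing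
  in \<open>K0\<close>.\<close>

lemma syzygy_structure:
  assumes M: "M \<in> fg_modules R"
  obtains vs ls where "set vs \<subseteq> verts Q" "length ls = length vs" "\<And>j. j < length vs \<Longrightarrow> ls ! j \<le> k"
    "frag_of (syzygy R M) - (\<Sum>j<length vs. frag_of (St (vs ! j) (ls ! j))) \<in> H"
proof -
  have rM: "right_module R M" "fin_gen_module R M" using M by (auto simp: fg_modules_def)
  obtain us bs where c: "set us \<subseteq> verts Q" "adapted R M (evs us) bs" "comb M bs ` carrier (PM us) = carrier M"
    "module_kernel (PM us) M (comb M bs) \<subseteq> mod_prod (PM us) (Jp 1)"
    by (rule minimal_cover[OF rM])
  interpret p: rmodule_hom R "PM us" M "comb M bs" by (rule rmodule_homI[OF PM_right_module rM(1) comb_hom[OF rM(1) c(2)]])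
  let ?K = "module_kernel (PM us) M (comb M bs)"
  let ?KM = "(PM us)\<lparr>carrier := ?K\<rparr>"
  have s: "is_syzygy R M ?KM" by (rule cover_of_minimal[OF rM(1) c(1) p.hom c(3,4)])
  have fg: "?KM \<in> fg_modules R" by (rule PM_submodule_fin_gen[OF c(1) p.kernel_submodule])
  obtain vs bs' ls where t: "set vs \<subseteq> verts Q" "adapted R (PM us) (evs vs) bs'"
    "comb (PM us) bs' ` carrier (PM vs) = ?K" "length ls = length vs"
    "\<And>xs. xs \<in> carrier (PM vs) \<Longrightarrow> comb (PM us) bs' xs = \<zero>\<^bsub>PM us\<^esub> \<longleftrightarrow> (\<forall>j<length vs. xs ! j \<in> Jp (ls ! j))"
    "\<And>j. j < length vs \<Longrightarrow> ls ! j \<le> k"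
    by (rule submodule_structure[OF c(1) p.kernel_submodule]) blast
  note h = module_homD[OF comb_hom[OF PM_right_module t(2)]]
  have f: "comb (PM us) bs' \<in> module_hom R (PM vs) ?KM"
    using h t(3) by (intro module_homI) auto
  have ok: "ideals_ok vs (map Jp ls)" using t(1,4) by (auto simp: ideals_ok_def Jp_right_ideal)
  have "frag_of ?KM - (\<Sum>i<length vs. frag_of (quot_PM [vs ! i] [map Jp ls ! i])) \<in> H"
    by (rule presentation_class[OF ok fg f]) (use t in auto)
  then have "frag_of ?KM - (\<Sum>i<length vs. frag_of (St (vs ! i) (ls ! i))) \<in> H"
    using t(4) by (simp add: St_def)
  moreover have "frag_of ?KM - frag_of (syzygy R M) \<in> H"
    by (rule H_iso[OF fg syzygy_fg[OF M] syzygy_iso[OF M s rM(1) module_iso_refl]])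
  ultimately have "(frag_of ?KM - (\<Sum>i<length vs. frag_of (St (vs ! i) (ls ! i)))) - (frag_of ?KM - frag_of (syzygy R M)) \<in> H"
    by (rule H_diff)
  then have "frag_of (syzygy R M) - (\<Sum>i<length vs. frag_of (St (vs ! i) (ls ! i))) \<in> H" by simp
  note class_eq = this
  show thesis by (rule that[OF t(1,4) _ class_eq]) (rule t(6))
qed

text \<open>For a set \<open>S\<close> of paths of length \<open>l\<close> starting at \<open>v\<close>, the right ideal generated by \<open>S\<close>.\<close>

definition path_ideal :: "'v \<Rightarrow> nat \<Rightarrow> 'e list set \<Rightarrow> 'r set" where
  "path_ideal v l S = {a \<in> carrier R. \<forall>u r. \<not> (u = v \<and> l \<le> length r \<and> take l r \<in> S) \<longrightarrow> co a (u, r) = 0}"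

lemma path_ideal_right_ideal: "right_ideal (path_ideal v l S)"
  unfolding right_ideal_def
proof (intro conjI ballI)
  fix a b assume a: "a \<in> path_ideal v l S" and b: "b \<in> carrier R"
  then have aR: "a \<in> carrier R" by (simp add: path_ideal_def)
  have "co (a \<otimes> b) (u, r) = 0" if n: "\<not> (u = v \<and> l \<le> length r \<and> take l r \<in> S)" for u r
  proof (cases "(u, r) \<in> paths")
    case True
    have "co a (u, take i r) * co b (tgt u (take i r), drop i r) = 0" if "i \<in> {..length r}" for i
    proof -
      have "\<not> (u = v \<and> l \<le> length (take i r) \<and> take l (take i r) \<in> S)"
        using n that by (auto simp: min_def split: if_splits)
      then show ?thesis using a by (simp add: path_ideal_def)
    qed
    then have "(\<Sum>i\<le>length r. co a (u, take i r) * co b (tgt u (take i r), drop i r)) = 0"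
      by (rule sum.neutral[OF ballI])
    then show ?thesis using True aR b by (simp add: co_mult')
  qed (use aR b in \<open>simp add: co_off\<close>)
  then show "a \<otimes> b \<in> path_ideal v l S" using aR b by (simp add: path_ideal_def)
qed (auto simp: path_ideal_def co_zero co_add)

lemma path_ideal_Jp: "path_ideal v l S \<subseteq> Jp l"
  by (auto simp: path_ideal_def Jp_def)

text \<open>Inside e_vA, an element whose terms all have length at least l is exactly one whose
  terms all begin with some path of length l from v. The standard modules are thus instances of the
  path ideal construction.\<close>

lemma path_ideal_all:
  assumes "v \<in> verts Q" 
  shows "quot_PM [v] [path_ideal v l {p. (v, p) \<in> paths \<and> length p = l}] = St v l"
proof -
  have "x ! 0 \<in> path_ideal v l {p. (v, p) \<in> paths \<and> length p = l} \<longleftrightarrow> x ! 0 \<in> Jp l" if "x \<in> carrier (PM [v])" for x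
  proof
    assume J: "x ! 0 \<in> Jp l"
    have x: "x ! 0 \<in> carrier R" "\<And>u p. u \<noteq> v \<Longrightarrow> co (x ! 0) (u, p) = 0"
      using that assms by (auto simp: PM_carrier ev_left_iff)
    have "co (x ! 0) (u, r) = 0" if n: "\<not> (u = v \<and> l \<le> length r \<and> take l r \<in> {p. (v, p) \<in> paths \<and> length p = l})" for u r
    proof -
      consider "u \<noteq> v" | "length r < l" | "u = v" "l \<le> length r" "(v, take l r) \<notin> paths" using n by force
      then show ?thesis
      proof cases
        case 3
        then have "(u, r) \<notin> paths" using paths_take_drop(1) by blast
        then show ?thesis using x(1) by (rule co_off[rotated])
      qed (use x J JpD in auto)
    qed
    then show "x ! 0 \<in> path_ideal v l {p. (v, p) \<in> paths \<and> length p = l}" using x(1) by (simp add: path_ideal_def)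
  qed (use path_ideal_Jp in blast)
  then have "sub_ideals [v] [path_ideal v l {p. (v, p) \<in> paths \<and> length p = l}] = sub_ideals [v] [Jp l]"
    by (auto simp: sub_ideals_def)
  then show ?thesis by (simp add: St_def quot_PM_def)
qed

lemma path_ideal_ok: "v \<in> verts Q \<Longrightarrow> ideals_ok [v] [path_ideal v l S]"
  by (simp add: ideals_ok_def path_ideal_right_ideal)

text \<open>The kernel of e_vA onto the quotient is the direct sum of the right ideals pA with p in
  S. Left multiplication by p kills exactly J^(k - l) on the projective at the end of p, because p r
  has length at least k precisely when r has length at least k - l.\<close>

lemma syzygy_path_ideal:
  assumes v: "v \<in> verts Q" and l: "l > 0" and S: "\<And>p. p \<in> S \<Longrightarrow> (v, p) \<in> paths \<and> length p = l"
  shows "frag_of (syzygy R (quot_PM [v] [path_ideal v l S])) - (\<Sum>p\<in>S. frag_of (St (tgt v p) (k - l))) \<in> H"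
proof -
  interpret P: right_module R "PM [v]" by (rule PM_right_module)
  note ok = path_ideal_ok[OF v, of l S]
  have vv: "set [v] \<subseteq> verts Q" using v by simp
  let ?M = "quot_PM [v] [path_ideal v l S]" and ?K = "sub_ideals [v] [path_ideal v l S]"
  let ?KM = "(PM [v])\<lparr>carrier := ?K\<rparr>"
  note M = quot_PM_right_module[OF ok] and Mfg = quot_PM_fg[OF ok] and K = sub_ideals_submodule[OF ok]
  have ker: "module_kernel (PM [v]) ?M (quotient_rep (PM [v]) ?K) = ?K"
    unfolding quot_PM_def by (rule quotient_rep_kernel[OF PM_right_module K])
  have "?K \<subseteq> mod_prod (PM [v]) (Jp 1)"
  proof
    fix x assume x: "x \<in> ?K"
    then have "x ! 0 \<in> Jp 1" using path_ideal_Jp[of v l S] Jp_antimono[of 1 l] l by (auto simp: sub_ideals_def)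
    then show "x \<in> mod_prod (PM [v]) (Jp 1)" using x PM_rad_iff[OF vv] by (auto simp: sub_ideals_def)
  qed
  then have s: "is_syzygy R ?M ?KM"
    by (rule cover_of_minimal[OF M vv rep_hom[OF ok] rep_surj[OF ok], unfolded ker])
  have KMfg: "?KM \<in> fg_modules R" by (rule PM_submodule_fin_gen[OF vv K])
  have "finite S"
  proof (rule finite_subset)
    show "S \<subseteq> snd ` paths" using S by force
    show "finite (snd ` paths)" using finite_paths by simp
  qed
  then obtain ps where ps: "set ps = S" "distinct ps" using finite_distinct_list by blast
  let ?vs = "map (tgt v) ps" and ?bs = "map (\<lambda>p. [pe (v, p)]) ps"
  have pS: "(v, ps ! j) \<in> paths" "length (ps ! j) = l" if "j < length ps" for j
    using S[of "ps ! j"] ps(1) that by auto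
  have vs: "set ?vs \<subseteq> verts Q" using S ps(1) paths_verts(2) by auto
  have ad: "adapted R (PM [v]) (evs ?vs) ?bs"
  proof -
    have "[pe (v, p)] \<in> carrier (PM [v])" if "(v, p) \<in> paths" for p
      using pe_ev(1)[OF that] by (simp add: PM_carrier)
    moreover have "ev (tgt v p) \<odot>\<^bsub>PM [v]\<^esub> [pe (v, p)] = [pe (v, p)]" if "(v, p) \<in> paths" for p
      using pe_ev(2)[OF that] by (simp add: idem_module_def)
    ultimately show ?thesis using pS by (simp add: adapted_def)
  qed
  let ?f = "comb (PM [v]) ?bs"
  note h = module_homD[OF comb_hom[OF PM_right_module ad]]
  have cf: "co (?f xs ! 0) z = (\<Sum>j<length ps. co (pe (v, ps ! j) \<otimes> xs ! j) z)" if "xs \<in> carrier (PM ?vs)" for xs z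
    using co_comb_nth[OF vv ad that, of 0 z] by simp
  have xR: "xs ! j \<in> carrier R" "\<And>u p. u \<noteq> tgt v (ps ! j) \<Longrightarrow> co (xs ! j) (u, p) = 0"
    if xs: "xs \<in> carrier (PM ?vs)" and j: "j < length ps" for xs j
  proof -
    have "\<forall>i<length ?vs. xs ! i \<in> carrier R \<and> ev (?vs ! i) \<otimes> xs ! i = xs ! i"
      using xs unfolding PM_carrier_iff by (rule conjunct2)
    then have x: "xs ! j \<in> carrier R" "ev (tgt v (ps ! j)) \<otimes> xs ! j = xs ! j" using j by simp_all
    have "tgt v (ps ! j) \<in> verts Q" using vs j by auto
    then show "xs ! j \<in> carrier R" "\<And>u p. u \<noteq> tgt v (ps ! j) \<Longrightarrow> co (xs ! j) (u, p) = 0"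
      using x ev_left_iff by blast+
  qed
  \<comment> \<open>Distinct paths of the same length l cannot both be prefixes of one path, so only
    the j-th summand contributes; this is the directness of the sum.\<close>
  have A: "co (?f xs ! 0) (v, ps ! j @ r) = co (xs ! j) (tgt v (ps ! j), r)"
    if xs: "xs \<in> carrier (PM ?vs)" and j: "j < length ps" and path: "(v, ps ! j @ r) \<in> paths" for xs j r
  proof -
    have "(\<Sum>j<length ps. co (pe (v, ps ! j) \<otimes> xs ! j) (v, ps ! j @ r)) =
        (\<Sum>j<length ps. co (pe (v, ps ! j) \<otimes> xs ! j) (v, ps ! j @ r))" ..
    have "(\<Sum>i<length ps. co (pe (v, ps ! i) \<otimes> xs ! i) (v, ps ! j @ r)) = co (pe (v, ps ! j) \<otimes> xs ! j) (v, ps ! j @ r)"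
    proof (rule sum_single)
      fix i assume i: "i \<in> {..<length ps}" "i \<noteq> j"
      then have "ps ! i \<noteq> ps ! j" using ps(2) j by (simp add: nth_eq_iff_index_eq)
      then have "\<not> (\<exists>r'. ps ! j @ r = ps ! i @ r')" using pS(2)[of i] pS(2)[OF j] i by auto
      then show "co (pe (v, ps ! i) \<otimes> xs ! i) (v, ps ! j @ r) = 0"
        using i pS(1)[of i] xR(1)[OF xs, of i] by (simp add: co_pe_mult)
    qed (use j in auto)
    then show ?thesis
      using cf[OF xs] co_pe_mult[OF xR(1)[OF xs j] pS(1)[OF j], of v "ps ! j @ r"] path by simp
  qed
  have B: "co (?f xs ! 0) (u, r) = 0"
    if xs: "xs \<in> carrier (PM ?vs)" and n: "\<not> (u = v \<and> l \<le> length r \<and> take l r \<in> S)" for xs u r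
  proof -
    have "co (pe (v, ps ! j) \<otimes> xs ! j) (u, r) = 0" if j: "j < length ps" for j
    proof -
      have "\<not> (u = v \<and> (\<exists>r'. r = ps ! j @ r'))"
        using n pS(2)[OF j] ps(1) j by auto
      then show ?thesis using co_pe_mult[OF xR(1)[OF xs j] pS(1)[OF j], of u r] by auto
    qed
    then show ?thesis using cf[OF xs] by simp
  qed
  have fc: "?f xs \<in> carrier (PM [v])" "?f xs ! 0 \<in> carrier R" if "xs \<in> carrier (PM ?vs)" for xs
    using h(1)[OF that] by (auto simp: PM_carrier)
  have inK: "?f xs \<in> ?K" if "xs \<in> carrier (PM ?vs)" for xs
    using fc[OF that] B[OF that] by (auto simp: sub_ideals_def path_ideal_def)
  have zero_iff: "?f xs = \<zero>\<^bsub>PM [v]\<^esub> \<longleftrightarrow> ?f xs ! 0 = \<zero>" if "xs \<in> carrier (PM ?vs)" for xs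
    using fc[OF that] by (auto simp: PM_carrier idem_module_def length_Suc_conv)
  have kerf: "?f xs = \<zero>\<^bsub>PM [v]\<^esub> \<longleftrightarrow> (\<forall>j<length ?vs. xs ! j \<in> map (\<lambda>p. Jp (k - l)) ps ! j)"
    if xs: "xs \<in> carrier (PM ?vs)" for xs
  proof
    assume "?f xs = \<zero>\<^bsub>PM [v]\<^esub>"
    then have z: "co (?f xs ! 0) y = 0" for y using zero_iff[OF xs] by (simp add: co_zero)
    have "co (xs ! j) (u, r) = 0" if j: "j < length ps" and r: "length r < k - l" for j u r
    proof (cases "u = tgt v (ps ! j) \<and> (u, r) \<in> paths")
      case True
      then have "(v, ps ! j @ r) \<in> paths" using pS[OF j] r by (auto simp: paths_iff Q.is_path_append)
      from A[OF xs j this] show ?thesis using z True by simp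
    qed (use xR[OF xs j] co_off in blast)
    then show "\<forall>j<length ?vs. xs ! j \<in> map (\<lambda>p. Jp (k - l)) ps ! j" using xR(1)[OF xs] by (simp add: Jp_def)
  next
    assume J: "\<forall>j<length ?vs. xs ! j \<in> map (\<lambda>p. Jp (k - l)) ps ! j"
    have "?f xs ! 0 = \<zero>"
    proof (rule co_eqI[OF fc(2)[OF xs] zero_closed])
      fix u r assume path: "(u, r) \<in> paths"
      show "co (?f xs ! 0) (u, r) = co \<zero> (u, r)"
      proof (cases "u = v \<and> l \<le> length r \<and> take l r \<in> S")
        case True
        then obtain j where j: "j < length ps" "ps ! j = take l r" using ps(1) by (metis in_set_conv_nth)
        then have r: "r = ps ! j @ drop l r" by simp
        have short: "length (drop l r) < k - l" using path True by (auto simp: paths_iff)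
        have "xs ! j \<in> Jp (k - l)" using J j(1) by simp
        from JpD[OF this short] have "co (xs ! j) (tgt v (ps ! j), drop l r) = 0" .
        then show ?thesis using A[OF xs j(1), of "drop l r"] path True r by (simp add: co_zero)
      qed (use B[OF xs] in \<open>simp add: co_zero\<close>)
    qed
    then show "?f xs = \<zero>\<^bsub>PM [v]\<^esub>" using zero_iff[OF xs] by simp
  qed
  have surj: "?f ` carrier (PM ?vs) = ?K"
  proof
    show "?f ` carrier (PM ?vs) \<subseteq> ?K" using inK by blast
    show "?K \<subseteq> ?f ` carrier (PM ?vs)"
    proof
      fix x assume x: "x \<in> ?K"
      then have x0: "x ! 0 \<in> carrier R" "x ! 0 \<in> path_ideal v l S" "length x = 1" by (auto simp: sub_ideals_def PM_carrier)
      \<comment> \<open>Left division: the j-th coordinate collects the terms of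
        \<open>x ! 0\<close> that begin with the j-th path and removes that prefix.\<close>
      let ?xs = "map (\<lambda>p. el (\<lambda>(u, r). if u = tgt v p then co (x ! 0) (v, p @ r) else 0)) ps"
      have xs: "?xs \<in> carrier (PM ?vs)"
      proof -
        have "ev (tgt v p) \<otimes> el (\<lambda>(u, r). if u = tgt v p then co (x ! 0) (v, p @ r) else 0) =
          el (\<lambda>(u, r). if u = tgt v p then co (x ! 0) (v, p @ r) else 0)" if "p \<in> S" for p
          using that S[of p] paths_verts(2) by (subst ev_left_iff) (auto simp: el)
        then show ?thesis unfolding PM_carrier_iff using ps(1) by (auto simp: el)
      qed
      have "?f ?xs ! 0 = x ! 0"
      proof (rule co_eqI[OF fc(2)[OF xs] x0(1)])
        fix u r assume path: "(u, r) \<in> paths"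
        show "co (?f ?xs ! 0) (u, r) = co (x ! 0) (u, r)"
        proof (cases "u = v \<and> l \<le> length r \<and> take l r \<in> S")
          case True
          then obtain j where j: "j < length ps" "ps ! j = take l r" using ps(1) by (metis in_set_conv_nth)
          then have r: "r = ps ! j @ drop l r" by simp
          then have p': "(v, ps ! j @ drop l r) \<in> paths" using path True by simp
          have "co (?f ?xs ! 0) (v, ps ! j @ drop l r) = co (?xs ! j) (tgt v (ps ! j), drop l r)"
            by (rule A[OF xs j(1) p'])
          also have "\<dots> = co (x ! 0) (v, ps ! j @ drop l r)"
            using j(1) paths_append_right[OF p'] by (simp add: el)
          finally show ?thesis using True r by simp
        next
          case False
          then show ?thesis using B[OF xs False] x0(2) by (simp add: path_ideal_def)
        qed
      qed
      moreover have "length (?f ?xs) = 1" using fc(1)[OF xs] by (simp add: PM_carrier)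
      ultimately have "?f ?xs = x" using x0(3) by (intro nth_equalityI) auto
      from rev_image_eqI[where f = ?f, OF xs this[symmetric]] show "x \<in> ?f ` carrier (PM ?vs)" .
    qed
  qed
  have okv: "ideals_ok ?vs (map (\<lambda>p. Jp (k - l)) ps)" using vs by (auto simp: ideals_ok_def Jp_right_ideal)
  have hom: "?f \<in> module_hom R (PM ?vs) ?KM" using h inK by (intro module_homI) auto
  have "frag_of ?KM - (\<Sum>i<length ?vs. frag_of (quot_PM [?vs ! i] [map (\<lambda>p. Jp (k - l)) ps ! i])) \<in> H"
    by (rule presentation_class[OF okv KMfg hom]) (use surj kerf in auto)
  moreover have "(\<Sum>i<length ?vs. frag_of (quot_PM [?vs ! i] [map (\<lambda>p. Jp (k - l)) ps ! i])) = (\<Sum>p\<in>S. frag_of (St (tgt v p) (k - l)))"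
  proof -
    have "(\<Sum>i<length ?vs. frag_of (quot_PM [?vs ! i] [map (\<lambda>p. Jp (k - l)) ps ! i]))
        = (\<Sum>i<length ps. frag_of (St (tgt v (ps ! i)) (k - l)))" by (simp add: St_def)
    also have "\<dots> = (\<Sum>p\<in>S. frag_of (St (tgt v p) (k - l)))"
      by (rule sum.reindex_bij_betw[OF bij_betw_nth[OF ps(2) refl ps(1)[symmetric]]])
    finally show ?thesis .
  qed
  ultimately have 1: "frag_of ?KM - (\<Sum>p\<in>S. frag_of (St (tgt v p) (k - l))) \<in> H" by simp
  have 2: "frag_of ?KM - frag_of (syzygy R ?M) \<in> H"
    by (rule H_iso[OF KMfg syzygy_fg[OF Mfg] syzygy_iso[OF Mfg s M module_iso_refl]])
  from H_diff[OF 1 2] show ?thesis by simp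
qed

section \<open>Indecomposable cyclic modules as summands\<close>

text \<open>The module has a simple top: it is generated by one element at v. In a decomposition
  with generator (x, y), one of the two components must already be radical, and Nakayama's lemma
  kills that summand.\<close>

lemma quot_PM_indecomposable:
  assumes v: "v \<in> verts Q" and I: "right_ideal I" "I \<subseteq> Jp 1"
  shows "indecomposable_module R (quot_PM [v] [I])"
  unfolding indecomposable_module_def
proof (intro conjI allI impI)
  have ok: "ideals_ok [v] [I]" using v I by (simp add: ideals_ok_def)
  let ?M = "quot_PM [v] [I]" and ?q = "quotient_rep (PM [v]) (sub_ideals [v] [I])"
  interpret q: rmodule_hom R "PM [v]" ?M ?q by (rule rmodule_homI[OF PM_right_module quot_PM_right_module[OF ok] rep_hom[OF ok]])
  have e: "[ev v] \<in> carrier (PM [v])" using v by (simp add: PM_carrier ev_idem)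
  have "ev v \<notin> I" using I(2) JpD[of "ev v" 1 "[]" v] v by (auto simp: co_ev)
  then have "?q [ev v] \<noteq> \<zero>\<^bsub>?M\<^esub>" using rep_zero_iff[OF ok e] by simp
  then show "carrier ?M \<noteq> {\<zero>\<^bsub>?M\<^esub>}" using q.closed[OF e] by blast
  fix X Y :: "('r, 'r list) module"
  assume a: "right_module R X \<and> right_module R Y \<and> module_iso R ?M (module_sum X Y)"
  then interpret X: right_module R X by simp
  interpret Y: right_module R Y using a by simp
  obtain f where f: "f \<in> module_hom R ?M (module_sum X Y)" "f ` carrier ?M = carrier (module_sum X Y)"
    using a by (auto simp: module_iso_def bij_betw_def)
  note S = module_sum_right_module[OF X.right_module_axioms Y.right_module_axioms]
  interpret f: rmodule_hom R ?M "module_sum X Y" f by (rule rmodule_homI[OF quot_PM_right_module[OF ok] S f(1)])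
  obtain x y where xy: "f (?q [ev v]) = (x, y)" "x \<in> carrier X" "y \<in> carrier Y"
    using f.closed[OF q.closed[OF e]] by auto
  have gen: "\<exists>a. a \<in> carrier R \<and> ev v \<otimes> a = a \<and> z = (a \<odot>\<^bsub>X\<^esub> x, a \<odot>\<^bsub>Y\<^esub> y)" if z: "z \<in> carrier (module_sum X Y)" for z
  proof -
    have "z \<in> f ` ?q ` carrier (PM [v])" using z by (simp only: rep_surj[OF ok] f(2))
    then obtain b where b: "b \<in> carrier (PM [v])" "z = f (?q b)" by blast
    then obtain a where ba: "b = [a]" "a \<in> carrier R" "ev v \<otimes> a = a" by (auto simp: PM_carrier length_Suc_conv)
    have "b = a \<odot>\<^bsub>PM [v]\<^esub> [ev v]" using ba by (simp add: idem_module_def)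
    then have "z = a \<odot>\<^bsub>module_sum X Y\<^esub> (x, y)"
      by (simp only: b(2) q.smult[OF ba(2) e] f.smult[OF ba(2) q.closed[OF e]] xy(1))
    then show ?thesis using ba by auto
  qed
  have ev: "ev v \<odot>\<^bsub>X\<^esub> x = x" "ev v \<odot>\<^bsub>Y\<^esub> y = y"
  proof -
    have "ev v \<odot>\<^bsub>PM [v]\<^esub> [ev v] = [ev v]" using v by (simp add: idem_module_def ev_idem)
    then have "ev v \<odot>\<^bsub>module_sum X Y\<^esub> (x, y) = (x, y)"
      using q.smult[OF ev_closed e, of v] f.smult[OF ev_closed q.closed[OF e], of v] by (simp only: xy(1))
    then show "ev v \<odot>\<^bsub>X\<^esub> x = x" "ev v \<odot>\<^bsub>Y\<^esub> y = y" by auto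
  qed
  \<comment> \<open>The element a reaches (x, 0) from the generator, so x a = x and y a = 0. If a
    has a nonzero coefficient at the trivial path, exchange makes y radical; otherwise a is radical
    and so is x = x a.\<close>
  obtain a where aa: "a \<in> carrier R" "ev v \<otimes> a = a" "x = a \<odot>\<^bsub>X\<^esub> x" "a \<odot>\<^bsub>Y\<^esub> y = \<zero>\<^bsub>Y\<^esub>"
    using gen[of "(x, \<zero>\<^bsub>Y\<^esub>)"] xy by auto
  show "carrier X = {\<zero>\<^bsub>X\<^esub>} \<or> carrier Y = {\<zero>\<^bsub>Y\<^esub>}"
  proof (cases "co a (v, []) = 0")
    case False
    have "\<exists>n\<in>{\<zero>\<^bsub>Y\<^esub>}. \<exists>r\<in>mod_prod Y (Jp 1). y = n \<oplus>\<^bsub>Y\<^esub> r"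
      by (rule exchange[OF Y.right_module_axioms Y.zero_submodule xy(3) v ev(2) aa(1,2) False]) (simp add: aa(4))
    then have yr: "y \<in> mod_prod Y (Jp 1)" using mod_prod_carrier[OF Y.right_module_axioms Jp_subset] by auto
    have "{\<zero>\<^bsub>Y\<^esub>} = carrier Y"
    proof (rule nakayama[OF Y.right_module_axioms Y.zero_submodule])
      fix y' assume y': "y' \<in> carrier Y"
      then obtain b where "b \<in> carrier R" "y' = b \<odot>\<^bsub>Y\<^esub> y" using gen[of "(\<zero>\<^bsub>X\<^esub>, y')"] by auto
      then have "y' \<in> mod_prod Y (Jp 1)"
        using yr rad_submodule[OF Y.right_module_axioms, of 1] by (simp add: Y.submodule_iff)
      then show "\<exists>n\<in>{\<zero>\<^bsub>Y\<^esub>}. \<exists>r\<in>mod_prod Y (Jp 1). y' = n \<oplus>\<^bsub>Y\<^esub> r" using y' by (intro bexI[of _ "\<zero>\<^bsub>Y\<^esub>"] bexI[of _ y']) auto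
    qed
    then show ?thesis by simp
  next
    case True
    have "co a (u, []) = 0" for u using True aa(1,2) v ev_left_iff by metis
    then have "a \<in> Jp 1" using aa(1) by (auto simp: Jp_def)
    then have xr: "x \<in> mod_prod X (Jp 1)"
      using mod_prod_incl[OF X.right_module_axioms Jp_subset xy(2)] aa(3) by metis
    have "{\<zero>\<^bsub>X\<^esub>} = carrier X"
    proof (rule nakayama[OF X.right_module_axioms X.zero_submodule])
      fix x' assume x': "x' \<in> carrier X"
      then obtain b where "b \<in> carrier R" "x' = b \<odot>\<^bsub>X\<^esub> x" using gen[of "(x', \<zero>\<^bsub>Y\<^esub>)"] by auto
      then have "x' \<in> mod_prod X (Jp 1)"
        using xr rad_submodule[OF X.right_module_axioms, of 1] by (simp add: X.submodule_iff)
      then show "\<exists>n\<in>{\<zero>\<^bsub>X\<^esub>}. \<exists>r\<in>mod_prod X (Jp 1). x' = n \<oplus>\<^bsub>X\<^esub> r" using x' by (intro bexI[of _ "\<zero>\<^bsub>X\<^esub>"] bexI[of _ x']) auto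
    qed
    then show ?thesis by simp
  qed
qed

lemma quot_PM_summands:
  assumes ok: "ideals_ok vs Is" and J: "\<And>I. I \<in> set Is \<Longrightarrow> I \<subseteq> Jp 1" and n: "n < length vs"
  shows "quot_PM [vs ! n] [Is ! n] \<in> summands (quot_PM vs Is)"
proof -
  note okn = remove_nth_ok[OF ok n]
  have "Is ! n \<in> set Is" using ok n by (simp add: ideals_ok_def)
  then have "indecomposable_module R (quot_PM [vs ! n] [Is ! n])"
    using ok J n by (intro quot_PM_indecomposable ideals_ok_nth[OF ok n]) (auto simp: ideals_ok_def)
  then show ?thesis
    unfolding summands_def using quot_PM_fg[OF okn(1)] quot_PM_fg[OF okn(2)] quot_PM_split[OF ok n] by blast
qed

end

subsection \<open>Relative ranks\<close>

text \<open>More unknowns than equations force a nontrivial solution. The elimination is free of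
  division so that it serves for integers as well as for fields.\<close>

lemma nontrivial_relation:
  fixes f :: "'i \<Rightarrow> 'j \<Rightarrow> 'a::idom"
  assumes "finite I" "finite J" "card I < card J"
  shows "\<exists>a. (\<exists>j\<in>J. a j \<noteq> 0) \<and> (\<forall>i\<in>I. (\<Sum>j\<in>J. a j * f i j) = 0)"
  using assms
proof (induction I arbitrary: J f)
  case empty
  then have "J \<noteq> {}" by auto
  then show ?case by (intro exI[of _ "\<lambda>_. 1"]) auto
next
  case (insert i I)
  show ?case
  proof (cases "\<forall>j\<in>J. f i j = 0")
    case True
    have "card I < card J" using insert by simp
    from insert.IH[OF insert.prems(1) this, of f] obtain a where
      a: "\<exists>j\<in>J. a j \<noteq> 0" "\<forall>i\<in>I. (\<Sum>j\<in>J. a j * f i j) = 0" by blast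
    then show ?thesis using True by (intro exI[of _ a]) auto
  next
    case False
    then obtain j0 where j0: "j0 \<in> J" "f i j0 \<noteq> 0" by blast
    let ?J = "J - {j0}"
    have c: "finite ?J" "card I < card ?J" using insert j0 by auto
    \<comment> \<open>Cross multiplication with the pivot \<open>f i j0\<close> eliminates the
      unknown \<open>j0\<close> from the remaining equations.\<close>
    from insert.IH[OF c, of "\<lambda>i' j. f i j0 * f i' j - f i j * f i' j0"] obtain a where
      a: "\<exists>j\<in>?J. a j \<noteq> 0" "\<And>i'. i' \<in> I \<Longrightarrow> (\<Sum>j\<in>?J. a j * (f i j0 * f i' j - f i j * f i' j0)) = 0" by blast
    \<comment> \<open>The value at \<open>j0\<close> is forced by equation i once the other unknowns
      have been scaled by the pivot.\<close>
    let ?b = "\<lambda>j. if j = j0 then - (\<Sum>j\<in>?J. a j * f i j) else f i j0 * a j"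
    have sum: "(\<Sum>j\<in>J. ?b j * f i' j) = f i j0 * (\<Sum>j\<in>?J. a j * f i' j) - (\<Sum>j\<in>?J. a j * f i j) * f i' j0" for i'
    proof -
      have "(\<Sum>j\<in>J. ?b j * f i' j) = ?b j0 * f i' j0 + (\<Sum>j\<in>?J. ?b j * f i' j)"
        by (rule sum.remove[OF insert.prems(1) j0(1)])
      also have "(\<Sum>j\<in>?J. ?b j * f i' j) = (\<Sum>j\<in>?J. f i j0 * (a j * f i' j))"
        by (rule sum.cong) auto
      finally show ?thesis by (simp add: sum_distrib_left)
    qed
    have "(\<Sum>j\<in>J. ?b j * f i' j) = 0" if "i' \<in> insert i I" for i'
    proof (cases "i' = i")
      case True
      then show ?thesis using sum[of i] by (simp add: mult.commute)
    next
      case False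
      then have "i' \<in> I" using that by simp
      from a(2)[OF this] have "f i j0 * (\<Sum>j\<in>?J. a j * f i' j) - (\<Sum>j\<in>?J. a j * f i j) * f i' j0 = 0"
        by (simp add: right_diff_distrib sum_subtractf sum_distrib_left sum_distrib_right mult.assoc mult.left_commute)
      then show ?thesis using sum by simp
    qed
    moreover have "\<exists>j\<in>J. ?b j \<noteq> 0"
      using a(1) j0(2) by auto
    ultimately show ?thesis by (intro exI[of _ ?b]) blast
  qed
qed

context path_coefficients
begin

primrec lin :: "('r, 'a) module \<Rightarrow> (nat \<Rightarrow> 'a) \<Rightarrow> (nat \<Rightarrow> 'f) \<Rightarrow> nat \<Rightarrow> 'a" where
  "lin M xs cs 0 = \<zero>\<^bsub>M\<^esub>"
| "lin M xs cs (Suc n) = lin M xs cs n \<oplus>\<^bsub>M\<^esub> sc (cs n) \<odot>\<^bsub>M\<^esub> xs n"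

context
  fixes M :: "('r, 'a) module" (structure)
  assumes M: "right_module R M"
begin

interpretation M: right_module R M by (rule M)

lemma lin_in:
  "\<lbrakk>k_subspace M V; \<And>i. i < n \<Longrightarrow> xs i \<in> V\<rbrakk> \<Longrightarrow> lin M xs cs n \<in> V"
  by (induction n) (auto simp: k_subspace_def)

lemma k_subspace_carrier: "k_subspace M (carrier M)"
  by (rule submodule_k_subspace[OF M M.carrier_submodule])

lemma lin_closed: "(\<And>i. i < n \<Longrightarrow> xs i \<in> carrier M) \<Longrightarrow> lin M xs cs n \<in> carrier M"
  by (rule lin_in[OF k_subspace_carrier])

lemma lin_add:
  "(\<And>i. i < n \<Longrightarrow> xs i \<in> carrier M) \<Longrightarrow> lin M xs (\<lambda>i. cs i + ds i) n = lin M xs cs n \<oplus>\<^bsub>M\<^esub> lin M xs ds n"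
proof (induction n)
  case (Suc n)
  then have "lin M xs cs n \<in> carrier M" "lin M xs ds n \<in> carrier M" "xs n \<in> carrier M"
    by (auto intro!: lin_closed)
  then show ?case using Suc by (simp add: sc_add M.rsmult_add_scalar M.rsmult_closed M.M.a_ac)
qed simp

lemma lin_scale:
  "(\<And>i. i < n \<Longrightarrow> xs i \<in> carrier M) \<Longrightarrow> lin M xs (\<lambda>i. e * cs i) n = sc e \<odot>\<^bsub>M\<^esub> lin M xs cs n"
proof (induction n)
  case (Suc n)
  then have c: "lin M xs cs n \<in> carrier M" "xs n \<in> carrier M"
    by (auto intro!: lin_closed)
  have "sc (e * cs n) = sc (cs n) \<otimes> sc e" by (simp add: sc_mult[symmetric] mult.commute)
  then have "sc (e * cs n) \<odot>\<^bsub>M\<^esub> xs n = sc e \<odot>\<^bsub>M\<^esub> (sc (cs n) \<odot>\<^bsub>M\<^esub> xs n)"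
    using c by (simp add: M.rsmult_assoc)
  then show ?case using Suc c by (simp add: M.rsmult_add M.rsmult_closed)
qed (simp add: M.rsmult_zero)

lemma lin_zero: "(\<And>i. i < n \<Longrightarrow> xs i \<in> carrier M) \<Longrightarrow> lin M xs (\<lambda>i. 0) n = \<zero>\<^bsub>M\<^esub>"
  by (induction n) (auto simp: sc_zero M.rsmult_zero_scalar)

lemma lin_cong: "(\<And>i. i < n \<Longrightarrow> xs i = ys i \<and> cs i = ds i) \<Longrightarrow> lin M xs cs n = lin M ys ds n"
  by (induction n) auto

lemma k_subspace_diff: "\<lbrakk>k_subspace M W; x \<in> W; y \<in> W\<rbrakk> \<Longrightarrow> x \<ominus>\<^bsub>M\<^esub> y \<in> W"
  using k_subspace_minus[OF M, of W y] by (simp add: k_subspace_def a_minus_def)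

lemma finite_spanning_lin:
  assumes "finite B" "B \<subseteq> carrier M"
  shows "\<exists>ys N. (\<forall>i<N. ys i \<in> carrier M) \<and> (\<forall>b\<in>B. \<exists>cs. b = lin M ys cs N)"
  using assms
proof (induction B)
  case (insert b B)
  then have "\<exists>ys N. (\<forall>i<N. ys i \<in> carrier M) \<and> (\<forall>b\<in>B. \<exists>cs. b = lin M ys cs N)" by simp
  then obtain ys N where yN: "(\<forall>i<N. ys i \<in> carrier M) \<and> (\<forall>b\<in>B. \<exists>cs. b = lin M ys cs N)"
    by (elim exE) (rule that)
  have y: "\<And>i. i < N \<Longrightarrow> ys i \<in> carrier M" "\<And>b. b \<in> B \<Longrightarrow> \<exists>cs. b = lin M ys cs N" using yN by blast+
  let ?ys = "ys(N := b)"
  have b: "b \<in> carrier M" using insert by simp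
  have "\<exists>cs. b' = lin M ?ys cs (Suc N)" if "b' \<in> insert b B" for b'
  proof (cases "b' = b")
    case True
    have "lin M ?ys (\<lambda>i. if i = N then 1 else 0) N = lin M ys (\<lambda>i. 0) N" by (rule lin_cong) auto
    then have "lin M ?ys (\<lambda>i. if i = N then 1 else 0) (Suc N) = b"
      using y(1) b by (simp add: lin_zero sc_one M.rsmult_one)
    then show ?thesis using True by metis
  next
    case False
    then have "b' \<in> B" using \<open>b' \<in> insert b B\<close> by simp
    from y(2)[OF this] obtain cs where cs: "b' = lin M ys cs N" by (rule exE)
    have "lin M ?ys (cs(N := 0)) N = lin M ys cs N" by (rule lin_cong) auto
    then have "lin M ?ys (cs(N := 0)) (Suc N) = b'"
      using y(1) b by (simp add: cs lin_closed sc_zero M.rsmult_zero_scalar)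
    then show ?thesis by metis
  qed
  moreover have "?ys i \<in> carrier M" if "i < Suc N" for i using that y(1) b by auto
  ultimately show ?case by (intro exI[of _ ?ys] exI[of _ "Suc N"] conjI ballI allI impI)
qed auto

definition independent_mod :: "'a set \<Rightarrow> 'a set \<Rightarrow> nat \<Rightarrow> (nat \<Rightarrow> 'a) \<Rightarrow> bool" where
  "independent_mod U W n xs \<longleftrightarrow> (\<forall>i<n. xs i \<in> U) \<and> (\<forall>cs. lin M xs cs n \<in> W \<longrightarrow> (\<forall>i<n. cs i = 0))"

text \<open>The dimension of (U + W)/W, measured as the greatest length of a list in U independent
  modulo W. The value is meaningful only once such lengths are bounded, which
  \<open>fin_gen_bound\<close> provides.\<close>

definition rel_rank :: "'a set \<Rightarrow> 'a set \<Rightarrow> nat" where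
  "rel_rank U W = (GREATEST n. \<exists>xs. independent_mod U W n xs)"

text \<open>The Steinitz bound: n vectors expressed modulo W through N < n vectors have coefficient
  columns with a nontrivial relation, and that relation puts a combination of the vectors into
  W.\<close>

lemma independent_le:
  assumes U: "U \<subseteq> carrier M" and W: "k_subspace M W" and ys: "\<And>i. i < N \<Longrightarrow> ys i \<in> carrier M"
    and span: "\<And>u. u \<in> U \<Longrightarrow> \<exists>ds. u \<ominus>\<^bsub>M\<^esub> lin M ys ds N \<in> W"
    and ind: "independent_mod U W n xs"
  shows "n \<le> N"
proof (rule ccontr)
  assume "\<not> n \<le> N"
  then have nN: "card {..<N} < card {..<n}" by simp
  have xU: "i < n \<Longrightarrow> xs i \<in> U" for i using ind by (simp add: independent_mod_def)
  have "\<forall>i<n. \<exists>ds. xs i \<ominus>\<^bsub>M\<^esub> lin M ys ds N \<in> W" using span xU by blast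
  then obtain d where d: "\<And>i. i < n \<Longrightarrow> xs i \<ominus>\<^bsub>M\<^esub> lin M ys (d i) N \<in> W" by metis
  obtain a where a: "\<exists>j\<in>{..<n}. a j \<noteq> 0" "\<And>i. i < N \<Longrightarrow> (\<Sum>j\<in>{..<n}. a j * d j i) = 0"
    using nontrivial_relation[OF _ _ nN, of "\<lambda>i j. d j i"] by auto
  have "lin M xs a m \<ominus>\<^bsub>M\<^esub> lin M ys (\<lambda>i. \<Sum>j<m. a j * d j i) N \<in> W" if "m \<le> n" for m
    using that
  proof (induction m)
    case 0
    have "\<zero>\<^bsub>M\<^esub> \<in> W" using W by (simp add: k_subspace_def)
    from k_subspace_diff[OF W this this] show ?case using ys by (simp add: lin_zero)
  next
    case (Suc m)
    have xm: "xs m \<in> carrier M" using xU[of m] U Suc.prems by auto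
    have lx: "lin M xs a m \<in> carrier M" by (rule lin_closed) (use xU U Suc.prems in auto)
    have ly: "lin M ys c N \<in> carrier M" for c by (rule lin_closed[OF ys])
    have "lin M ys (\<lambda>i. \<Sum>j<Suc m. a j * d j i) N
        = lin M ys (\<lambda>i. \<Sum>j<m. a j * d j i) N \<oplus>\<^bsub>M\<^esub> sc (a m) \<odot>\<^bsub>M\<^esub> lin M ys (d m) N"
      by (simp add: lin_add[OF ys] lin_scale[OF ys])
    then have "lin M xs a (Suc m) \<ominus>\<^bsub>M\<^esub> lin M ys (\<lambda>i. \<Sum>j<Suc m. a j * d j i) N
      = (lin M xs a m \<ominus>\<^bsub>M\<^esub> lin M ys (\<lambda>i. \<Sum>j<m. a j * d j i) N) \<oplus>\<^bsub>M\<^esub> sc (a m) \<odot>\<^bsub>M\<^esub> (xs m \<ominus>\<^bsub>M\<^esub> lin M ys (d m) N)"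
      using xm lx ly by (simp add: a_minus_def M.rsmult_add M.rsmult_minus M.M.minus_add M.rsmult_closed M.M.a_ac)
    then show ?case using Suc d[of m] W by (simp add: k_subspace_def)
  qed
  from this[of n] have "lin M xs a n \<ominus>\<^bsub>M\<^esub> lin M ys (\<lambda>i. \<Sum>j<n. a j * d j i) N \<in> W" by simp
  moreover have "lin M ys (\<lambda>i. \<Sum>j<n. a j * d j i) N = lin M ys (\<lambda>i. 0) N" by (rule lin_cong) (simp add: a(2))
  moreover have lx: "lin M xs a n \<in> carrier M" by (rule lin_closed) (use xU U in auto)
  moreover have "lin M xs a n \<ominus>\<^bsub>M\<^esub> \<zero>\<^bsub>M\<^esub> = lin M xs a n"
    using lx M.minus_minus_cancel[OF lx M.M.zero_closed] M.M.minus_closed[OF lx M.M.zero_closed] by (simp add: M.M.l_zero)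
  ultimately have "lin M xs a n \<in> W" by (simp add: lin_zero ys)
  then show False using ind a(1) by (auto simp: independent_mod_def)
qed

lemma rel_rank_eqI:
  assumes "U \<subseteq> carrier M" "k_subspace M W" "\<And>i. i < N \<Longrightarrow> ys i \<in> carrier M"
    "\<And>u. u \<in> U \<Longrightarrow> \<exists>ds. u \<ominus>\<^bsub>M\<^esub> lin M ys ds N \<in> W" "independent_mod U W N xs"
  shows "rel_rank U W = N"
  unfolding rel_rank_def using independent_le[OF assms(1-4)] assms(5)
  by (intro Greatest_equality) blast+

lemma rel_rank_basis:
  assumes U: "k_subspace M U" and W: "k_subspace M W"
    and bound: "\<And>n xs. independent_mod U W n xs \<Longrightarrow> n \<le> N"
  obtains xs where "independent_mod U W (rel_rank U W) xs"
    "\<And>u. u \<in> U \<Longrightarrow> \<exists>ds. u \<ominus>\<^bsub>M\<^esub> lin M xs ds (rel_rank U W) \<in> W"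
proof -
  let ?n = "rel_rank U W"
  have Uc: "u \<in> U \<Longrightarrow> u \<in> carrier M" for u using U by (auto simp: k_subspace_def)
  have "\<exists>xs. independent_mod U W 0 xs" by (simp add: independent_mod_def)
  then have "\<exists>xs. independent_mod U W ?n xs"
    unfolding rel_rank_def by (rule GreatestI_nat[where b = N]) (use bound in blast)
  then obtain xs where xs: "independent_mod U W ?n xs" by blast
  have max: "n \<le> ?n" if "independent_mod U W n ys" for n ys
    unfolding rel_rank_def by (rule Greatest_le_nat[where b = N]) (use that bound in blast)+
  have xU: "i < ?n \<Longrightarrow> xs i \<in> U" for i using xs by (simp add: independent_mod_def)
  have "\<exists>ds. u \<ominus>\<^bsub>M\<^esub> lin M xs ds ?n \<in> W" if u: "u \<in> U" for u
  proof -
    \<comment> \<open>A list of maximal length cannot be extended by u. The coefficient of u in the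
      resulting dependence is not zero, since otherwise the list itself would be dependent, so it
      can be divided out.\<close>
    have "\<not> independent_mod U W (Suc ?n) (xs(?n := u))" using max by fastforce
    moreover have "\<forall>i<Suc ?n. (xs(?n := u)) i \<in> U" using xU u by auto
    ultimately obtain cs i where cs: "lin M (xs(?n := u)) cs (Suc ?n) \<in> W" "i < Suc ?n" "cs i \<noteq> 0"
      by (auto simp: independent_mod_def)
    have "lin M (xs(?n := u)) cs ?n = lin M xs cs ?n" by (rule lin_cong) auto
    then have s: "lin M xs cs ?n \<oplus>\<^bsub>M\<^esub> sc (cs ?n) \<odot>\<^bsub>M\<^esub> u \<in> W" using cs(1) by simp
    have lc: "lin M xs c ?n \<in> carrier M" for c by (rule lin_closed) (use xU Uc in auto)
    have c: "cs ?n \<noteq> 0"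
    proof
      assume z: "cs ?n = 0"
      then have "lin M xs cs ?n \<in> W" using s lc Uc[OF u] by (simp add: sc_zero M.rsmult_zero_scalar)
      then have "\<forall>i<?n. cs i = 0" using xs by (simp add: independent_mod_def)
      then show False using cs(2,3) z less_Suc_eq by auto
    qed
    let ?e = "inverse (cs ?n)"
    have "sc ?e \<odot>\<^bsub>M\<^esub> (lin M xs cs ?n \<oplus>\<^bsub>M\<^esub> sc (cs ?n) \<odot>\<^bsub>M\<^esub> u) \<in> W" using s W by (simp add: k_subspace_def)
    moreover have "sc ?e \<odot>\<^bsub>M\<^esub> (sc (cs ?n) \<odot>\<^bsub>M\<^esub> u) = u"
      using c Uc[OF u] by (simp add: sc_one M.rsmult_one flip: M.rsmult_assoc sc_mult)
    ultimately have "lin M xs (\<lambda>i. ?e * cs i) ?n \<oplus>\<^bsub>M\<^esub> u \<in> W"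
      using lc Uc[OF u] xU by (simp add: M.rsmult_add M.rsmult_closed lin_scale Uc)
    moreover have "lin M xs (\<lambda>i. - 1 * (?e * cs i)) ?n = \<ominus>\<^bsub>M\<^esub> lin M xs (\<lambda>i. ?e * cs i) ?n"
      using lin_scale[of ?n xs "- 1" "\<lambda>i. ?e * cs i"] lc xU Uc
      by (simp add: sc_minus sc_one M.rsmult_minus_scalar M.rsmult_one)
    moreover have "u \<ominus>\<^bsub>M\<^esub> \<ominus>\<^bsub>M\<^esub> lin M xs (\<lambda>i. ?e * cs i) ?n = lin M xs (\<lambda>i. ?e * cs i) ?n \<oplus>\<^bsub>M\<^esub> u"
      using lc Uc[OF u] by (simp add: a_minus_def M.M.a_comm)
    ultimately show ?thesis by metis
  qed
  then show thesis using xs that by blast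
qed

lemma rsmult_finsum_scalar:
  assumes "f \<in> I \<rightarrow> carrier R" "x \<in> carrier M"
  shows "(\<Oplus>i\<in>I. f i) \<odot>\<^bsub>M\<^esub> x = (\<Oplus>\<^bsub>M\<^esub>i\<in>I. f i \<odot>\<^bsub>M\<^esub> x)"
  using assms(1)
proof (induction I rule: infinite_finite_induct)
  case (insert i I)
  then show ?case
    using assms(2) by (simp add: finsum_insert M.M.finsum_insert Pi_iff M.rsmult_closed M.rsmult_add_scalar finsum_closed)
qed (use assms(2) in \<open>simp_all add: M.rsmult_zero_scalar\<close>)

lemma k_subspace_finsum:
  assumes V: "k_subspace M V" and f: "f \<in> I \<rightarrow> V"
  shows "(\<Oplus>\<^bsub>M\<^esub>i\<in>I. f i) \<in> V"
  using f
proof (induction I rule: infinite_finite_induct)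
  case (insert i I)
  moreover have "f \<in> insert i I \<rightarrow> carrier M" using insert.prems V by (auto simp: k_subspace_def)
  ultimately show ?case using V by (auto simp: k_subspace_def)
qed (use V in \<open>simp_all add: k_subspace_def\<close>)

text \<open>Finitely many paths applied to finitely many generators span the module over the field,
  because every ring element is a combination of paths.\<close>

lemma fin_gen_spanning:
  assumes fg: "fin_gen_module R M"
  obtains ys N where "\<And>i. i < N \<Longrightarrow> ys i \<in> carrier M" "\<And>x. x \<in> carrier M \<Longrightarrow> \<exists>cs. x = lin M ys cs N"
proof -
  obtain es bs where es: "set es \<subseteq> {\<one>}" and ad: "adapted R M es bs"
    and surj: "comb M bs ` carrier (idem_module R es) = carrier M"
    by (rule fin_gen_cover[OF M fg])
  have len: "length bs = length es" using ad by (simp add: adapted_def)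
  have bc: "i < length bs \<Longrightarrow> bs ! i \<in> carrier M" for i using ad by (simp add: adapted_def)
  let ?B = "(\<lambda>(z, i). pe z \<odot>\<^bsub>M\<^esub> bs ! i) ` (paths \<times> {..<length bs})"
  have B: "finite ?B" "?B \<subseteq> carrier M" using finite_paths bc by (auto intro: M.rsmult_closed)
  obtain ys N where yN: "(\<forall>i<N. ys i \<in> carrier M) \<and> (\<forall>b\<in>?B. \<exists>cs. b = lin M ys cs N)"
    using finite_spanning_lin[OF B] by (elim exE) (rule that)
  have y: "\<And>i. i < N \<Longrightarrow> ys i \<in> carrier M" "\<And>b. b \<in> ?B \<Longrightarrow> \<exists>cs. b = lin M ys cs N"
    using conjunct1[OF yN] conjunct2[OF yN] by (simp_all only: simp_thms)
  let ?V = "{x. \<exists>cs. x = lin M ys cs N}"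
  have V: "k_subspace M ?V"
    unfolding k_subspace_def
  proof (intro conjI ballI allI)
    show "?V \<subseteq> carrier M" using lin_closed[OF y(1)] by auto
    show "\<zero>\<^bsub>M\<^esub> \<in> ?V" by (rule CollectI, rule exI[of _ "\<lambda>i. 0"]) (simp add: lin_zero y(1))
    show "a \<oplus>\<^bsub>M\<^esub> b \<in> ?V" if ab: "a \<in> ?V" "b \<in> ?V" for a b
    proof -
      obtain cs ds where "a = lin M ys cs N" "b = lin M ys ds N" using ab by blast
      then show ?thesis by (intro CollectI exI[of _ "\<lambda>i. cs i + ds i"]) (simp add: lin_add y(1))
    qed
    show "sc c \<odot>\<^bsub>M\<^esub> a \<in> ?V" if a: "a \<in> ?V" for c a
    proof -
      obtain cs where "a = lin M ys cs N" using a by blast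
      then show ?thesis by (intro CollectI exI[of _ "\<lambda>i. c * cs i"]) (simp add: lin_scale y(1))
    qed
  qed
  have "x \<in> ?V" if x: "x \<in> carrier M" for x
  proof -
    have "x \<in> comb M bs ` carrier (idem_module R es)" using x by (simp only: surj)
    then obtain xs where xs: "x = comb M bs xs" "xs \<in> carrier (idem_module R es)" by (rule imageE)
    have "xs ! i \<odot>\<^bsub>M\<^esub> bs ! i \<in> ?V" if i: "i < length bs" for i
    proof -
      have xi: "xs ! i \<in> carrier R" using xs(2) i len by (simp add: idem_module_carrier_iff)
      have "xs ! i \<odot>\<^bsub>M\<^esub> bs ! i = (\<Oplus>z\<in>paths. pe z \<otimes> sc (co (xs ! i) z)) \<odot>\<^bsub>M\<^esub> bs ! i"
        using decompose[OF xi] by simp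
      also have "\<dots> = (\<Oplus>\<^bsub>M\<^esub>z\<in>paths. (pe z \<otimes> sc (co (xs ! i) z)) \<odot>\<^bsub>M\<^esub> bs ! i)"
        by (rule rsmult_finsum_scalar) (use bc[OF i] in auto)
      also have "\<dots> \<in> ?V"
      proof (rule k_subspace_finsum[OF V], rule Pi_I)
        fix z assume z: "z \<in> paths"
        have "pe z \<odot>\<^bsub>M\<^esub> bs ! i \<in> ?V" using y(2) z i by blast
        then have "sc (co (xs ! i) z) \<odot>\<^bsub>M\<^esub> (pe z \<odot>\<^bsub>M\<^esub> bs ! i) \<in> ?V" using V unfolding k_subspace_def by blast
        then show "(pe z \<otimes> sc (co (xs ! i) z)) \<odot>\<^bsub>M\<^esub> bs ! i \<in> ?V"
          using bc[OF i] by (simp only: M.rsmult_assoc pe_closed sc_closed)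
      qed
      finally show ?thesis .
    qed
    then show ?thesis unfolding xs(1) comb_def by (intro k_subspace_finsum[OF V] Pi_I) simp
  qed
  then show thesis using that y(1) by blast
qed

lemma fin_gen_bound:
  assumes fg: "fin_gen_module R M" and U: "U \<subseteq> carrier M" and W: "k_subspace M W"
  shows "\<exists>N. \<forall>n xs. independent_mod U W n xs \<longrightarrow> n \<le> N"
proof -
  obtain ys N where y: "\<And>i. i < N \<Longrightarrow> ys i \<in> carrier M" "\<And>x. x \<in> carrier M \<Longrightarrow> \<exists>cs. x = lin M ys cs N"
    by (rule fin_gen_spanning[OF fg]) blast
  have "\<exists>ds. u \<ominus>\<^bsub>M\<^esub> lin M ys ds N \<in> W" if u: "u \<in> U" for u
  proof -
    have uc: "u \<in> carrier M" using u U by auto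
    then obtain cs where "u = lin M ys cs N" using y(2) by blast
    then have "u \<ominus>\<^bsub>M\<^esub> lin M ys cs N = \<zero>\<^bsub>M\<^esub>" using M.diff_zero_iff[OF uc uc] by simp
    then show ?thesis using W by (metis k_subspace_def)
  qed
  note span = this
  have "n \<le> N" if ind: "independent_mod U W n xs" for n xs
  proof (rule independent_le[OF U W])
    show "i < N \<Longrightarrow> ys i \<in> carrier M" for i by (rule y(1))
    show "u \<in> U \<Longrightarrow> \<exists>ds. u \<ominus>\<^bsub>M\<^esub> lin M ys ds N \<in> W" for u by (rule span)
  qed (rule ind)
  then show ?thesis by (intro exI[of _ N] allI impI)
qed

end

lemma lin_hom:
  assumes "right_module R M" "right_module R N" and f: "f \<in> module_hom R M N" and xs: "\<And>i. i < n \<Longrightarrow> xs i \<in> carrier M"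
  shows "f (lin M xs cs n) = lin N (\<lambda>i. f (xs i)) cs n"
proof -
  interpret f: rmodule_hom R M N f using assms by (simp add: rmodule_homI)
  show ?thesis
    using xs
  proof (induction n)
    case (Suc n)
    then have "lin M xs cs n \<in> carrier M" "xs n \<in> carrier M" by (auto intro!: lin_closed[OF assms(1)])
    then show ?case using Suc by (simp add: f.add f.smult f.M.rsmult_closed)
  qed (simp add: f.zero)
qed

lemma lin_split:
  assumes M: "right_module R M" and xs: "\<And>i. i < n + m \<Longrightarrow> xs i \<in> carrier M"
  shows "lin M xs cs (n + m) = lin M xs cs n \<oplus>\<^bsub>M\<^esub> lin M (\<lambda>i. xs (n + i)) (\<lambda>i. cs (n + i)) m"
  using xs
proof (induction m)
  case 0
  interpret right_module R M by (rule M)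
  show ?case using lin_closed[OF M, of n xs cs] 0 by simp
next
  case (Suc m)
  interpret right_module R M by (rule M)
  have "lin M xs cs n \<in> carrier M" "lin M (\<lambda>i. xs (n + i)) (\<lambda>i. cs (n + i)) m \<in> carrier M" "xs (n + m) \<in> carrier M"
    using Suc.prems by (auto intro!: lin_closed[OF M])
  then show ?case using Suc by (simp add: M.a_assoc rsmult_closed)
qed

section \<open>Ranks of annihilators modulo the radical\<close>

subsection \<open>An additive invariant\<close>

definition annihilated :: "nat \<Rightarrow> 'v \<Rightarrow> ('r, 'a) module \<Rightarrow> 'a set" where
  "annihilated l v M = {x \<in> carrier M. ev v \<odot>\<^bsub>M\<^esub> x = x \<and> (\<forall>a\<in>Jp l. a \<odot>\<^bsub>M\<^esub> x = \<zero>\<^bsub>M\<^esub>)}"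

text \<open>The dimension of \<open>((Ann J\<^sup>l + M J) / M J) e\<^sub>v\<close>.\<close>

definition ann_rank :: "nat \<Rightarrow> 'v \<Rightarrow> ('r, 'a) module \<Rightarrow> nat" where
  "ann_rank l v M = rel_rank M (annihilated l v M) (mod_prod M (Jp 1))"

lemma annihilated_k_subspace:
  assumes M: "right_module R M" shows "k_subspace M (annihilated l v M)"
proof -
  interpret right_module R M by (rule M)
  have "a \<odot>\<^bsub>M\<^esub> (sc c \<odot>\<^bsub>M\<^esub> x) = sc c \<odot>\<^bsub>M\<^esub> (a \<odot>\<^bsub>M\<^esub> x)" if "a \<in> carrier R" "x \<in> carrier M" for a c x
    using that by (simp flip: rsmult_assoc add: sc_comm)
  moreover have "a \<in> Jp l \<Longrightarrow> a \<in> carrier R" for a by (rule Jp_carrier)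
  ultimately show ?thesis
    by (auto simp: k_subspace_def annihilated_def rsmult_closed rsmult_zero rsmult_add)
qed

lemma annihilated_hom:
  assumes "right_module R M" "right_module R N" and f: "f \<in> module_hom R M N" and x: "x \<in> annihilated l v M"
  shows "f x \<in> annihilated l v N"
proof -
  interpret f: rmodule_hom R M N f using assms by (simp add: rmodule_homI)
  have "a \<in> Jp l \<Longrightarrow> a \<in> carrier R" for a by (rule Jp_carrier)
  then show ?thesis
    using x by (auto simp: annihilated_def f.closed f.zero simp flip: f.smult)
qed

lemma rad_k_subspace: "right_module R M \<Longrightarrow> k_subspace M (mod_prod M (Jp l))"
  by (rule submodule_k_subspace[OF _ rad_submodule])

lemma ann_rank_basis:
  assumes M: "M \<in> fg_modules R"
  obtains xs where "independent_mod M (annihilated l v M) (mod_prod M (Jp 1)) (ann_rank l v M) xs"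
    "\<And>u. u \<in> annihilated l v M \<Longrightarrow> \<exists>ds. u \<ominus>\<^bsub>M\<^esub> lin M xs ds (ann_rank l v M) \<in> mod_prod M (Jp 1)"
proof -
  note rM = fg_right_module[OF M]
  note U = annihilated_k_subspace[OF rM, of l v] and W = rad_k_subspace[OF rM, of 1]
  have "annihilated l v M \<subseteq> carrier M" by (auto simp: annihilated_def)
  then have "\<exists>N. \<forall>n xs. independent_mod M (annihilated l v M) (mod_prod M (Jp 1)) n xs \<longrightarrow> n \<le> N"
    using M by (intro fin_gen_bound[OF rM _ _ W]) (simp_all add: fg_modules_def)
  then obtain N where N: "\<forall>n xs. independent_mod M (annihilated l v M) (mod_prod M (Jp 1)) n xs \<longrightarrow> n \<le> N"
    by (rule exE)
  show thesis
    by (rule rel_rank_basis[OF rM U W N[rule_format]], assumption) (rule that, simp_all only: ann_rank_def)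
qed

text \<open>Module homomorphisms map annihilators of J^l to annihilators and radicals to radicals.
  Hence the inclusions and projections of the sum carry bases of the two relative quotients to a
  basis of the third.\<close>

lemma ann_rank_add:
  assumes M: "M \<in> fg_modules R" and X: "X \<in> fg_modules R" and Y: "Y \<in> fg_modules R"
    and iso: "module_iso R M (module_sum X Y)"
  shows "ann_rank l v M = ann_rank l v X + ann_rank l v Y"
proof -
  note rM = fg_right_module[OF M] and rX = fg_right_module[OF X] and rY = fg_right_module[OF Y]
  interpret M: right_module R M by (rule rM)
  interpret X: right_module R X by (rule rX)
  interpret Y: right_module R Y by (rule rY)
  note rS = module_sum_right_module[OF rX rY] and homs = module_sum_homs[OF rX rY]
  obtain f where f: "f \<in> module_hom R M (module_sum X Y)" "bij_betw f (carrier M) (carrier (module_sum X Y))"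
    using iso by (auto simp: module_iso_def)
  interpret f: rmodule_hom R M "module_sum X Y" f by (rule rmodule_homI[OF rM rS f(1)])
  obtain g where g: "g \<in> module_hom R (module_sum X Y) M"
    and gf: "\<And>x. x \<in> carrier M \<Longrightarrow> g (f x) = x" and fg: "\<And>z. z \<in> carrier (module_sum X Y) \<Longrightarrow> f (g z) = z"
  proof -
    let ?g = "inv_into (carrier M) f"
    have 1: "x \<in> carrier M \<Longrightarrow> ?g (f x) = x" "z \<in> carrier (module_sum X Y) \<Longrightarrow> f (?g z) = z" for x z
      using f(2) by (simp_all only: bij_betw_inv_into_right bij_betw_inv_into_left)
    have c: "z \<in> carrier (module_sum X Y) \<Longrightarrow> ?g z \<in> carrier M" for z
      using bij_betw_inv_into[OF f(2)] by (auto simp: bij_betw_def)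
    have "?g \<in> module_hom R (module_sum X Y) M"
    proof (rule module_homI)
      show "?g (x \<oplus>\<^bsub>module_sum X Y\<^esub> y) = ?g x \<oplus>\<^bsub>M\<^esub> ?g y" if "x \<in> carrier (module_sum X Y)" "y \<in> carrier (module_sum X Y)" for x y
        using 1(1)[OF M.M.a_closed[OF c[OF that(1)] c[OF that(2)]]] that by (simp only: f.add c 1(2))
      show "?g (a \<odot>\<^bsub>module_sum X Y\<^esub> x) = a \<odot>\<^bsub>M\<^esub> ?g x" if "a \<in> carrier R" "x \<in> carrier (module_sum X Y)" for a x
        using 1(1)[OF M.rsmult_closed[OF that(1) c[OF that(2)]]] that by (simp only: f.smult c 1(2))
    qed (rule c)
    then show thesis using that 1 by blast
  qed
  define p q i j where "p = (\<lambda>x. fst (f x))" and "q = (\<lambda>x. snd (f x))" and "i = (\<lambda>x. g (x, \<zero>\<^bsub>Y\<^esub>))" and "j = (\<lambda>y. g (\<zero>\<^bsub>X\<^esub>, y))"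
  have p: "p \<in> module_hom R M X" and q: "q \<in> module_hom R M Y" and i: "i \<in> module_hom R X M" and j: "j \<in> module_hom R Y M"
    unfolding p_def q_def i_def j_def
    by (rule module_hom_comp[OF f(1) homs(1)], rule module_hom_comp[OF f(1) homs(2)],
        rule module_hom_comp[OF homs(3) g], rule module_hom_comp[OF homs(4) g])
  interpret p: rmodule_hom R M X p by (rule rmodule_homI[OF rM rX p])
  interpret q: rmodule_hom R M Y q by (rule rmodule_homI[OF rM rY q])
  interpret i: rmodule_hom R X M i by (rule rmodule_homI[OF rX rM i])
  interpret j: rmodule_hom R Y M j by (rule rmodule_homI[OF rY rM j])
  have pi: "x \<in> carrier X \<Longrightarrow> p (i x) = x" and qi: "x \<in> carrier X \<Longrightarrow> q (i x) = \<zero>\<^bsub>Y\<^esub>" for x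
    using fg[of "(x, \<zero>\<^bsub>Y\<^esub>)"] by (simp_all add: p_def q_def i_def)
  have pj: "y \<in> carrier Y \<Longrightarrow> p (j y) = \<zero>\<^bsub>X\<^esub>" and qj: "y \<in> carrier Y \<Longrightarrow> q (j y) = y" for y
    using fg[of "(\<zero>\<^bsub>X\<^esub>, y)"] by (simp_all add: p_def q_def j_def)
  have ij: "x = i (p x) \<oplus>\<^bsub>M\<^esub> j (q x)" if x: "x \<in> carrier M" for x
  proof -
    have fx: "f x \<in> carrier (module_sum X Y)" by (rule f.closed[OF x])
    have "g ((fst (f x), \<zero>\<^bsub>Y\<^esub>) \<oplus>\<^bsub>module_sum X Y\<^esub> (\<zero>\<^bsub>X\<^esub>, snd (f x))) = i (p x) \<oplus>\<^bsub>M\<^esub> j (q x)"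
      unfolding i_def j_def p_def q_def using fx by (intro module_homD(2)[OF g]) auto
    moreover have "(fst (f x), \<zero>\<^bsub>Y\<^esub>) \<oplus>\<^bsub>module_sum X Y\<^esub> (\<zero>\<^bsub>X\<^esub>, snd (f x)) = f x" using fx by auto
    ultimately show ?thesis using gf[OF x] by simp
  qed
  let ?U = "annihilated l v" and ?W = "\<lambda>M. mod_prod M (Jp 1)"
  let ?n = "ann_rank l v X" and ?m = "ann_rank l v Y"
  obtain xs where xs: "independent_mod X (annihilated l v X) (mod_prod X (Jp 1)) ?n xs"
    "\<And>u. u \<in> annihilated l v X \<Longrightarrow> \<exists>ds. u \<ominus>\<^bsub>X\<^esub> lin X xs ds ?n \<in> mod_prod X (Jp 1)" by (rule ann_rank_basis[OF X]) blast
  obtain ys where ys: "independent_mod Y (annihilated l v Y) (mod_prod Y (Jp 1)) ?m ys"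
    "\<And>u. u \<in> annihilated l v Y \<Longrightarrow> \<exists>ds. u \<ominus>\<^bsub>Y\<^esub> lin Y ys ds ?m \<in> mod_prod Y (Jp 1)" by (rule ann_rank_basis[OF Y]) blast
  have xU: "a < ?n \<Longrightarrow> xs a \<in> annihilated l v X" for a using xs(1) by (simp add: independent_mod_def[OF rX])
  have yU: "a < ?m \<Longrightarrow> ys a \<in> annihilated l v Y" for a using ys(1) by (simp add: independent_mod_def[OF rY])
  have xc: "a < ?n \<Longrightarrow> xs a \<in> carrier X" for a using xU by (auto simp: annihilated_def)
  have yc: "a < ?m \<Longrightarrow> ys a \<in> carrier Y" for a using yU by (auto simp: annihilated_def)
  \<comment> \<open>The concatenated basis: the first \<open>?n\<close> vectors come from X and the
    next \<open>?m\<close> from Y, with the index shifted back.\<close>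
  define zs where "zs = (\<lambda>a. if a < ?n then i (xs a) else j (ys (a - ?n)))"
  have zU: "zs a \<in> annihilated l v M" if "a < ?n + ?m" for a
    using that annihilated_hom[OF rX rM i xU] annihilated_hom[OF rY rM j yU] by (auto simp: zs_def)
  have zc: "a < ?n + ?m \<Longrightarrow> zs a \<in> carrier M" for a using zU by (auto simp: annihilated_def)
  have lz: "lin M zs cs (?n + ?m) = i (lin X xs cs ?n) \<oplus>\<^bsub>M\<^esub> j (lin Y ys (\<lambda>a. cs (?n + a)) ?m)" for cs
  proof -
    have "lin M zs cs ?n = lin M (\<lambda>a. i (xs a)) cs ?n"
      by (rule lin_cong[OF rM]) (simp add: zs_def)
    moreover have "lin M (\<lambda>a. zs (?n + a)) (\<lambda>a. cs (?n + a)) ?m = lin M (\<lambda>a. j (ys a)) (\<lambda>a. cs (?n + a)) ?m"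
      by (rule lin_cong[OF rM]) (simp add: zs_def)
    ultimately show ?thesis
      using lin_split[OF rM zc, where cs = cs] by (simp add: lin_hom[OF rX rM i xc] lin_hom[OF rY rM j yc])
  qed
  have lxc: "lin X xs cs ?n \<in> carrier X" and lyc: "lin Y ys ds ?m \<in> carrier Y" for cs ds
    using lin_closed[OF rX xc] lin_closed[OF rY yc] by auto
  have "rel_rank M (annihilated l v M) (mod_prod M (Jp 1)) = ?n + ?m"
  proof (rule rel_rank_eqI[OF rM _ rad_k_subspace[OF rM] zc])
    show "annihilated l v M \<subseteq> carrier M" by (auto simp: annihilated_def)
    show "independent_mod M (annihilated l v M) (mod_prod M (Jp 1)) (?n + ?m) zs"
      unfolding independent_mod_def[OF rM]
    proof (intro conjI allI impI)
      fix a cs assume a: "a < ?n + ?m" and w: "lin M zs cs (?n + ?m) \<in> mod_prod M (Jp 1)"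
      have "p (lin M zs cs (?n + ?m)) = lin X xs cs ?n"
        unfolding lz by (simp add: p.add i.closed j.closed lxc lyc pi pj)
      then have 1: "lin X xs cs ?n \<in> mod_prod X (Jp 1)" using mod_prod_hom[OF rM rX p Jp_subset w] by simp
      have "q (lin M zs cs (?n + ?m)) = lin Y ys (\<lambda>a. cs (?n + a)) ?m"
        unfolding lz by (simp add: q.add i.closed j.closed lxc lyc qi qj)
      then have 2: "lin Y ys (\<lambda>a. cs (?n + a)) ?m \<in> mod_prod Y (Jp 1)" using mod_prod_hom[OF rM rY q Jp_subset w] by simp
      have z1: "\<forall>a<?n. cs a = 0" using xs(1) 1 by (simp add: independent_mod_def[OF rX])
      have "\<forall>cs. lin Y ys cs ?m \<in> mod_prod Y (Jp 1) \<longrightarrow> (\<forall>a<?m. cs a = 0)"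
        using ys(1) unfolding independent_mod_def[OF rY] by (rule conjunct2)
      from spec[OF this, of "\<lambda>a. cs (?n + a)"] 2 have z2: "\<forall>a<?m. cs (?n + a) = 0" by (rule mp)
      show "cs a = 0"
      proof (cases "a < ?n")
        case False
        then have "a - ?n < ?m" "a = ?n + (a - ?n)" using a by auto
        then show ?thesis using z2 by metis
      qed (use z1 in simp)
    qed (use zU in blast)
    fix u assume u: "u \<in> annihilated l v M"
    then have uc: "u \<in> carrier M" by (simp add: annihilated_def)
    obtain ds es where d: "p u \<ominus>\<^bsub>X\<^esub> lin X xs ds ?n \<in> mod_prod X (Jp 1)" and e: "q u \<ominus>\<^bsub>Y\<^esub> lin Y ys es ?m \<in> mod_prod Y (Jp 1)"
      using xs(2)[OF annihilated_hom[OF rM rX p u]] ys(2)[OF annihilated_hom[OF rM rY q u]] by blast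
    let ?c = "\<lambda>a. if a < ?n then ds a else es (a - ?n)"
    have c1: "lin X xs ?c ?n = lin X xs ds ?n" by (rule lin_cong[OF rX]) simp
    have c2: "lin Y ys (\<lambda>a. ?c (?n + a)) ?m = lin Y ys es ?m" by (rule lin_cong[OF rY]) simp
    have "i (p u \<ominus>\<^bsub>X\<^esub> lin X xs ds ?n) \<oplus>\<^bsub>M\<^esub> j (q u \<ominus>\<^bsub>Y\<^esub> lin Y ys es ?m) \<in> mod_prod M (Jp 1)"
      by (rule mod_prod_add[OF rM Jp_subset mod_prod_hom[OF rX rM i Jp_subset d] mod_prod_hom[OF rY rM j Jp_subset e]])
    moreover have "i (p u \<ominus>\<^bsub>X\<^esub> lin X xs ds ?n) \<oplus>\<^bsub>M\<^esub> j (q u \<ominus>\<^bsub>Y\<^esub> lin Y ys es ?m)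
        = (i (p u) \<oplus>\<^bsub>M\<^esub> j (q u)) \<ominus>\<^bsub>M\<^esub> (i (lin X xs ds ?n) \<oplus>\<^bsub>M\<^esub> j (lin Y ys es ?m))"
      unfolding i.diff[OF p.closed[OF uc] lxc] j.diff[OF q.closed[OF uc] lyc]
      using uc by (simp add: p.closed q.closed lxc lyc i.closed j.closed a_minus_def M.M.minus_add M.M.a_ac)
    ultimately have "u \<ominus>\<^bsub>M\<^esub> lin M zs ?c (?n + ?m) \<in> mod_prod M (Jp 1)"
      unfolding lz c1 c2 using ij[OF uc] by simp
    then show "\<exists>ds. u \<ominus>\<^bsub>M\<^esub> lin M zs ds (?n + ?m) \<in> mod_prod M (Jp 1)" by blast
  qed
  then show ?thesis by (simp add: ann_rank_def)
qed

lemma ann_rank_zero: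
  assumes M: "right_module R M" and sub: "annihilated l v M \<subseteq> mod_prod M (Jp 1)"
  shows "ann_rank l v M = 0"
  unfolding ann_rank_def
proof (rule rel_rank_eqI[OF M _ rad_k_subspace[OF M]])
  interpret right_module R M by (rule M)
  show c: "annihilated l v M \<subseteq> carrier M" by (auto simp: annihilated_def)
  show "\<exists>ds. u \<ominus>\<^bsub>M\<^esub> lin M (\<lambda>_. \<zero>\<^bsub>M\<^esub>) ds 0 \<in> mod_prod M (Jp 1)" if "u \<in> annihilated l v M" for u
    using k_subspace_diff[OF M rad_k_subspace[OF M] subsetD[OF sub that] mod_prod.zero] by simp
  show "independent_mod M (annihilated l v M) (mod_prod M (Jp 1)) 0 (\<lambda>_. \<zero>\<^bsub>M\<^esub>)"
    by (simp add: independent_mod_def[OF M])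
qed simp

end

subsection \<open>The transfer operator of a quiver\<close>

text \<open>The adjacency operator, pushing weights along the arrows: its l-th power sums the weight
  of the source over all paths of length l ending at a given vertex.\<close>

definition transfer :: "('v, 'e) pre_digraph \<Rightarrow> ('v \<Rightarrow> int) \<Rightarrow> 'v \<Rightarrow> int" where
  "transfer Q f w = (\<Sum>e | e \<in> arcs Q \<and> head Q e = w. f (tail Q e))"

definition vanishes :: "('v, 'e) pre_digraph \<Rightarrow> ('v \<Rightarrow> int) \<Rightarrow> bool" where
  "vanishes Q f \<longleftrightarrow> (\<forall>v\<in>verts Q. f v = 0)"

text \<open>The number m of the overview. Weights are functions on the whole vertex type, so
  vanishing is tested on the vertices only; that one coincidence of consecutive kernels persists is
  \<open>nil_index_stable\<close>.\<close>

definition nil_index :: "('v, 'e) pre_digraph \<Rightarrow> nat" where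
  "nil_index Q = (LEAST j. \<forall>f. vanishes Q ((transfer Q ^^ Suc j) f) \<longrightarrow> vanishes Q ((transfer Q ^^ j) f))"

context fin_digraph
begin

lemma transfer_sum: "(transfer G ^^ j) (\<lambda>v. \<Sum>i\<in>I. c i * f i v) w = (\<Sum>i\<in>I. c i * (transfer G ^^ j) (f i) w)"
proof (induction j arbitrary: w)
  case (Suc j)
  have "(transfer G ^^ Suc j) (\<lambda>v. \<Sum>i\<in>I. c i * f i v) w
      = transfer G (\<lambda>w. \<Sum>i\<in>I. c i * (transfer G ^^ j) (f i) w) w"
    by (simp add: Suc.IH[abs_def])
  also have "\<dots> = (\<Sum>i\<in>I. c i * (transfer G ^^ Suc j) (f i) w)"
    by (simp add: transfer_def sum_distrib_left) (rule sum.swap)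
  finally show ?case .
qed simp

lemma transfer_cong:
  "(\<And>v. v \<in> verts G \<Longrightarrow> f v = g v) \<Longrightarrow> w \<in> verts G \<Longrightarrow> (transfer G ^^ j) f w = (transfer G ^^ j) g w"
proof (induction j arbitrary: w)
  case (Suc j)
  then show ?case by (auto simp: transfer_def intro!: sum.cong)
qed simp

lemma transfer_vanishes: "vanishes G f \<Longrightarrow> vanishes G ((transfer G ^^ j) f)"
proof (induction j)
  case (Suc j)
  then show ?case by (auto simp: vanishes_def transfer_def intro!: sum.neutral)
qed simp

lemma transfer_vanishes_mono:
  assumes "vanishes G ((transfer G ^^ i) f)" "i \<le> j" shows "vanishes G ((transfer G ^^ j) f)"
proof -
  have "(transfer G ^^ j) f = (transfer G ^^ (j - i)) ((transfer G ^^ i) f)"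
    using funpow_add[of "j - i" i "transfer G"] assms(2) by simp
  then show ?thesis using transfer_vanishes[OF assms(1)] by simp
qed

lemma transfer_expand:
  assumes "w \<in> verts G"
  shows "(transfer G ^^ j) f w = (\<Sum>v\<in>verts G. f v * (transfer G ^^ j) (\<lambda>u. if u = v then 1 else 0) w)"
proof -
  have "(transfer G ^^ j) f w = (transfer G ^^ j) (\<lambda>u. \<Sum>v\<in>verts G. f v * (if u = v then 1 else 0)) w"
    by (rule transfer_cong[OF _ assms]) (simp add: if_distrib cong: if_cong)
  then show ?thesis by (simp only: transfer_sum)
qed

text \<open>An integral polynomial annihilates the operator. If a_j0 is its lowest nonzero
  coefficient and the power j0 + 1 kills f, then only the term of degree j0 survives, so the power
  j0 kills f as well.\<close>

lemma ex_nil_index: "\<exists>j. \<forall>f. vanishes G ((transfer G ^^ Suc j) f) \<longrightarrow> vanishes G ((transfer G ^^ j) f)"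
proof -
  let ?I = "verts G \<times> verts G" and ?J = "{..card (verts G \<times> verts G)}"
  let ?d = "\<lambda>v u. if u = v then 1 else 0 :: int"
  \<comment> \<open>With n vertices there are n^2 + 1 powers but only n^2 matrix entries, so some
    nontrivial combination of powers is zero.\<close>
  have "\<exists>a. (\<exists>j\<in>?J. a j \<noteq> 0) \<and> (\<forall>i\<in>?I. (\<Sum>j\<in>?J. a j * (transfer G ^^ j) (?d (fst i)) (snd i)) = 0)"
    by (rule nontrivial_relation) auto
  then obtain a where ar: "(\<exists>j\<in>?J. a j \<noteq> 0) \<and> (\<forall>i\<in>?I. (\<Sum>j\<in>?J. a j * (transfer G ^^ j) (?d (fst i)) (snd i)) = 0)"
    by (rule exE)
  note a = conjunct1[OF ar] and rel = conjunct2[OF ar, rule_format]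
  define j0 where "j0 = (LEAST j. j \<in> ?J \<and> a j \<noteq> 0)"
  have j0: "j0 \<in> ?J \<and> a j0 \<noteq> 0" unfolding j0_def by (rule LeastI_ex) (use a in blast)
  have low: "a j = 0" if "j \<in> ?J" "j < j0" for j using not_less_Least[of j "\<lambda>j. j \<in> ?J \<and> a j \<noteq> 0"] that unfolding j0_def by blast
  have "vanishes G ((transfer G ^^ j0) f)" if f: "vanishes G ((transfer G ^^ Suc j0) f)" for f
    unfolding vanishes_def
  proof
    fix w assume w: "w \<in> verts G"
    have "(\<Sum>j\<in>?J. a j * (transfer G ^^ j) f w) = (\<Sum>j\<in>?J. \<Sum>v\<in>verts G. f v * (a j * (transfer G ^^ j) (?d v) w))"
      by (subst transfer_expand[OF w]) (simp add: sum_distrib_left mult.left_commute)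
    also have "\<dots> = (\<Sum>v\<in>verts G. f v * (\<Sum>j\<in>?J. a j * (transfer G ^^ j) (?d v) w))"
      by (subst sum.swap) (simp add: sum_distrib_left)
    also have "\<dots> = 0" using rel w by (intro sum.neutral) auto
    finally have z: "(\<Sum>j\<in>?J. a j * (transfer G ^^ j) f w) = 0" .
    have "a j * (transfer G ^^ j) f w = 0" if "j \<in> ?J" "j \<noteq> j0" for j
    proof (cases "j < j0")
      case False
      then have "Suc j0 \<le> j" using that by simp
      then show ?thesis using transfer_vanishes_mono[OF f] w by (simp add: vanishes_def)
    qed (use low that in simp)
    then have "(\<Sum>j\<in>?J - {j0}. a j * (transfer G ^^ j) f w) = 0" by (intro sum.neutral ballI) blast
    then have "(\<Sum>j\<in>?J. a j * (transfer G ^^ j) f w) = a j0 * (transfer G ^^ j0) f w"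
      using j0 sum.remove[of ?J j0 "\<lambda>j. a j * (transfer G ^^ j) f w"] by simp
    then show "(transfer G ^^ j0) f w = 0" using z j0 by simp
  qed
  then show ?thesis by blast
qed

text \<open>Applying the defining condition to images under further powers gives the same
  implication at every later index; a descending induction from j to i finishes.\<close>

lemma nil_index_stable:
  assumes "vanishes G ((transfer G ^^ j) f)" "nil_index G \<le> i"
  shows "vanishes G ((transfer G ^^ i) f)"
proof (cases "i \<le> j")
  case False
  then show ?thesis using transfer_vanishes_mono[OF assms(1)] by simp
next
  case True
  have base: "vanishes G ((transfer G ^^ nil_index G) f)" if "vanishes G ((transfer G ^^ Suc (nil_index G)) f)" for f
    using LeastI_ex[OF ex_nil_index] that unfolding nil_index_def by blast
  have step: "vanishes G ((transfer G ^^ i) f)" if s: "vanishes G ((transfer G ^^ Suc i) f)" and le: "nil_index G \<le> i" for i f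
  proof -
    obtain d where d: "i = nil_index G + d" using le_Suc_ex[OF le] by blast
    have "(transfer G ^^ Suc i) f = (transfer G ^^ Suc (nil_index G)) ((transfer G ^^ d) f)"
      unfolding d using funpow_add[of "Suc (nil_index G)" d "transfer G"] by (metis add_Suc o_apply)
    then have "vanishes G ((transfer G ^^ nil_index G) ((transfer G ^^ d) f))" using s by (intro base) simp
    then show ?thesis unfolding d funpow_add o_apply .
  qed
  obtain d where d: "j = i + d" using le_Suc_ex[OF True] by blast
  have "vanishes G ((transfer G ^^ (i + d)) f) \<Longrightarrow> vanishes G ((transfer G ^^ i) f)"
  proof (induction d)
    case (Suc d)
    then show ?case using step[of "i + d" f] assms(2) by simp
  qed simp
  then show ?thesis using assms(1) d by simp
qed

lemma nil_index_witness:
  assumes "nil_index G > 0"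
  obtains f where "vanishes G ((transfer G ^^ nil_index G) f)" "\<not> vanishes G ((transfer G ^^ (nil_index G - 1)) f)"
proof -
  have "\<not> (\<forall>f. vanishes G ((transfer G ^^ Suc (nil_index G - 1)) f) \<longrightarrow> vanishes G ((transfer G ^^ (nil_index G - 1)) f))"
    using not_less_Least[of "nil_index G - 1" "\<lambda>j. \<forall>f. vanishes G ((transfer G ^^ Suc j) f) \<longrightarrow> vanishes G ((transfer G ^^ j) f)"] assms
    by (simp only: nil_index_def[symmetric]) simp
  then show thesis using that assms by (auto simp del: funpow.simps)
qed

end

subsection \<open>Quivers without sources and sinks\<close>

text \<open>What remains of the hypotheses after self-injective algebras are excluded. Absence of
  sinks makes the ranks vanish on projectives, absence of sources realises standard modules as
  syzygies, and the branching vertex yields the extra step when the adjacency operator is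
  injective.\<close>

locale branching_quiver_algebra = path_coefficients Q R k co
  for Q :: "('v, 'e) pre_digraph" and R :: "('r, 'm) ring_scheme" (structure)
    and k :: nat and co :: "'r \<Rightarrow> 'v \<times> 'e list \<Rightarrow> 'f::field" +
  assumes k2: "k \<ge> 2"
    and no_sink: "v \<in> verts Q \<Longrightarrow> \<exists>e\<in>arcs Q. tail Q e = v"
    and no_source: "v \<in> verts Q \<Longrightarrow> \<exists>e\<in>arcs Q. head Q e = v"
    and branch: "\<exists>a\<in>arcs Q. \<exists>b\<in>arcs Q. a \<noteq> b \<and> tail Q a = tail Q b"
begin

lemma path_from: "v \<in> verts Q \<Longrightarrow> \<exists>p. is_path Q v p \<and> length p = n"
proof (induction n arbitrary: v)
  case (Suc n)
  then obtain e where e: "e \<in> arcs Q" "tail Q e = v" using no_sink by blast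
  then obtain p where "is_path Q (head Q e) p \<and> length p = n" using Suc.IH[of "head Q e"] by auto
  then show ?case using e by (intro exI[of _ "e # p"]) simp
qed (auto intro: exI[of _ "[]"])

lemma path_to: "v \<in> verts Q \<Longrightarrow> \<exists>u p. is_path Q u p \<and> length p = n \<and> tgt u p = v"
proof (induction n arbitrary: v)
  case 0
  then show ?case by (intro exI[of _ v] exI[of _ "[]"]) simp
next
  case (Suc n)
  then obtain e where e: "e \<in> arcs Q" "head Q e = v" using no_source by blast
  then obtain u p where "is_path Q u p \<and> length p = n \<and> tgt u p = tail Q e" using Suc.IH[of "tail Q e"] by auto
  then show ?case using e Q.head_in_verts[of e]
    by (intro exI[of _ u] exI[of _ "p @ [e]"]) (simp add: Q.is_path_append path_target_append)
qed

lemma co_mult_pe_start: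
  assumes "a \<in> carrier R" "(v, p) \<in> paths" shows "co (a \<otimes> pe (v, p)) (v, p) = co a (v, [])"
  using assms by (simp add: co_mult_pe)

text \<open>An entry with a nonzero coefficient at a trivial path survives multiplication by any
  path of length l < k from that vertex, and such a path exists because there are no sinks.\<close>

lemma annihilated_PM:
  assumes vs: "set vs \<subseteq> verts Q" and l: "l < k"
  shows "annihilated l v (PM vs) \<subseteq> mod_prod (PM vs) (Jp 1)"
proof
  fix x assume x: "x \<in> annihilated l v (PM vs)"
  then have xc: "x \<in> carrier (PM vs)" by (simp add: annihilated_def)
  have "x ! i \<in> Jp 1" if i: "i < length vs" for i
  proof (rule ccontr)
    assume n: "x ! i \<notin> Jp 1"
    let ?v = "vs ! i"
    have xi: "x ! i \<in> carrier R" "ev ?v \<otimes> x ! i = x ! i" and len: "length x = length vs" using xc i by (auto simp: PM_carrier_iff)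
    have v: "?v \<in> verts Q" using vs i by auto
    obtain u where "co (x ! i) (u, []) \<noteq> 0" using n xi(1) by (auto simp: Jp_def)
    then have c: "co (x ! i) (?v, []) \<noteq> 0" using ev_left_iff[OF xi(1) v] xi(2) by metis
    obtain p where p: "is_path Q ?v p" "length p = l" using path_from[OF v] by blast
    then have pp: "(?v, p) \<in> paths" using l by (simp add: paths_iff)
    have "pe (?v, p) \<odot>\<^bsub>PM vs\<^esub> x = \<zero>\<^bsub>PM vs\<^esub>" using x pe_Jp[OF pp, of l] p(2) by (simp add: annihilated_def)
    then have "(pe (?v, p) \<odot>\<^bsub>PM vs\<^esub> x) ! i = \<zero>" using PM_nth(3)[OF i] by simp
    then have "x ! i \<otimes> pe (?v, p) = \<zero>" using PM_nth(2)[OF len i] by simp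
    then show False using co_mult_pe_start[OF xi(1) pp] c by (simp add: co_zero)
  qed
  then show "x \<in> mod_prod (PM vs) (Jp 1)" by (simp add: PM_rad_iff[OF vs xc])
qed

lemma ann_rank_projective:
  assumes P: "P \<in> fg_modules R" "projective_module R P" and l: "l < k"
  shows "ann_rank l v P = 0"
proof (rule ann_rank_zero[OF fg_right_module[OF P(1)]])
  have rP: "right_module R P" "fin_gen_module R P" using P by (auto simp: fg_modules_def)
  obtain us bs where c: "set us \<subseteq> verts Q" "adapted R P (evs us) bs" "comb P bs ` carrier (PM us) = carrier P"
    by (rule minimal_cover[OF rP])
  note h = comb_hom[OF rP(1) c(2)]
  \<comment> \<open>A section of the cover, obtained by lifting the identity of P. It moves
    annihilated elements into a direct sum of modules e_vA, where they are radical, and the cover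
    brings them back.\<close>
  obtain s where s: "s \<in> module_hom R P (PM us)" "\<forall>x\<in>carrier P. comb P bs (s x) = x"
    using P(2)[unfolded projective_module_def, rule_format, of "PM us" P "comb P bs" "\<lambda>x. x"]
      PM_right_module rP(1) h c(3) module_hom_id by blast
  show "annihilated l v P \<subseteq> mod_prod P (Jp 1)"
  proof
    fix x assume x: "x \<in> annihilated l v P"
    then have "s x \<in> mod_prod (PM us) (Jp 1)"
      using annihilated_hom[OF rP(1) PM_right_module s(1)] annihilated_PM[OF c(1) l] by blast
    from mod_prod_hom[OF PM_right_module rP(1) h Jp_subset this]
    show "x \<in> mod_prod P (Jp 1)" using s(2) x by (simp add: annihilated_def)
  qed
qed

definition ann_functional :: "nat \<Rightarrow> 'v \<Rightarrow> (('r, 'r list) module \<Rightarrow>\<^sub>0 int) \<Rightarrow> int" where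
  "ann_functional l v = frag_eval (\<lambda>M. int (ann_rank l v M))"

lemma ann_functional_H: "\<lbrakk>l < k; x \<in> H\<rbrakk> \<Longrightarrow> ann_functional l v x = 0"
  unfolding ann_functional_def
  by (rule frag_eval_H) (auto simp: ann_rank_add ann_rank_projective)

context
  fixes v I assumes v: "v \<in> verts Q" and I: "right_ideal I"
begin

lemma single_ok: "ideals_ok [v] [I]"
  using v I by (simp add: ideals_ok_def)

abbreviation (input) "rep \<equiv> quotient_rep (PM [v]) (sub_ideals [v] [I])"

lemma rep_rad:
  assumes "x \<in> carrier (PM [v])" "x ! 0 \<in> Jp 1" shows "rep x \<in> mod_prod (quot_PM [v] [I]) (Jp 1)"
proof (rule mod_prod_hom[OF PM_right_module quot_PM_right_module[OF single_ok] rep_hom[OF single_ok] Jp_subset])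
  show "x \<in> mod_prod (PM [v]) (Jp 1)" using assms v PM_rad_iff[of "[v]" x 1] by simp
qed

text \<open>A nonradical element is represented by some y with a nonzero coefficient at the trivial
  path of v. Then y p has that same coefficient at p, and y p must lie in I for every path p of
  length l from v.\<close>

lemma annihilated_quot:
  assumes x: "x \<in> annihilated l v' (quot_PM [v] [I])" and v': "v' \<in> verts Q" and n: "x \<notin> mod_prod (quot_PM [v] [I]) (Jp 1)"
  shows "v' = v" "\<And>p. \<lbrakk>is_path Q v p; length p = l; l < k\<rbrakk> \<Longrightarrow> \<exists>z\<in>I. co z (v, p) \<noteq> 0"
proof -
  let ?M = "quot_PM [v] [I]"
  interpret q: rmodule_hom R "PM [v]" ?M rep
    by (rule rmodule_homI[OF PM_right_module quot_PM_right_module[OF single_ok] rep_hom[OF single_ok]])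
  have xc: "x \<in> carrier ?M" using x by (simp add: annihilated_def)
  then have "x \<in> rep ` carrier (PM [v])" by (simp only: rep_surj[OF single_ok])
  then obtain y where y: "x = rep y" "y \<in> carrier (PM [v])" by (rule imageE)
  have y0: "y ! 0 \<in> carrier R" "ev v \<otimes> y ! 0 = y ! 0" and len: "length y = length [v]" using y(2) by (auto simp: PM_carrier)
  show "v' = v"
  proof (rule ccontr)
    assume ne: "v' \<noteq> v"
    have c: "ev v' \<odot>\<^bsub>PM [v]\<^esub> y \<in> carrier (PM [v])" by (rule q.M.rsmult_closed[OF ev_closed y(2)])
    have "x = rep (ev v' \<odot>\<^bsub>PM [v]\<^esub> y)"
      using x q.smult[OF ev_closed y(2), of v'] y(1) by (simp add: annihilated_def)
    moreover have "(ev v' \<odot>\<^bsub>PM [v]\<^esub> y) ! 0 = y ! 0 \<otimes> ev v'" using PM_nth(2)[OF len, of 0] by simp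
    moreover have "y ! 0 \<otimes> ev v' \<in> Jp 1"
    proof -
      have "co (y ! 0 \<otimes> ev v') (u, []) = 0" for u
        using co_mult_ev[OF y0(1) v', of u "[]"] ev_left_iff[OF y0(1) v] y0(2) ne by simp
      then show ?thesis using y0(1) by (auto simp: Jp_def)
    qed
    ultimately show False using rep_rad[OF c] n by simp
  qed
  fix p assume p: "is_path Q v p" "length p = l" "l < k"
  then have pp: "(v, p) \<in> paths" by (simp add: paths_iff)
  have "y ! 0 \<notin> Jp 1" using rep_rad[OF y(2)] n y(1) by blast
  then obtain u where "co (y ! 0) (u, []) \<noteq> 0" using y0(1) by (auto simp: Jp_def)
  then have c: "co (y ! 0) (v, []) \<noteq> 0" using ev_left_iff[OF y0(1) v] y0(2) by metis
  have "rep (pe (v, p) \<odot>\<^bsub>PM [v]\<^esub> y) = \<zero>\<^bsub>?M\<^esub>"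
    using x q.smult[OF pe_closed y(2)] y(1) pe_Jp[OF pp, of l] p(2) by (simp add: annihilated_def)
  then have "(pe (v, p) \<odot>\<^bsub>PM [v]\<^esub> y) ! 0 \<in> I"
    using rep_zero_iff[OF single_ok q.M.rsmult_closed[OF pe_closed y(2)]] by simp
  then have "y ! 0 \<otimes> pe (v, p) \<in> I" using PM_nth(2)[OF len, of 0] by simp
  then show "\<exists>z\<in>I. co z (v, p) \<noteq> 0" using co_mult_pe_start[OF y0(1) pp] c by (intro bexI) auto
qed

lemma rad_rep:
  assumes "x \<in> mod_prod (quot_PM [v] [I]) (Jp 1)"
  shows "\<exists>y\<in>carrier (PM [v]). y ! 0 \<in> Jp 1 \<and> x = rep y"
proof -
  let ?M = "quot_PM [v] [I]"
  interpret q: rmodule_hom R "PM [v]" ?M rep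
    by (rule rmodule_homI[OF PM_right_module quot_PM_right_module[OF single_ok] rep_hom[OF single_ok]])
  have len: "y \<in> carrier (PM [v]) \<Longrightarrow> length y = length [v] \<and> y ! 0 \<in> carrier R" for y by (auto simp: PM_carrier)
  show ?thesis
    using assms
  proof (induction rule: mod_prod.induct)
    case zero
    show ?case
      using q.zero q.M.M.zero_closed PM_nth(3)[of 0 "[v]"] by (intro bexI[of _ "\<zero>\<^bsub>PM [v]\<^esub>"] conjI) auto
  next
    case (step x z a)
    then obtain y where y: "y \<in> carrier (PM [v])" "y ! 0 \<in> Jp 1" "x = rep y" by blast
    have "z \<in> rep ` carrier (PM [v])" using step(2) by (simp only: rep_surj[OF single_ok])
    then obtain z' where z': "z = rep z'" "z' \<in> carrier (PM [v])" by (rule imageE)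
    have a: "a \<in> carrier R" by (rule Jp_carrier[OF step(3)])
    let ?y = "y \<oplus>\<^bsub>PM [v]\<^esub> a \<odot>\<^bsub>PM [v]\<^esub> z'"
    have c: "?y \<in> carrier (PM [v])" by (rule q.M.M.a_closed[OF y(1) q.M.rsmult_closed[OF a z'(2)]])
    have "x \<oplus>\<^bsub>?M\<^esub> a \<odot>\<^bsub>?M\<^esub> z = rep ?y"
      by (simp only: y(3) z'(1) q.add[OF y(1) q.M.rsmult_closed[OF a z'(2)]] q.smult[OF a z'(2)])
    moreover have "?y ! 0 = y ! 0 \<oplus> z' ! 0 \<otimes> a"
      using PM_nth(1)[of y "[v]" "a \<odot>\<^bsub>PM [v]\<^esub> z'" 0] PM_nth(2)[of z' "[v]" 0 a] len[OF y(1)] len[OF z'(2)]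
        len[OF q.M.rsmult_closed[OF a z'(2)]] by simp
    then have "?y ! 0 \<in> Jp 1" using Jp_add[OF y(2) Jp_mult_left[OF step(3)]] len[OF z'(2)] by simp
    ultimately show ?case using c by blast
  qed
qed

end

text \<open>For m <= l the whole module is killed by J^l, so the rank at v is the dimension of the
  simple top. For l < m a path of length l from v exists, lies outside J^m, and excludes nonradical
  annihilated elements.\<close>

lemma ann_rank_St:
  assumes v: "v \<in> verts Q" and v': "v' \<in> verts Q" and m: "m \<ge> 1" and l: "l < k"
  shows "ann_rank l v' (St v m) = (if v' = v \<and> m \<le> l then 1 else 0)"
proof (cases "v' = v \<and> m \<le> l")
  case False
  have "annihilated l v' (quot_PM [v] [Jp m]) \<subseteq> mod_prod (quot_PM [v] [Jp m]) (Jp 1)"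
  proof (rule ccontr)
    assume "\<not> annihilated l v' (quot_PM [v] [Jp m]) \<subseteq> mod_prod (quot_PM [v] [Jp m]) (Jp 1)"
    then obtain x where x: "x \<in> annihilated l v' (quot_PM [v] [Jp m])" "x \<notin> mod_prod (quot_PM [v] [Jp m]) (Jp 1)" by blast
    note a = annihilated_quot[OF v Jp_right_ideal x(1) v' x(2)]
    obtain p where p: "is_path Q v p" "length p = l" using path_from[OF v] by blast
    obtain z where "z \<in> Jp m" "co z (v, p) \<noteq> 0" using a(2)[OF p l] by blast
    then have "m \<le> l" using JpD[of z m p v] p(2) by (meson not_less)
    then show False using a(1) False by simp
  qed
  then show ?thesis
    using ann_rank_zero[OF quot_PM_right_module[OF St_ok[OF v]]] False unfolding St_def by simp
next
  case True
  let ?M = "quot_PM [v] [Jp m]" and ?r = "quotient_rep (PM [v]) (sub_ideals [v] [Jp m])"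
  note ok = St_ok[OF v, of m]
  interpret q: rmodule_hom R "PM [v]" ?M ?r
    by (rule rmodule_homI[OF PM_right_module quot_PM_right_module[OF ok] rep_hom[OF ok]])
  note rM = quot_PM_right_module[OF ok]
  have e: "[ev v] \<in> carrier (PM [v])" using v by (simp add: PM_carrier ev_idem)
  let ?g = "?r [ev v]"
  have g: "?g \<in> carrier ?M" by (rule q.closed[OF e])
  have act: "a \<odot>\<^bsub>?M\<^esub> ?g = ?r [ev v \<otimes> a]" if "a \<in> carrier R" for a
    using q.smult[OF that e] by (simp add: idem_module_def)
  have ein: "[ev v \<otimes> a] \<in> carrier (PM [v])" if "a \<in> carrier R" for a
    using that v by (simp add: PM_carrier m_assoc[symmetric] ev_idem)
  have gU: "?g \<in> annihilated l v' ?M"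
  proof -
    have "ev v \<odot>\<^bsub>?M\<^esub> ?g = ?g" using act[OF ev_closed] v by (simp add: ev_idem)
    moreover have "a \<odot>\<^bsub>?M\<^esub> ?g = \<zero>\<^bsub>?M\<^esub>" if a: "a \<in> Jp l" for a
    proof -
      have "ev v \<otimes> a \<in> Jp m" using Jp_mult_left[OF a ev_closed] Jp_antimono[of m l] True by blast
      then show ?thesis
        using act[OF Jp_carrier[OF a]] rep_zero_iff[OF ok ein[OF Jp_carrier[OF a]]] by simp
    qed
    ultimately show ?thesis using g True by (simp add: annihilated_def)
  qed
  have lin1: "lin ?M (\<lambda>_. ?g) cs (Suc 0) = ?r [ev v \<otimes> sc (cs 0)]" for cs
    by (simp only: lin.simps act[OF sc_closed] q.N.M.l_zero[OF q.closed[OF ein[OF sc_closed]]])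
  have "rel_rank ?M (annihilated l v' ?M) (mod_prod ?M (Jp 1)) = Suc 0"
  proof (rule rel_rank_eqI[OF rM _ rad_k_subspace[OF rM], where ys = "\<lambda>_. ?g" and xs = "\<lambda>_. ?g"])
    show "annihilated l v' ?M \<subseteq> carrier ?M" by (auto simp: annihilated_def)
    show "?g \<in> carrier ?M" by (rule g)
    show "independent_mod ?M (annihilated l v' ?M) (mod_prod ?M (Jp 1)) (Suc 0) (\<lambda>_. ?g)"
      unfolding independent_mod_def[OF rM]
    proof (intro conjI allI impI)
      fix cs i assume i: "i < Suc 0" and "lin ?M (\<lambda>_. ?g) cs (Suc 0) \<in> mod_prod ?M (Jp 1)"
      then have "?r [ev v \<otimes> sc (cs 0)] \<in> mod_prod ?M (Jp 1)" by (simp only: lin1)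
      then obtain y where y: "y \<in> carrier (PM [v])" "y ! 0 \<in> Jp 1" "?r [ev v \<otimes> sc (cs 0)] = ?r y"
        using rad_rep[OF v Jp_right_ideal] by blast
      let ?x = "[ev v \<otimes> sc (cs 0)]"
      have d: "?x \<ominus>\<^bsub>PM [v]\<^esub> y \<in> carrier (PM [v])" by (rule q.M.M.minus_closed[OF ein[OF sc_closed] y(1)])
      have "?r (?x \<ominus>\<^bsub>PM [v]\<^esub> y) = \<zero>\<^bsub>?M\<^esub>"
        using q.diff[OF ein[OF sc_closed] y(1)] y(3) q.N.diff_zero_iff[OF q.closed[OF y(1)] q.closed[OF y(1)]] by simp
      then have "(?x \<ominus>\<^bsub>PM [v]\<^esub> y) ! 0 \<in> Jp m" using rep_zero_iff[OF ok d] by simp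
      then have J: "(?x \<ominus>\<^bsub>PM [v]\<^esub> y) ! 0 \<in> Jp 1" using Jp_antimono[OF m] by blast
      have "?x = y \<oplus>\<^bsub>PM [v]\<^esub> (?x \<ominus>\<^bsub>PM [v]\<^esub> y)" by (rule q.M.minus_minus_cancel[OF ein[OF sc_closed] y(1)])
      then have "?x ! 0 = (y \<oplus>\<^bsub>PM [v]\<^esub> (?x \<ominus>\<^bsub>PM [v]\<^esub> y)) ! 0" by simp
      also have "\<dots> = y ! 0 \<oplus> (?x \<ominus>\<^bsub>PM [v]\<^esub> y) ! 0"
        by (rule PM_nth(1)) (use y(1) d in \<open>auto simp: PM_carrier\<close>)
      finally have "ev v \<otimes> sc (cs 0) \<in> Jp 1" using Jp_add[OF y(2) J] by simp
      then have "co (ev v \<otimes> sc (cs 0)) (v, []) = 0" by (rule JpD) simp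
      then show "cs i = 0" using v i by (simp add: co_ev_mult co_sc)
    qed (use gU in simp)
    fix u assume u: "u \<in> annihilated l v' ?M"
    then have uc: "u \<in> carrier ?M" by (simp add: annihilated_def)
    then have "u \<in> ?r ` carrier (PM [v])" by (simp only: rep_surj[OF ok])
    then obtain y where y: "u = ?r y" "y \<in> carrier (PM [v])" by (rule imageE)
    have y0: "y ! 0 \<in> carrier R" "ev v \<otimes> y ! 0 = y ! 0" and len: "length y = 1" using y(2) by (auto simp: PM_carrier)
    \<comment> \<open>Modulo the radical a representative is determined by its coefficient at the
      trivial path, so subtracting this multiple of the generator leaves a radical element.\<close>
    let ?c = "co (y ! 0) (v, [])"
    let ?z = "[y ! 0 \<ominus> ev v \<otimes> sc ?c]"
    have yy: "y = [y ! 0]" using len by (auto simp: length_Suc_conv)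
    have zc: "?z \<in> carrier (PM [v])"
      using y0 v by (simp add: PM_carrier a_minus_def r_distr r_minus m_assoc[symmetric] ev_idem)
    have "?z ! 0 \<in> Jp 1"
    proof -
      have "co (y ! 0 \<ominus> ev v \<otimes> sc ?c) (w, []) = 0" for w
        using y0 v ev_left_iff[OF y0(1) v] by (auto simp: a_minus_def co_add co_minus co_ev_mult co_sc)
      then show ?thesis using y0(1) by (auto simp: Jp_def)
    qed
    then have zr: "?r ?z \<in> mod_prod ?M (Jp 1)" using rep_rad[OF v Jp_right_ideal zc] by blast
    have "y = ?z \<oplus>\<^bsub>PM [v]\<^esub> [ev v \<otimes> sc ?c]"
      using y0 by (subst yy) (simp add: idem_module_def a_minus_def a_assoc l_neg)
    then have "?r y = ?r ?z \<oplus>\<^bsub>?M\<^esub> ?r [ev v \<otimes> sc ?c]" using q.add[OF zc ein[OF sc_closed]] by metis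
    then have "u \<ominus>\<^bsub>?M\<^esub> ?r [ev v \<otimes> sc ?c] = ?r ?z"
      using y(1) q.closed[OF zc] q.closed[OF ein[OF sc_closed]] by (simp add: a_minus_def q.N.M.a_assoc q.N.M.r_neg)
    then show "\<exists>ds. u \<ominus>\<^bsub>?M\<^esub> lin ?M (\<lambda>_. ?g) ds (Suc 0) \<in> mod_prod ?M (Jp 1)"
      using zr lin1[of "\<lambda>_. ?c"] by metis
  qed
  then show ?thesis using True by (simp add: ann_rank_def St_def)
qed

text \<open>The second arrow b at the same source extends to a path of length l that does not begin
  with a, hence lies outside the ideal generated by a. The module is therefore invisible to these
  ranks although its syzygy is standard.\<close>

lemma ann_rank_arrow:
  assumes ab: "a \<in> arcs Q" "b \<in> arcs Q" "a \<noteq> b" "tail Q a = tail Q b" and v': "v' \<in> verts Q" and l: "l \<ge> 1" "l < k"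
  shows "ann_rank l v' (quot_PM [tail Q a] [path_ideal (tail Q a) 1 {[a]}]) = 0"
proof -
  let ?v = "tail Q a" and ?I = "path_ideal (tail Q a) 1 {[a]}"
  have v: "?v \<in> verts Q" using ab by simp
  show ?thesis
  proof (rule ann_rank_zero[OF quot_PM_right_module[OF path_ideal_ok[OF v]]], rule ccontr)
    assume "\<not> annihilated l v' (quot_PM [?v] [?I]) \<subseteq> mod_prod (quot_PM [?v] [?I]) (Jp 1)"
    then obtain x where x: "x \<in> annihilated l v' (quot_PM [?v] [?I])" "x \<notin> mod_prod (quot_PM [?v] [?I]) (Jp 1)" by blast
    obtain p where p: "is_path Q (head Q b) p" "length p = l - 1" using path_from[of "head Q b"] ab by auto
    then have "is_path Q ?v (b # p)" "length (b # p) = l" using ab l by auto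
    from annihilated_quot(2)[OF v path_ideal_right_ideal x(1) v' x(2) this l(2)]
    obtain z where "z \<in> ?I" "co z (?v, b # p) \<noteq> 0" by blast
    then show False using ab(3) by (auto simp: path_ideal_def)
  qed
qed

end

text \<open>The function f(k, m) of the overview. With m = kq + r, an even number 2i of steps
  suffices when ki >= m, and an odd number 2i+1 when ki + 1 >= m, since ki + 1 is the smallest power
  reached; this gives 2q, 2q + 1 or 2q + 2.\<close>

definition stable_index :: "nat \<Rightarrow> nat \<Rightarrow> nat" where
  "stable_index k m = 2 * (m div k) + (if m mod k = 0 then 0 else if m mod k = 1 then 1 else 2)"

lemma frag_cmul_sum_left: "frag_cmul (sum f A) x = (\<Sum>i\<in>A. frag_cmul (f i) x)"
  by (induction A rule: infinite_finite_induct) (simp_all add: frag_cmul_distrib)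

context branching_quiver_algebra
begin

subsection \<open>The syzygy operator on standard modules\<close>

definition std_sum :: "('v \<Rightarrow> nat \<Rightarrow> int) \<Rightarrow> (('r, 'r list) module \<Rightarrow>\<^sub>0 int)" where
  "std_sum c = (\<Sum>v\<in>verts Q. \<Sum>l\<in>{1..<k}. frag_cmul (c v l) (frag_of (St v l)))"

text \<open>The syzygy operator in coordinates: \<open>St v l\<close> occurs in the syzygy of
  \<open>St u (k - l)\<close> once for every path of length k - l from u to v.\<close>

definition shift :: "('v \<Rightarrow> nat \<Rightarrow> int) \<Rightarrow> 'v \<Rightarrow> nat \<Rightarrow> int" where
  "shift c v l = (transfer Q ^^ (k - l)) (\<lambda>u. c u (k - l)) v"

definition null :: "('v \<Rightarrow> nat \<Rightarrow> int) \<Rightarrow> bool" where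
  "null c \<longleftrightarrow> (\<forall>v\<in>verts Q. \<forall>l\<in>{1..<k}. c v l = 0)"

lemma std_sum_null: "null c \<Longrightarrow> std_sum c = 0"
  by (simp add: std_sum_def null_def)

lemma std_sum_add: "std_sum (\<lambda>v l. c v l + d v l) = std_sum c + std_sum d"
  by (simp add: std_sum_def frag_cmul_distrib sum.distrib)

lemma std_sum_diff: "std_sum (\<lambda>v l. c v l - d v l) = std_sum c - std_sum d"
  by (simp add: std_sum_def sum_subtractf frag_cmul_diff_distrib)

lemma std_sum_single:
  assumes "w \<in> verts Q" "l \<in> {1..<k}"
  shows "std_sum (\<lambda>v m. if v = w \<and> m = l then e else 0) = frag_cmul e (frag_of (St w l))"
proof -
  have "(\<Sum>m\<in>{1..<k}. frag_cmul (if v = w \<and> m = l then e else 0) (frag_of (St v m)))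
      = (if v = w then frag_cmul e (frag_of (St w l)) else 0)" for v
  proof (cases "v = w")
    case True
    have "(\<Sum>m\<in>{1..<k}. frag_cmul (if v = w \<and> m = l then e else 0) (frag_of (St v m)))
        = (\<Sum>m\<in>{1..<k}. if m = l then frag_cmul e (frag_of (St w l)) else 0)"
      by (rule sum.cong) (auto simp: True)
    then show ?thesis using assms(2) True by simp
  qed simp
  then show ?thesis using assms(1) by (simp add: std_sum_def)
qed

lemma ann_functional_std_sum:
  assumes v: "v \<in> verts Q" and l: "l < k"
  shows "ann_functional l v (std_sum c) = (\<Sum>m\<in>{1..l}. c v m)"
proof -
  have "ann_functional l v (std_sum c) = (\<Sum>w\<in>verts Q. \<Sum>m\<in>{1..<k}. c w m * int (ann_rank l v (St w m)))"
    by (simp add: ann_functional_def std_sum_def)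
  also have "\<dots> = (\<Sum>w\<in>verts Q. if w = v then (\<Sum>m\<in>{1..l}. c v m) else 0)"
  proof (rule sum.cong)
    fix w assume w: "w \<in> verts Q"
    have "(\<Sum>m\<in>{1..<k}. c w m * int (ann_rank l v (St w m))) = (\<Sum>m\<in>{1..<k}. if v = w \<and> m \<le> l then c w m else 0)"
      by (rule sum.cong) (use w v l in \<open>auto simp: ann_rank_St\<close>)
    also have "\<dots> = (if w = v then (\<Sum>m\<in>{1..l}. c v m) else 0)"
    proof (cases "w = v")
      case True
      have "(\<Sum>m\<in>{1..<k}. if m \<le> l then c v m else 0) = (\<Sum>m\<in>{1..l}. c v m)"
        by (rule sum.mono_neutral_cong_right) (use l in auto)
      then show ?thesis unfolding True by simp
    qed simp
    finally show "(\<Sum>m\<in>{1..<k}. c w m * int (ann_rank l v (St w m))) = (if w = v then (\<Sum>m\<in>{1..l}. c v m) else 0)" .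
  qed simp
  finally show ?thesis using v by simp
qed

text \<open>The functional with parameter l returns the partial sum of the coefficients up to l, so
  consecutive functionals differ by a single coefficient.\<close>

lemma std_sum_H: assumes "std_sum c \<in> H" shows "null c"
  unfolding null_def
proof (intro ballI)
  fix v l assume v: "v \<in> verts Q" and l: "l \<in> {1..<k}"
  have z: "(\<Sum>m\<in>{1..l}. c v m) = 0" if "l < k" for l
    by (rule trans[OF ann_functional_std_sum[OF v that, symmetric] ann_functional_H[OF that assms]])
  obtain n where n: "l = Suc n" using l by (cases l) auto
  have "(\<Sum>m\<in>{1..Suc n}. c v m) = (\<Sum>m\<in>{1..n}. c v m) + c v (Suc n)" by simp
  then show "c v l = 0" using z[of "Suc n"] z[of n] l n by simp
qed

lemma std_sum_H_iff: "std_sum c \<in> H \<longleftrightarrow> null c"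
  using std_sum_H std_sum_null H_zero by auto

definition paths_from :: "'v \<Rightarrow> nat \<Rightarrow> 'e list set" where
  "paths_from v l = {p. is_path Q v p \<and> length p = l}"

lemma finite_paths_from: "finite (paths_from v l)"
proof (rule finite_subset)
  show "paths_from v l \<subseteq> snd ` {z. is_path Q (fst z) (snd z) \<and> length (snd z) < Suc l}"
  proof
    fix p assume "p \<in> paths_from v l"
    then have "(v, p) \<in> {z. is_path Q (fst z) (snd z) \<and> length (snd z) < Suc l}" by (simp add: paths_from_def)
    from imageI[OF this, of snd] show "p \<in> snd ` {z. is_path Q (fst z) (snd z) \<and> length (snd z) < Suc l}" by simp
  qed
qed (intro finite_imageI Q.finite_paths)

text \<open>Induction on the length, splitting off the first arrow: its weight is pushed to its head
  before the shorter path is followed, which is one application of the transfer operator.\<close>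

lemma sum_paths_from:
  fixes g :: "'v \<Rightarrow> 'x \<Rightarrow>\<^sub>0 int"
  shows "(\<Sum>v\<in>verts Q. \<Sum>p\<in>paths_from v l. frag_cmul (f v) (g (tgt v p))) =
    (\<Sum>w\<in>verts Q. frag_cmul ((transfer Q ^^ l) f w) (g w))"
proof (induction l arbitrary: f)
  case 0
  have "paths_from v 0 = {[]}" if "v \<in> verts Q" for v using that by (auto simp: paths_from_def)
  then show ?case by simp
next
  case (Suc l)
  let ?A = "\<lambda>v. {e \<in> arcs Q. tail Q e = v}" and ?B = "\<lambda>v. {e \<in> arcs Q. head Q e = v}"
  have fin: "finite (?A v)" "finite (?B v)" for v by auto
  have pf: "paths_from v (Suc l) = (\<lambda>(e, p). e # p) ` (SIGMA e:?A v. paths_from (head Q e) l)" for v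
  proof
    show "paths_from v (Suc l) \<subseteq> (\<lambda>(e, p). e # p) ` (SIGMA e:?A v. paths_from (head Q e) l)"
    proof
      fix p assume "p \<in> paths_from v (Suc l)"
      then obtain e p' where "p = e # p'" "e \<in> ?A v" "p' \<in> paths_from (head Q e) l"
        by (cases p) (auto simp: paths_from_def)
      then show "p \<in> (\<lambda>(e, p). e # p) ` (SIGMA e:?A v. paths_from (head Q e) l)" by force
    qed
  qed (auto simp: paths_from_def)
  have "(\<Sum>v\<in>verts Q. \<Sum>p\<in>paths_from v (Suc l). frag_cmul (f v) (g (tgt v p)))
      = (\<Sum>v\<in>verts Q. \<Sum>e\<in>?A v. \<Sum>p\<in>paths_from (head Q e) l. frag_cmul (f (tail Q e)) (g (tgt (head Q e) p)))"
  proof (rule sum.cong[OF refl])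
    fix v
    have "(\<Sum>p\<in>paths_from v (Suc l). frag_cmul (f v) (g (tgt v p)))
        = (\<Sum>(e, p)\<in>(SIGMA e:?A v. paths_from (head Q e) l). frag_cmul (f v) (g (tgt v (e # p))))"
      unfolding pf by (subst sum.reindex) (auto simp: inj_on_def case_prod_unfold)
    also have "\<dots> = (\<Sum>e\<in>?A v. \<Sum>p\<in>paths_from (head Q e) l. frag_cmul (f v) (g (tgt v (e # p))))"
      by (subst sum.Sigma) (auto simp: fin finite_paths_from)
    also have "\<dots> = (\<Sum>e\<in>?A v. \<Sum>p\<in>paths_from (head Q e) l. frag_cmul (f (tail Q e)) (g (tgt (head Q e) p)))"
      by (rule sum.cong) auto
    finally show "(\<Sum>p\<in>paths_from v (Suc l). frag_cmul (f v) (g (tgt v p)))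
        = (\<Sum>e\<in>?A v. \<Sum>p\<in>paths_from (head Q e) l. frag_cmul (f (tail Q e)) (g (tgt (head Q e) p)))" .
  qed
  \<comment> \<open>The arrows are regrouped, from the grouping by tail to the grouping by head, by
    passing through the sum over all arrows.\<close>
  also have "\<dots> = (\<Sum>e\<in>arcs Q. \<Sum>p\<in>paths_from (head Q e) l. frag_cmul (f (tail Q e)) (g (tgt (head Q e) p)))"
    by (rule sum.group) auto
  also have "\<dots> = (\<Sum>u\<in>verts Q. \<Sum>e\<in>?B u. \<Sum>p\<in>paths_from (head Q e) l. frag_cmul (f (tail Q e)) (g (tgt (head Q e) p)))"
    by (rule sum.group[symmetric]) auto
  also have "\<dots> = (\<Sum>u\<in>verts Q. \<Sum>p\<in>paths_from u l. frag_cmul (transfer Q f u) (g (tgt u p)))"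
  proof (rule sum.cong[OF refl])
    fix u
    have "(\<Sum>e\<in>?B u. \<Sum>p\<in>paths_from (head Q e) l. frag_cmul (f (tail Q e)) (g (tgt (head Q e) p)))
        = (\<Sum>e\<in>?B u. \<Sum>p\<in>paths_from u l. frag_cmul (f (tail Q e)) (g (tgt u p)))"
      by (rule sum.cong) auto
    also have "\<dots> = (\<Sum>p\<in>paths_from u l. \<Sum>e\<in>?B u. frag_cmul (f (tail Q e)) (g (tgt u p)))"
      by (rule sum.swap)
    finally show "(\<Sum>e\<in>?B u. \<Sum>p\<in>paths_from (head Q e) l. frag_cmul (f (tail Q e)) (g (tgt (head Q e) p)))
        = (\<Sum>p\<in>paths_from u l. frag_cmul (transfer Q f u) (g (tgt u p)))"
      by (simp add: transfer_def frag_cmul_sum_left)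
  qed
  also have "\<dots> = (\<Sum>w\<in>verts Q. frag_cmul ((transfer Q ^^ l) (transfer Q f) w) (g w))"
    by (rule Suc.IH)
  finally show ?case by (simp add: funpow_swap1)
qed

lemma Syz_St:
  assumes v: "v \<in> verts Q" and l: "l \<in> {1..<k}"
  shows "frag_of (syzygy R (St v l)) - (\<Sum>p\<in>paths_from v l. frag_of (St (tgt v p) (k - l))) \<in> H"
proof -
  have "{p. (v, p) \<in> paths \<and> length p = l} = paths_from v l" using l by (auto simp: paths_iff paths_from_def)
  then show ?thesis
    using syzygy_path_ideal[OF v, of l "paths_from v l"] path_ideal_all[OF v, of l] l
    by (auto simp: paths_from_def paths_iff)
qed

lemma Syz_std_sum: "Syz (std_sum c) - std_sum (shift c) \<in> H"
proof -
  let ?g = "\<lambda>v l. \<Sum>p\<in>paths_from v l. frag_of (St (tgt v p) (k - l))"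
  have "Syz (std_sum c) = (\<Sum>v\<in>verts Q. \<Sum>l\<in>{1..<k}. frag_cmul (c v l) (frag_of (syzygy R (St v l))))"
    by (simp add: std_sum_def frag_extend_sum frag_extend_cmul comp_def)
  moreover have "frag_cmul (c v l) (frag_of (syzygy R (St v l))) - frag_cmul (c v l) (?g v l) \<in> H"
    if "v \<in> verts Q" "l \<in> {1..<k}" for v l
  proof -
    have "frag_cmul a (x - y) = frag_cmul a x - frag_cmul a y" for a and x y :: "('r, 'r list) module \<Rightarrow>\<^sub>0 int"
      by (rule poly_mapping_eqI) (simp add: lookup_minus right_diff_distrib)
    then show ?thesis using H_cmul[OF Syz_St[OF that], of "c v l"] by simp
  qed
  then have "(\<Sum>v\<in>verts Q. \<Sum>l\<in>{1..<k}. frag_cmul (c v l) (frag_of (syzygy R (St v l))) - frag_cmul (c v l) (?g v l)) \<in> H"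
    by (intro H_sum)
  moreover have "(\<Sum>v\<in>verts Q. \<Sum>l\<in>{1..<k}. frag_cmul (c v l) (?g v l)) = std_sum (shift c)"
  proof -
    have "(\<Sum>v\<in>verts Q. \<Sum>l\<in>{1..<k}. frag_cmul (c v l) (?g v l))
        = (\<Sum>l\<in>{1..<k}. \<Sum>v\<in>verts Q. \<Sum>p\<in>paths_from v l. frag_cmul (c v l) (frag_of (St (tgt v p) (k - l))))"
      by (subst sum.swap) (simp add: frag_cmul_sum)
    also have "\<dots> = (\<Sum>l\<in>{1..<k}. \<Sum>w\<in>verts Q. frag_cmul ((transfer Q ^^ l) (\<lambda>v. c v l) w) (frag_of (St w (k - l))))"
      by (rule sum.cong[OF refl]) (rule sum_paths_from)
    also have "\<dots> = (\<Sum>l\<in>{1..<k}. \<Sum>w\<in>verts Q. frag_cmul (shift c w l) (frag_of (St w l)))"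
      by (rule sum.reindex_bij_witness[of _ "\<lambda>l. k - l" "\<lambda>l. k - l"]) (auto simp: shift_def)
    finally show ?thesis by (simp add: std_sum_def) (rule sum.swap)
  qed
  ultimately show ?thesis by (simp add: sum_subtractf)
qed

lemma Syz_pow_std_sum: "(Syz ^^ n) (std_sum c) - std_sum ((shift ^^ n) c) \<in> H"
proof (induction n)
  case (Suc n)
  have "Syz ((Syz ^^ n) (std_sum c)) - Syz (std_sum ((shift ^^ n) c)) \<in> H"
    using Syz_H[OF Suc] by (simp add: frag_extend_diff)
  from H_add[OF this Syz_std_sum[of "(shift ^^ n) c"]] show ?case by simp
qed (simp add: H_zero)

lemma Syz_pow_std_sum_H: "(Syz ^^ n) (std_sum c) \<in> H \<longleftrightarrow> null ((shift ^^ n) c)"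
proof -
  note d = Syz_pow_std_sum[of n c]
  have "(Syz ^^ n) (std_sum c) \<in> H \<longleftrightarrow> std_sum ((shift ^^ n) c) \<in> H"
    using H_diff[OF _ d, of "(Syz ^^ n) (std_sum c)"] H_add[OF d, of "std_sum ((shift ^^ n) c)"] by auto
  then show ?thesis by (simp add: std_sum_H_iff)
qed

lemma St_span: assumes v: "v \<in> verts Q" and l: "l \<le> k" shows "\<exists>c. frag_of (St v l) - std_sum c \<in> H"
proof -
  consider "l = 0" | "l = k" | "l \<in> {1..<k}" using l by force
  then show ?thesis
  proof cases
    case 3
    then show ?thesis using std_sum_single[OF v 3, of 1] H_zero by (intro exI[of _ "\<lambda>v' m. if v' = v \<and> m = l then 1 else 0"]) simp
  qed (use St_0[OF v] St_k[OF v] std_sum_null[of "\<lambda>_ _. 0"] in \<open>auto simp: null_def intro!: exI[of _ "\<lambda>_ _. 0"]\<close>)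
qed

lemma sum_span:
  assumes "finite I" "\<And>i. i \<in> I \<Longrightarrow> \<exists>c. f i - std_sum c \<in> H" shows "\<exists>c. sum f I - std_sum c \<in> H"
  using assms
proof (induction I)
  case empty
  show ?case using std_sum_null[of "\<lambda>_ _. 0"] H_zero by (intro exI[of _ "\<lambda>_ _. 0"]) (simp add: null_def)
next
  case (insert i I)
  then obtain c d where "f i - std_sum c \<in> H" "sum f I - std_sum d \<in> H" by blast
  from H_add[OF this] show ?case using insert
    by (intro exI[of _ "\<lambda>v l. c v l + d v l"]) (simp add: std_sum_add algebra_simps)
qed

text \<open>One syzygy leads every class into the span of the standard ones, on which
  \<open>shift\<close> describes the operator completely. This is the source of the summand 1 in the
  upper bound.\<close>

lemma Syz_span:
  assumes "Poly_Mapping.keys x \<subseteq> fg_modules R" shows "\<exists>c. Syz x - std_sum c \<in> H"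
proof (rule free_Abelian_group_induct[where P = "\<lambda>x. \<exists>c. Syz x - std_sum c \<in> H", OF assms])
  show "\<exists>c. Syz 0 - std_sum c \<in> H"
    using std_sum_null[of "\<lambda>_ _. 0"] H_zero by (intro exI[of _ "\<lambda>_ _. 0"]) (simp add: null_def)
next
  fix x y assume "\<exists>c. Syz x - std_sum c \<in> H" "\<exists>c. Syz y - std_sum c \<in> H"
  then obtain c d where "Syz x - std_sum c \<in> H" "Syz y - std_sum d \<in> H" by blast
  from H_diff[OF this] show "\<exists>c. Syz (x - y) - std_sum c \<in> H"
    by (intro exI[of _ "\<lambda>v l. c v l - d v l"]) (simp add: std_sum_diff frag_extend_diff algebra_simps)
next
  fix M assume M: "M \<in> fg_modules R"
  obtain vs ls where s: "set vs \<subseteq> verts Q" "length ls = length vs" "\<And>j. j < length vs \<Longrightarrow> ls ! j \<le> k"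
    "frag_of (syzygy R M) - (\<Sum>j<length vs. frag_of (St (vs ! j) (ls ! j))) \<in> H"
    by (rule syzygy_structure[OF M]) blast
  have "\<exists>c. (\<Sum>j<length vs. frag_of (St (vs ! j) (ls ! j))) - std_sum c \<in> H"
    by (rule sum_span) (use s in \<open>auto intro!: St_span\<close>)
  then obtain c where "(\<Sum>j<length vs. frag_of (St (vs ! j) (ls ! j))) - std_sum c \<in> H" by (rule exE)
  from H_add[OF s(4) this] show "\<exists>c. Syz (frag_of M) - std_sum c \<in> H" by (intro exI[of _ c]) simp
qed

text \<open>Two steps send the index l to k - l and back, collecting the powers l and k - l of the
  transfer operator, in total k. An odd number of steps leaves one incomplete round.\<close>

lemma shift_pow:
  assumes "l \<in> {1..<k}"
  shows "(shift ^^ (2 * i)) c v l = (transfer Q ^^ (k * i)) (\<lambda>v. c v l) v"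
    "(shift ^^ Suc (2 * i)) c v l = (transfer Q ^^ (k * i + (k - l))) (\<lambda>v. c v (k - l)) v"
proof -
  have "\<forall>l v. l \<in> {1..<k} \<longrightarrow> (shift ^^ (2 * i)) c v l = (transfer Q ^^ (k * i)) (\<lambda>v. c v l) v"
  proof (induction i)
    case (Suc i)
    have odd: "(shift ^^ Suc (2 * i)) c v l = (transfer Q ^^ ((k - l) + k * i)) (\<lambda>v. c v (k - l)) v" if "l \<in> {1..<k}" for v l
    proof -
      have "(\<lambda>u. (shift ^^ (2 * i)) c u (k - l)) = (transfer Q ^^ (k * i)) (\<lambda>v. c v (k - l))"
        using Suc that by auto
      then show ?thesis by (simp add: shift_def[of "(shift ^^ (2 * i)) c"] funpow_add)
    qed
    show ?case
    proof (intro allI impI)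
      fix l v assume l: "l \<in> {1..<k}"
      then have l': "k - l \<in> {1..<k}" by auto
      have "(\<lambda>u. (shift ^^ Suc (2 * i)) c u (k - l)) = (transfer Q ^^ (l + k * i)) (\<lambda>v. c v l)"
        using odd[OF l'] l by (auto simp: add.commute)
      then have "shift ((shift ^^ Suc (2 * i)) c) v l = (transfer Q ^^ ((k - l) + (l + k * i))) (\<lambda>v. c v l) v"
        unfolding shift_def[of "(shift ^^ Suc (2 * i)) c"] by (simp only: funpow_add o_apply)
      moreover have "(k - l) + (l + k * i) = k * Suc i" using l by simp
      ultimately show "(shift ^^ (2 * Suc i)) c v l = (transfer Q ^^ (k * Suc i)) (\<lambda>v. c v l) v" by simp
    qed
  qed simp
  note even = this
  show "(shift ^^ (2 * i)) c v l = (transfer Q ^^ (k * i)) (\<lambda>v. c v l) v" using even assms by blast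
  have "(\<lambda>u. (shift ^^ (2 * i)) c u (k - l)) = (transfer Q ^^ (k * i)) (\<lambda>v. c v (k - l))"
    using even assms by auto
  then show "(shift ^^ Suc (2 * i)) c v l = (transfer Q ^^ (k * i + (k - l))) (\<lambda>v. c v (k - l)) v"
    by (simp add: shift_def[of "(shift ^^ (2 * i)) c"] add.commute[of "k * i"] funpow_add)
qed

lemma null_shift_even: "null ((shift ^^ (2 * i)) c) \<longleftrightarrow> (\<forall>l\<in>{1..<k}. vanishes Q ((transfer Q ^^ (k * i)) (\<lambda>v. c v l)))"
  unfolding null_def vanishes_def by (simp add: shift_pow(1)) blast

text \<open>Replacing l by k - l turns the exponents of the incomplete round into k i + l attached
  to the component l of the original coefficients.\<close>

lemma null_shift_odd:
  "null ((shift ^^ Suc (2 * i)) c) \<longleftrightarrow> (\<forall>l\<in>{1..<k}. vanishes Q ((transfer Q ^^ (k * i + l)) (\<lambda>v. c v l)))"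
proof -
  have "null ((shift ^^ Suc (2 * i)) c) \<longleftrightarrow>
      (\<forall>l\<in>{1..<k}. vanishes Q ((transfer Q ^^ (k * i + (k - l))) (\<lambda>v. c v (k - l))))"
    unfolding null_def vanishes_def using shift_pow(2) by (simp del: funpow.simps) blast
  also have "\<dots> \<longleftrightarrow> (\<forall>l\<in>{1..<k}. vanishes Q ((transfer Q ^^ (k * i + l)) (\<lambda>v. c v l)))"
  proof (intro iffI ballI)
    fix l assume a: "\<forall>l\<in>{1..<k}. vanishes Q ((transfer Q ^^ (k * i + (k - l))) (\<lambda>v. c v (k - l)))" and l: "l \<in> {1..<k}"
    then have "k - l \<in> {1..<k}" "k - (k - l) = l" by auto
    then show "vanishes Q ((transfer Q ^^ (k * i + l)) (\<lambda>v. c v l))" using a by metis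
  next
    fix l assume a: "\<forall>l\<in>{1..<k}. vanishes Q ((transfer Q ^^ (k * i + l)) (\<lambda>v. c v l))" and l: "l \<in> {1..<k}"
    then have "k - l \<in> {1..<k}" by auto
    then show "vanishes Q ((transfer Q ^^ (k * i + (k - l))) (\<lambda>v. c v (k - l)))" using a by blast
  qed
  finally show ?thesis .
qed

abbreviation "ni \<equiv> nil_index Q"

text \<open>The bound on j makes all transfer powers reached after j steps at least the nilpotency
  index, where vanishing at a later power already implies vanishing now.\<close>

lemma shift_stable:
  assumes "stable_index k ni \<le> j" "null ((shift ^^ Suc j) c)"
  shows "null ((shift ^^ j) c)"
proof -
  let ?q = "ni div k"
  have m: "ni = k * ?q + ni mod k" by simp
  have r: "ni mod k < k" using k2 by simp
  show ?thesis
  proof (cases "even j")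
    case True
    then obtain i where j: "j = 2 * i" by blast
    have "ni \<le> k * i"
    proof (cases "ni mod k = 0")
      case True
      then have "?q \<le> i" using assms(1) j by (simp add: stable_index_def)
      then have "k * ?q \<le> k * i" by simp
      then show ?thesis using m True by linarith
    next
      case False
      then have "Suc ?q \<le> i" using assms(1) j by (auto simp: stable_index_def split: if_splits)
      then have "k * Suc ?q \<le> k * i" by (rule mult_le_mono2)
      then have "k * ?q + k \<le> k * i" by simp
      then show ?thesis using m r by linarith
    qed
    then show ?thesis
      using assms(2) Q.nil_index_stable unfolding j null_shift_even null_shift_odd by blast
  next
    case False
    then obtain i where j: "j = Suc (2 * i)" by (auto elim: oddE)
    have "ni \<le> k * i + l" if "l \<ge> 1" for l
    proof (cases "ni mod k \<le> 1")
      case True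
      then have "?q \<le> i" using assms(1) j by (auto simp: stable_index_def split: if_splits)
      then have "k * ?q \<le> k * i" by simp
      then show ?thesis using m True that by linarith
    next
      case False
      then have "Suc ?q \<le> i" using assms(1) j by (auto simp: stable_index_def split: if_splits)
      then have "k * Suc ?q \<le> k * i" by (rule mult_le_mono2)
      then have "k * ?q + k \<le> k * i" by simp
      then show ?thesis using m r by linarith
    qed
    moreover have "Suc j = 2 * Suc i" using j by simp
    ultimately show ?thesis
      using assms(2) Q.nil_index_stable unfolding \<open>Suc j = 2 * Suc i\<close> unfolding j null_shift_even null_shift_odd by fastforce
  qed
qed

subsection \<open>The $\phi$-dimension\<close>

text \<open>All witnesses come from one weight f killed by the power \<open>ni\<close> but not by
  the power \<open>ni - 1\<close>. It is placed so that the last step before the stable index still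
  leaves a power below \<open>ni\<close>.\<close>

lemma shift_witness:
  assumes m: "ni > 0"
  obtains c j where "stable_index k ni = Suc j" "null ((shift ^^ Suc j) c)" "\<not> null ((shift ^^ j) c)"
proof -
  obtain f where f: "vanishes Q ((transfer Q ^^ ni) f)" "\<not> vanishes Q ((transfer Q ^^ (ni - 1)) f)"
    by (rule Q.nil_index_witness[OF m])
  have later: "vanishes Q ((transfer Q ^^ i) f)" if "ni \<le> i" for i
    using Q.transfer_vanishes_mono[OF f(1) that] .
  have earlier: "\<not> vanishes Q ((transfer Q ^^ i) f)" if "i < ni" for i
  proof
    assume i: "vanishes Q ((transfer Q ^^ i) f)"
    have "i \<le> ni - 1" using that by simp
    from Q.transfer_vanishes_mono[OF i this] f(2) show False by contradiction
  qed
  let ?q = "ni div k"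
  have mq: "ni = k * ?q + ni mod k" by simp
  have vz: "vanishes Q ((transfer Q ^^ i) (\<lambda>v. 0))" for i
    by (rule Q.transfer_vanishes) (simp add: vanishes_def)
  have vif: "vanishes Q ((transfer Q ^^ i) (\<lambda>v. if P then g v else 0)) \<longleftrightarrow> (P \<longrightarrow> vanishes Q ((transfer Q ^^ i) g))" for i P g
    using vz[of i] by (cases P) simp_all
  have k1: "1 \<in> {1..<k}" "k - 1 \<in> {1..<k}" using k2 by auto
  consider "ni mod k = 0" | "ni mod k = 1" | "ni mod k \<ge> 2" by linarith
  then show thesis
  proof cases
    case 1
    then have "?q > 0" using m mq by (cases "?q") auto
    then obtain i where q: "?q = Suc i" using gr0_implies_Suc by blast
    \<comment> \<open>The component k - 1 has met the largest power, k i + k - 1, after 2i + 1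
      steps, and this is \<open>ni - 1\<close>; the other components are zero.\<close>
    let ?c = "\<lambda>v l. if l = k - 1 then f v else 0"
    have ki: "k * Suc i = ni" using mq 1 q by simp
    have s: "stable_index k ni = Suc (Suc (2 * i))" using 1 q by (simp add: stable_index_def)
    have "null ((shift ^^ (2 * Suc i)) ?c)"
      unfolding null_shift_even ki using later[of ni] by (simp add: vif)
    then have n1: "null ((shift ^^ Suc (Suc (2 * i))) ?c)" by simp
    have "\<not> vanishes Q ((transfer Q ^^ (k * i + (k - 1))) (\<lambda>v. ?c v (k - 1)))"
      using earlier[of "k * i + (k - 1)"] ki k2 by simp
    then have n2: "\<not> null ((shift ^^ Suc (2 * i)) ?c)" unfolding null_shift_odd using k1(2) by blast
    show thesis by (rule that[OF s n1 n2])
  next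
    case 2
    \<comment> \<open>After 2q steps every component has met the power kq = \<open>ni - 1\<close>;
      one more step gives kq + l with l >= 1, so all components vanish at once.\<close>
    let ?c = "\<lambda>v l. f v"
    have s: "stable_index k ni = Suc (2 * ?q)" using 2 by (simp add: stable_index_def)
    have "vanishes Q ((transfer Q ^^ (k * ?q + l)) f)" if "l \<in> {1..<k}" for l
      using later[of "k * ?q + l"] that mq 2 by simp
    then have n1: "null ((shift ^^ Suc (2 * ?q)) ?c)" unfolding null_shift_odd by blast
    have "\<not> vanishes Q ((transfer Q ^^ (k * ?q)) f)" by (rule earlier) (use mq 2 in linarith)
    then have n2: "\<not> null ((shift ^^ (2 * ?q)) ?c)" unfolding null_shift_even using k1(1) by blast
    show thesis by (rule that[OF s n1 n2])
  next
    case 3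
    \<comment> \<open>After 2q + 1 steps the component 1 has met only the power kq + 1, still below
      \<open>ni\<close> because the residue is at least 2.\<close>
    let ?c = "\<lambda>v l. f v"
    have s: "stable_index k ni = Suc (Suc (2 * ?q))" using 3 by (simp add: stable_index_def)
    have "ni mod k < k" using k2 by simp
    then have "ni \<le> k * Suc ?q" using mq unfolding mult_Suc_right by linarith
    then have "null ((shift ^^ (2 * Suc ?q)) ?c)" unfolding null_shift_even using later by blast
    then have n1: "null ((shift ^^ Suc (Suc (2 * ?q))) ?c)" by simp
    have "\<not> vanishes Q ((transfer Q ^^ (k * ?q + 1)) f)" by (rule earlier) (use mq 3 in linarith)
    then have n2: "\<not> null ((shift ^^ Suc (2 * ?q)) ?c)" unfolding null_shift_odd using k1(1) by blast
    show thesis by (rule that[OF s n1 n2])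
  qed
qed

text \<open>Presentations of all modules used as witnesses: e_uA/pA for nontrivial paths p, and the
  standard modules. The set is finite, so one module can contain all of them.\<close>

definition ideal_pairs :: "('v \<times> 'r set) set" where
  "ideal_pairs = (\<lambda>(u, p). (u, path_ideal u (length p) {p})) ` {z \<in> paths. snd z \<noteq> []} \<union>
     (\<lambda>(v, l). (v, Jp l)) ` (verts Q \<times> {1..<k})"

text \<open>The direct sum over all pairs. The phi-dimension is a supremum over single modules, so
  the classes used in one combination have to be summands of one module.\<close>

lemma test_module:
  obtains M where "M \<in> fg_modules R" "\<And>v I. (v, I) \<in> ideal_pairs \<Longrightarrow> quot_PM [v] [I] \<in> summands M"
proof -
  have "finite ideal_pairs" using finite_paths by (simp add: ideal_pairs_def)
  then obtain prs where prs: "set prs = ideal_pairs" using finite_list by blast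
  let ?vs = "map fst prs" and ?Is = "map snd prs"
  have pr: "v \<in> verts Q \<and> right_ideal I \<and> I \<subseteq> Jp 1" if vI: "(v, I) \<in> ideal_pairs" for v I
  proof -
    consider p where "(v, p) \<in> paths" "p \<noteq> []" "I = path_ideal v (length p) {p}" | l where "v \<in> verts Q" "l \<in> {1..<k}" "I = Jp l"
      using vI by (auto simp: ideal_pairs_def)
    then show ?thesis
    proof cases
      case 1
      then have "1 \<le> length p" by (cases p) auto
      then show ?thesis
        using paths_verts(1)[OF 1(1)] path_ideal_right_ideal path_ideal_Jp[of v "length p" "{p}"] Jp_antimono[of 1 "length p"] 1(3) by blast
    next
      case 2
      then show ?thesis using Jp_right_ideal Jp_antimono[of 1 l] by simp
    qed
  qed
  have ok: "ideals_ok ?vs ?Is" using pr prs by (fastforce simp: ideals_ok_def)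
  have J: "I \<subseteq> Jp 1" if "I \<in> set ?Is" for I using that pr prs by fastforce
  show thesis
  proof (rule that[OF quot_PM_fg[OF ok]])
    fix v I assume "(v, I) \<in> ideal_pairs"
    then obtain n where "n < length prs" "prs ! n = (v, I)" using prs by (metis in_set_conv_nth)
    then show "quot_PM [v] [I] \<in> summands (quot_PM ?vs ?Is)"
      using quot_PM_summands[OF ok J, of n] by simp
  qed
qed

lemma ideal_pairs_path: "\<lbrakk>(u, p) \<in> paths; p \<noteq> []\<rbrakk> \<Longrightarrow> (u, path_ideal u (length p) {p}) \<in> ideal_pairs"
  unfolding ideal_pairs_def by (intro UnI1 image_eqI[of _ _ "(u, p)"]) auto

lemma ideal_pairs_St: "\<lbrakk>v \<in> verts Q; l \<in> {1..<k}\<rbrakk> \<Longrightarrow> (v, Jp l) \<in> ideal_pairs"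
  unfolding ideal_pairs_def by (intro UnI2 image_eqI[of _ _ "(v, l)"]) auto

text \<open>After the first syzygy the class is a combination of standard modules, so n + 1 syzygies
  correspond to n shifts, and stability starts one step later than for \<open>shift\<close>.\<close>

lemma Syz_pow_stable:
  assumes x: "x \<in> add_span M" and z: "(Syz ^^ Suc (Suc (stable_index k ni) + s)) x \<in> H"
  shows "(Syz ^^ (Suc (stable_index k ni) + s)) x \<in> H"
proof -
  let ?n = "stable_index k ni + s"
  obtain c where c: "Syz x - std_sum c \<in> H" using Syz_span[OF add_span_carrier[OF x]] by blast
  have e: "(Syz ^^ Suc n) x \<in> H \<longleftrightarrow> null ((shift ^^ n) c)" for n
    using Syz_pow_cong[OF c, of n] by (simp only: Syz_pow_std_sum_H funpow_Suc_right o_apply)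
  have "null ((shift ^^ Suc ?n) c)" using z e[of "Suc ?n"] by (simp only: add_Suc)
  then have "null ((shift ^^ ?n) c)" by (rule shift_stable[OF le_add1])
  then show ?thesis using e[of ?n] by (simp only: add_Suc)
qed

lemma phi_le: "phi R M \<le> Suc (stable_index k ni)"
  unfolding phi_eq using Syz_pow_stable by (intro Least_le allI ballI impI)

text \<open>The condition defining phi refers to all later powers as well, so a failure of
  injectivity at step n excludes every value up to n. Stability provides the existence of the least
  value.\<close>

lemma phi_ge:
  assumes x: "x \<in> add_span M" and z: "(Syz ^^ Suc n) x \<in> H" "(Syz ^^ n) x \<notin> H"
  shows "n < phi R M"
proof -
  let ?P = "\<lambda>l. \<forall>s. \<forall>x\<in>add_span M. (Syz ^^ Suc (l + s)) x \<in> H \<longrightarrow> (Syz ^^ (l + s)) x \<in> H"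
  have "?P (Suc (stable_index k ni))" using Syz_pow_stable by blast
  then have P: "?P (phi R M)" unfolding phi_eq by (rule LeastI)
  show ?thesis
  proof (rule ccontr)
    assume "\<not> n < phi R M"
    then have "n = phi R M + (n - phi R M)" by simp
    then show False using P x z by metis
  qed
qed

text \<open>For positive \<open>ni\<close> the witness for \<open>shift\<close> is pulled back
  through one syzygy. For \<open>ni = 0\<close> the operator is injective on the standard span, and
  the single step lost must come from a class outside that span.\<close>

lemma ex_phi: "\<exists>M\<in>fg_modules R. Suc (stable_index k ni) \<le> phi R M"
proof -
  obtain M where M: "M \<in> fg_modules R" and sm: "\<And>v I. (v, I) \<in> ideal_pairs \<Longrightarrow> quot_PM [v] [I] \<in> summands M"
    by (rule test_module) blast
  have span: "frag_of (quot_PM [v] [I]) \<in> add_span M" if "(v, I) \<in> ideal_pairs" for v I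
    by (rule add_span_incl[OF sm[OF that]])
  have "\<exists>x\<in>add_span M. (Syz ^^ Suc (stable_index k ni)) x \<in> H \<and> (Syz ^^ stable_index k ni) x \<notin> H"
  proof (cases "ni = 0")
    case False
    then obtain c j where c: "stable_index k ni = Suc j" "null ((shift ^^ Suc j) c)" "\<not> null ((shift ^^ j) c)"
      using shift_witness by blast
    \<comment> \<open>Absence of sources gives a path p of length k - l ending at w; the syzygy of
      e_uA/pA is then \<open>St w l\<close>, since k - (k - l) = l.\<close>
    have "\<forall>w l. \<exists>u p. w \<in> verts Q \<longrightarrow> is_path Q u p \<and> length p = l \<and> tgt u p = w" using path_to by blast
    then obtain u p where up: "\<And>w l. w \<in> verts Q \<Longrightarrow> is_path Q (u w l) (p w l) \<and> length (p w l) = l \<and> tgt (u w l) (p w l) = w"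
      by metis
    let ?N = "\<lambda>w l. quot_PM [u w (k - l)] [path_ideal (u w (k - l)) (k - l) {p w (k - l)}]"
    let ?x = "\<Sum>w\<in>verts Q. \<Sum>l\<in>{1..<k}. frag_cmul (c w l) (frag_of (?N w l))"
    have paths: "(u w (k - l), p w (k - l)) \<in> paths" "p w (k - l) \<noteq> []" if "w \<in> verts Q" "l \<in> {1..<k}" for w l
      using up[OF that(1), of "k - l"] that(2) by (auto simp: paths_iff)
    have x: "?x \<in> add_span M"
    proof (intro add_span_sum add_span_cmul)
      fix w l assume wl: "w \<in> verts Q" "l \<in> {1..<k}"
      show "frag_of (?N w l) \<in> add_span M"
        using span[OF ideal_pairs_path[OF paths[OF wl]]] up[OF wl(1), of "k - l"] by simp
    qed
    have "Syz ?x - std_sum c = (\<Sum>w\<in>verts Q. \<Sum>l\<in>{1..<k}. frag_cmul (c w l) (frag_of (syzygy R (?N w l)) - frag_of (St w l)))"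
    proof -
      have d: "frag_cmul a (x - y) = frag_cmul a x - frag_cmul a y" for a and x y :: "('r, 'r list) module \<Rightarrow>\<^sub>0 int"
        by (rule poly_mapping_eqI) (simp add: lookup_minus right_diff_distrib)
      show ?thesis by (simp add: std_sum_def frag_extend_sum frag_extend_cmul comp_def sum_subtractf d)
    qed
    also have "\<dots> \<in> H"
    proof (intro H_sum H_cmul)
      fix w l assume wl: "w \<in> verts Q" "l \<in> {1..<k}"
      have v: "u w (k - l) \<in> verts Q" by (rule paths_verts(1)[OF paths(1)[OF wl]])
      have l: "k - l > 0" "k - (k - l) = l" using wl(2) by auto
      show "frag_of (syzygy R (?N w l)) - frag_of (St w l) \<in> H"
        using syzygy_path_ideal[OF v l(1), of "{p w (k - l)}"] paths(1)[OF wl] up[OF wl(1), of "k - l"] by (simp add: l(2))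
    qed
    finally have s: "Syz ?x - std_sum c \<in> H" .
    have e: "(Syz ^^ Suc n) ?x \<in> H \<longleftrightarrow> null ((shift ^^ n) c)" for n
      using Syz_pow_cong[OF s, of n] by (simp only: Syz_pow_std_sum_H funpow_Suc_right o_apply)
    show ?thesis
      unfolding c(1) using e[of "Suc j"] e[of j] c(2,3) x by blast
  next
    case True
    obtain a b where ab: "a \<in> arcs Q" "b \<in> arcs Q" "a \<noteq> b" "tail Q a = tail Q b" using branch by blast
    let ?J = "insert None (Some ` verts Q)"
    \<comment> \<open>Column \<open>None\<close> is the syzygy of e_vA/aA, with v the tail of a, and
      column \<open>Some v\<close> that of \<open>St v 1\<close>, all in the classes
      \<open>St w (k - 1)\<close>. There is one column more than there are vertices, so a relation r
      exists.\<close>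
    let ?f = "\<lambda>w z. (case z of None \<Rightarrow> (if w = head Q a then 1 else 0) | Some v \<Rightarrow> transfer Q (\<lambda>u. if u = v then 1 else 0) w) :: int"
    have "card (verts Q) < card ?J" by (simp add: card_image)
    then have "\<exists>r. (\<exists>z\<in>?J. r z \<noteq> 0) \<and> (\<forall>w\<in>verts Q. (\<Sum>z\<in>?J. r z * ?f w z) = 0)"
      by (intro nontrivial_relation) auto
    then obtain r where r: "\<exists>z\<in>?J. r z \<noteq> 0" "\<And>w. w \<in> verts Q \<Longrightarrow> (\<Sum>z\<in>?J. r z * ?f w z) = 0" by blast
    have r': "r None * (if w = head Q a then 1 else 0) + transfer Q (\<lambda>v. r (Some v)) w = 0" if w: "w \<in> verts Q" for w
    proof -
      have "(\<Sum>z\<in>?J. r z * ?f w z) = r None * (if w = head Q a then 1 else 0) + (\<Sum>v\<in>verts Q. r (Some v) * transfer Q (\<lambda>u. if u = v then 1 else 0) w)"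
        by (subst sum.insert) (auto simp: sum.reindex)
      moreover have "(\<Sum>v\<in>verts Q. r (Some v) * transfer Q (\<lambda>u. if u = v then 1 else 0) w) = transfer Q (\<lambda>v. r (Some v)) w"
        using Q.transfer_expand[OF w, of 1 "\<lambda>v. r (Some v)"] by simp
      ultimately show ?thesis using r(2)[OF w] by simp
    qed
    let ?v = "tail Q a"
    let ?q = "quot_PM [?v] [path_ideal ?v 1 {[a]}]"
    let ?c = "\<lambda>v l. if l = 1 then r (Some v) else (0::int)"
    let ?x = "std_sum ?c + frag_cmul (r None) (frag_of ?q)"
    have v: "?v \<in> verts Q" and ha: "head Q a \<in> verts Q" using ab(1) by auto
    have k1: "1 \<in> {1..<k}" "k - 1 \<in> {1..<k}" using k2 by auto
    have pa: "(?v, [a]) \<in> paths" using ab(1) k2 by (simp add: paths_iff)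
    have q: "frag_of ?q \<in> add_span M" using span[OF ideal_pairs_path[OF pa]] by simp
    have "frag_of (St w l) \<in> add_span M" if "w \<in> verts Q" "l \<in> {1..<k}" for w l
      using span[OF ideal_pairs_St[OF that]] by (simp add: St_def)
    then have "std_sum ?c \<in> add_span M" unfolding std_sum_def by (intro add_span_sum add_span_cmul)
    then have x: "?x \<in> add_span M" using add_span_add add_span_cmul[OF q] by blast
    \<comment> \<open>The coordinates of the syzygy of \<open>?x\<close>. Both parts are
      concentrated at l = k - 1, where they cancel by the choice of r.\<close>
    let ?d = "\<lambda>w l. shift ?c w l + (if w = head Q a \<and> l = k - 1 then r None else 0)"
    have "frag_of (syzygy R ?q) - frag_of (St (head Q a) (k - 1)) \<in> H"
      using syzygy_path_ideal[OF v, of 1 "{[a]}"] pa by simp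
    from H_add[OF Syz_std_sum[of ?c] H_cmul[OF this, of "r None"]]
    have "Syz (std_sum ?c) - std_sum (shift ?c) + frag_cmul (r None) (frag_of (syzygy R ?q) - frag_of (St (head Q a) (k - 1))) \<in> H" .
    moreover have "Syz ?x - std_sum ?d =
        Syz (std_sum ?c) - std_sum (shift ?c) + frag_cmul (r None) (frag_of (syzygy R ?q) - frag_of (St (head Q a) (k - 1)))"
    proof -
      have d: "frag_cmul a (x - y) = frag_cmul a x - frag_cmul a y" for a and x y :: "('r, 'r list) module \<Rightarrow>\<^sub>0 int"
        by (rule poly_mapping_eqI) (simp add: lookup_minus right_diff_distrib)
      show ?thesis
        by (simp only: std_sum_add std_sum_single[OF ha k1(2)] frag_extend_add frag_extend_cmul frag_extend_of d) simp
    qed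
    ultimately have s: "Syz ?x - std_sum ?d \<in> H" by simp
    have "null ?d"
      unfolding null_def
    proof (intro ballI)
      fix w l assume w: "w \<in> verts Q" and l: "l \<in> {1..<k}"
      show "?d w l = 0"
      proof (cases "l = k - 1")
        case True
        then have "k - l = 1" using k2 by simp
        then show ?thesis using r'[OF w] True by (simp add: shift_def split: if_splits)
      next
        case False
        then have "k - l \<noteq> 1" using l by auto
        then have "(\<lambda>u. ?c u (k - l)) = (\<lambda>u. 0)" by auto
        moreover have "vanishes Q ((transfer Q ^^ (k - l)) (\<lambda>u. 0))"
          by (rule Q.transfer_vanishes) (simp add: vanishes_def)
        ultimately show ?thesis using False w by (simp add: shift_def vanishes_def)
      qed
    qed
    then have "std_sum ?d \<in> H" by (simp add: std_sum_H_iff)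
    from H_add[OF s this] have sH: "Syz ?x \<in> H" by simp
    \<comment> \<open>The rank with parameter 1 does not see the arrow module, so it would force all
      \<open>r (Some w)\<close> to be zero; the relation at the head of a then forces
      \<open>r None\<close> to be zero too.\<close>
    have "?x \<notin> H"
    proof
      assume xH: "?x \<in> H"
      have "r (Some w) = 0" if w: "w \<in> verts Q" for w
      proof -
        have "ann_functional 1 w ?x = ann_functional 1 w (std_sum ?c) + r None * int (ann_rank 1 w ?q)"
          by (simp add: ann_functional_def)
        also have "\<dots> = r (Some w)"
          using ann_functional_std_sum[OF w, of 1 ?c] ann_rank_arrow[OF ab w, of 1] k2 by simp
        finally show ?thesis using ann_functional_H[OF _ xH, of 1 w] k2 by simp
      qed
      moreover from this have "transfer Q (\<lambda>v. r (Some v)) (head Q a) = 0"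
        unfolding transfer_def using Q.tail_in_verts by (intro sum.neutral) auto
      then have "r None = 0" using r'[OF ha] by simp
      ultimately show False using r(1) by auto
    qed
    moreover have "stable_index k ni = 0" using True by (simp add: stable_index_def)
    ultimately show ?thesis using x sH by (intro bexI[of _ ?x]) auto
  qed
  then show ?thesis using phi_ge M by (meson Suc_leI)
qed

theorem phi_dim_eq: "phi_dim R = enat (Suc (stable_index k ni))"
proof -
  obtain M where M: "M \<in> fg_modules R" "Suc (stable_index k ni) \<le> phi R M" using ex_phi by blast
  show ?thesis
    unfolding phi_dim_def
  proof (rule antisym)
    show "(SUP M\<in>fg_modules R. enat (phi R M)) \<le> enat (Suc (stable_index k ni))"
      using phi_le by (intro SUP_least) simp
    have "enat (Suc (stable_index k ni)) \<le> enat (phi R M)" using M(2) by simp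
    also have "\<dots> \<le> (SUP M\<in>fg_modules R. enat (phi R M))" by (rule SUP_upper[OF M(1)])
    finally show "enat (Suc (stable_index k ni)) \<le> (SUP M\<in>fg_modules R. enat (phi R M))" .
  qed
qed

end

subsection \<open>Truncated path algebras\<close>

context fin_digraph
begin

lemma awalk_is_path: "awalk u p v \<longleftrightarrow> is_path G u p \<and> path_target G u p = v"
  by (induction p arbitrary: u) (auto simp: awalk_Nil_iff awalk_Cons_iff)

definition path_functions :: "(('a, 'b) path \<Rightarrow>\<^sub>0 'k::field) set" where
  "path_functions = {f. \<forall>u p v. Poly_Mapping.lookup f (u, p, v) \<noteq> 0 \<longrightarrow> awalk u p v}"

definition coeff :: "(('a, 'b) path \<Rightarrow>\<^sub>0 'k::field) \<Rightarrow> 'a \<Rightarrow> 'b list \<Rightarrow> 'k" where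
  "coeff f u p = Poly_Mapping.lookup f (u, p, path_target G u p)"

lemma path_algebra_simps:
  "carrier (path_algebra TYPE('k) G) = (path_functions :: (('a, 'b) path \<Rightarrow>\<^sub>0 'k::field) set)"
  "f \<otimes>\<^bsub>path_algebra TYPE('k) G\<^esub> g = path_mult f g"
  "f \<oplus>\<^bsub>path_algebra TYPE('k) G\<^esub> g = f + g"
  "\<zero>\<^bsub>path_algebra TYPE('k) G\<^esub> = 0"
  "\<one>\<^bsub>path_algebra TYPE('k) G\<^esub> = (\<Sum>v \<in> verts G. Poly_Mapping.single (v, [], v) 1)"
  by (auto simp: path_algebra_def path_functions_def quiver_paths_def in_keys_iff)

lemma path_functionsD: "\<lbrakk>f \<in> path_functions; Poly_Mapping.lookup f (u, p, v) \<noteq> 0\<rbrakk> \<Longrightarrow> awalk u p v"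
  by (auto simp: path_functions_def)

lemma coeff_zero: "coeff 0 u p = 0" by (simp add: coeff_def)
lemma coeff_add: "coeff (f + g) u p = coeff f u p + coeff g u p" by (simp add: coeff_def lookup_add)

lemma coeff_off: "\<lbrakk>f \<in> path_functions; \<not> is_path G u p\<rbrakk> \<Longrightarrow> coeff f u p = 0"
  using path_functionsD[of f u p "path_target G u p"] by (auto simp: coeff_def awalk_is_path)

lemma lookup_coeff: "f \<in> path_functions \<Longrightarrow> Poly_Mapping.lookup f (u, p, v) = (if v = path_target G u p then coeff f u p else 0)"
  using path_functionsD[of f u p v] by (auto simp: coeff_def awalk_is_path)

lemma path_functions_eqI:
  assumes "f \<in> path_functions" "g \<in> path_functions" "\<And>u p. is_path G u p \<Longrightarrow> coeff f u p = coeff g u p"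
  shows "f = g"
proof (rule poly_mapping_eqI)
  fix z :: "('a, 'b) path"
  obtain u p v where z: "z = (u, p, v)" by (cases z)
  have "coeff f u p = coeff g u p"
    using assms(3) coeff_off[OF assms(1)] coeff_off[OF assms(2)] by (cases "is_path G u p") auto
  then show "Poly_Mapping.lookup f z = Poly_Mapping.lookup g z" by (simp add: z lookup_coeff assms(1,2))
qed

lemma path_functions_closed:
  "0 \<in> path_functions"
  "\<lbrakk>f \<in> path_functions; g \<in> path_functions\<rbrakk> \<Longrightarrow> f + g \<in> path_functions"
  "f \<in> path_functions \<Longrightarrow> - f \<in> path_functions"
  "is_path G u p \<Longrightarrow> Poly_Mapping.single (u, p, path_target G u p) c \<in> path_functions"
proof -
  show "f + g \<in> path_functions" if f: "f \<in> path_functions" and g: "g \<in> path_functions"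
    unfolding path_functions_def
  proof (intro CollectI allI impI)
    fix u p v assume "Poly_Mapping.lookup (f + g) (u, p, v) \<noteq> 0"
    then have "Poly_Mapping.lookup f (u, p, v) \<noteq> 0 \<or> Poly_Mapping.lookup g (u, p, v) \<noteq> 0" by (auto simp: lookup_add)
    then show "awalk u p v" using path_functionsD[OF f] path_functionsD[OF g] by blast
  qed
qed (auto simp: path_functions_def lookup_single when_def awalk_is_path)

lemma path_functions_sum: "(\<And>i. i \<in> I \<Longrightarrow> f i \<in> path_functions) \<Longrightarrow> sum f I \<in> path_functions"
  by (induction I rule: infinite_finite_induct) (auto simp: path_functions_closed)

lemma coeff_sum: "coeff (sum f I) u p = (\<Sum>i\<in>I. coeff (f i) u p)"
  by (simp add: coeff_def lookup_sum)

lemma coeff_single: "coeff (Poly_Mapping.single (v, q, path_target G v q) c) u p = (if u = v \<and> p = q then c else 0)"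
  by (auto simp: coeff_def lookup_single when_def)

text \<open>A product term contributes only if its first factor is a prefix of \<open>p\<close>
  starting at \<open>u\<close> and its second the matching suffix. Since \<open>f\<close> is
  supported on genuine paths, the vertex in between is determined by the prefix.\<close>

lemma lookup_path_mult:
  assumes f: "f \<in> path_functions"
  shows "Poly_Mapping.lookup (path_mult f g) (u, p, w) =
    (\<Sum>i\<le>length p. coeff f u (take i p) * Poly_Mapping.lookup g (path_target G u (take i p), drop i p, w))"
proof -
  let ?x = "\<lambda>i. (u, take i p, path_target G u (take i p))"
  let ?F = "\<lambda>x y. case x of (u', p', v) \<Rightarrow> case y of (v', q, w') \<Rightarrow>
    if v = v' \<and> u' = u \<and> p' @ q = p \<and> w' = w then Poly_Mapping.lookup f x * Poly_Mapping.lookup g y else 0"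
  let ?h = "\<lambda>(u', p', v). Poly_Mapping.lookup f (u', p', v) * Poly_Mapping.lookup g (v, drop (length p') p, w)"
  let ?C = "\<lambda>(u', p', v). u' = u \<and> p' = take (length p') p"
  have "Poly_Mapping.lookup (path_mult f g) (u, p, w) = (\<Sum>x\<in>Poly_Mapping.keys f. \<Sum>y\<in>Poly_Mapping.keys g. ?F x y)"
    unfolding path_mult_def lookup_sum case_prod_unfold
    by (intro sum.cong refl) (auto simp: lookup_single when_def)
  also have "\<dots> = (\<Sum>x\<in>Poly_Mapping.keys f. if ?C x then ?h x else 0)"
  proof (rule sum.cong[OF refl])
    fix x assume "x \<in> Poly_Mapping.keys f"
    obtain u' p' v where x: "x = (u', p', v)" by (cases x)
    let ?y = "(v, drop (length p') p, w)"
    have "(\<Sum>y\<in>Poly_Mapping.keys g. ?F x y) = (\<Sum>y\<in>Poly_Mapping.keys g. if y = ?y then if ?C x then ?h x else 0 else 0)"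
      by (intro sum.cong refl) (auto simp: x append_eq_conv_conj split: if_splits)
    also have "\<dots> = (if ?C x then ?h x else 0)"
      by (auto simp: x in_keys_iff)
    finally show "(\<Sum>y\<in>Poly_Mapping.keys g. ?F x y) = (if ?C x then ?h x else 0)" .
  qed
  also have "\<dots> = sum ?h (?x ` {..length p})"
  proof (rule sum.mono_neutral_cong)
    show "(if ?C x then ?h x else 0) = ?h x" if "x \<in> Poly_Mapping.keys f \<inter> ?x ` {..length p}" for x
      using that by (auto simp: min_absorb2)
    show "?h x = 0" if "x \<in> ?x ` {..length p} - Poly_Mapping.keys f" for x
      using that by (auto simp: in_keys_iff)
    show "(if ?C x then ?h x else 0) = 0" if x: "x \<in> Poly_Mapping.keys f - ?x ` {..length p}" for x
    proof -
      obtain u' p' v where x': "x = (u', p', v)" by (cases x)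
      then have v: "v = path_target G u' p'"
        using x path_functionsD[OF f] by (auto simp: in_keys_iff awalk_is_path)
      have "\<not> ?C x"
      proof
        assume "?C x"
        then have c: "u' = u" "p' = take (length p') p" by (auto simp: x')
        then have "length p' \<le> length p" by (metis length_take min.cobounded1)
        moreover have "x = ?x (length p')" using c v x' by simp
        ultimately show False using x by blast
      qed
      then show ?thesis by simp
    qed
  qed auto
  also have "\<dots> = (\<Sum>i\<le>length p. ?h (?x i))"
  proof (rule trans[OF sum.reindex])
    show "inj_on ?x {..length p}"
      by (rule inj_onI) (metis atMost_iff length_take min_absorb2 prod.inject)
  qed (simp add: comp_def)
  also have "\<dots> = (\<Sum>i\<le>length p. coeff f u (take i p) * Poly_Mapping.lookup g (path_target G u (take i p), drop i p, w))"
    by (intro sum.cong) (auto simp: coeff_def min_absorb2)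
  finally show ?thesis .
qed

lemma path_target_take_drop: "path_target G (path_target G u (take i p)) (drop i p) = path_target G u p"
  by (simp flip: path_target_append)

lemma coeff_path_mult:
  "f \<in> path_functions \<Longrightarrow> coeff (path_mult f g) u p =
    (\<Sum>i\<le>length p. coeff f u (take i p) * coeff g (path_target G u (take i p)) (drop i p))"
  by (simp add: coeff_def[of "path_mult f g"] lookup_path_mult) (simp add: coeff_def path_target_take_drop)

lemma path_mult_closed:
  assumes f: "f \<in> path_functions" and g: "g \<in> path_functions"
  shows "path_mult f g \<in> path_functions"
  unfolding path_functions_def
proof (intro CollectI allI impI)
  fix u p w assume "Poly_Mapping.lookup (path_mult f g) (u, p, w) \<noteq> 0"
  then obtain i where "coeff f u (take i p) * Poly_Mapping.lookup g (path_target G u (take i p), drop i p, w) \<noteq> 0"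
    unfolding lookup_path_mult[OF f] by (meson sum.not_neutral_contains_not_neutral)
  then have "is_path G u (take i p)" "awalk (path_target G u (take i p)) (drop i p) w"
    using coeff_off[OF f] path_functionsD[OF g] by auto
  then show "awalk u p w"
    using awalk_appendI[of u "take i p" "path_target G u (take i p)" "drop i p" w] by (simp add: awalk_is_path)
qed

lemma path_mult_assoc:
  assumes f: "f \<in> path_functions" and g: "g \<in> path_functions" and h: "h \<in> path_functions"
  shows "path_mult (path_mult f g) h = path_mult f (path_mult g h)"
proof (rule path_functions_eqI)
  fix u p
  let ?t = "\<lambda>i. path_target G u (take i p)"
  let ?F = "\<lambda>j i. coeff f u (take j p) * coeff g (?t j) (take (i - j) (drop j p)) * coeff h (?t i) (drop i p)"
  have "coeff (path_mult (path_mult f g) h) u p = (\<Sum>i\<le>length p. \<Sum>j\<le>i. ?F j i)"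
    unfolding coeff_path_mult[OF path_mult_closed[OF f g]]
    by (intro sum.cong refl) (simp add: coeff_path_mult[OF f] sum_distrib_right min_absorb2 drop_take min_absorb1)
  also have "\<dots> = (\<Sum>(i, j)\<in>(SIGMA i:{..length p}. {..i}). ?F j i)"
    by (rule sum.Sigma) auto
  \<comment> \<open>The cuts j <= i of a path into three pieces are described instead by j and the
    length i - j of the middle piece.\<close>
  also have "\<dots> = (\<Sum>(j, i)\<in>(SIGMA j:{..length p}. {..length p - j}). ?F j (j + i))"
    by (rule sum.reindex_bij_witness[of _ "\<lambda>(j, i). (j + i, j)" "\<lambda>(i, j). (j, i - j)"]) auto
  also have "\<dots> = (\<Sum>j\<le>length p. \<Sum>i\<le>length p - j. ?F j (j + i))"
    by (rule sum.Sigma[symmetric]) auto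
  also have "\<dots> = coeff (path_mult f (path_mult g h)) u p"
    unfolding coeff_path_mult[OF f]
    by (intro sum.cong refl)
      (simp add: coeff_path_mult[OF g] sum_distrib_left mult.assoc take_add path_target_append add.commute)
  finally show "coeff (path_mult (path_mult f g) h) u p = coeff (path_mult f (path_mult g h)) u p" .
qed (simp_all add: path_mult_closed f g h)

lemma one_closed: "(\<Sum>v\<in>verts G. Poly_Mapping.single (v, [], v) 1) \<in> path_functions"
  using path_functions_closed(4)[where p = "[]"] by (intro path_functions_sum) auto

lemma coeff_one: "coeff (\<Sum>v\<in>verts G. Poly_Mapping.single (v, [], v) 1) u p = (if u \<in> verts G \<and> p = [] then 1 else 0)"
proof -
  have "coeff (\<Sum>v\<in>verts G. Poly_Mapping.single (v, [], v) 1) u p = (\<Sum>v\<in>verts G. if u = v \<and> p = [] then 1 else 0)"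
    unfolding coeff_sum by (intro sum.cong) (auto simp: coeff_single[where q = "[]", simplified])
  then show ?thesis by (cases "p = []") auto
qed

lemma path_algebra_ring: "ring (path_algebra TYPE('k::field) G)"
proof (intro ringI abelian_groupI monoidI, unfold path_algebra_simps)
  fix f g h :: "('a, 'b) path \<Rightarrow>\<^sub>0 'k"
  let ?one = "\<Sum>v\<in>verts G. Poly_Mapping.single (v, [], v) 1 :: ('a, 'b) path \<Rightarrow>\<^sub>0 'k"
  assume f: "f \<in> path_functions"
  show "\<exists>y\<in>path_functions. y + f = 0" using path_functions_closed(3)[OF f] by (intro bexI[of _ "- f"]) auto
  show "path_mult ?one f = f"
  proof (rule path_functions_eqI)
    fix u p assume u: "is_path G u p"
    have "coeff (path_mult ?one f) u p = (\<Sum>i\<le>length p. if i = 0 then coeff f u p else 0)"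
      unfolding coeff_path_mult[OF one_closed] using is_path_source[OF u]
      by (intro sum.cong refl) (auto simp: coeff_one)
    then show "coeff (path_mult ?one f) u p = coeff f u p" by simp
  qed (simp_all add: path_mult_closed one_closed f)
  show "path_mult f ?one = f"
  proof (rule path_functions_eqI)
    fix u p assume u: "is_path G u p"
    have "coeff (path_mult f ?one) u p = (\<Sum>i\<le>length p. if i = length p then coeff f u p else 0)"
      unfolding coeff_path_mult[OF f] using is_path_target[OF u]
      by (intro sum.cong refl) (auto simp: coeff_one)
    then show "coeff (path_mult f ?one) u p = coeff f u p" by simp
  qed (simp_all add: path_mult_closed one_closed f)
  assume g: "g \<in> path_functions" and h: "h \<in> path_functions"
  show "path_mult (f + g) h = path_mult f h + path_mult g h"
    by (rule path_functions_eqI)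
      (simp_all add: path_mult_closed path_functions_closed f g h coeff_path_mult coeff_add sum.distrib distrib_right)
  show "path_mult h (f + g) = path_mult h f + path_mult h g"
    by (rule path_functions_eqI)
      (simp_all add: path_mult_closed path_functions_closed f g h coeff_path_mult coeff_add sum.distrib distrib_left)
qed (auto simp: path_functions_closed path_mult_closed one_closed path_mult_assoc add_ac)

section \<open>Powers of the arrow ideal and the truncated algebra\<close>

text \<open>The combinations of paths of length at least l; proved below to be the l-th power of the
  arrow ideal.\<close>

definition long_functions :: "nat \<Rightarrow> (('a, 'b) path \<Rightarrow>\<^sub>0 'k::field) set" where
  "long_functions l = {f \<in> path_functions. \<forall>u p. length p < l \<longrightarrow> coeff f u p = 0}"

lemma long_functions_ideal: "ideal (long_functions l) (path_algebra TYPE('k::field) G)"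
proof (rule idealI[OF path_algebra_ring])
  show "subgroup (long_functions l) (add_monoid (path_algebra TYPE('k::field) G))"
  proof (rule group.subgroupI)
    show "Group.group (add_monoid (path_algebra TYPE('k::field) G))"
      using ring.is_abelian_group[OF path_algebra_ring] abelian_group.a_group by blast
    show "long_functions l \<subseteq> carrier (add_monoid (path_algebra TYPE('k::field) G))"
      by (auto simp: long_functions_def path_algebra_simps)
    have "0 \<in> long_functions l" by (simp add: long_functions_def path_functions_closed coeff_zero)
    then show "long_functions l \<noteq> {}" by blast
    fix f g :: "('a, 'b) path \<Rightarrow>\<^sub>0 'k" assume f: "f \<in> long_functions l"
    have "inv\<^bsub>add_monoid (path_algebra TYPE('k::field) G)\<^esub> f = - f"
    proof (rule group.inv_equality)
      show "Group.group (add_monoid (path_algebra TYPE('k::field) G))"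
        using ring.is_abelian_group[OF path_algebra_ring] abelian_group.a_group by blast
    qed (use f in \<open>auto simp: long_functions_def path_algebra_simps path_functions_closed\<close>)
    then show "inv\<^bsub>add_monoid (path_algebra TYPE('k::field) G)\<^esub> f \<in> long_functions l"
      using f by (auto simp: long_functions_def path_functions_closed coeff_def)
    assume "g \<in> long_functions l"
    then show "f \<otimes>\<^bsub>add_monoid (path_algebra TYPE('k::field) G)\<^esub> g \<in> long_functions l"
      using f by (auto simp: long_functions_def path_functions_closed path_algebra_simps coeff_add)
  qed
next
  fix a x :: "('a, 'b) path \<Rightarrow>\<^sub>0 'k" assume a: "a \<in> long_functions l" and x: "x \<in> carrier (path_algebra TYPE('k) G)"
  show "x \<otimes>\<^bsub>path_algebra TYPE('k) G\<^esub> a \<in> long_functions l" "a \<otimes>\<^bsub>path_algebra TYPE('k) G\<^esub> x \<in> long_functions l"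
    using a x by (auto simp: long_functions_def path_algebra_simps path_mult_closed coeff_path_mult intro!: sum.neutral)
qed

text \<open>These elements are finite sums of multiples of single long paths, so it suffices to
  treat such multiples and sums.\<close>

lemma long_functions_induct:
  assumes f: "f \<in> long_functions l" and z: "0 \<in> I" and add: "\<And>g h. \<lbrakk>g \<in> I; h \<in> I\<rbrakk> \<Longrightarrow> g + h \<in> I"
    and s: "\<And>u p c. \<lbrakk>is_path G u p; l \<le> length p\<rbrakk> \<Longrightarrow> Poly_Mapping.single (u, p, path_target G u p) c \<in> I"
  shows "f \<in> I"
proof -
  have "(\<Sum>x\<in>A. Poly_Mapping.single x (Poly_Mapping.lookup f x)) \<in> I" if "A \<subseteq> Poly_Mapping.keys f" for A
  proof -
    have "finite A" by (rule finite_subset[OF that]) simp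
    then show ?thesis using that
    proof (induction A rule: finite_induct)
      case (insert x A)
      obtain u p v where x: "x = (u, p, v)" by (cases x)
      have "Poly_Mapping.lookup f (u, p, v) \<noteq> 0" using insert.prems by (auto simp: x in_keys_iff)
      then have "is_path G u p" "v = path_target G u p" "l \<le> length p"
        using f path_functionsD[of f u p v] by (auto simp: long_functions_def awalk_is_path coeff_def not_less[symmetric])
      then have "Poly_Mapping.single x (Poly_Mapping.lookup f x) \<in> I" using s x by simp
      then show ?case using add insert by simp
    qed (simp add: z)
  qed
  from this[of "Poly_Mapping.keys f"] have "(\<Sum>x\<in>Poly_Mapping.keys f. Poly_Mapping.single x (Poly_Mapping.lookup f x)) \<in> I" by simp
  moreover have "(\<Sum>x\<in>Poly_Mapping.keys f. Poly_Mapping.single x (Poly_Mapping.lookup f x)) = f"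
    by (rule poly_mapping_eqI) (auto simp: lookup_sum lookup_single when_def in_keys_iff)
  ultimately show ?thesis by simp
qed

lemma path_mult_single:
  assumes "is_path G u (p @ q)"
  shows "path_mult (Poly_Mapping.single (u, p, path_target G u p) 1)
      (Poly_Mapping.single (path_target G u p, q, path_target G (path_target G u p) q) c)
    = Poly_Mapping.single (u, p @ q, path_target G u (p @ q)) (c::'k::field)"
  by (cases "c = 0") (simp_all add: path_mult_def path_target_append)

text \<open>A path of positive length is its first arrow times the rest, hence lies in the ideal
  generated by the arrows; the converse holds because the paths of positive length span an
  ideal.\<close>

lemma arrow_ideal_eq: "arrow_ideal TYPE('k::field) G = long_functions 1"
proof
  let ?P = "path_algebra TYPE('k::field) G"
  let ?S = "(\<lambda>a. Poly_Mapping.single (tail G a, [a], head G a) 1) ` arcs G :: (('a, 'b) path \<Rightarrow>\<^sub>0 'k) set"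
  interpret P: ring ?P by (rule path_algebra_ring)
  have single: "Poly_Mapping.single (tail G a, [a], head G a) 1 \<in> path_functions" if "a \<in> arcs G" for a
    using path_functions_closed(4)[of "tail G a" "[a]"] that by simp
  then have S: "?S \<subseteq> carrier ?P" by (auto simp: path_algebra_simps)
  have "?S \<subseteq> long_functions 1"
    using single by (auto simp: long_functions_def coeff_single[of "tail G a" "[a]" for a, simplified])
  then show "arrow_ideal TYPE('k) G \<subseteq> long_functions 1"
    unfolding arrow_ideal_def by (rule P.genideal_minimal[OF long_functions_ideal])
  interpret I: ideal "arrow_ideal TYPE('k) G" ?P
    unfolding arrow_ideal_def by (rule P.genideal_ideal[OF S])
  show "long_functions 1 \<subseteq> arrow_ideal TYPE('k) G"
  proof
    fix f :: "('a, 'b) path \<Rightarrow>\<^sub>0 'k" assume "f \<in> long_functions 1"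
    then show "f \<in> arrow_ideal TYPE('k) G"
    proof (rule long_functions_induct)
      show "0 \<in> arrow_ideal TYPE('k) G" using I.zero_closed by (simp add: path_algebra_simps)
      show "g + h \<in> arrow_ideal TYPE('k) G" if "g \<in> arrow_ideal TYPE('k) G" "h \<in> arrow_ideal TYPE('k) G" for g h
        using I.a_closed[OF that] by (simp add: path_algebra_simps)
      fix u p c assume p: "is_path G u p" "1 \<le> length p"
      then obtain a q where a: "p = a # q" by (cases p) auto
      have "Poly_Mapping.single (tail G a, [a], head G a) 1 \<in> arrow_ideal TYPE('k) G"
        unfolding arrow_ideal_def using p(1) a by (intro subsetD[OF P.genideal_self[OF S]]) auto
      moreover have "Poly_Mapping.single (head G a, q, path_target G (head G a) q) c \<in> carrier ?P"
        using p(1) a by (simp add: path_algebra_simps path_functions_closed)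
      ultimately have "path_mult (Poly_Mapping.single (tail G a, [a], head G a) 1)
          (Poly_Mapping.single (head G a, q, path_target G (head G a) q) c) \<in> arrow_ideal TYPE('k) G"
        using I.I_r_closed by (simp add: path_algebra_simps)
      then show "Poly_Mapping.single (u, p, path_target G u p) c \<in> arrow_ideal TYPE('k) G"
        using path_mult_single[of u "[a]" q c] p(1) a by simp
    qed
  qed
qed

lemma arrow_ideal_power:
  "arrow_ideal TYPE('k::field) G [^]\<^bsub>ideals_set (path_algebra TYPE('k) G)\<^esub> (n::nat) = long_functions n"
proof (induction n)
  case 0
  \<comment> \<open>The zeroth power in the monoid of ideals is its unit, the whole ring, and the
    length condition for 0 is void.\<close>
  show ?case by (auto simp: nat_pow_def ideals_set_def path_algebra_simps long_functions_def)
next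
  case (Suc n)
  let ?P = "path_algebra TYPE('k::field) G"
  have "arrow_ideal TYPE('k) G [^]\<^bsub>ideals_set ?P\<^esub> Suc n = ideal_prod ?P (long_functions n) (long_functions 1)"
    using Suc unfolding arrow_ideal_eq by (simp add: nat_pow_def ideals_set_def)
  also have "\<dots> = long_functions (Suc n)"
  proof
    show "ideal_prod ?P (long_functions n) (long_functions 1) \<subseteq> long_functions (Suc n)"
    proof
      fix x assume "x \<in> ideal_prod ?P (long_functions n) (long_functions 1)"
      then show "x \<in> long_functions (Suc n)"
      proof induction
        case (prod f g)
        have "coeff f u (take i p) * coeff g (path_target G u (take i p)) (drop i p) = 0" if "length p < Suc n" "i \<le> length p" for u p i
        proof (cases "i < n")
          case True
          then have "coeff f u (take i p) = 0" using prod(1) that by (simp add: long_functions_def)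
          then show ?thesis by simp
        next
          case False
          then have "coeff g (path_target G u (take i p)) (drop i p) = 0" using prod(2) that by (simp add: long_functions_def)
          then show ?thesis by simp
        qed
        then have "(\<Sum>i\<le>length p. coeff f u (take i p) * coeff g (path_target G u (take i p)) (drop i p)) = 0" if "length p < Suc n" for u p
          using that by (intro sum.neutral) auto
        then show ?case using prod by (simp add: long_functions_def path_algebra_simps path_mult_closed coeff_path_mult)
      next
        case (sum f g)
        then show ?case by (simp add: long_functions_def path_algebra_simps path_functions_closed coeff_add)
      qed
    qed
    show "long_functions (Suc n) \<subseteq> ideal_prod ?P (long_functions n) (long_functions 1)"
    proof
      fix f :: "('a, 'b) path \<Rightarrow>\<^sub>0 'k" assume "f \<in> long_functions (Suc n)"
      then show "f \<in> ideal_prod ?P (long_functions n) (long_functions 1)"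
      proof (rule long_functions_induct)
        have "path_mult 0 0 \<in> ideal_prod ?P (long_functions n) (long_functions 1)"
          using ideal_prod.prod[of 0 "long_functions n" 0 "long_functions 1" ?P]
          by (simp add: path_algebra_simps long_functions_def path_functions_closed coeff_zero)
        then show "0 \<in> ideal_prod ?P (long_functions n) (long_functions 1)" by (simp add: path_mult_def)
        show "g + h \<in> ideal_prod ?P (long_functions n) (long_functions 1)"
          if "g \<in> ideal_prod ?P (long_functions n) (long_functions 1)" "h \<in> ideal_prod ?P (long_functions n) (long_functions 1)" for g h
          using ideal_prod.sum[OF that] by (simp add: path_algebra_simps)
        fix u p and c :: 'k assume p: "is_path G u p" "Suc n \<le> length p"
        \<comment> \<open>A path of length at least n + 1 is cut after n arrows, which leaves a
          second factor of positive length carrying the coefficient.\<close>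
        let ?t = "path_target G u (take n p)"
        have q: "is_path G u (take n p)" "is_path G ?t (drop n p)"
          using p(1) is_path_append[of u "take n p" "drop n p"] by auto
        have "Poly_Mapping.single (u, take n p, ?t) (1::'k) \<in> long_functions n"
          "Poly_Mapping.single (?t, drop n p, path_target G ?t (drop n p)) c \<in> long_functions 1"
          using q p(2) by (auto simp: long_functions_def path_functions_closed coeff_single)
        from ideal_prod.prod[OF this, of ?P] path_mult_single[of u "take n p" "drop n p" c] p(1)
        show "Poly_Mapping.single (u, p, path_target G u p) c \<in> ideal_prod ?P (long_functions n) (long_functions 1)"
          by (simp add: path_algebra_simps)
      qed
    qed
  qed
  finally show ?case .
qed

text \<open>The coefficient of an arbitrary representative of the coset. For paths shorter than n it
  does not depend on the representative, since elements of the ideal vanish there.\<close>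

definition truncated_coeff :: "nat \<Rightarrow> (('a, 'b) path \<Rightarrow>\<^sub>0 'k::field) set \<Rightarrow> 'a \<times> 'b list \<Rightarrow> 'k" where
  "truncated_coeff n X z = (if is_path G (fst z) (snd z) \<and> length (snd z) < n then coeff (SOME f. f \<in> X) (fst z) (snd z) else 0)"

text \<open>Connects the algebra of the theorem with the axiomatic locale: every element is a coset
  of a path function, and the ring operations on cosets reduce to those on coefficients of
  representatives.\<close>

lemma truncated_path_coefficients:
  assumes n: "n > 0"
  shows "path_coefficients G (truncated_path_algebra TYPE('k::field) G n) n
    (truncated_coeff n :: (('a, 'b) path \<Rightarrow>\<^sub>0 'k) set \<Rightarrow> 'a \<times> 'b list \<Rightarrow> 'k)"
proof -
  let ?P = "path_algebra TYPE('k) G" and ?I = "long_functions n :: (('a, 'b) path \<Rightarrow>\<^sub>0 'k) set"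
  interpret I: ideal ?I ?P by (rule long_functions_ideal)
  interpret h: ring_hom_ring ?P "?P Quot ?I" "(+>\<^bsub>?P\<^esub>) ?I" by (rule I.rcos_ring_hom_ring)
  have R: "truncated_path_algebra TYPE('k) G n = ?P Quot ?I"
    by (simp add: truncated_path_algebra_def arrow_ideal_power)
  have co: "truncated_coeff n (?I +>\<^bsub>?P\<^esub> f) (u, p) = (if is_path G u p \<and> length p < n then coeff f u p else 0)"
    if f: "f \<in> path_functions" for f u p
  proof -
    have "f \<in> ?I +>\<^bsub>?P\<^esub> f" using I.a_rcos_self f by (simp add: path_algebra_simps)
    then have "(SOME g. g \<in> ?I +>\<^bsub>?P\<^esub> f) \<in> ?I +>\<^bsub>?P\<^esub> f" by (rule someI)
    then obtain g where g: "g \<in> ?I" "(SOME g. g \<in> ?I +>\<^bsub>?P\<^esub> f) = g + f"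
      by (auto simp: a_r_coset_def' path_algebra_simps)
    then show ?thesis by (simp add: truncated_coeff_def coeff_add long_functions_def)
  qed
  have ex: "\<exists>f\<in>path_functions. X = ?I +>\<^bsub>?P\<^esub> f" if "X \<in> carrier (?P Quot ?I)" for X
    using that by (auto simp: FactRing_def A_RCOSETS_def' path_algebra_simps)
  show ?thesis
    unfolding R
  proof (intro path_coefficients.intro path_coefficients_axioms.intro)
    show "fin_digraph G" by unfold_locales
    show "ring (?P Quot ?I)" by (rule I.quotient_is_ring)
    show "0 < n" by (rule n)
  next
    fix X Y assume X: "X \<in> carrier (?P Quot ?I)" and Y: "Y \<in> carrier (?P Quot ?I)"
    obtain f g where f: "f \<in> path_functions" "X = ?I +>\<^bsub>?P\<^esub> f" and g: "g \<in> path_functions" "Y = ?I +>\<^bsub>?P\<^esub> g"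
      using ex[OF X] ex[OF Y] by blast
    have s: "X \<oplus>\<^bsub>?P Quot ?I\<^esub> Y = ?I +>\<^bsub>?P\<^esub> (f + g)"
      using h.hom_add[of f g] f g by (simp add: path_algebra_simps)
    show "truncated_coeff n (X \<oplus>\<^bsub>?P Quot ?I\<^esub> Y) z = truncated_coeff n X z + truncated_coeff n Y z" for z
      unfolding s unfolding f(2) g(2) using co[OF f(1), of "fst z" "snd z"] co[OF g(1), of "fst z" "snd z"]
        co[OF path_functions_closed(2)[OF f(1) g(1)], of "fst z" "snd z"] by (simp add: coeff_add)
    show "X = Y" if eq: "truncated_coeff n X = (truncated_coeff n Y :: _ \<Rightarrow> 'k)"
    proof -
      have "coeff f u p = coeff g u p" if "length p < n" for u p
      proof (cases "is_path G u p")
        case True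
        then show ?thesis using fun_cong[OF eq, of "(u, p)"] that by (simp add: f(2) g(2) co f(1) g(1))
      qed (simp add: coeff_off f(1) g(1))
      then have "f + - g \<in> ?I"
        using path_functions_closed(2)[OF f(1) path_functions_closed(3)[OF g(1)]]
        by (simp add: long_functions_def coeff_def lookup_minus)
      moreover have "f = (f + - g) \<oplus>\<^bsub>?P\<^esub> g" by (simp add: path_algebra_simps)
      ultimately have fg: "f \<in> ?I +>\<^bsub>?P\<^esub> g" unfolding a_r_coset_def' by blast
      show ?thesis unfolding f(2) g(2)
        by (rule I.a_repr_independence[OF fg _ I.a_subgroup, symmetric]) (use g(1) in \<open>simp add: path_algebra_simps\<close>)
    qed
    have m: "X \<otimes>\<^bsub>?P Quot ?I\<^esub> Y = ?I +>\<^bsub>?P\<^esub> (path_mult f g)"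
      using h.hom_mult[of f g] f g by (simp add: path_algebra_simps)
    fix u p assume u: "is_path G u p" "length p < n"
    have pieces: "is_path G u (take i p)" "is_path G (path_target G u (take i p)) (drop i p)" for i
      using u(1) is_path_append[of u "take i p" "drop i p"] by auto
    show "truncated_coeff n (X \<otimes>\<^bsub>?P Quot ?I\<^esub> Y) (u, p) =
        (\<Sum>i\<le>length p. truncated_coeff n X (u, take i p) * truncated_coeff n Y (path_target G u (take i p), drop i p))"
      unfolding m unfolding f(2) g(2) using u pieces
      by (simp add: co path_mult_closed f(1) g(1) coeff_path_mult min_less_iff_disj less_imp_diff_less)
  next
    fix f :: "'a \<times> 'b list \<Rightarrow> 'k"
    let ?Z = "{z. is_path G (fst z) (snd z) \<and> length (snd z) < n}"
    let ?s = "\<lambda>z. Poly_Mapping.single (fst z, snd z, path_target G (fst z) (snd z)) (f z)"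
    have c: "sum ?s ?Z \<in> path_functions" by (intro path_functions_sum) (auto intro: path_functions_closed)
    have "coeff (sum ?s ?Z) u p = f (u, p)" if u: "is_path G u p" "length p < n" for u p
    proof -
      have "coeff (sum ?s ?Z) u p = (\<Sum>z\<in>?Z. if z = (u, p) then f (u, p) else 0)"
        unfolding coeff_sum by (intro sum.cong refl) (auto simp: coeff_single)
      then show ?thesis using u finite_paths[of n] by simp
    qed
    then show "\<exists>X\<in>carrier (?P Quot ?I). \<forall>u p. truncated_coeff n X (u, p) = (if is_path G u p \<and> length p < n then f (u, p) else 0)"
      using h.hom_closed[of "sum ?s ?Z"] c by (intro bexI[of _ "?I +>\<^bsub>?P\<^esub> sum ?s ?Z"]) (auto simp: co path_algebra_simps)
  next
    fix X u p assume "\<not> (is_path G u p \<and> length p < n)"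
    then show "truncated_coeff n X (u, p) = (0::'k)" by (auto simp: truncated_coeff_def)
  next
    fix u p assume u: "is_path G u p"
    have "truncated_coeff n \<one>\<^bsub>?P Quot ?I\<^esub> (u, p) = truncated_coeff n (?I +>\<^bsub>?P\<^esub> \<one>\<^bsub>?P\<^esub>) (u, p)"
      by (simp add: h.hom_one)
    also have "\<dots> = (if p = [] then 1 else 0)"
      using u n co[OF one_closed] is_path_source[OF u] by (auto simp: path_algebra_simps coeff_one)
    finally show "truncated_coeff n \<one>\<^bsub>?P Quot ?I\<^esub> (u, p) = (if p = [] then 1 else (0::'k))" .
  qed
qed

end

subsection \<open>Self-injectivity\<close>

context path_coefficients
begin

section \<open>Extension of linear functionals, and the Frobenius form\<close>

definition k_functional :: "('r, 'a) module \<Rightarrow> ('a \<Rightarrow> 'f) \<Rightarrow> bool" where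
  "k_functional M \<phi> \<longleftrightarrow> (\<forall>x\<in>carrier M. \<forall>y\<in>carrier M. \<phi> (x \<oplus>\<^bsub>M\<^esub> y) = \<phi> x + \<phi> y) \<and>
     (\<forall>c. \<forall>x\<in>carrier M. \<phi> (sc c \<odot>\<^bsub>M\<^esub> x) = c * \<phi> x)"

lemma k_functionalD:
  assumes "k_functional M \<phi>"
  shows "\<lbrakk>x \<in> carrier M; y \<in> carrier M\<rbrakk> \<Longrightarrow> \<phi> (x \<oplus>\<^bsub>M\<^esub> y) = \<phi> x + \<phi> y"
    "x \<in> carrier M \<Longrightarrow> \<phi> (sc c \<odot>\<^bsub>M\<^esub> x) = c * \<phi> x"
  using assms by (auto simp: k_functional_def)

text \<open>A subspace W maximal among those avoiding z has codimension one: if y is not in W, then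
  W + ky contains z, and solving for y gives y in W + kz. The functional reads off the coefficient
  of z.\<close>

lemma k_functional_decompose:
  assumes M: "right_module R M" and z: "z \<in> carrier M" and W: "k_subspace M W" "z \<notin> W"
    and max: "\<forall>V. k_subspace M V \<and> W \<subseteq> V \<and> z \<notin> V \<longrightarrow> V = W"
  shows "\<exists>\<psi>. k_functional M \<psi> \<and> (\<forall>w\<in>W. \<forall>c. \<psi> (w \<oplus>\<^bsub>M\<^esub> sc c \<odot>\<^bsub>M\<^esub> z) = c)"
proof -
  interpret M: right_module R M by fact
  have Wc: "w \<in> carrier M" if "w \<in> W" for w using that W(1) by (auto simp: k_subspace_def)
  have W0: "\<zero>\<^bsub>M\<^esub> \<in> W" and Wadd: "\<And>v w. \<lbrakk>v \<in> W; w \<in> W\<rbrakk> \<Longrightarrow> v \<oplus>\<^bsub>M\<^esub> w \<in> W"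
    and Wsc: "\<And>c w. w \<in> W \<Longrightarrow> sc c \<odot>\<^bsub>M\<^esub> w \<in> W"
    using W(1) by (auto simp: k_subspace_def)
  have smc: "sc c \<odot>\<^bsub>M\<^esub> x \<in> carrier M" if "x \<in> carrier M" for c x
    using that by (simp add: M.rsmult_closed)
  have add: "(w \<oplus>\<^bsub>M\<^esub> sc c \<odot>\<^bsub>M\<^esub> x) \<oplus>\<^bsub>M\<^esub> (w' \<oplus>\<^bsub>M\<^esub> sc c' \<odot>\<^bsub>M\<^esub> x) = (w \<oplus>\<^bsub>M\<^esub> w') \<oplus>\<^bsub>M\<^esub> sc (c + c') \<odot>\<^bsub>M\<^esub> x"
    if "w \<in> W" "w' \<in> W" "x \<in> carrier M" for w w' c c' x
    using that by (simp add: Wc smc sc_add M.rsmult_add_scalar M.a_ac)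
  have mult: "sc d \<odot>\<^bsub>M\<^esub> (w \<oplus>\<^bsub>M\<^esub> sc c \<odot>\<^bsub>M\<^esub> x) = sc d \<odot>\<^bsub>M\<^esub> w \<oplus>\<^bsub>M\<^esub> sc (c * d) \<odot>\<^bsub>M\<^esub> x"
    if "w \<in> W" "x \<in> carrier M" for w c d x
    using that by (simp add: Wc smc sc_mult M.rsmult_add M.rsmult_assoc)
  have scd: "sc d \<odot>\<^bsub>M\<^esub> (sc c \<odot>\<^bsub>M\<^esub> x) = sc (c * d) \<odot>\<^bsub>M\<^esub> x" if "x \<in> carrier M" for c d x
    using that by (simp add: sc_mult M.rsmult_assoc)
  have one: "sc 1 \<odot>\<^bsub>M\<^esub> x = x" if "x \<in> carrier M" for x
    using that by (simp add: sc_one M.rsmult_one)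
  have zero: "sc 0 \<odot>\<^bsub>M\<^esub> x = \<zero>\<^bsub>M\<^esub>" if "x \<in> carrier M" for x
    using that by (simp add: sc_zero M.rsmult_zero_scalar)
  have key: "y \<in> W" if "w \<in> W" "v \<in> W" "d \<noteq> 0" "y \<in> carrier M" "w \<oplus>\<^bsub>M\<^esub> sc d \<odot>\<^bsub>M\<^esub> y = v" for w v d y
  proof -
    have "\<ominus>\<^bsub>M\<^esub> w \<oplus>\<^bsub>M\<^esub> v = sc d \<odot>\<^bsub>M\<^esub> y"
      using that(1,4) by (simp add: that(5)[symmetric] Wc smc M.r_neg1)
    then have "sc d \<odot>\<^bsub>M\<^esub> y \<in> W"
      using Wadd[OF k_subspace_minus[OF M W(1) that(1)] that(2)] by simp
    from Wsc[OF this, of "inverse d"] show ?thesis using that(3,4) by (simp add: scd one)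
  qed
  have ex: "\<exists>c. \<exists>w\<in>W. y = w \<oplus>\<^bsub>M\<^esub> sc c \<odot>\<^bsub>M\<^esub> z" if y: "y \<in> carrier M" for y
  proof (cases "y \<in> W")
    case True
    then show ?thesis by (intro exI[of _ 0] bexI[of _ y]) (simp_all add: zero z y)
  next
    case False
    let ?V = "{w \<oplus>\<^bsub>M\<^esub> sc d \<odot>\<^bsub>M\<^esub> y | w d. w \<in> W}"
    have "k_subspace M ?V"
      unfolding k_subspace_def
    proof (intro conjI ballI allI)
      show "?V \<subseteq> carrier M" using Wc smc[OF y] by auto
      show "\<zero>\<^bsub>M\<^esub> \<in> ?V" using W0 zero[OF y] by (intro CollectI exI[of _ "\<zero>\<^bsub>M\<^esub>"] exI[of _ 0]) simp
      fix a assume "a \<in> ?V"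
      then obtain w c where a: "a = w \<oplus>\<^bsub>M\<^esub> sc c \<odot>\<^bsub>M\<^esub> y" "w \<in> W" by blast
      show "sc d \<odot>\<^bsub>M\<^esub> a \<in> ?V" for d using mult[OF a(2) y, of d c] a Wsc[OF a(2), of d] by blast
      fix b assume "b \<in> ?V"
      then obtain w' c' where b: "b = w' \<oplus>\<^bsub>M\<^esub> sc c' \<odot>\<^bsub>M\<^esub> y" "w' \<in> W" by blast
      show "a \<oplus>\<^bsub>M\<^esub> b \<in> ?V" using add[OF a(2) b(2) y, of c c'] a b Wadd[OF a(2) b(2)] by blast
    qed
    moreover have "W \<subseteq> ?V"
    proof
      fix w assume w: "w \<in> W"
      then have "w = w \<oplus>\<^bsub>M\<^esub> sc 0 \<odot>\<^bsub>M\<^esub> y" by (simp add: zero y Wc)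
      then show "w \<in> ?V" using w by blast
    qed
    moreover have "y \<in> ?V"
    proof -
      have "y = \<zero>\<^bsub>M\<^esub> \<oplus>\<^bsub>M\<^esub> sc 1 \<odot>\<^bsub>M\<^esub> y" by (simp add: one y)
      then show ?thesis using W0 by blast
    qed
    ultimately have "z \<in> ?V" using max False by blast
    then obtain w d where wd: "z = w \<oplus>\<^bsub>M\<^esub> sc d \<odot>\<^bsub>M\<^esub> y" "w \<in> W" by blast
    have "d \<noteq> 0" using W(2) wd y by (auto simp: zero Wc)
    then have "sc (inverse d) \<odot>\<^bsub>M\<^esub> z = sc (inverse d) \<odot>\<^bsub>M\<^esub> w \<oplus>\<^bsub>M\<^esub> y"
      using wd y by (simp add: mult one)
    then have "y = \<ominus>\<^bsub>M\<^esub> (sc (inverse d) \<odot>\<^bsub>M\<^esub> w) \<oplus>\<^bsub>M\<^esub> sc (inverse d) \<odot>\<^bsub>M\<^esub> z"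
      using y wd(2) by (simp add: Wc smc M.r_neg1)
    then show ?thesis using k_subspace_minus[OF M W(1) Wsc[OF wd(2)]] by blast
  qed
  have uniq: "c = c'" if "w \<in> W" "w' \<in> W" "w \<oplus>\<^bsub>M\<^esub> sc c \<odot>\<^bsub>M\<^esub> z = w' \<oplus>\<^bsub>M\<^esub> sc c' \<odot>\<^bsub>M\<^esub> z" for w w' c c'
  proof (rule ccontr)
    assume "c \<noteq> c'"
    then have d: "c + - c' \<noteq> 0" by simp
    have "(w \<oplus>\<^bsub>M\<^esub> sc c \<odot>\<^bsub>M\<^esub> z) \<oplus>\<^bsub>M\<^esub> (\<zero>\<^bsub>M\<^esub> \<oplus>\<^bsub>M\<^esub> sc (- c') \<odot>\<^bsub>M\<^esub> z) = (w' \<oplus>\<^bsub>M\<^esub> sc c' \<odot>\<^bsub>M\<^esub> z) \<oplus>\<^bsub>M\<^esub> (\<zero>\<^bsub>M\<^esub> \<oplus>\<^bsub>M\<^esub> sc (- c') \<odot>\<^bsub>M\<^esub> z)"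
      using that(3) by simp
    then have "w \<oplus>\<^bsub>M\<^esub> sc (c + - c') \<odot>\<^bsub>M\<^esub> z = w'"
      using that(1,2) unfolding add[OF that(1) W0 z] add[OF that(2) W0 z] by (simp add: zero z Wc)
    from key[OF that(1,2) d z this] W(2) show False by contradiction
  qed
  define \<psi> where "\<psi> y = (THE c. \<exists>w\<in>W. y = w \<oplus>\<^bsub>M\<^esub> sc c \<odot>\<^bsub>M\<^esub> z)" for y
  have \<psi>: "\<psi> (w \<oplus>\<^bsub>M\<^esub> sc c \<odot>\<^bsub>M\<^esub> z) = c" if "w \<in> W" for w c
    unfolding \<psi>_def using that uniq by (intro the_equality) blast+
  have "k_functional M \<psi>"
    unfolding k_functional_def
  proof (intro conjI ballI allI)
    fix x y assume "x \<in> carrier M" "y \<in> carrier M"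
    then obtain c w d v where x: "x = w \<oplus>\<^bsub>M\<^esub> sc c \<odot>\<^bsub>M\<^esub> z" "w \<in> W" and y: "y = v \<oplus>\<^bsub>M\<^esub> sc d \<odot>\<^bsub>M\<^esub> z" "v \<in> W"
      using ex by meson
    show "\<psi> (x \<oplus>\<^bsub>M\<^esub> y) = \<psi> x + \<psi> y"
      unfolding x(1) y(1) add[OF x(2) y(2) z] using \<psi> x(2) y(2) Wadd by simp
  next
    fix a x assume "x \<in> carrier M"
    then obtain c w where x: "x = w \<oplus>\<^bsub>M\<^esub> sc c \<odot>\<^bsub>M\<^esub> z" "w \<in> W" using ex by meson
    show "\<psi> (sc a \<odot>\<^bsub>M\<^esub> x) = a * \<psi> x"
      unfolding x(1) mult[OF x(2) z] using \<psi> x(2) Wsc by simp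
  qed
  then show ?thesis using \<psi> by blast
qed

text \<open>Injectivity is tested against arbitrary modules, also of infinite dimension, so Zorn's
  lemma enters. It is applied to subspaces of Y that contain the image of the kernel of \<phi> but
  not a vector of value 1.\<close>

lemma k_functional_extension:
  assumes X: "right_module R X" and Y: "right_module R Y" and i: "i \<in> module_hom R X Y" "inj_on i (carrier X)"
    and \<phi>: "k_functional X \<phi>"
  obtains \<psi> where "k_functional Y \<psi>" "\<And>x. x \<in> carrier X \<Longrightarrow> \<psi> (i x) = \<phi> x"
proof (cases "\<forall>x\<in>carrier X. \<phi> x = 0")
  case True
  then show thesis using that[of "\<lambda>_. 0"] by (simp add: k_functional_def)
next
  case False
  then obtain x1 where x1: "x1 \<in> carrier X" "\<phi> x1 \<noteq> 0" by blast
  interpret X: right_module R X by fact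
  interpret Y: right_module R Y by fact
  interpret i: rmodule_hom R X Y i using X Y i(1) by (rule rmodule_homI)
  note add = k_functionalD(1)[OF \<phi>] and mult = k_functionalD(2)[OF \<phi>]
  \<comment> \<open>Normalised to the value 1, so that the extension can be read off as the
    coefficient of its image in the decomposition of Y.\<close>
  define x0 where "x0 = sc (inverse (\<phi> x1)) \<odot>\<^bsub>X\<^esub> x1"
  have x0: "x0 \<in> carrier X" "\<phi> x0 = 1" using x1 by (simp_all add: x0_def mult X.rsmult_closed)
  let ?N = "{x \<in> carrier X. \<phi> x = 0}"
  let ?K = "i ` ?N"
  let ?A = "{W. k_subspace Y W \<and> ?K \<subseteq> W \<and> i x0 \<notin> W}"
  have smc: "sc c \<odot>\<^bsub>X\<^esub> x \<in> carrier X" if "x \<in> carrier X" for c x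
    using that by (simp add: X.rsmult_closed)
  have \<phi>0: "\<phi> \<zero>\<^bsub>X\<^esub> = 0"
    using mult[OF X.zero_closed, of 0] by (simp add: sc_zero X.rsmult_zero_scalar)
  have "k_subspace Y ?K"
    unfolding k_subspace_def
  proof (intro conjI ballI allI)
    show "?K \<subseteq> carrier Y" using i.closed by auto
    show "\<zero>\<^bsub>Y\<^esub> \<in> ?K" using \<phi>0 by (intro image_eqI[of _ _ "\<zero>\<^bsub>X\<^esub>"]) (simp_all add: i.zero)
    fix a assume "a \<in> ?K"
    then obtain x where x: "x \<in> carrier X" "\<phi> x = 0" "a = i x" by blast
    show "sc c \<odot>\<^bsub>Y\<^esub> a \<in> ?K" for c
      using x by (intro image_eqI[of _ _ "sc c \<odot>\<^bsub>X\<^esub> x"]) (simp_all add: i.smult smc mult)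
    fix b assume "b \<in> ?K"
    then obtain y where y: "y \<in> carrier X" "\<phi> y = 0" "b = i y" by blast
    show "a \<oplus>\<^bsub>Y\<^esub> b \<in> ?K"
      using x y by (intro image_eqI[of _ _ "x \<oplus>\<^bsub>X\<^esub> y"]) (simp_all add: i.add add)
  qed
  moreover have "i x0 \<notin> ?K" 
  proof
    assume "i x0 \<in> ?K"
    then obtain x where x: "x \<in> carrier X" "\<phi> x = 0" "i x0 = i x" by blast
    have "x0 = x" by (rule inj_onD[OF i(2) x(3) x0(1) x(1)])
    then show False using x(2) x0(2) by simp
  qed
  ultimately have K: "?K \<in> ?A" by simp
  have "\<exists>W\<in>?A. \<forall>V\<in>?A. W \<subseteq> V \<longrightarrow> V = W"
  proof (rule subset_Zorn_nonempty)
    show "?A \<noteq> {}"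
    proof
      assume e: "?A = {}"
      show False using K unfolding e by (rule emptyE)
    qed
    fix C assume C: "C \<noteq> {}" "subset.chain ?A C"
    then obtain V where V: "V \<in> C" by blast
    have C2: "C \<subseteq> ?A" "\<forall>V\<in>C. \<forall>W\<in>C. V \<subseteq> W \<or> W \<subseteq> V"
      using C(2) unfolding subset_chain_def by (rule conjunct1, rule conjunct2)
    have CA: "k_subspace Y V \<and> ?K \<subseteq> V \<and> i x0 \<notin> V" if "V \<in> C" for V
      using subsetD[OF C2(1) that] by (rule CollectD)
    have ch: "V \<subseteq> W \<or> W \<subseteq> V" if "V \<in> C" "W \<in> C" for V W
      using C2(2) that by blast
    have "k_subspace Y (\<Union>C)"
      unfolding k_subspace_def
    proof (intro conjI ballI allI)
      show "\<Union>C \<subseteq> carrier Y" using CA unfolding k_subspace_def by blast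
      show "\<zero>\<^bsub>Y\<^esub> \<in> \<Union>C" using CA V unfolding k_subspace_def by blast
      show "sc c \<odot>\<^bsub>Y\<^esub> a \<in> \<Union>C" if "a \<in> \<Union>C" for a c using CA that unfolding k_subspace_def by blast
      show "a \<oplus>\<^bsub>Y\<^esub> b \<in> \<Union>C" if a: "a \<in> \<Union>C" and b: "b \<in> \<Union>C" for a b
      proof -
        obtain V W where VW: "V \<in> C" "W \<in> C" "a \<in> V" "b \<in> W" using a b by blast
        then obtain U where "U \<in> C" "a \<in> U" "b \<in> U" using ch[OF VW(1,2)] by blast
        then show ?thesis using CA[of U] unfolding k_subspace_def by blast
      qed
    qed
    moreover have "?K \<subseteq> \<Union>C" using CA[OF V] V by blast
    moreover have "i x0 \<notin> \<Union>C" using CA by blast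
    ultimately show "\<Union>C \<in> ?A" by simp
  qed
  then obtain W where WA: "W \<in> ?A" and max: "\<forall>V\<in>?A. W \<subseteq> V \<longrightarrow> V = W" by (rule bexE)
  note W = CollectD[OF WA, THEN conjunct1] CollectD[OF WA, THEN conjunct2, THEN conjunct1]
    CollectD[OF WA, THEN conjunct2, THEN conjunct2]
  have mx: "\<forall>V. k_subspace Y V \<and> W \<subseteq> V \<and> i x0 \<notin> V \<longrightarrow> V = W"
  proof (intro allI impI)
    fix V assume V: "k_subspace Y V \<and> W \<subseteq> V \<and> i x0 \<notin> V"
    then have "V \<in> ?A" using subset_trans[OF W(2)] by (intro CollectI conjI) blast+
    then show "V = W" using max V by (elim ballE impE) auto
  qed
  obtain \<psi> where \<psi>: "k_functional Y \<psi>" "\<forall>w\<in>W. \<forall>c. \<psi> (w \<oplus>\<^bsub>Y\<^esub> sc c \<odot>\<^bsub>Y\<^esub> i x0) = c"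
    using k_functional_decompose[OF Y i.closed[OF x0(1)] W(1,3) mx] by (elim exE conjE)
  have "\<psi> (i x) = \<phi> x" if x: "x \<in> carrier X" for x
  proof -
    let ?y = "x \<oplus>\<^bsub>X\<^esub> sc (- \<phi> x) \<odot>\<^bsub>X\<^esub> x0"
    have y: "?y \<in> carrier X" "\<phi> ?y = 0" using x x0 by (simp_all add: smc add mult)
    have "sc (- \<phi> x) \<odot>\<^bsub>X\<^esub> x0 \<oplus>\<^bsub>X\<^esub> sc (\<phi> x) \<odot>\<^bsub>X\<^esub> x0 = sc (- \<phi> x + \<phi> x) \<odot>\<^bsub>X\<^esub> x0"
      unfolding sc_add using x0(1) by (simp add: X.rsmult_add_scalar)
    then have "x = ?y \<oplus>\<^bsub>X\<^esub> sc (\<phi> x) \<odot>\<^bsub>X\<^esub> x0"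
      using x x0(1) by (simp add: X.a_assoc smc sc_zero X.rsmult_zero_scalar)
    then have "i x = i ?y \<oplus>\<^bsub>Y\<^esub> sc (\<phi> x) \<odot>\<^bsub>Y\<^esub> i x0"
      using i.add[OF y(1) smc[OF x0(1)], of "\<phi> x"] i.smult[of "sc (\<phi> x)" x0] x0(1) by simp
    moreover have "i ?y \<in> W" using W(2) y by blast
    ultimately show ?thesis using \<psi>(2) by simp
  qed
  then show thesis using that \<psi>(1) by blast
qed

text \<open>The composite of z and y is a path of length k - 1, the greatest length that is not
  truncated.\<close>

definition complement :: "'v \<times> 'e list \<Rightarrow> 'v \<times> 'e list \<Rightarrow> bool" where
  "complement z y \<longleftrightarrow> z \<in> paths \<and> y \<in> paths \<and> tgt (fst z) (snd z) = fst y \<and> Suc (length (snd z) + length (snd y)) = k"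

text \<open>The sum of the coefficients at all paths of greatest length k - 1; it becomes a
  Frobenius form when complements are unique.\<close>

definition socle_form :: "'r \<Rightarrow> 'f" where
  "socle_form a = (\<Sum>z\<in>{z \<in> paths. Suc (length (snd z)) = k}. co a z)"

text \<open>The product has coefficients only at paths ending in y. One of length k - 1 is a
  complement of y followed by y, and by uniqueness there is only one, so the form pairs the path
  basis with the basis of complements.\<close>

lemma socle_form_mult_pe:
  assumes a: "a \<in> carrier R" and zy: "complement z y" and unique: "\<And>z'. complement z' y \<Longrightarrow> z' = z"
  shows "socle_form (a \<otimes> pe y) = co a z"
proof -
  obtain u p w q where z: "z = (u, p)" and y: "y = (w, q)" by (cases z, cases y)
  have up: "(u, p) \<in> paths" "(w, q) \<in> paths" "tgt u p = w" "Suc (length p + length q) = k"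
    using zy by (auto simp: complement_def z y)
  have pq: "(u, p @ q) \<in> paths" using up by (auto simp: paths_iff Q.is_path_append)
  have "socle_form (a \<otimes> pe y) = co (a \<otimes> pe y) (u, p @ q)"
    unfolding socle_form_def
  proof (rule sum_single)
    show "finite {z \<in> paths. Suc (length (snd z)) = k}" using finite_paths by simp
    show "(u, p @ q) \<in> {z \<in> paths. Suc (length (snd z)) = k}" using pq up(4) by simp
    fix x assume x: "x \<in> {z \<in> paths. Suc (length (snd z)) = k}" "x \<noteq> (u, p @ q)"
    obtain u' p' where x': "x = (u', p')" by (cases x)
    have nr: "\<not> (\<exists>r. p' = r @ q \<and> tgt u' r = w)"
    proof
      assume "\<exists>r. p' = r @ q \<and> tgt u' r = w"
      then obtain r where r: "p' = r @ q" "tgt u' r = w" by blast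
      have "complement (u', r) y"
        using x(1) r up(2) paths_append_left[of u' r q] by (auto simp: complement_def x' y)
      from unique[OF this] show False using x(2) x' r(1) z by simp
    qed
    show "co (a \<otimes> pe y) x = 0" unfolding x' y co_mult_pe[OF a up(2)] by (simp only: nr simp_thms if_False)
  qed
  also have "\<dots> = co a z" unfolding z y co_mult_pe[OF a up(2)] using pq up(3) by auto
  finally show ?thesis .
qed

lemma socle_form_functional: "a \<in> carrier R \<Longrightarrow> k_functional (regular_module R) (\<lambda>c. socle_form (a \<otimes> c))"
  by (auto simp: k_functional_def regular_module_def socle_form_def r_distr co_add sum.distrib
      co_mult_sc sum_distrib_left simp flip: m_assoc)

lemma k_functional_eqI:
  assumes f: "k_functional (regular_module R) \<phi>" and g: "k_functional (regular_module R) \<psi>"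
    and eq: "\<And>y. y \<in> paths \<Longrightarrow> \<phi> (pe y) = \<psi> (pe y)" and c: "c \<in> carrier R"
  shows "\<phi> c = \<psi> c"
proof -
  have s: "\<chi> (\<Oplus>z\<in>I. pe z \<otimes> sc (d z)) = (\<Sum>z\<in>I. d z * \<chi> (pe z))"
    if \<chi>: "k_functional (regular_module R) \<chi>" and "finite I" for \<chi> I and d :: "_ \<Rightarrow> 'f"
    using that(2)
  proof (induction I rule: finite_induct)
    case empty
    show ?case using k_functionalD(2)[OF \<chi>, of \<zero> 0] by (simp add: regular_module_def)
  next
    case (insert z I)
    then show ?case
      using k_functionalD(1)[OF \<chi>, of "pe z \<otimes> sc (d z)" "\<Oplus>z\<in>I. pe z \<otimes> sc (d z)"] k_functionalD(2)[OF \<chi>, of "pe z" "d z"]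
      by (simp add: regular_module_def finsum_closed)
  qed
  show ?thesis
    using s[OF f finite_paths, of "co c"] s[OF g finite_paths, of "co c"] eq decompose[OF c] by simp
qed

text \<open>If every path can be completed uniquely on either side to a path of length $k - 1$, then
  \<open>socle_form\<close> is a Frobenius form: every functional on \<open>R\<close> is \<open>c \<mapsto> socle_form (a \<otimes> c)\<close> for a unique \<open>a\<close>.\<close>

lemma self_injective_if_complement:
  assumes right: "\<And>z. z \<in> paths \<Longrightarrow> \<exists>!y. complement z y" and left: "\<And>y. y \<in> paths \<Longrightarrow> \<exists>!z. complement z y"
  shows "self_injective R"
  unfolding self_injective_def injective_module_def
proof (intro allI impI, elim conjE)
  have pairing: "socle_form (a \<otimes> pe y) = co a z" if "a \<in> carrier R" "complement z y" for a y z
    using socle_form_mult_pe[OF that] left[of y] that(2) unfolding complement_def by blast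
  have represent: "\<exists>a\<in>carrier R. \<forall>c\<in>carrier R. socle_form (a \<otimes> c) = \<chi> c" if \<chi>: "k_functional (regular_module R) \<chi>" for \<chi>
  proof
    \<comment> \<open>The coefficient at z is the value of the functional at the complement of z, as
      dictated by the pairing of path basis elements.\<close>
    let ?a = "el (\<lambda>z. \<chi> (pe (THE y. complement z y)))"
    show a: "?a \<in> carrier R" by (rule el)
    show "\<forall>c\<in>carrier R. socle_form (?a \<otimes> c) = \<chi> c"
    proof (rule ballI, rule k_functional_eqI[OF socle_form_functional[OF a] \<chi>])
      fix y assume y: "y \<in> paths"
      then obtain z where z: "complement z y" using left by blast
      then have zp: "z \<in> paths" by (simp add: complement_def)
      have "(THE y. complement z y) = y" by (rule the1_equality[OF right[OF zp] z])
      then show "socle_form (?a \<otimes> pe y) = \<chi> (pe y)" using pairing[OF a z] zp by (simp add: el)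
    qed
  qed
  have unique: "a = b" if "a \<in> carrier R" "b \<in> carrier R" "\<And>c. c \<in> carrier R \<Longrightarrow> socle_form (a \<otimes> c) = socle_form (b \<otimes> c)" for a b
  proof (rule co_eqI[OF that(1,2)])
    fix u p assume "(u, p) \<in> paths"
    then obtain y where y: "complement (u, p) y" using right by blast
    show "co a (u, p) = co b (u, p)"
      using pairing[OF that(1) y] pairing[OF that(2) y] that(3)[of "pe y"] by simp
  qed
  fix X Y :: "('r, 'r list) module" and i f
  assume X: "right_module R X" and Y: "right_module R Y" and i: "i \<in> module_hom R X Y" "inj_on i (carrier X)"
    and f: "f \<in> module_hom R X (regular_module R)"
  interpret X: right_module R X by fact
  interpret Y: right_module R Y by fact
  have fc: "f x \<in> carrier R" if "x \<in> carrier X" for x using module_homD(1)[OF f that] by (simp add: regular_module_def)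
  have fa: "f (x \<oplus>\<^bsub>X\<^esub> y) = f x \<oplus> f y" if "x \<in> carrier X" "y \<in> carrier X" for x y
    using module_homD(2)[OF f that] by (simp add: regular_module_def)
  have fm: "f (a \<odot>\<^bsub>X\<^esub> x) = f x \<otimes> a" if "a \<in> carrier R" "x \<in> carrier X" for a x
    using module_homD(3)[OF f that] by (simp add: regular_module_def)
  have "k_functional X (\<lambda>x. socle_form (f x))"
    unfolding k_functional_def
    by (simp add: fa fm fc co_add co_mult_sc socle_form_def sum.distrib sum_distrib_left)
  then obtain \<psi> where \<psi>: "k_functional Y \<psi>" "\<And>x. x \<in> carrier X \<Longrightarrow> \<psi> (i x) = socle_form (f x)"
    using k_functional_extension[OF X Y i] by blast
  \<comment> \<open>Each y defines the functional c to \<psi>(y c) on R. The element representing it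
    becomes \<open>g y\<close>, and uniqueness of representing elements makes \<open>g\<close> a
    homomorphism extending f.\<close>
  have "\<exists>a. a \<in> carrier R \<and> (\<forall>c\<in>carrier R. socle_form (a \<otimes> c) = \<psi> (c \<odot>\<^bsub>Y\<^esub> y))" if y: "y \<in> carrier Y" for y
  proof -
    have "k_functional (regular_module R) (\<lambda>c. \<psi> (c \<odot>\<^bsub>Y\<^esub> y))"
      using y by (simp add: k_functional_def regular_module_def Y.rsmult_add_scalar Y.rsmult_assoc Y.rsmult_closed
          k_functionalD[OF \<psi>(1)])
    from represent[OF this] show ?thesis by blast
  qed
  then obtain g where g: "\<And>y. y \<in> carrier Y \<Longrightarrow> g y \<in> carrier R"
    "\<And>y c. \<lbrakk>y \<in> carrier Y; c \<in> carrier R\<rbrakk> \<Longrightarrow> socle_form (g y \<otimes> c) = \<psi> (c \<odot>\<^bsub>Y\<^esub> y)" by metis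
  have lam_add: "socle_form ((a \<oplus> b) \<otimes> c) = socle_form (a \<otimes> c) + socle_form (b \<otimes> c)"
    if "a \<in> carrier R" "b \<in> carrier R" "c \<in> carrier R" for a b c
    using that by (simp add: socle_form_def l_distr co_add sum.distrib)
  have "g \<in> module_hom R Y (regular_module R)"
  proof (rule module_homI)
    show "g y \<in> carrier (regular_module R)" if "y \<in> carrier Y" for y
      using g(1)[OF that] by (simp add: regular_module_def)
    show "g (x \<oplus>\<^bsub>Y\<^esub> y) = g x \<oplus>\<^bsub>regular_module R\<^esub> g y" if x: "x \<in> carrier Y" and y: "y \<in> carrier Y" for x y
    proof -
      have "g (x \<oplus>\<^bsub>Y\<^esub> y) = g x \<oplus> g y"
        by (rule unique) (simp_all add: g x y lam_add Y.rsmult_add Y.rsmult_closed k_functionalD(1)[OF \<psi>(1)])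
      then show ?thesis by (simp add: regular_module_def)
    qed
    show "g (a \<odot>\<^bsub>Y\<^esub> y) = a \<odot>\<^bsub>regular_module R\<^esub> g y" if a: "a \<in> carrier R" and y: "y \<in> carrier Y" for a y
    proof -
      have "g (a \<odot>\<^bsub>Y\<^esub> y) = g y \<otimes> a"
        by (rule unique) (simp_all add: g a y Y.rsmult_closed m_assoc Y.rsmult_assoc)
      then show ?thesis by (simp add: regular_module_def)
    qed
  qed
  moreover have "g (i x) = f x" if x: "x \<in> carrier X" for x
  proof (rule unique)
    fix c assume c: "c \<in> carrier R"
    have "socle_form (g (i x) \<otimes> c) = \<psi> (i (c \<odot>\<^bsub>X\<^esub> x))"
      using c x by (simp add: g module_homD[OF i(1)])
    then show "socle_form (g (i x) \<otimes> c) = socle_form (f x \<otimes> c)"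
      using c x by (simp add: \<psi>(2) X.rsmult_closed fm)
  qed (use x in \<open>simp_all add: g module_homD[OF i(1)] fc\<close>)
  ultimately show "\<exists>g\<in>module_hom R Y (regular_module R). \<forall>x\<in>carrier X. g (i x) = f x" by blast
qed

end

section \<open>Quivers with one arrow out of and one arrow into each vertex\<close>

context fin_digraph
begin

lemma unique_path_from:
  assumes arc: "\<And>v. v \<in> verts G \<Longrightarrow> \<exists>!a. a \<in> arcs G \<and> tail G a = v" and v: "v \<in> verts G"
  shows "\<exists>!q. is_path G v q \<and> length q = n"
  using v
proof (induction n arbitrary: v)
  case (Suc n)
  obtain a where a: "a \<in> arcs G" "tail G a = v" "\<And>b. \<lbrakk>b \<in> arcs G; tail G b = v\<rbrakk> \<Longrightarrow> b = a"
    using arc[OF Suc.prems] by blast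
  have "\<exists>!q. is_path G (head G a) q \<and> length q = n" using Suc.IH[of "head G a"] a(1) by simp
  then obtain q where q: "is_path G (head G a) q" "length q = n" "\<And>r. \<lbrakk>is_path G (head G a) r; length r = n\<rbrakk> \<Longrightarrow> r = q"
    by (elim ex1E) blast
  show ?case
  proof (rule ex1I[of _ "a # q"])
    show "r = a # q" if "is_path G v r \<and> length r = Suc n" for r
      using that a(3) q(3) by (cases r) auto
  qed (use a(1,2) q(1,2) in auto)
qed auto

lemma unique_path_to:
  assumes arc: "\<And>v. v \<in> verts G \<Longrightarrow> \<exists>!a. a \<in> arcs G \<and> head G a = v" and v: "v \<in> verts G"
  shows "\<exists>!z. is_path G (fst z) (snd z) \<and> path_target G (fst z) (snd z) = v \<and> length (snd z) = n"
  using v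
proof (induction n arbitrary: v)
  case 0
  show ?case
    by (rule ex1I[of _ "(v, [])"]) (use 0 in \<open>auto simp: prod_eq_iff\<close>)
next
  case (Suc n)
  obtain a where a: "a \<in> arcs G" "head G a = v" "\<And>b. \<lbrakk>b \<in> arcs G; head G b = v\<rbrakk> \<Longrightarrow> b = a"
    using arc[OF Suc.prems] by blast
  have "\<exists>!z. is_path G (fst z) (snd z) \<and> path_target G (fst z) (snd z) = tail G a \<and> length (snd z) = n"
    using Suc.IH[of "tail G a"] a(1) by simp
  then obtain z where z: "is_path G (fst z) (snd z)" "path_target G (fst z) (snd z) = tail G a" "length (snd z) = n"
    "\<And>y. \<lbrakk>is_path G (fst y) (snd y); path_target G (fst y) (snd y) = tail G a; length (snd y) = n\<rbrakk> \<Longrightarrow> y = z"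
    by (elim ex1E) blast
  show ?case
  proof (rule ex1I[of _ "(fst z, snd z @ [a])"])
    fix y assume y: "is_path G (fst y) (snd y) \<and> path_target G (fst y) (snd y) = v \<and> length (snd y) = Suc n"
    then obtain q b where q: "snd y = q @ [b]" by (cases "snd y" rule: rev_cases) auto
    have b: "is_path G (fst y) q" "b \<in> arcs G" "tail G b = path_target G (fst y) q" "head G b = v" "length q = n"
      using y by (auto simp: q is_path_append path_target_append)
    then have "b = a" using a(3) by blast
    moreover from this have "(fst y, q) = z" using z(4)[of "(fst y, q)"] b by simp
    ultimately show "y = (fst z, snd z @ [a])" using q by (auto simp: prod_eq_iff)
  qed (use a(1,2) z(1-3) in \<open>auto simp: is_path_append path_target_append\<close>)
qed

text \<open>Without branching the tail map is a bijection from arrows to vertices, so there are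
  equally many of both. The head map is onto because there are no sources, hence it is injective by
  counting.\<close>

lemma unique_arcs:
  assumes sink: "\<And>v. v \<in> verts G \<Longrightarrow> \<exists>a\<in>arcs G. tail G a = v"
    and source: "\<And>v. v \<in> verts G \<Longrightarrow> \<exists>a\<in>arcs G. head G a = v"
    and branch: "\<not> (\<exists>a\<in>arcs G. \<exists>b\<in>arcs G. a \<noteq> b \<and> tail G a = tail G b)"
    and v: "v \<in> verts G"
  shows "\<exists>!a. a \<in> arcs G \<and> tail G a = v" "\<exists>!a. a \<in> arcs G \<and> head G a = v"
proof -
  have ex1: "\<exists>!a. a \<in> arcs G \<and> f a = v" if inj: "inj_on f (arcs G)" and ex: "\<exists>a\<in>arcs G. f a = v" for f
  proof -
    obtain a where a: "a \<in> arcs G" "f a = v" using ex by (rule bexE)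
    show ?thesis by (rule ex1I[of _ a]) (use a inj_onD[OF inj] in auto)
  qed
  have tail: "inj_on (tail G) (arcs G)"
  proof (rule inj_onI, rule ccontr)
    fix a b assume "a \<in> arcs G" "b \<in> arcs G" "tail G a = tail G b" "a \<noteq> b"
    then show False using branch by blast
  qed
  then show "\<exists>!a. a \<in> arcs G \<and> tail G a = v" by (rule ex1[OF _ sink[OF v]])
  note tail
  moreover have "tail G ` arcs G = verts G" 
  proof (intro equalityI subsetI)
    fix w assume "w \<in> verts G"
    from sink[OF this] show "w \<in> tail G ` arcs G" by (elim bexE) (auto intro: rev_image_eqI)
  qed auto
  ultimately have "card (arcs G) = card (verts G)" by (metis card_image)
  moreover have "head G ` arcs G = verts G" 
  proof (intro equalityI subsetI)
    fix w assume "w \<in> verts G"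
    from source[OF this] show "w \<in> head G ` arcs G" by (elim bexE) (auto intro: rev_image_eqI)
  qed auto
  ultimately have "inj_on (head G) (arcs G)" by (intro eq_card_imp_inj_on) simp_all
  then show "\<exists>!a. a \<in> arcs G \<and> head G a = v" by (rule ex1[OF _ source[OF v]])
qed

end

context path_coefficients
begin

text \<open>In either excluded case complements are unique. For k = 1 all paths are trivial and each
  is its own complement; without branching every path extends uniquely in both directions to any
  prescribed length.\<close>

lemma not_self_injective:
  assumes sink: "\<And>v. v \<in> verts Q \<Longrightarrow> \<exists>a\<in>arcs Q. tail Q a = v"
    and source: "\<And>v. v \<in> verts Q \<Longrightarrow> \<exists>a\<in>arcs Q. head Q a = v"
    and ni: "\<not> self_injective R"
  shows "k \<ge> 2" "\<exists>a\<in>arcs Q. \<exists>b\<in>arcs Q. a \<noteq> b \<and> tail Q a = tail Q b"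
proof -
  show "k \<ge> 2"
  proof (rule ccontr)
    assume "\<not> k \<ge> 2"
    then have k: "k = 1" using k_pos by simp
    have e: "snd z = []" if "z \<in> paths" for z using that k unfolding paths_def by simp
    have k': "Suc 0 = k" using k by simp
    have c: "complement z y \<longleftrightarrow> z \<in> paths \<and> y = z" for z y
    proof
      assume "complement z y"
      then show "z \<in> paths \<and> y = z" using e[of z] e[of y] by (auto simp: complement_def prod_eq_iff)
    qed (use e[of z] k' in \<open>auto simp: complement_def\<close>)
    have "self_injective R" by (rule self_injective_if_complement) (auto simp: c)
    with ni show False by contradiction
  qed
  show "\<exists>a\<in>arcs Q. \<exists>b\<in>arcs Q. a \<noteq> b \<and> tail Q a = tail Q b"
  proof (rule ccontr)
    assume br: "\<not> (\<exists>a\<in>arcs Q. \<exists>b\<in>arcs Q. a \<noteq> b \<and> tail Q a = tail Q b)"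
    have arcs: "\<exists>!a. a \<in> arcs Q \<and> tail Q a = v" "\<exists>!a. a \<in> arcs Q \<and> head Q a = v" if v: "v \<in> verts Q" for v
      by (rule Q.unique_arcs[OF _ _ br v]; erule sink source)+
    have "self_injective R"
    proof (rule self_injective_if_complement)
      fix z assume z: "z \<in> paths"
      have t: "tgt (fst z) (snd z) \<in> verts Q" using z paths_verts(2)[of "fst z" "snd z"] by simp
      have uq: "\<exists>!q. is_path Q (tgt (fst z) (snd z)) q \<and> length q = k - 1 - length (snd z)"
        by (rule Q.unique_path_from[OF _ t]) (rule arcs(1))
      obtain q where q: "is_path Q (tgt (fst z) (snd z)) q" "length q = k - 1 - length (snd z)"
        "\<And>r. \<lbrakk>is_path Q (tgt (fst z) (snd z)) r; length r = k - 1 - length (snd z)\<rbrakk> \<Longrightarrow> r = q"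
        using uq by (elim ex1E) blast
      have lz: "length (snd z) < k" using z by (simp add: paths_def)
      show "\<exists>!y. complement z y"
      proof (rule ex1I[of _ "(tgt (fst z) (snd z), q)"])
        show "complement z (tgt (fst z) (snd z), q)" using z q(1,2) lz by (auto simp: complement_def paths_iff)
        fix y assume y: "complement z y"
        then have "snd y = q" by (intro q(3)) (auto simp: complement_def paths_def)
        then show "y = (tgt (fst z) (snd z), q)" using y by (auto simp: complement_def prod_eq_iff)
      qed
    next
      fix y assume y: "y \<in> paths"
      have t: "fst y \<in> verts Q" using y paths_verts(1)[of "fst y" "snd y"] by simp
      have uz: "\<exists>!z. is_path Q (fst z) (snd z) \<and> tgt (fst z) (snd z) = fst y \<and> length (snd z) = k - 1 - length (snd y)"
        by (rule Q.unique_path_to[OF _ t]) (rule arcs(2))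
      obtain z where z: "is_path Q (fst z) (snd z)" "tgt (fst z) (snd z) = fst y" "length (snd z) = k - 1 - length (snd y)"
        "\<And>x. \<lbrakk>is_path Q (fst x) (snd x); tgt (fst x) (snd x) = fst y; length (snd x) = k - 1 - length (snd y)\<rbrakk> \<Longrightarrow> x = z"
        using uz by (elim ex1E) blast
      have ly: "length (snd y) < k" using y by (simp add: paths_def)
      show "\<exists>!z. complement z y"
      proof (rule ex1I[of _ z])
        show "complement z y" using y z(1-3) ly by (auto simp: complement_def paths_def)
        fix x assume x: "complement x y"
        then show "x = z" by (intro z(4)) (auto simp: complement_def paths_def)
      qed
    qed
    with ni show False by contradiction
  qed
qed

end

subsection \<open>The main theorem\<close>

text \<open>For radical square zero every step applies the adjacency operator exactly once. Hence d
  = m + 1, which explains the d - 1 of the theorem.\<close>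

lemma stable_index_two: "stable_index 2 m = m"
  by (simp add: stable_index_def) presburger

lemma Suc_stable_index:
  assumes k: "k \<ge> 2"
  shows "real (Suc (stable_index k m)) =
    (if [int (Suc m) - 1 = 0] (mod int k) then 2 * ((real (Suc m) - 1) / real k) + 1
     else if [int (Suc m) - 1 = 1] (mod int k) then 2 * ((real (Suc m) - 2) / real k) + 2
     else 2 * real_of_int \<lceil>(real (Suc m) - 2) / real k\<rceil> + 1)"
proof -
  define q r where "q = m div k" and "r = m mod k"
  have m: "m = k * q + r" and r: "r < k" using k by (simp_all add: q_def r_def)
  have s: "stable_index k m = 2 * q + (if r = 0 then 0 else if r = 1 then 1 else 2)"
    by (simp add: stable_index_def q_def r_def)
  have i: "int m mod int k = int r" by (simp add: r_def of_nat_mod)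
  have c0: "[int (Suc m) - 1 = 0] (mod int k) \<longleftrightarrow> r = 0"
    by (simp add: cong_def i)
  have c1: "[int (Suc m) - 1 = 1] (mod int k) \<longleftrightarrow> r = 1"
    using k by (simp add: cong_def i)
  have rm: "real m = real k * real q + real r" by (simp add: m)
  have k0: "real k > 0" using k by simp
  consider "r = 0" | "r = 1" | "r \<ge> 2" by linarith
  then show ?thesis
  proof cases
    case 1
    then show ?thesis unfolding c0 c1 s using k0 by (simp add: rm)
  next
    case 2
    then show ?thesis unfolding c0 c1 s using k0 by (simp add: rm)
  next
    case 3
    \<comment> \<open>Here d - 2 = m - 1 = kq + (r - 1) with 2 <= r < k, so the quotient lies in the
      interval from q, excluded, to q + 1; its ceiling is q + 1 and the value becomes 2q +
      3.\<close>
    have "(real (Suc m) - 2) / real k = real q + (real r - 1) / real k"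
      using k0 by (simp add: rm field_simps)
    moreover have "0 < (real r - 1) / real k" "(real r - 1) / real k \<le> 1"
      using 3 r k0 by (simp_all add: field_simps)
    ultimately have "\<lceil>(real (Suc m) - 2) / real k\<rceil> = int q + 1"
      by (intro ceiling_unique) simp_all
    then show ?thesis unfolding c0 c1 s using 3 by simp
  qed
qed

theorem theorem4p17:
  fixes Q :: "('v, 'e) pre_digraph" and k :: nat
  assumes "fin_digraph Q"
    and "Digraph_Component.connected Q"
    and "k > 0"
    and "\<not> self_injective (truncated_path_algebra TYPE('k::field) Q k)"
    and "\<not> (\<exists>v. is_source Q v)"
    and "\<not> (\<exists>v. is_sink Q v)"
  shows "\<exists>d n :: nat.
           phi_dim (truncated_path_algebra TYPE('k) Q 2) = enat d \<and>
           phi_dim (truncated_path_algebra TYPE('k) Q k) = enat n \<and>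
           real n =
             (if [int d - 1 = 0] (mod int k) then 2 * ((real d - 1) / real k) + 1
              else if [int d - 1 = 1] (mod int k) then 2 * ((real d - 2) / real k) + 2
              else 2 * real_of_int \<lceil>(real d - 2) / real k\<rceil> + 1)"
proof -
  interpret Q: fin_digraph Q by fact
  have sink: "\<exists>a\<in>arcs Q. tail Q a = v" if "v \<in> verts Q" for v
    using assms(6) that unfolding is_sink_def by blast
  have source: "\<exists>a\<in>arcs Q. head Q a = v" if "v \<in> verts Q" for v
    using assms(5) that unfolding is_source_def by blast
  note not_si = path_coefficients.not_self_injective[OF Q.truncated_path_coefficients[OF assms(3)] sink source assms(4)]
  have k: "k \<ge> 2" using not_si(1) by blast
  have branch: "\<exists>a\<in>arcs Q. \<exists>b\<in>arcs Q. a \<noteq> b \<and> tail Q a = tail Q b" using not_si(2) by blast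
  \<comment> \<open>One statement for all truncation lengths, since both algebras of the theorem
    share the quiver and thus the index m; only the original k was needed to obtain the branching
    vertex.\<close>
  have phi: "phi_dim (truncated_path_algebra TYPE('k) Q n) = enat (Suc (stable_index n (nil_index Q)))" if n: "n \<ge> 2" for n
  proof -
    have "n > 0" using n by simp
    then interpret path_coefficients Q "truncated_path_algebra TYPE('k) Q n" n
        "Q.truncated_coeff n :: (('v, 'e) path \<Rightarrow>\<^sub>0 'k) set \<Rightarrow> 'v \<times> 'e list \<Rightarrow> 'k"
      by (rule Q.truncated_path_coefficients)
    interpret branching_quiver_algebra Q "truncated_path_algebra TYPE('k) Q n" n
        "Q.truncated_coeff n :: (('v, 'e) path \<Rightarrow>\<^sub>0 'k) set \<Rightarrow> 'v \<times> 'e list \<Rightarrow> 'k"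
      by unfold_locales (use n sink source branch in auto)
    show ?thesis by (rule phi_dim_eq)
  qed
  show ?thesis
    using phi[of 2] phi[OF k] Suc_stable_index[OF k, of "nil_index Q"]
    by (intro exI[of _ "Suc (nil_index Q)"] exI[of _ "Suc (stable_index k (nil_index Q))"]) (simp only: stable_index_two order_refl simp_thms)
qed

end
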